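(* Let $M$ be a compact oriented surface with conformal class $\mathcal{C}$. Suppose that $\Psi\colon(M,\mathcal{C})\to\mathbb{CP}^{2m-1}$ is a quaternionic harmonic map and let $D=(\bar\partial\Psi)$ be the zero divisor of $\bar\partial\Psi$. Then $\Psi$ induces a natural spin structure $S_\Psi=L_0^*\otimes[\frac12D]$ on $M$. Furthermore, for the metric $g_\Psi=|\bar\partial\Psi|_g^2g$ ($g\in\mathcal{C}$ arbitrary), one can choose a collection of $\mathcal{D}_{g_\Psi}$-eigenspinors $\psi_1,\dots,\psi_m$ (with respect to $S_\Psi$), $\psi_j=(\psi_{j+},\psi_{j-})$, such that $$\Psi=[\psi_{1+}:\bar\psi_{1-}:\dots:\psi_{m+}:\bar\psi_{m-}]\qquad\text{and}\qquad\sum_{j=1}^m|\psi_j|_{g_\Psi}^2=1.$$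
   Context: Dirac operator. $\mathcal{C}$ and the orientation give $M$ a complex structure with canonical bundle $K=(T^{(1,0)}M)^*$. A spin structure is a holomorphic line bundle $S$ with a holomorphic isomorphism $S\otimes S\cong K$; the spinor bundle is $S\oplus\bar S$. A metric $g=\mathrm{Re}(h)\in\mathcal{C}$ ($h$ Hermitian) induces a metric on $S$ by $|s|_g^2=|s\otimes s|_h$; if $s_0\otimes s_0=dz$ then $g=|s_0|_g^{-4}(dx^2+dy^2)$. $\mathcal{D}_g(\psi_+,\psi_-)=2(\partial_g\psi_-,-\bar\partial_g\psi_+)$ with, locally, $\bar\partial_g(fs_0)=|s_0|_g^2(\partial_{\bar z}f)\bar s_0$, $\partial_g(f\bar s_0)=|s_0|_g^2(\partial_zf)s_0$; $|\psi|_g^2=|\psi_+|_g^2+|\psi_-|_g^2$. Maps to $\mathbb{CP}^n$. $\mathbb{CP}^n$ carries $4g_{FS}$, where $g_{FS}$ has constant holomorphic curvature $4$. $L$ is the tautological bundle, $L^\perp$ its orthogonal complement in the trivial $\mathbb{C}^{n+1}$-bundle, $T^{(1,0)}\mathbb{CP}^n\cong\mathrm{Hom}_{\mathbb{C}}(L,L^\perp)$. $\bar\partial\Psi\colon T^{(0,1)}M\to T^{(1,0)}\mathbb{CP}^n$ is the component of the complexified differential; for a local nonvanishing lift $F$ of $\Psi$, $[\bar\partial\Psi(\partial_{\bar z})](F)=\pi_{L^\perp}\partial_{\bar z}F$, and $|\bar\partial\Psi|_g^2=4\frac{|\pi_{L^\perp}\partial_{\bar z}F|^2}{|\partial_{\bar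 z}|_g^2|F|^2}$, with $|\partial_{\bar z}|_g^2=e^{2\omega}$ if $g=e^{2\omega}(dx^2+dy^2)$. Harmonic means critical for $\frac12\int_M|d\Psi|^2dv_g$. $L_0=\Psi^*L$ has the holomorphic structure in which a local section $F$ is holomorphic iff $\partial_{\bar z}F\perp F$. If $\Psi$ is harmonic and not holomorphic, $\bar\partial\Psi$ is anti-holomorphic, and $L_{-1}\subset\Psi^*L^\perp$ is the line bundle spanned by its image, extended across its zeros. Quaternionic harmonic maps. Let $I(z_1,\dots,z_{2m})=(-\bar z_2,\bar z_1,-\bar z_4,\bar z_3,\dots,-\bar z_{2m},\bar z_{2m-1})$. A harmonic map $\Psi\colon(M,\mathcal{C})\to\mathbb{CP}^{2m-1}$ is quaternionic harmonic if (it is not holomorphic and) $L_{-1}=I(L_0)$ and all zeros of $\bar\partial\Psi$ have even order. The natural isomorphism $S_\Psi\otimes S_\Psi\cong K$. Define the map $A\colon L_0^*\otimes L_0^*\to K$ by $A(s_1\otimes s_2)=\overline{\langle\bar\partial\Psi(\partial_{\bar z})(v_1),I(v_2)\rangle}\,dz$, where $s_i=\langle\cdot,v_i\rangle$, $v_i\in L_0$. The assertion that $S_\Psi$ is a spin structure is that $A$ is holomorphic with zero divisor $D$, so that $s_1\otimes s_2\otimes1_D\mapsto A(s_1\otimes s_2)$ ($1_D$ the canonical section of $[D]$) gives a holomorphic isomorphism $L_0^*\otimes L_0^*\otimes[D]\cong K$. The metric $g_\Psi$ is independent of the choice of $g\in\mathcal{C}$ and may have conical singularities at the zeros of $\bar\partial\Psi$;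 the eigenspinors are smooth sections of $S_\Psi\oplus\bar S_\Psi$ on $M$, the eigenvalue equation and the identity $\sum|\psi_j|^2_{g_\Psi}=1$ are understood away from these zeros, and the homogeneous-coordinate expression is extended continuously across common zeros of the $\psi_j$. *)

theory Defs
  imports "HOL-Complex_Analysis.Complex_Analysis"
begin

section \<open>Smoothness in normed spaces\<close>

text \<open>\<open>S\<close> is meant to be open and the domain finite-dimensional: all iterated directional
  derivatives exist and are continuous.\<close>

primrec Ck_on :: "nat \<Rightarrow> 'v::real_normed_vector set \<Rightarrow> ('v \<Rightarrow> 'w::real_normed_vector) \<Rightarrow> bool" where
  "Ck_on 0 S f \<longleftrightarrow> continuous_on S f"
| "Ck_on (Suc k) S f \<longleftrightarrow>
     (\<forall>x\<in>S. f differentiable (at x)) \<and> (\<forall>v. Ck_on k S (\<lambda>x. frechet_derivative f (at x) v))"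

definition smooth_on :: "'v::real_normed_vector set \<Rightarrow> ('v \<Rightarrow> 'w::real_normed_vector) \<Rightarrow> bool" where
  "smooth_on S f \<longleftrightarrow> (\<forall>k. Ck_on k S f)"


section \<open>Surfaces with a conformal class\<close>

text \<open>The underlying set of the surface is the whole type. An oriented conformal structure is
  given by its atlas of oriented isothermal (that is, holomorphic) coordinates \<open>z = x + iy\<close>.
  A chart is a pair \<open>(U, z)\<close>; the values of \<open>z\<close> outside \<open>U\<close> are irrelevant.\<close>

type_synonym 'a chart = "'a set \<times> ('a \<Rightarrow> complex)"

definition in_chart :: "'a chart \<Rightarrow> ('a \<Rightarrow> 'b) \<Rightarrow> complex \<Rightarrow> 'b" where
  "in_chart c f = f \<circ> inv_into (fst c) (snd c)"

definition complex_atlas :: "'a::topological_space chart set \<Rightarrow> bool" where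
  "complex_atlas X \<longleftrightarrow>
     (\<Union>c\<in>X. fst c) = UNIV \<and>
     (\<forall>c\<in>X. open (fst c) \<and> open (snd c ` fst c) \<and>
        homeomorphism (fst c) (snd c ` fst c) (snd c) (inv_into (fst c) (snd c))) \<and>
     (\<forall>c\<in>X. \<forall>c'\<in>X. in_chart c (snd c') holomorphic_on (snd c ` (fst c \<inter> fst c')))"

definition smooth_fun ::
  "'a chart set \<Rightarrow> 'a set \<Rightarrow> ('a \<Rightarrow> 'v::real_normed_vector) \<Rightarrow> bool" where
  "smooth_fun X U f \<longleftrightarrow> (\<forall>c\<in>X. smooth_on (snd c ` (U \<inter> fst c)) (in_chart c f))"

definition holo_fun :: "'a chart set \<Rightarrow> 'a set \<Rightarrow> ('a \<Rightarrow> complex) \<Rightarrow> bool" where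
  "holo_fun X U f \<longleftrightarrow> (\<forall>c\<in>X. in_chart c f holomorphic_on (snd c ` (U \<inter> fst c)))"

text \<open>A metric in the conformal class is \<open>g = \<rho> (dx\<^sup>2 + dy\<^sup>2)\<close> with
  \<open>\<rho> = e\<^bsup>2\<omega>\<^esup>\<close> in every chart; \<open>g c p\<close> is the value of \<open>\<rho>\<close> at \<open>p\<close> for the chart \<open>c\<close>.\<close>

type_synonym 'a conf_metric = "'a chart \<Rightarrow> 'a \<Rightarrow> real"

definition conformal_metric :: "'a chart set \<Rightarrow> 'a conf_metric \<Rightarrow> bool" where
  "conformal_metric X g \<longleftrightarrow>
     (\<forall>c\<in>X. smooth_fun X (fst c) (g c) \<and> (\<forall>p\<in>fst c. 0 < g c p)) \<and>
     (\<forall>c\<in>X. \<forall>c'\<in>X. \<forall>p\<in>fst c \<inter> fst c'.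
        g c p = g c' p * (cmod (deriv (in_chart c (snd c')) (snd c p)))\<^sup>2)"

definition compact_conformal_surface ::
  "'a::t2_space chart set \<Rightarrow> 'a conf_metric set \<Rightarrow> bool" where
  "compact_conformal_surface X C \<longleftrightarrow>
     compact (UNIV :: 'a set) \<and> connected (UNIV :: 'a set) \<and> complex_atlas X \<and>
     C = {g. conformal_metric X g} \<and> C \<noteq> {}"

text \<open>The Riemannian area measure \<open>dv\<^sub>g = \<rho> dx dy\<close>.\<close>

definition area_measure ::
  "'a::topological_space chart set \<Rightarrow> 'a conf_metric \<Rightarrow> 'a measure" where
  "area_measure X g = (THE \<mu>. sets \<mu> = sets borel \<and>
     (\<forall>c\<in>X. \<forall>A\<in>sets borel. A \<subseteq> fst c \<longrightarrow>
        emeasure \<mu> A = (\<integral>\<^sup>+ z\<in>snd c ` A. ennreal (in_chart c (g c) z) \<partial>lborel)))"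

text \<open>Derivative in the direction \<open>\<xi>\<close>: \<open>\<xi> = 1\<close> gives \<open>\<partial>\<^sub>x\<close>, and \<open>\<xi> = \<i>\<close> gives \<open>\<partial>\<^sub>y\<close>.\<close>

definition dir_deriv ::
  "'a chart \<Rightarrow> complex \<Rightarrow> ('a \<Rightarrow> 'v::real_normed_vector) \<Rightarrow> 'a \<Rightarrow> 'v" where
  "dir_deriv c \<xi> f p = frechet_derivative (in_chart c f) (at (snd c p)) \<xi>"

definition dz :: "'a chart \<Rightarrow> ('a \<Rightarrow> complex) \<Rightarrow> 'a \<Rightarrow> complex" where
  "dz c f p = (dir_deriv c 1 f p - \<i> * dir_deriv c \<i> f p) / 2"

definition dzbar :: "'a chart \<Rightarrow> ('a \<Rightarrow> complex) \<Rightarrow> 'a \<Rightarrow> complex" where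
  "dzbar c f p = (dir_deriv c 1 f p + \<i> * dir_deriv c \<i> f p) / 2"

definition dzbar_vec :: "'a chart \<Rightarrow> ('a \<Rightarrow> complex ^ 'n) \<Rightarrow> 'a \<Rightarrow> complex ^ 'n" where
  "dzbar_vec c F p = (\<chi> i. dzbar c (\<lambda>q. F q $ i) p)"


section \<open>Maps to complex projective space\<close>

text \<open>The Hermitian product is complex linear in the first argument.\<close>

definition herm :: "complex ^ 'n \<Rightarrow> complex ^ 'n \<Rightarrow> complex" where
  "herm v w = (\<Sum>i\<in>UNIV. v $ i * cnj (w $ i))"

text \<open>A point of projective space is a complex line in \<open>complex ^ 'n\<close>.\<close>

definition cline :: "complex ^ 'n \<Rightarrow> (complex ^ 'n) set" where
  "cline v = {a *s v | a. True}"

definition perp :: "complex ^ 'n \<Rightarrow> complex ^ 'n \<Rightarrow> complex ^ 'n" where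
  "perp v w = w - (herm w v / herm v v) *s v"

definition smooth_lift ::
  "'a::topological_space chart set \<Rightarrow> ('a \<Rightarrow> (complex ^ 'n) set) \<Rightarrow> 'a set
     \<Rightarrow> ('a \<Rightarrow> complex ^ 'n) \<Rightarrow> bool" where
  "smooth_lift X \<Psi> U F \<longleftrightarrow>
     open U \<and> smooth_fun X U F \<and> (\<forall>p\<in>U. F p \<noteq> 0 \<and> \<Psi> p = cline (F p))"

definition smooth_map_CP ::
  "'a::topological_space chart set \<Rightarrow> ('a \<Rightarrow> (complex ^ 'n) set) \<Rightarrow> bool" where
  "smooth_map_CP X \<Psi> \<longleftrightarrow> (\<forall>p. \<exists>U F. p \<in> U \<and> smooth_lift X \<Psi> U F)"

definition continuous_map_CP ::
  "('a::topological_space \<Rightarrow> (complex ^ 'n) set) \<Rightarrow> bool" where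
  "continuous_map_CP \<Psi> \<longleftrightarrow> (\<forall>p. \<exists>U F. p \<in> U \<and> open U \<and> continuous_on U F \<and>
     (\<forall>q\<in>U. F q \<noteq> 0 \<and> \<Psi> q = cline (F q)))"

text \<open>With \<open>T\<^sup>(\<^sup>1\<^sup>,\<^sup>0\<^sup>)CP = Hom(L, L\<^sup>\<bottom>)\<close>, a tangent vector at \<open>\<Psi> p\<close> is a linear map
  \<open>\<Psi> p \<rightarrow> (\<Psi> p)\<^sup>\<bottom>\<close>; for \<open>v \<in> \<Psi> p\<close> nonzero its value at \<open>v\<close> is computed from an arbitrary local lift \<open>F\<close>
  with \<open>F p = v\<close>.\<close>

definition hom_value ::
  "'a::topological_space chart set \<Rightarrow> ('a \<Rightarrow> (complex ^ 'n) set) \<Rightarrow>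
     (('a \<Rightarrow> complex ^ 'n) \<Rightarrow> complex ^ 'n) \<Rightarrow> 'a \<Rightarrow> complex ^ 'n \<Rightarrow> complex ^ 'n" where
  "hom_value X \<Psi> \<delta> p v =
     (if v = 0 then 0
      else (THE w. \<exists>U F. p \<in> U \<and> smooth_lift X \<Psi> U F \<and> F p = v \<and> w = perp v (\<delta> F)))"

definition dPsi ::
  "'a::topological_space chart set \<Rightarrow> ('a \<Rightarrow> (complex ^ 'n) set) \<Rightarrow> 'a chart \<Rightarrow> complex \<Rightarrow> 'a
     \<Rightarrow> complex ^ 'n \<Rightarrow> complex ^ 'n" where
  "dPsi X \<Psi> c \<xi> p = hom_value X \<Psi> (\<lambda>F. dir_deriv c \<xi> F p) p"

text \<open>\<open>dbar_Psi X \<Psi> c p\<close> is the homomorphism \<open>\<partial>\<^bsup>bar\<^esup>\<Psi>(\<partial>\<^bsub>z bar\<^esub>)\<close> at \<open>p\<close>, where \<open>z\<close> is the coordinate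
  of the chart \<open>c\<close>.\<close>

definition dbar_Psi ::
  "'a::topological_space chart set \<Rightarrow> ('a \<Rightarrow> (complex ^ 'n) set) \<Rightarrow> 'a chart \<Rightarrow> 'a
     \<Rightarrow> complex ^ 'n \<Rightarrow> complex ^ 'n" where
  "dbar_Psi X \<Psi> c p = hom_value X \<Psi> (\<lambda>F. dzbar_vec c F p) p"

text \<open>Squared length, for \<open>4g\<^bsub>FS\<^esub>\<close>, of the tangent vector at the line of \<open>v\<close> that maps
  \<open>v\<close> to \<open>w\<close>, where \<open>g\<^bsub>FS\<^esub>\<close> has constant holomorphic curvature 4.\<close>

definition fs4_sq :: "complex ^ 'n \<Rightarrow> complex ^ 'n \<Rightarrow> real" where
  "fs4_sq v w = 4 * (norm w)\<^sup>2 / (norm v)\<^sup>2"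

definition dPsi_norm_sq ::
  "'a::topological_space chart set \<Rightarrow> 'a conf_metric \<Rightarrow> ('a \<Rightarrow> (complex ^ 'n) set) \<Rightarrow> 'a \<Rightarrow> real" where
  "dPsi_norm_sq X g \<Psi> p =
     (THE r. \<exists>c\<in>X. p \<in> fst c \<and> (\<exists>v\<in>\<Psi> p. v \<noteq> 0 \<and>
        r = (fs4_sq v (dPsi X \<Psi> c 1 p v) + fs4_sq v (dPsi X \<Psi> c \<i> p v)) / g c p))"

definition dbar_norm_sq ::
  "'a::topological_space chart set \<Rightarrow> 'a conf_metric \<Rightarrow> ('a \<Rightarrow> (complex ^ 'n) set) \<Rightarrow> 'a \<Rightarrow> real" where
  "dbar_norm_sq X g \<Psi> p =
     (THE r. \<exists>c\<in>X. p \<in> fst c \<and> (\<exists>v\<in>\<Psi> p. v \<noteq> 0 \<and>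
        r = fs4_sq v (dbar_Psi X \<Psi> c p v) / g c p))"

definition dbar_vanishes ::
  "'a::topological_space chart set \<Rightarrow> ('a \<Rightarrow> (complex ^ 'n) set) \<Rightarrow> 'a \<Rightarrow> bool" where
  "dbar_vanishes X \<Psi> p \<longleftrightarrow> (\<forall>c\<in>X. p \<in> fst c \<longrightarrow> (\<forall>v\<in>\<Psi> p. dbar_Psi X \<Psi> c p v = 0))"

definition holomorphic_map_CP ::
  "'a::topological_space chart set \<Rightarrow> ('a \<Rightarrow> (complex ^ 'n) set) \<Rightarrow> bool" where
  "holomorphic_map_CP X \<Psi> \<longleftrightarrow> smooth_map_CP X \<Psi> \<and> (\<forall>p. dbar_vanishes X \<Psi> p)"


section \<open>Harmonic maps\<close>

definition energy ::
  "'a::topological_space chart set \<Rightarrow> 'a conf_metric \<Rightarrow> ('a \<Rightarrow> (complex ^ 'n) set) \<Rightarrow> real" where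
  "energy X g \<Psi> = 1/2 * (\<integral>p. dPsi_norm_sq X g \<Psi> p \<partial>(area_measure X g))"

text \<open>Smooth variations \<open>(-\<epsilon>, \<epsilon>) \<times> M \<rightarrow> CP\<close>, smooth jointly in both variables.\<close>

definition smooth_variation ::
  "'a::topological_space chart set \<Rightarrow> ('a \<Rightarrow> (complex ^ 'n) set) \<Rightarrow> real
     \<Rightarrow> (real \<Rightarrow> 'a \<Rightarrow> (complex ^ 'n) set) \<Rightarrow> bool" where
  "smooth_variation X \<Psi> \<epsilon> \<Phi> \<longleftrightarrow> 0 < \<epsilon> \<and> \<Phi> 0 = \<Psi> \<and>
     (\<forall>t\<^sub>0 p\<^sub>0. \<bar>t\<^sub>0\<bar> < \<epsilon> \<longrightarrow>
        (\<exists>c\<in>X. \<exists>U \<delta> F. open U \<and> p\<^sub>0 \<in> U \<and> U \<subseteq> fst c \<and> 0 < \<delta> \<and>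
           smooth_on (snd c ` U \<times> {t\<^sub>0 - \<delta><..<t\<^sub>0 + \<delta>}) (\<lambda>(z, t). in_chart c (F t) z) \<and>
           (\<forall>t\<in>{t\<^sub>0 - \<delta><..<t\<^sub>0 + \<delta>}. \<forall>q\<in>U. F t q \<noteq> 0 \<and> \<Phi> t q = cline (F t q))))"

definition harmonic_map ::
  "'a::topological_space chart set \<Rightarrow> 'a conf_metric set \<Rightarrow> ('a \<Rightarrow> (complex ^ 'n) set) \<Rightarrow> bool" where
  "harmonic_map X C \<Psi> \<longleftrightarrow> smooth_map_CP X \<Psi> \<and>
     (\<forall>g\<in>C. \<forall>\<epsilon> \<Phi>. smooth_variation X \<Psi> \<epsilon> \<Phi> \<longrightarrow>
        ((\<lambda>t. energy X g (\<Phi> t)) has_real_derivative 0) (at 0))"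

text \<open>\<open>dbar_leading X \<Psi> p k l\<close>: for a local lift \<open>F\<close> one has
  \<open>\<partial>\<^bsup>bar\<^esup>\<Psi>(\<partial>\<^bsub>z bar\<^esub>)(F) = (cnj (z - z(p)))\<^sup>k G\<close> with \<open>G\<close> continuous and \<open>G(p)\<close> a nonzero element of the
  line \<open>l\<close>. Since \<open>\<partial>\<^bsup>bar\<^esup>\<Psi>\<close> is anti-holomorphic, this says that it has order \<open>k\<close> at \<open>p\<close>
  (order 0 meaning no zero) and that \<open>l\<close> is the fibre at \<open>p\<close> of the line bundle spanned by its image
  and extended across its zeros.\<close>

definition dbar_leading ::
  "'a::topological_space chart set \<Rightarrow> ('a \<Rightarrow> (complex ^ 'n) set) \<Rightarrow> 'a \<Rightarrow> nat
     \<Rightarrow> (complex ^ 'n) set \<Rightarrow> bool" where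
  "dbar_leading X \<Psi> p k l \<longleftrightarrow>
     (\<exists>c\<in>X. \<exists>U F G. p \<in> U \<and> U \<subseteq> fst c \<and> smooth_lift X \<Psi> U F \<and> continuous_on U G \<and> G p \<noteq> 0 \<and>
        (\<forall>q\<in>U. dbar_Psi X \<Psi> c q (F q) = cnj (snd c q - snd c p) ^ k *s G q) \<and>
        l = cline (G p))"

definition dbar_order ::
  "'a::topological_space chart set \<Rightarrow> ('a \<Rightarrow> (complex ^ 'n) set) \<Rightarrow> 'a \<Rightarrow> nat" where
  "dbar_order X \<Psi> p = (THE k. \<exists>l. dbar_leading X \<Psi> p k l)"

text \<open>\<open>is_L_minus1 X \<Psi> N\<close>: the line field \<open>N\<close> is the bundle \<open>L\<^sub>-\<^sub>1\<close>.\<close>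

definition is_L_minus1 ::
  "'a::topological_space chart set \<Rightarrow> ('a \<Rightarrow> (complex ^ 'n) set) \<Rightarrow> ('a \<Rightarrow> (complex ^ 'n) set)
     \<Rightarrow> bool" where
  "is_L_minus1 X \<Psi> N \<longleftrightarrow> (\<forall>p. \<exists>k. dbar_leading X \<Psi> p k (N p))"


section \<open>Quaternionic harmonic maps\<close>

text \<open>\<open>\<complex>\<^sup>2\<^sup>m\<close> is \<open>complex ^ ('m \<times> 2)\<close> with \<open>m = CARD('m)\<close>: if \<open>j\<close> is the \<open>j\<close>-th element of the index
  type, the coordinates \<open>(j, 1)\<close> and \<open>(j, 2)\<close> are \<open>z\<^bsub>2j-1\<^esub>\<close> and \<open>z\<^bsub>2j\<^esub>\<close>.\<close>

definition quat_I :: "complex ^ ('m::finite \<times> 2) \<Rightarrow> complex ^ ('m \<times> 2)" where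
  "quat_I v = (\<chi> i. if snd i = 1 then - cnj (v $ (fst i, 2)) else cnj (v $ (fst i, 1)))"

definition quaternionic_harmonic ::
  "'a::topological_space chart set \<Rightarrow> 'a conf_metric set
     \<Rightarrow> ('a \<Rightarrow> (complex ^ ('m::finite \<times> 2)) set) \<Rightarrow> bool" where
  "quaternionic_harmonic X C \<Psi> \<longleftrightarrow>
     harmonic_map X C \<Psi> \<and> \<not> holomorphic_map_CP X \<Psi> \<and>
     is_L_minus1 X \<Psi> (\<lambda>p. quat_I ` \<Psi> p) \<and>
     (\<forall>p. dbar_vanishes X \<Psi> p \<longrightarrow> even (dbar_order X \<Psi> p))"


section \<open>Holomorphic line bundles\<close>

text \<open>A line bundle is given by a family of local frames \<open>e\<^sub>i\<close> and their transition functions: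
  \<open>e\<^sub>j = transition L i j \<cdot> e\<^sub>i\<close> where both are defined.\<close>

datatype ('a, 'i) line_bundle =
  Line_Bundle (frame_set: "'i set") (frame_dom: "'i \<Rightarrow> 'a set")
    (transition: "'i \<Rightarrow> 'i \<Rightarrow> 'a \<Rightarrow> complex")

definition holomorphic_line_bundle ::
  "'a::topological_space chart set \<Rightarrow> ('a, 'i) line_bundle \<Rightarrow> bool" where
  "holomorphic_line_bundle X L \<longleftrightarrow>
     (\<forall>i\<in>frame_set L. open (frame_dom L i)) \<and>
     (\<Union>i\<in>frame_set L. frame_dom L i) = UNIV \<and>
     (\<forall>i\<in>frame_set L. \<forall>j\<in>frame_set L.
        holo_fun X (frame_dom L i \<inter> frame_dom L j) (transition L i j) \<and>
        (\<forall>p\<in>frame_dom L i \<inter> frame_dom L j. transition L i j p \<noteq> 0)) \<and>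
     (\<forall>i\<in>frame_set L. \<forall>p\<in>frame_dom L i. transition L i i p = 1) \<and>
     (\<forall>i\<in>frame_set L. \<forall>j\<in>frame_set L. \<forall>k\<in>frame_set L.
        \<forall>p\<in>frame_dom L i \<inter> frame_dom L j \<inter> frame_dom L k.
          transition L i k p = transition L i j p * transition L j k p)"

definition dual_bundle :: "('a, 'i) line_bundle \<Rightarrow> ('a, 'i) line_bundle" where
  "dual_bundle L =
     Line_Bundle (frame_set L) (frame_dom L) (\<lambda>i j p. inverse (transition L i j p))"

definition conj_bundle :: "('a, 'i) line_bundle \<Rightarrow> ('a, 'i) line_bundle" where
  "conj_bundle L =
     Line_Bundle (frame_set L) (frame_dom L) (\<lambda>i j p. cnj (transition L i j p))"

definition tensor_bundle ::
  "('a, 'i) line_bundle \<Rightarrow> ('a, 'j) line_bundle \<Rightarrow> ('a, 'i \<times> 'j) line_bundle" where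
  "tensor_bundle L N =
     Line_Bundle (frame_set L \<times> frame_set N)
       (\<lambda>i. frame_dom L (fst i) \<inter> frame_dom N (snd i))
       (\<lambda>i j p. transition L (fst i) (fst j) p * transition N (snd i) (snd j) p)"

text \<open>A homomorphism \<open>h : L \<rightarrow> N\<close> is given by its coefficients: \<open>h(e\<^sub>i) = h\<^sub>i\<^sub>k \<cdot> e'\<^sub>k\<close>.\<close>

definition holomorphic_hom ::
  "'a::topological_space chart set \<Rightarrow> ('a, 'i) line_bundle \<Rightarrow> ('a, 'k) line_bundle
     \<Rightarrow> ('i \<Rightarrow> 'k \<Rightarrow> 'a \<Rightarrow> complex) \<Rightarrow> bool" where
  "holomorphic_hom X L N h \<longleftrightarrow>
     (\<forall>i\<in>frame_set L. \<forall>k\<in>frame_set N. holo_fun X (frame_dom L i \<inter> frame_dom N k) (h i k)) \<and>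
     (\<forall>i\<in>frame_set L. \<forall>j\<in>frame_set L. \<forall>k\<in>frame_set N.
        \<forall>p\<in>frame_dom L i \<inter> frame_dom L j \<inter> frame_dom N k. h j k p = transition L i j p * h i k p) \<and>
     (\<forall>i\<in>frame_set L. \<forall>k\<in>frame_set N. \<forall>l\<in>frame_set N.
        \<forall>p\<in>frame_dom L i \<inter> frame_dom N k \<inter> frame_dom N l. h i k p = transition N k l p * h i l p)"

definition holomorphic_iso ::
  "'a::topological_space chart set \<Rightarrow> ('a, 'i) line_bundle \<Rightarrow> ('a, 'k) line_bundle
     \<Rightarrow> ('i \<Rightarrow> 'k \<Rightarrow> 'a \<Rightarrow> complex) \<Rightarrow> bool" where
  "holomorphic_iso X L N h \<longleftrightarrow> holomorphic_hom X L N h \<and>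
     (\<forall>i\<in>frame_set L. \<forall>k\<in>frame_set N. \<forall>p\<in>frame_dom L i \<inter> frame_dom N k. h i k p \<noteq> 0)"

text \<open>Smooth sections \<open>s = s\<^sub>i e\<^sub>i\<close>, given by their coefficients \<open>s\<^sub>i\<close>.\<close>

definition smooth_section ::
  "'a chart set \<Rightarrow> ('a, 'i) line_bundle \<Rightarrow> ('i \<Rightarrow> 'a \<Rightarrow> complex) \<Rightarrow> bool" where
  "smooth_section X L s \<longleftrightarrow>
     (\<forall>i\<in>frame_set L. smooth_fun X (frame_dom L i) (s i)) \<and>
     (\<forall>i\<in>frame_set L. \<forall>j\<in>frame_set L. \<forall>p\<in>frame_dom L i \<inter> frame_dom L j.
        s i p = transition L i j p * s j p)"

text \<open>The canonical bundle, with the frame \<open>dz\<close> for every chart.\<close>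

definition canonical_bundle :: "'a chart set \<Rightarrow> ('a, 'a chart) line_bundle" where
  "canonical_bundle X =
     Line_Bundle X fst (\<lambda>c c' p. deriv (in_chart c (snd c')) (snd c p))"

text \<open>The bundle \<open>[E]\<close> of an effective divisor \<open>E\<close>: every local equation \<open>f\<close> of \<open>E\<close> gives the frame
  \<open>e\<^sub>f\<close> with \<open>1\<^sub>E = f e\<^sub>f\<close>. The limit extends the quotient of two local equations across the
  points of \<open>E\<close>.\<close>

definition local_equation ::
  "'a::topological_space chart set \<Rightarrow> ('a \<Rightarrow> nat) \<Rightarrow> 'a set \<Rightarrow> ('a \<Rightarrow> complex) \<Rightarrow> bool" where
  "local_equation X E V f \<longleftrightarrow> open V \<and> holo_fun X V f \<and>
     (\<forall>c\<in>X. \<forall>p\<in>V \<inter> fst c.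
        (\<exists>\<^sub>F z in at (snd c p). in_chart c f z \<noteq> 0) \<and>
        zorder (in_chart c f) (snd c p) = int (E p))"

definition divisor_bundle ::
  "'a::t2_space chart set \<Rightarrow> ('a \<Rightarrow> nat) \<Rightarrow> ('a, 'a set \<times> ('a \<Rightarrow> complex)) line_bundle" where
  "divisor_bundle X E =
     Line_Bundle {(V, f). local_equation X E V f} fst
       (\<lambda>i j p. Lim (at p) (\<lambda>q. snd i q / snd j q))"

text \<open>\<open>L\<^sub>0 = \<Psi>\<^sup>*L\<close>: a local section \<open>F\<close> is holomorphic iff \<open>\<partial>\<^bsub>z bar\<^esub>F\<close> is orthogonal to \<open>F\<close>.\<close>

definition L0_frame ::
  "'a::topological_space chart set \<Rightarrow> ('a \<Rightarrow> (complex ^ 'n) set) \<Rightarrow> 'a set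
     \<Rightarrow> ('a \<Rightarrow> complex ^ 'n) \<Rightarrow> bool" where
  "L0_frame X \<Psi> U F \<longleftrightarrow> smooth_lift X \<Psi> U F \<and>
     (\<forall>c\<in>X. \<forall>p\<in>U \<inter> fst c. herm (dzbar_vec c F p) (F p) = 0)"

definition L0_bundle ::
  "'a::topological_space chart set \<Rightarrow> ('a \<Rightarrow> (complex ^ 'n) set)
     \<Rightarrow> ('a, 'a set \<times> ('a \<Rightarrow> complex ^ 'n)) line_bundle" where
  "L0_bundle X \<Psi> =
     Line_Bundle {(U, F). L0_frame X \<Psi> U F} fst (\<lambda>i j p. THE a. snd j p = a *s snd i p)"


section \<open>Spin structures and the Dirac operator\<close>

text \<open>A spin structure is a holomorphic line bundle \<open>S\<close> together with a holomorphic isomorphism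
  \<open>\<iota> : S \<otimes> S \<rightarrow> K\<close>.\<close>

definition spin_structure ::
  "'a::topological_space chart set \<Rightarrow> ('a, 'i) line_bundle
     \<Rightarrow> ('i \<times> 'i \<Rightarrow> 'a chart \<Rightarrow> 'a \<Rightarrow> complex) \<Rightarrow> bool" where
  "spin_structure X S \<iota> \<longleftrightarrow> holomorphic_line_bundle X S \<and>
     holomorphic_iso X (tensor_bundle S S) (canonical_bundle X) \<iota>"

text \<open>\<open>|s|\<^sup>2 = |s \<otimes> s|\<close>, where \<open>|dz| = \<rho>\<^bsup>-1/2\<^esup>\<close> for the metric \<open>\<rho> (dx\<^sup>2 + dy\<^sup>2)\<close>. As only
  moduli enter, the same expression serves for sections of the conjugate bundle.\<close>

definition spin_norm_sq ::
  "'a chart set \<Rightarrow> ('a, 'i) line_bundle \<Rightarrow> ('i \<times> 'i \<Rightarrow> 'a chart \<Rightarrow> 'a \<Rightarrow> complex)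
     \<Rightarrow> 'a conf_metric \<Rightarrow> ('i \<Rightarrow> 'a \<Rightarrow> complex) \<Rightarrow> 'a \<Rightarrow> real" where
  "spin_norm_sq X S \<iota> g s p =
     (THE r. \<exists>i\<in>frame_set S. \<exists>c\<in>X. p \<in> frame_dom S i \<inter> fst c \<and>
        r = cmod (s i p * s i p * \<iota> (i, i) c p) / sqrt (g c p))"

definition spinor_norm_sq ::
  "'a chart set \<Rightarrow> ('a, 'i) line_bundle \<Rightarrow> ('i \<times> 'i \<Rightarrow> 'a chart \<Rightarrow> 'a \<Rightarrow> complex)
     \<Rightarrow> 'a conf_metric \<Rightarrow> ('i \<Rightarrow> 'a \<Rightarrow> complex) \<times> ('i \<Rightarrow> 'a \<Rightarrow> complex) \<Rightarrow> 'a \<Rightarrow> real" where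
  "spinor_norm_sq X S \<iota> g \<psi> p =
     spin_norm_sq X S \<iota> g (fst \<psi>) p + spin_norm_sq X S \<iota> g (snd \<psi>) p"

definition smooth_spinor ::
  "'a chart set \<Rightarrow> ('a, 'i) line_bundle
     \<Rightarrow> ('i \<Rightarrow> 'a \<Rightarrow> complex) \<times> ('i \<Rightarrow> 'a \<Rightarrow> complex) \<Rightarrow> bool" where
  "smooth_spinor X S \<psi> \<longleftrightarrow>
     smooth_section X S (fst \<psi>) \<and> smooth_section X (conj_bundle S) (snd \<psi>)"

text \<open>\<open>s\<^sub>0 = u e\<^sub>i\<close> is a holomorphic section over \<open>V\<close> with \<open>s\<^sub>0 \<otimes> s\<^sub>0 = dz\<close>.\<close>

definition root_of_dz ::
  "'a::topological_space chart set \<Rightarrow> ('a, 'i) line_bundle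
     \<Rightarrow> ('i \<times> 'i \<Rightarrow> 'a chart \<Rightarrow> 'a \<Rightarrow> complex) \<Rightarrow> 'a chart \<Rightarrow> 'i \<Rightarrow> 'a set \<Rightarrow> ('a \<Rightarrow> complex)
     \<Rightarrow> bool" where
  "root_of_dz X S \<iota> c i V u \<longleftrightarrow>
     c \<in> X \<and> i \<in> frame_set S \<and> open V \<and> V \<subseteq> fst c \<inter> frame_dom S i \<and> holo_fun X V u \<and>
     (\<forall>p\<in>V. u p * u p * \<iota> (i, i) c p = 1)"

text \<open>\<open>dirac_on X S \<iota> g W \<psi> \<phi>\<close>: on the set \<open>W\<close> one has \<open>\<phi> = D\<^sub>g \<psi>\<close>, where
  \<open>D\<^sub>g (f s\<^sub>0, h cnj(s\<^sub>0)) = 2 (|s\<^sub>0|\<^sup>2 (\<partial>\<^sub>z h) s\<^sub>0, - |s\<^sub>0|\<^sup>2 (\<partial>\<^bsub>z bar\<^esub> f) cnj(s\<^sub>0))\<close> and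
  \<open>|s\<^sub>0|\<^sup>2 = \<rho>\<^bsup>-1/2\<^esup>\<close> for every local \<open>s\<^sub>0 = u e\<^sub>i\<close> with \<open>s\<^sub>0 \<otimes> s\<^sub>0 = dz\<close>. Such \<open>s\<^sub>0\<close> exist near
  every point.\<close>

definition dirac_on ::
  "'a::topological_space chart set \<Rightarrow> ('a, 'i) line_bundle
     \<Rightarrow> ('i \<times> 'i \<Rightarrow> 'a chart \<Rightarrow> 'a \<Rightarrow> complex) \<Rightarrow> 'a conf_metric \<Rightarrow> 'a set
     \<Rightarrow> ('i \<Rightarrow> 'a \<Rightarrow> complex) \<times> ('i \<Rightarrow> 'a \<Rightarrow> complex)
     \<Rightarrow> ('i \<Rightarrow> 'a \<Rightarrow> complex) \<times> ('i \<Rightarrow> 'a \<Rightarrow> complex) \<Rightarrow> bool" where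
  "dirac_on X S \<iota> g W \<psi> \<phi> \<longleftrightarrow>
     (\<forall>c i V u. root_of_dz X S \<iota> c i V u \<longrightarrow>
        (\<forall>p\<in>V \<inter> W.
           fst \<phi> i p =
             2 * complex_of_real (1 / sqrt (g c p)) * dz c (\<lambda>q. snd \<psi> i q / cnj (u q)) p * u p \<and>
           snd \<phi> i p =
             - 2 * complex_of_real (1 / sqrt (g c p)) * dzbar c (\<lambda>q. fst \<psi> i q / u q) p * cnj (u p)))"

text \<open>Solutions of \<open>D\<^sub>g \<psi> = \<mu> \<psi>\<close> on \<open>W\<close>. The zero spinor is not excluded: below, \<open>\<psi>\<^sub>j\<close> vanishes
  identically if \<open>\<Psi>\<close> takes values in the projective subspace where the corresponding two homogeneous
  coordinates are zero.\<close>

definition eigenspinor_on ::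
  "'a::topological_space chart set \<Rightarrow> ('a, 'i) line_bundle
     \<Rightarrow> ('i \<times> 'i \<Rightarrow> 'a chart \<Rightarrow> 'a \<Rightarrow> complex) \<Rightarrow> 'a conf_metric \<Rightarrow> 'a set \<Rightarrow> real
     \<Rightarrow> ('i \<Rightarrow> 'a \<Rightarrow> complex) \<times> ('i \<Rightarrow> 'a \<Rightarrow> complex) \<Rightarrow> bool" where
  "eigenspinor_on X S \<iota> g W \<mu> \<psi> \<longleftrightarrow> smooth_spinor X S \<psi> \<and>
     dirac_on X S \<iota> g W \<psi>
       (\<lambda>i p. of_real \<mu> * fst \<psi> i p, \<lambda>i p. of_real \<mu> * snd \<psi> i p)"


section \<open>The spin structure and the metric induced by a quaternionic harmonic map\<close>

type_synonym ('a, 'n) spin_frame =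
  "('a set \<times> ('a \<Rightarrow> complex ^ 'n)) \<times> ('a set \<times> ('a \<Rightarrow> complex))"

definition half_divisor ::
  "'a::topological_space chart set \<Rightarrow> ('a \<Rightarrow> (complex ^ 'n) set) \<Rightarrow> 'a \<Rightarrow> nat" where
  "half_divisor X \<Psi> p = dbar_order X \<Psi> p div 2"

definition S_Psi ::
  "'a::t2_space chart set \<Rightarrow> ('a \<Rightarrow> (complex ^ 'n) set) \<Rightarrow> ('a, ('a, 'n) spin_frame) line_bundle"
  where
  "S_Psi X \<Psi> =
     tensor_bundle (dual_bundle (L0_bundle X \<Psi>)) (divisor_bundle X (half_divisor X \<Psi>))"

definition riesz_vector ::
  "('a \<Rightarrow> (complex ^ 'n) set) \<Rightarrow> 'a \<Rightarrow> (complex ^ 'n \<Rightarrow> complex) \<Rightarrow> complex ^ 'n" where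
  "riesz_vector \<Psi> p s = (THE v. v \<in> \<Psi> p \<and> (\<forall>w\<in>\<Psi> p. s w = herm w v))"

text \<open>The coefficient of \<open>dz\<close> in \<open>A(s\<^sub>1 \<otimes> s\<^sub>2)\<close>, for linear functionals \<open>s\<^sub>1, s\<^sub>2\<close> on the
  line \<open>\<Psi> p\<close>.\<close>

definition A_value ::
  "'a::topological_space chart set \<Rightarrow> ('a \<Rightarrow> (complex ^ ('m::finite \<times> 2)) set) \<Rightarrow> 'a chart \<Rightarrow> 'a
     \<Rightarrow> (complex ^ ('m \<times> 2) \<Rightarrow> complex) \<Rightarrow> (complex ^ ('m \<times> 2) \<Rightarrow> complex) \<Rightarrow> complex" where
  "A_value X \<Psi> c p s1 s2 =
     cnj (herm (dbar_Psi X \<Psi> c p (riesz_vector \<Psi> p s1)) (quat_I (riesz_vector \<Psi> p s2)))"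

text \<open>The functional on the line of \<open>F p\<close> taking the value 1 at \<open>F p\<close>, that is, the frame of
  \<open>L\<^sub>0\<^sup>*\<close> dual to \<open>F\<close>.\<close>

definition coframe :: "('a \<Rightarrow> complex ^ 'n) \<Rightarrow> 'a \<Rightarrow> complex ^ 'n \<Rightarrow> complex" where
  "coframe F p w = (THE a. w = a *s F p)"

definition A_hom ::
  "'a::topological_space chart set \<Rightarrow> ('a \<Rightarrow> (complex ^ ('m::finite \<times> 2)) set)
     \<Rightarrow> ('a set \<times> ('a \<Rightarrow> complex ^ ('m \<times> 2))) \<times> ('a set \<times> ('a \<Rightarrow> complex ^ ('m \<times> 2)))
     \<Rightarrow> 'a chart \<Rightarrow> 'a \<Rightarrow> complex" where
  "A_hom X \<Psi> i c p = A_value X \<Psi> c p (coframe (snd (fst i)) p) (coframe (snd (snd i)) p)"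

definition holomorphic_hom_with_divisor ::
  "'a::topological_space chart set \<Rightarrow> ('a, 'i) line_bundle \<Rightarrow> ('a, 'k) line_bundle
     \<Rightarrow> ('i \<Rightarrow> 'k \<Rightarrow> 'a \<Rightarrow> complex) \<Rightarrow> ('a \<Rightarrow> nat) \<Rightarrow> bool" where
  "holomorphic_hom_with_divisor X L N h E \<longleftrightarrow> holomorphic_hom X L N h \<and>
     (\<forall>i\<in>frame_set L. \<forall>k\<in>frame_set N.
        local_equation X E (frame_dom L i \<inter> frame_dom N k) (h i k))"

text \<open>\<open>\<iota>((s\<^sub>1 \<otimes> 1\<^bsub>D/2\<^esub>) \<otimes> (s\<^sub>2 \<otimes> 1\<^bsub>D/2\<^esub>)) = A(s\<^sub>1 \<otimes> s\<^sub>2)\<close>, that is,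
  \<open>s\<^sub>1 \<otimes> s\<^sub>2 \<otimes> 1\<^sub>D \<mapsto> A(s\<^sub>1 \<otimes> s\<^sub>2)\<close>; in the frame given by a local equation \<open>f\<close> the section
  \<open>1\<^bsub>D/2\<^esub>\<close> has the coefficient \<open>f\<close>.\<close>

definition induced_by_A ::
  "'a::t2_space chart set \<Rightarrow> ('a \<Rightarrow> (complex ^ ('m::finite \<times> 2)) set)
     \<Rightarrow> (('a, 'm \<times> 2) spin_frame \<times> ('a, 'm \<times> 2) spin_frame \<Rightarrow> 'a chart \<Rightarrow> 'a \<Rightarrow> complex) \<Rightarrow> bool"
  where
  "induced_by_A X \<Psi> \<iota> \<longleftrightarrow>
     (\<forall>i\<in>frame_set (S_Psi X \<Psi>). \<forall>j\<in>frame_set (S_Psi X \<Psi>). \<forall>c\<in>X.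
        \<forall>p\<in>frame_dom (S_Psi X \<Psi>) i \<inter> frame_dom (S_Psi X \<Psi>) j \<inter> fst c.
          snd (snd i) p * snd (snd j) p * \<iota> (i, j) c p = A_hom X \<Psi> (fst i, fst j) c p)"

text \<open>\<open>|\<partial>\<^bsup>bar\<^esup>\<Psi>|\<^sub>g\<^sup>2 g\<close>, which degenerates at the zeros of \<open>\<partial>\<^bsup>bar\<^esup>\<Psi>\<close>.\<close>

definition g_Psi ::
  "'a::topological_space chart set \<Rightarrow> 'a conf_metric \<Rightarrow> ('a \<Rightarrow> (complex ^ 'n) set)
     \<Rightarrow> 'a conf_metric" where
  "g_Psi X g \<Psi> c p = dbar_norm_sq X g \<Psi> p * g c p"

text \<open>The coefficients \<open>(\<psi>\<^sub>1\<^sub>+, cnj \<psi>\<^sub>1\<^sub>-, \<dots>, \<psi>\<^sub>m\<^sub>+, cnj \<psi>\<^sub>m\<^sub>-)\<close>, all sections of the same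
  bundle \<open>S\<close>, in the frame \<open>e\<^sub>i\<close>.\<close>

definition spinor_coords ::
  "('m::finite \<Rightarrow> ('i \<Rightarrow> 'a \<Rightarrow> complex) \<times> ('i \<Rightarrow> 'a \<Rightarrow> complex)) \<Rightarrow> 'i \<Rightarrow> 'a
     \<Rightarrow> complex ^ ('m \<times> 2)" where
  "spinor_coords \<psi> i p =
     (\<chi> jk. if snd jk = 1 then fst (\<psi> (fst jk)) i p else cnj (snd (\<psi> (fst jk)) i p))"

text \<open>\<open>\<Psi>\<close> is the continuous extension, across the common zeros, of the map with the given
  homogeneous coordinates.\<close>

definition has_homogeneous_coords ::
  "('a::topological_space, 'i) line_bundle \<Rightarrow> ('a \<Rightarrow> (complex ^ 'n) set)
     \<Rightarrow> ('i \<Rightarrow> 'a \<Rightarrow> complex ^ 'n) \<Rightarrow> bool" where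
  "has_homogeneous_coords S \<Psi> w \<longleftrightarrow> continuous_map_CP \<Psi> \<and>
     closure {p. \<exists>i\<in>frame_set S. p \<in> frame_dom S i \<and> w i p \<noteq> 0} = UNIV \<and>
     (\<forall>i\<in>frame_set S. \<forall>p\<in>frame_dom S i. w i p \<noteq> 0 \<longrightarrow> \<Psi> p = cline (w i p))"

end

theory Submission
  imports Defs
begin

text \<open>
  Near every point there is a lift \<open>F\<close> of \<open>\<Psi>\<close> with \<open>\<partial>F/\<partial>cnj z \<bottom> F\<close>; it is obtained from an arbitrary lift by solving
  an inhomogeneous Cauchy--Riemann equation. The condition \<open>L\<^sub>-\<^sub>1 = I(L\<^sub>0)\<close> says that
  \<open>\<partial>F/\<partial>cnj z = \<beta> I(F)\<close> for a function \<open>\<beta>\<close>. Varying \<open>F\<close> in the direction \<open>\<phi> I(F)\<close>, one sees that the energy is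
  stationary only if \<open>(\<partial>/\<partial>z) (\<beta> / |F|\<^sup>2) = 0\<close>. In the frame dual to \<open>F\<close> the map \<open>A\<close> is the
  function \<open>a = cnj(\<beta>) / |F|\<^sup>2\<close>, so it is holomorphic, and its order of vanishing is that of \<open>dbar \<Psi>\<close>.
  Moreover \<open>g\<^sub>\<Psi> = 4 |\<beta>|\<^sup>2 (dx\<^sup>2 + dy\<^sup>2)\<close>. The coordinates of \<open>\<complex>\<^sup>2\<^sup>m\<close> restrict to sections of \<open>L\<^sub>0\<^sup>*\<close>; multiplied by
  \<open>\<surd>2 \<cdot> 1\<^bsub>D/2\<^esub>\<close> and combined in pairs they give the spinors, and the Dirac equation with eigenvalue \<open>1\<close> is
  \<open>\<partial>F/\<partial>cnj z = \<beta> I(F)\<close> read componentwise.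
\<close>

section \<open>Calculus of smooth maps\<close>

text \<open>Only the direction \<open>\<phi> I(F)\<close> is varied, because a single complex
  equation has to be extracted. The derivative of the energy integrand is \<open>16 Re\<close> of a
  sum of exact terms, which integrate to zero, minus twice \<open>cnj \<phi> \<kappa>\<close>, where
  \<open>\<kappa> = |F|\<^sup>2 (\<partial>/\<partial>z)(\<beta> / |F|\<^sup>2)\<close>. The choice
  \<open>\<phi> = \<eta> \<kappa>\<close> with a cutoff \<open>\<eta>\<close> forces
  \<open>\<kappa> = 0\<close>. The constants come from \<open>4g_FS\<close>, which gives
  \<open>sqrt g\<^sub>\<Psi> = 2 |a| |F|\<^sup>2\<close>. The 2 cancels the 2 of the Dirac operator,
  whence the eigenvalue 1; and the section with coefficient \<open>f F_k\<close> has squared length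
  \<open>|F_k|\<^sup>2 / (2 |F|\<^sup>2)\<close>, whence \<open>\<surd>2\<close>. Two obstacles
  shape the proof. The measure, the norms, \<open>hom_value\<close> and the orders are definite
  descriptions, so existence and independence of chart and lift come before any computation. And at
  zeros of \<open>dbar \<Psi>\<close> quotients such as \<open>a / f\<^sup>2\<close> make no
  pointwise sense; identities are proved off the zeros, which are isolated, and passed to the
  limit.\<close>

lemma Ck_on_cong:
  assumes "open S" "\<And>x. x \<in> S \<Longrightarrow> f x = g x"
  shows "Ck_on k S f \<longleftrightarrow> Ck_on k S g"
  using assms
proof (induction k arbitrary: f g)
  case 0
  then show ?case by (auto cong: continuous_on_cong)
next
  case (Suc k)
  have ev: "eventually (\<lambda>y. f y = g y) (nhds x)" if "x \<in> S" for x
    using Suc.prems that eventually_nhds by blast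
  have hd: "(f has_derivative D) (at x) \<longleftrightarrow> (g has_derivative D) (at x)" if "x \<in> S" for x D
    by (metis Suc.prems has_derivative_transform_within_open that)
  have fd: "frechet_derivative f (at x) = frechet_derivative g (at x)" if "x \<in> S" for x
    unfolding frechet_derivative_def using hd[OF that] by simp
  have d: "f differentiable (at x) \<longleftrightarrow> g differentiable (at x)" if "x \<in> S" for x
    unfolding differentiable_def using hd[OF that] by simp
  have "Ck_on k S (\<lambda>x. frechet_derivative f (at x) v) \<longleftrightarrow> Ck_on k S (\<lambda>x. frechet_derivative g (at x) v)" for v
    by (rule Suc.IH[OF Suc.prems(1)]) (simp add: fd)
  then show ?case
    using d by simp
qed

text \<open>Smoothness is proved by induction on \<open>k\<close> through this rule: it suffices to
  have some formula \<open>f'\<close> for the derivative whose values in each fixed direction are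
  again built from functions of class \<open>k\<close>.\<close>

lemma Ck_on_SucI:
  assumes "open S" "\<And>x. x \<in> S \<Longrightarrow> (f has_derivative f' x) (at x)"
    and "\<And>v. Ck_on k S (\<lambda>x. f' x v)"
  shows "Ck_on (Suc k) S f"
proof -
  have "frechet_derivative f (at x) = f' x" if "x \<in> S" for x
    using assms(2)[OF that] frechet_derivative_at by metis
  then have "Ck_on k S (\<lambda>x. frechet_derivative f (at x) v)" for v
    using Ck_on_cong[OF assms(1), of "\<lambda>x. frechet_derivative f (at x) v" "\<lambda>x. f' x v"] assms(3)
    by simp
  then show ?thesis using assms(2) by (auto simp: differentiable_def)
qed

lemma Ck_on_SucD:
  assumes "Ck_on (Suc k) S f"
  shows "x \<in> S \<Longrightarrow> (f has_derivative frechet_derivative f (at x)) (at x)"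
    and "Ck_on k S (\<lambda>x. frechet_derivative f (at x) v)"
  using assms by (auto simp: frechet_derivative_works)

lemma Ck_on_imp_continuous_on: "Ck_on k S f \<Longrightarrow> continuous_on S f"
proof (cases k)
  case (Suc n)
  assume "Ck_on k S f"
  then show ?thesis
    using Suc by (auto intro!: continuous_at_imp_continuous_on differentiable_imp_continuous_within)
qed auto

text \<open>The recursion in \<open>Ck_on\<close> asks only for differentiability and for the
  directional derivatives, so the inclusion of the classes is itself an induction. Product rules
  depend on it: their derivatives contain undifferentiated factors of class
  \<open>Suc k\<close>.\<close>

lemma Ck_on_pred: "Ck_on (Suc k) S f \<Longrightarrow> Ck_on k S f"
proof (induction k arbitrary: f)
  case 0
  then show ?case using Ck_on_imp_continuous_on[OF 0] by simp
next
  case (Suc k)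
  then show ?case by simp
qed

lemma Ck_on_subset: "Ck_on k S f \<Longrightarrow> T \<subseteq> S \<Longrightarrow> Ck_on k T f"
  by (induction k arbitrary: f) (auto intro: continuous_on_subset)

lemma Ck_on_local:
  assumes "\<And>x. x \<in> S \<Longrightarrow> \<exists>T. open T \<and> x \<in> T \<and> Ck_on k T f"
  shows "Ck_on k S f"
  using assms
proof (induction k arbitrary: f)
  case 0
  have "isCont f x" if x: "x \<in> S" for x
    using 0[OF x] continuous_on_eq_continuous_at by fastforce
  then show ?case by (simp add: continuous_at_imp_continuous_on)
next
  case (Suc k)
  have "Ck_on k S (\<lambda>x. frechet_derivative f (at x) v)" for v
    by (rule Suc.IH) (use Suc.prems in fastforce)
  moreover have "f differentiable (at x)" if "x \<in> S" for x
    using Suc.prems[OF that] by auto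
  ultimately show ?case by simp
qed

lemma Ck_on_const [simp]: "Ck_on k S (\<lambda>x. c)"
  by (induction k arbitrary: c) (auto simp: frechet_derivative_const)

lemma Ck_on_bounded_linear_comp:
  assumes "bounded_linear L" "open S" "Ck_on k S f"
  shows "Ck_on k S (\<lambda>x. L (f x))"
  using assms(3)
proof (induction k arbitrary: f)
  case 0
  then show ?case using assms(1) bounded_linear.continuous_on by auto
next
  case (Suc k)
  note D = Ck_on_SucD[OF Suc.prems]
  show ?case
    by (rule Ck_on_SucI[OF assms(2) bounded_linear.has_derivative[OF assms(1) D(1)] Suc.IH[OF D(2)]])
qed

lemma Ck_on_bounded_linear:
  assumes "bounded_linear L" "open S"
  shows "Ck_on k S L"
proof (cases k)
  case 0
  then show ?thesis using assms by (simp add: linear_continuous_on)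
next
  case (Suc n)
  show ?thesis unfolding Suc
    by (rule Ck_on_SucI[OF assms(2) bounded_linear_imp_has_derivative[OF assms(1)]]) auto
qed

lemma Ck_on_add:
  assumes "open S" "Ck_on k S f" "Ck_on k S g"
  shows "Ck_on k S (\<lambda>x. f x + g x)"
  using assms(2,3)
proof (induction k arbitrary: f g)
  case 0
  then show ?case by (auto intro: continuous_intros)
next
  case (Suc k)
  show ?case
    by (rule Ck_on_SucI[OF assms(1) has_derivative_add[OF Ck_on_SucD(1)[OF Suc.prems(1)] Ck_on_SucD(1)[OF Suc.prems(2)]]
        Suc.IH[OF Ck_on_SucD(2)[OF Suc.prems(1)] Ck_on_SucD(2)[OF Suc.prems(2)]]])
qed

lemma Ck_on_sum:
  assumes "open S" "\<And>i. i \<in> I \<Longrightarrow> Ck_on k S (f i)"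
  shows "Ck_on k S (\<lambda>x. \<Sum>i\<in>I. f i x)"
  using assms(2) by (induction I rule: infinite_finite_induct) (auto intro!: Ck_on_add[OF assms(1)])

lemma Ck_on_bilinear:
  assumes "bounded_bilinear prd" "open S" "Ck_on k S f" "Ck_on k S g"
  shows "Ck_on k S (\<lambda>x. prd (f x) (g x))"
  using assms(3,4)
proof (induction k arbitrary: f g)
  case 0
  then show ?case using assms(1) bounded_bilinear.continuous_on by auto
next
  case (Suc k)
  note D = Ck_on_SucD[OF Suc.prems(1)] Ck_on_SucD[OF Suc.prems(2)]
  show ?case
    by (rule Ck_on_SucI[OF assms(2) bounded_bilinear.FDERIV[OF assms(1) D(1) D(3)]])
       (auto intro!: Ck_on_add[OF assms(2)] Suc.IH Ck_on_pred[OF Suc.prems(1)]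
          Ck_on_pred[OF Suc.prems(2)] simp del: Ck_on.simps(2) intro: D)
qed

lemma Ck_on_inverse:
  fixes f :: "'v::real_normed_vector \<Rightarrow> 'w::real_normed_field"
  assumes "open S" "Ck_on k S f" "\<And>x. x \<in> S \<Longrightarrow> f x \<noteq> 0"
  shows "Ck_on k S (\<lambda>x. inverse (f x))"
  using assms(2,3)
proof (induction k arbitrary: f)
  case 0
  then show ?case by (auto intro: continuous_intros)
next
  case (Suc k)
  note D = Ck_on_SucD[OF Suc.prems(1)]
  have I: "Ck_on k S (\<lambda>x. inverse (f x))"
    by (rule Suc.IH[OF Ck_on_pred[OF Suc.prems(1)] Suc.prems(2)])
  have m: "bounded_bilinear ((*) :: 'w \<Rightarrow> _)" by (rule bounded_bilinear_mult)
  show ?case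
    by (rule Ck_on_SucI[OF assms(1) Deriv.has_derivative_inverse[OF Suc.prems(2) D(1)]])
       (auto intro!: Ck_on_bounded_linear_comp[OF bounded_linear_minus[OF bounded_linear_ident] assms(1)]
          Ck_on_bilinear[OF m assms(1)] I D(2) simp del: Ck_on.simps(2))
qed

lemma Ck_on_exp:
  fixes f :: "'v::real_normed_vector \<Rightarrow> complex"
  assumes "open S" "Ck_on k S f"
  shows "Ck_on k S (\<lambda>x. exp (f x))"
  using assms(2)
proof (induction k arbitrary: f)
  case 0
  then show ?case by (auto intro: continuous_intros)
next
  case (Suc k)
  note D = Ck_on_SucD[OF Suc.prems(1)]
  have I: "Ck_on k S (\<lambda>x. exp (f x))"
    by (rule Suc.IH[OF Ck_on_pred[OF Suc.prems(1)]])
  have "((\<lambda>x. exp (f x)) has_derivative (\<lambda>v. exp (f x) * frechet_derivative f (at x) v)) (at x)"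
    if "x \<in> S" for x
    using has_derivative_compose[OF D(1)[OF that] DERIV_exp[unfolded has_field_derivative_def]]
    by simp
  then show ?case
    by (rule Ck_on_SucI[OF assms(1)])
       (auto intro!: Ck_on_bilinear[OF bounded_bilinear_mult assms(1)] I D(2) simp del: Ck_on.simps(2))
qed

text \<open>The derivative is that of \<open>f\<close> at \<open>g x\<close> in a direction that
  varies with \<open>x\<close>, while \<open>Ck_on\<close> controls fixed directions. Expanding in
  \<open>Basis\<close> turns it into a sum of fixed-direction derivatives of \<open>f\<close>
  composed with \<open>g\<close>, to which the induction hypothesis applies; hence the Euclidean
  middle space.\<close>

lemma Ck_on_compose:
  fixes g :: "'v::real_normed_vector \<Rightarrow> 'u::euclidean_space"
  assumes "open S" "Ck_on k S g" "open T" "Ck_on k T f" "g ` S \<subseteq> T"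
  shows "Ck_on k S (\<lambda>x. f (g x))"
  using assms(2,4)
proof (induction k arbitrary: f)
  case 0
  then show ?case using assms(5) continuous_on_compose2 by (metis Ck_on.simps(1))
next
  case (Suc k)
  note Dg = Ck_on_SucD[OF Suc.prems(1)] and Df = Ck_on_SucD[OF Suc.prems(2)]
  have d: "((\<lambda>x. f (g x)) has_derivative
      (\<lambda>v. \<Sum>b\<in>Basis. (frechet_derivative g (at x) v \<bullet> b) *\<^sub>R frechet_derivative f (at (g x)) b)) (at x)"
    if x: "x \<in> S" for x
  proof -
    have gx: "g x \<in> T" using assms(5) x by auto
    have l: "linear (frechet_derivative f (at (g x)))"
      using Df(1)[OF gx] has_derivative_linear by blast
    have rep: "frechet_derivative f (at (g x)) w
       = (\<Sum>b\<in>Basis. (w \<bullet> b) *\<^sub>R frechet_derivative f (at (g x)) b)" for w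
    proof -
      have "frechet_derivative f (at (g x)) w = frechet_derivative f (at (g x)) (\<Sum>b\<in>Basis. (w \<bullet> b) *\<^sub>R b)"
        by (simp add: euclidean_representation)
      then show ?thesis by (simp add: linear_sum[OF l] linear_cmul[OF l])
    qed
    have "(\<lambda>v. frechet_derivative f (at (g x)) (frechet_derivative g (at x) v)) =
      (\<lambda>v. \<Sum>b\<in>Basis. (frechet_derivative g (at x) v \<bullet> b) *\<^sub>R frechet_derivative f (at (g x)) b)"
      by (rule ext) (rule rep)
    then show ?thesis
      using has_derivative_compose[OF Dg(1)[OF x] Df(1)[OF gx]] by metis
  qed
  show ?case
  proof (rule Ck_on_SucI[OF assms(1) d])
    fix v
    show "Ck_on k S (\<lambda>x. \<Sum>b\<in>Basis. (frechet_derivative g (at x) v \<bullet> b) *\<^sub>R frechet_derivative f (at (g x)) b)"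
      by (intro Ck_on_sum assms Ck_on_bilinear[OF bounded_bilinear_scaleR]
          Ck_on_bounded_linear_comp[OF bounded_linear_inner_left] Dg(2)
          Suc.IH[OF Ck_on_pred[OF Suc.prems(1)]] Df(2))
  qed
qed

lemma Ck_on_holomorphic:
  assumes "open S" "f holomorphic_on S"
  shows "Ck_on k S f"
  using assms(2)
proof (induction k arbitrary: f)
  case 0
  then show ?case by (simp add: holomorphic_on_imp_continuous_on)
next
  case (Suc k)
  have "(f has_derivative (\<lambda>v. deriv f x * v)) (at x)" if "x \<in> S" for x
    using holomorphic_derivI[OF Suc.prems assms(1) that] has_field_derivative_def by blast
  then show ?case
    by (rule Ck_on_SucI[OF assms(1)])
      (auto intro!: Suc.IH holomorphic_intros Suc.prems assms(1))
qed

lemma smooth_on_cong: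
  assumes "open S" "\<And>x. x \<in> S \<Longrightarrow> f x = g x"
  shows "smooth_on S f \<longleftrightarrow> smooth_on S g"
  using Ck_on_cong[OF assms] by (simp add: smooth_on_def)

lemma smooth_on_subset: "smooth_on S f \<Longrightarrow> T \<subseteq> S \<Longrightarrow> smooth_on T f"
  unfolding smooth_on_def by (blast intro: Ck_on_subset)

lemma smooth_on_local:
  assumes "\<And>x. x \<in> S \<Longrightarrow> \<exists>T. open T \<and> x \<in> T \<and> smooth_on T f"
  shows "smooth_on S f"
  unfolding smooth_on_def
proof
  show "Ck_on k S f" for k
    by (rule Ck_on_local) (use assms in \<open>auto simp: smooth_on_def\<close>)
qed

lemma smooth_on_imp_continuous_on: "smooth_on S f \<Longrightarrow> continuous_on S f"
  unfolding smooth_on_def by (blast intro: Ck_on_imp_continuous_on)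

lemma smooth_on_has_derivative:
  "smooth_on S f \<Longrightarrow> x \<in> S \<Longrightarrow> (f has_derivative frechet_derivative f (at x)) (at x)"
  unfolding smooth_on_def by (blast intro: Ck_on_SucD(1))

lemma smooth_on_frechet:
  "smooth_on S f \<Longrightarrow> smooth_on S (\<lambda>x. frechet_derivative f (at x) v)"
  unfolding smooth_on_def by (blast intro: Ck_on_SucD(2))

lemma smooth_on_const [simp]: "smooth_on S (\<lambda>x. c)"
  by (simp add: smooth_on_def)

lemma smooth_on_bounded_linear_comp:
  "bounded_linear L \<Longrightarrow> open S \<Longrightarrow> smooth_on S f \<Longrightarrow> smooth_on S (\<lambda>x. L (f x))"
  by (simp add: smooth_on_def Ck_on_bounded_linear_comp)

lemma smooth_on_bounded_linear: "bounded_linear L \<Longrightarrow> open S \<Longrightarrow> smooth_on S L"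
  by (simp add: smooth_on_def Ck_on_bounded_linear)

lemma smooth_on_ident: "open S \<Longrightarrow> smooth_on S (\<lambda>x. x)"
  by (rule smooth_on_bounded_linear[OF bounded_linear_ident])

lemma smooth_on_add:
  "open S \<Longrightarrow> smooth_on S f \<Longrightarrow> smooth_on S g \<Longrightarrow> smooth_on S (\<lambda>x. f x + g x)"
  by (simp add: smooth_on_def Ck_on_add)

lemma smooth_on_sum:
  "open S \<Longrightarrow> (\<And>i. i \<in> I \<Longrightarrow> smooth_on S (f i)) \<Longrightarrow> smooth_on S (\<lambda>x. \<Sum>i\<in>I. f i x)"
  by (simp add: smooth_on_def Ck_on_sum)

lemma smooth_on_uminus: "open S \<Longrightarrow> smooth_on S f \<Longrightarrow> smooth_on S (\<lambda>x. - f x)"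
  by (rule smooth_on_bounded_linear_comp[OF bounded_linear_minus[OF bounded_linear_ident]])

lemma smooth_on_diff:
  "open S \<Longrightarrow> smooth_on S f \<Longrightarrow> smooth_on S g \<Longrightarrow> smooth_on S (\<lambda>x. f x - g x)"
  using smooth_on_add[of S f "\<lambda>x. - g x"] smooth_on_uminus[of S g] by simp

lemma smooth_on_mult:
  fixes f g :: "'v::real_normed_vector \<Rightarrow> 'w::real_normed_algebra"
  shows "open S \<Longrightarrow> smooth_on S f \<Longrightarrow> smooth_on S g \<Longrightarrow> smooth_on S (\<lambda>x. f x * g x)"
  by (simp add: smooth_on_def Ck_on_bilinear[OF bounded_bilinear_mult])

lemma smooth_on_inverse:
  fixes f :: "'v::real_normed_vector \<Rightarrow> 'w::real_normed_field"
  shows "open S \<Longrightarrow> smooth_on S f \<Longrightarrow> (\<And>x. x \<in> S \<Longrightarrow> f x \<noteq> 0) \<Longrightarrow> smooth_on S (\<lambda>x. inverse (f x))"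
  by (simp add: smooth_on_def Ck_on_inverse)

lemma smooth_on_divide:
  fixes f :: "'v::real_normed_vector \<Rightarrow> 'w::real_normed_field"
  shows "open S \<Longrightarrow> smooth_on S f \<Longrightarrow> smooth_on S g \<Longrightarrow> (\<And>x. x \<in> S \<Longrightarrow> g x \<noteq> 0) \<Longrightarrow>
    smooth_on S (\<lambda>x. f x / g x)"
  unfolding divide_inverse by (intro smooth_on_mult smooth_on_inverse)

lemma smooth_on_exp:
  fixes f :: "'v::real_normed_vector \<Rightarrow> complex"
  shows "open S \<Longrightarrow> smooth_on S f \<Longrightarrow> smooth_on S (\<lambda>x. exp (f x))"
  by (simp add: smooth_on_def Ck_on_exp)

lemma smooth_on_cnj: "open S \<Longrightarrow> smooth_on S f \<Longrightarrow> smooth_on S (\<lambda>x. cnj (f x))"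
  by (rule smooth_on_bounded_linear_comp[OF bounded_linear_cnj])

lemma smooth_on_of_real: "open S \<Longrightarrow> smooth_on S f \<Longrightarrow> smooth_on S (\<lambda>x. complex_of_real (f x))"
  by (rule smooth_on_bounded_linear_comp[OF bounded_linear_of_real])

lemma smooth_on_Re: "open S \<Longrightarrow> smooth_on S f \<Longrightarrow> smooth_on S (\<lambda>x. Re (f x))"
  by (rule smooth_on_bounded_linear_comp[OF bounded_linear_Re])

lemma smooth_on_vec_nth: "open S \<Longrightarrow> smooth_on S f \<Longrightarrow> smooth_on S (\<lambda>x. f x $ i)"
  by (rule smooth_on_bounded_linear_comp[OF bounded_linear_vec_nth])

lemma bounded_linear_axis: "bounded_linear (axis i :: 'w::euclidean_space \<Rightarrow> 'w ^ 'n)"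
  by (rule linear_conv_bounded_linear[THEN iffD1])
    (rule linearI; auto simp: vec_eq_iff axis_def)

lemma smooth_on_vec_lambda:
  fixes f :: "'v::real_normed_vector \<Rightarrow> 'n::finite \<Rightarrow> 'w::euclidean_space"
  assumes "open S" "\<And>i. smooth_on S (\<lambda>x. f x i)"
  shows "smooth_on S (\<lambda>x. \<chi> i. f x i)"
proof -
  have "(\<chi> i. f x i) = (\<Sum>i\<in>UNIV. axis i (f x i))" for x
    by (simp add: vec_eq_iff axis_def sum.delta)
  then show ?thesis
    using assms by (simp add: smooth_on_sum smooth_on_bounded_linear_comp[OF bounded_linear_axis])
qed

lemma smooth_on_compose:
  fixes g :: "'v::real_normed_vector \<Rightarrow> 'u::euclidean_space"
  shows "open S \<Longrightarrow> smooth_on S g \<Longrightarrow> open T \<Longrightarrow> smooth_on T f \<Longrightarrow> g ` S \<subseteq> T \<Longrightarrow>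
    smooth_on S (\<lambda>x. f (g x))"
  unfolding smooth_on_def using Ck_on_compose by blast

lemma smooth_on_holomorphic: "open S \<Longrightarrow> f holomorphic_on S \<Longrightarrow> smooth_on S f"
  by (simp add: smooth_on_def Ck_on_holomorphic)

lemma smooth_on_herm:
  assumes "open S" "smooth_on S f" "smooth_on S g"
  shows "smooth_on S (\<lambda>x. herm (f x) (g x))"
  unfolding herm_def
  by (intro smooth_on_sum smooth_on_mult smooth_on_cnj smooth_on_vec_nth assms)

lemma smooth_on_vec_scale:
  fixes f :: "'v::real_normed_vector \<Rightarrow> complex"
  assumes "open S" "smooth_on S f" "smooth_on S g"
  shows "smooth_on S (\<lambda>x. f x *s g x)"
  unfolding vector_scalar_mult_def
  by (intro smooth_on_vec_lambda smooth_on_mult smooth_on_vec_nth assms)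

section \<open>Cutoff functions\<close>

text \<open>The family \<open>p(1/x) exp(-1/x)\<close> is closed under differentiation, which the
  single function with \<open>p = 1\<close> is not; smoothness then follows by induction for all
  \<open>p\<close> at once.\<close>

definition flat_exp :: "real poly \<Rightarrow> real \<Rightarrow> real" where
  "flat_exp p x = (if 0 < x then poly p (1 / x) * exp (- (1 / x)) else 0)"

lemma poly_exp_tendsto_0: "((\<lambda>y. poly p y * exp (- y)) \<longlongrightarrow> (0::real)) at_top"
proof -
  have "((\<lambda>y. \<Sum>i\<le>degree p. coeff p i * (y ^ i / exp y)) \<longlongrightarrow> (\<Sum>i\<le>degree p. coeff p i * 0)) at_top"
    by (intro tendsto_sum tendsto_mult tendsto_const tendsto_power_div_exp_0)
  then show ?thesis
    by (simp add: poly_altdef exp_minus divide_inverse sum_distrib_right mult.assoc)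
qed

text \<open>With \<open>y = 1/x\<close> the derivative is \<open>y^2 (p(y) - p'(y)) exp(-y)\<close>;
  the polynomial \<open>[:0, 0, 1:]\<close> is \<open>y^2\<close>.\<close>

lemma flat_exp_DERIV:
  "(flat_exp p has_real_derivative flat_exp ([:0, 0, 1:] * (p - pderiv p)) x) (at x)"
proof -
  consider "x > 0" | "x < 0" | "x = 0" by linarith
  then show ?thesis
  proof cases
    case 1
    have "((\<lambda>x. poly p (1 / x) * exp (- (1 / x))) has_real_derivative
        poly ([:0, 0, 1:] * (p - pderiv p)) (1 / x) * exp (- (1 / x))) (at x)"
      using 1 by (auto intro!: derivative_eq_intros simp: divide_simps power2_eq_square) (simp add: algebra_simps)
    then have "((\<lambda>x. poly p (1 / x) * exp (- (1 / x))) has_real_derivative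
        flat_exp ([:0, 0, 1:] * (p - pderiv p)) x) (at x)"
      using 1 by (simp add: flat_exp_def)
    then show ?thesis
      by (rule DERIV_cong_ev[THEN iffD1, rotated -1])
        (use 1 in \<open>auto simp: flat_exp_def eventually_nhds intro!: exI[of _ "{0<..}"]\<close>)
  next
    case 2
    have "((\<lambda>x. 0) has_real_derivative flat_exp ([:0, 0, 1:] * (p - pderiv p)) x) (at x)"
      using 2 by (simp add: flat_exp_def)
    then show ?thesis
      by (rule DERIV_cong_ev[THEN iffD1, rotated -1])
        (use 2 in \<open>auto simp: flat_exp_def eventually_nhds intro!: exI[of _ "{..<0}"]\<close>)
  next
    case 3
    have "((\<lambda>h. flat_exp p h / h) \<longlongrightarrow> 0) (at_right 0)"
    proof -
      \<comment> \<open>The right difference quotient at 0 is \<open>y p(y) exp(-y)\<close> with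
        \<open>y = 1/h\<close>; \<open>pCons 0 p\<close> supplies the extra factor
        \<open>y\<close>.\<close>
      have "((\<lambda>h. poly (pCons 0 p) (inverse h) * exp (- (inverse h))) \<longlongrightarrow> 0) (at_right (0::real))"
        by (rule filterlim_compose[OF poly_exp_tendsto_0 filterlim_inverse_at_top_right])
      then show ?thesis
        by (rule Lim_transform_eventually)
          (auto simp: flat_exp_def eventually_at_right_field field_simps intro!: exI[of _ 1])
    qed
    moreover have "((\<lambda>h. flat_exp p h / h) \<longlongrightarrow> 0) (at_left 0)"
      by (rule tendsto_eventually) (auto simp: flat_exp_def eventually_at_left_field intro!: exI[of _ "-1"])
    ultimately have "((\<lambda>h. flat_exp p h / h) \<longlongrightarrow> 0) (at 0)"
      by (simp add: filterlim_split_at)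
    then show ?thesis
      using 3 by (simp add: DERIV_def flat_exp_def)
  qed
qed

lemma smooth_on_flat_exp: "smooth_on UNIV (flat_exp p)"
  unfolding smooth_on_def
proof
  fix k show "Ck_on k UNIV (flat_exp p)"
  proof (induction k arbitrary: p)
    case 0
    then show ?case
      by (simp add: continuous_at_imp_continuous_on DERIV_isCont[OF flat_exp_DERIV])
  next
    case (Suc k)
    show ?case
      by (rule Ck_on_SucI[OF open_UNIV flat_exp_DERIV[unfolded has_field_derivative_def]])
        (intro Ck_on_bilinear[OF bounded_bilinear_mult] Suc open_UNIV Ck_on_const)
  qed
qed

text \<open>The quotient \<open>f / (f + g)\<close> works when \<open>f\<close> is positive exactly
  inside radius \<open>2r\<close> and \<open>g\<close> exactly outside radius \<open>r\<close>, for
  then \<open>f + g\<close> never vanishes. The squared distance is used because the distance is not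
  smooth at the centre.\<close>

lemma exists_cutoff:
  fixes a :: "'v::euclidean_space"
  assumes "0 < r"
  obtains \<eta> :: "'v \<Rightarrow> real"
  where "smooth_on UNIV \<eta>" "\<And>z. 0 \<le> \<eta> z" "\<And>z. z \<in> cball a r \<Longrightarrow> \<eta> z = 1"
    "\<And>z. z \<notin> ball a (2 * r) \<Longrightarrow> \<eta> z = 0"
proof -
  define s where "s z = (z - a) \<bullet> (z - a)" for z :: 'v
  define f where "f z = flat_exp 1 (4 * r\<^sup>2 - s z)" for z
  define g where "g z = flat_exp 1 (s z - r\<^sup>2)" for z
  have s: "smooth_on UNIV s"
    unfolding s_def smooth_on_def
    using smooth_on_diff[OF open_UNIV smooth_on_ident[OF open_UNIV] smooth_on_const[of UNIV a]]
    by (auto simp: smooth_on_def intro!: Ck_on_bilinear[OF bounded_bilinear_inner])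
  have s_norm: "s z = (dist a z)\<^sup>2" for z
    by (simp add: s_def dist_norm norm_minus_commute[of a z] power2_norm_eq_inner)
  have f: "smooth_on UNIV f" and g: "smooth_on UNIV g"
    unfolding f_def g_def
    by (auto intro!: smooth_on_compose[OF open_UNIV _ open_UNIV smooth_on_flat_exp] smooth_on_diff s)
  have nn: "f z \<ge> 0" "g z \<ge> 0" for z
    by (simp_all add: f_def g_def flat_exp_def)
  have pos: "f z + g z > 0" for z
  proof (cases "s z < 4 * r\<^sup>2")
    case True
    then have "f z > 0" by (simp add: f_def flat_exp_def)
    then show ?thesis using nn[of z] by linarith
  next
    case False
    moreover have "r\<^sup>2 > 0" using assms by simp
    ultimately have "s z > r\<^sup>2" by linarith
    then have "g z > 0" by (simp add: g_def flat_exp_def)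
    then show ?thesis using nn[of z] by linarith
  qed
  show thesis
  proof
    show "smooth_on UNIV (\<lambda>z. f z / (f z + g z))"
      using pos by (intro smooth_on_divide smooth_on_add f g open_UNIV) (metis less_irrefl)
    show "0 \<le> f z / (f z + g z)" for z
      using nn[of z] by simp
    show "f z / (f z + g z) = 1" if "z \<in> cball a r" for z
    proof -
      have "s z \<le> r\<^sup>2" using that assms by (simp add: s_norm power_mono)
      then have "g z = 0" by (simp add: g_def flat_exp_def)
      then show ?thesis using pos[of z] by simp
    qed
    show "f z / (f z + g z) = 0" if "z \<notin> ball a (2 * r)" for z
    proof -
      have "(2 * r)\<^sup>2 \<le> s z" unfolding s_norm using that assms by (intro power_mono) auto
      then have "f z = 0" by (simp add: f_def flat_exp_def power_mult_distrib)
      then show ?thesis by simp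
    qed
  qed
qed

section \<open>Wirtinger derivatives\<close>

definition wdz :: "(complex \<Rightarrow> complex) \<Rightarrow> complex \<Rightarrow> complex" where
  "wdz f z = (frechet_derivative f (at z) 1 - \<i> * frechet_derivative f (at z) \<i>) / 2"

definition wdzb :: "(complex \<Rightarrow> complex) \<Rightarrow> complex \<Rightarrow> complex" where
  "wdzb f z = (frechet_derivative f (at z) 1 + \<i> * frechet_derivative f (at z) \<i>) / 2"

lemma has_derivative_complex_expand:
  assumes "(f has_derivative D) (at (z::complex))"
  shows "D v = Re v *\<^sub>R D 1 + Im v *\<^sub>R D \<i>"
proof -
  have l: "linear D" using assms has_derivative_linear by blast
  have "D v = D (Re v *\<^sub>R 1 + Im v *\<^sub>R \<i>)"
    by (rule arg_cong[of _ _ D]) (simp add: complex_eq_iff)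
  then show ?thesis by (simp add: linear_add[OF l] linear_cmul[OF l])
qed

lemma wirtinger_has_derivative:
  assumes "f differentiable (at z)"
  shows "(f has_derivative (\<lambda>v. wdz f z * v + wdzb f z * cnj v)) (at z)"
proof -
  have d: "(f has_derivative frechet_derivative f (at z)) (at z)"
    using assms frechet_derivative_works by blast
  have e: "frechet_derivative f (at z) v = wdz f z * v + wdzb f z * cnj v" for v
    using has_derivative_complex_expand[OF d, of v]
    by (simp add: wdz_def wdzb_def complex_eq_iff field_simps)
  show ?thesis by (rule has_derivative_eq_rhs[OF d]) (rule ext, rule e)
qed

text \<open>The calculation rules below follow one pattern: write the derivative of the new function
  as \<open>a * v + b * cnj v\<close> and read off \<open>a\<close> and \<open>b\<close>. The
  decomposition is unique because a real-linear map is determined by its values at \<open>1\<close>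
  and \<open>\<i>\<close>.\<close>

lemma wirtinger_unique:
  assumes "(f has_derivative (\<lambda>v. a * v + b * cnj v)) (at z)"
  shows "wdz f z = a" "wdzb f z = b"
proof -
  have "frechet_derivative f (at z) = (\<lambda>v. a * v + b * cnj v)"
    using frechet_derivative_at[OF assms] by simp
  then show "wdz f z = a" "wdzb f z = b"
    by (simp_all add: wdz_def wdzb_def algebra_simps)
qed

lemma wirtinger_cong:
  assumes "open S" "z \<in> S" "\<And>x. x \<in> S \<Longrightarrow> f x = g x"
  shows "wdz f z = wdz g z" "wdzb f z = wdzb g z"
proof -
  have "(f has_derivative D) (at z) \<longleftrightarrow> (g has_derivative D) (at z)" for D
    by (metis assms has_derivative_transform_within_open)
  then have "frechet_derivative f (at z) = frechet_derivative g (at z)"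
    by (simp add: frechet_derivative_def)
  then show "wdz f z = wdz g z" "wdzb f z = wdzb g z" by (simp_all add: wdz_def wdzb_def)
qed

lemma wirtinger_const [simp]: "wdz (\<lambda>x. c) z = 0" "wdzb (\<lambda>x. c) z = 0"
  by (simp_all add: wdz_def wdzb_def frechet_derivative_const)

lemma wirtinger_add:
  assumes "f differentiable (at z)" "g differentiable (at z)"
  shows "wdz (\<lambda>x. f x + g x) z = wdz f z + wdz g z" "wdzb (\<lambda>x. f x + g x) z = wdzb f z + wdzb g z"
  using wirtinger_unique[of "\<lambda>x. f x + g x" "wdz f z + wdz g z" "wdzb f z + wdzb g z" z]
    has_derivative_add[OF assms[THEN wirtinger_has_derivative]]
  by (simp_all add: algebra_simps)

lemma wirtinger_minus:
  assumes "f differentiable (at z)"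
  shows "wdz (\<lambda>x. - f x) z = - wdz f z" "wdzb (\<lambda>x. - f x) z = - wdzb f z"
  using wirtinger_unique[of "\<lambda>x. - f x" "- wdz f z" "- wdzb f z" z]
    has_derivative_minus[OF assms[THEN wirtinger_has_derivative]]
  by (simp_all add: algebra_simps)

lemma wirtinger_sum:
  assumes "finite I" "\<And>i. i \<in> I \<Longrightarrow> f i differentiable (at z)"
  shows "wdz (\<lambda>x. \<Sum>i\<in>I. f i x) z = (\<Sum>i\<in>I. wdz (f i) z) \<and>
    wdzb (\<lambda>x. \<Sum>i\<in>I. f i x) z = (\<Sum>i\<in>I. wdzb (f i) z)"
  using assms
proof (induction I)
  case (insert i I)
  have "(\<lambda>x. \<Sum>i\<in>I. f i x) differentiable (at z)"
    by (intro differentiable_sum) (use insert in auto)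
  then show ?case
    using insert wirtinger_add[of "f i" z "\<lambda>x. \<Sum>i\<in>I. f i x"] by simp
qed simp

lemma wirtinger_mult:
  assumes "f differentiable (at z)" "g differentiable (at z)"
  shows "wdz (\<lambda>x. f x * g x) z = wdz f z * g z + f z * wdz g z"
    "wdzb (\<lambda>x. f x * g x) z = wdzb f z * g z + f z * wdzb g z"
  using wirtinger_unique[of "\<lambda>x. f x * g x" "wdz f z * g z + f z * wdz g z"
      "wdzb f z * g z + f z * wdzb g z" z]
    has_derivative_mult[OF assms[THEN wirtinger_has_derivative]]
  by (simp_all add: algebra_simps)

lemma wirtinger_inverse:
  assumes "f differentiable (at z)" "f z \<noteq> 0"
  shows "wdz (\<lambda>x. inverse (f x)) z = - wdz f z / (f z)\<^sup>2"
    "wdzb (\<lambda>x. inverse (f x)) z = - wdzb f z / (f z)\<^sup>2"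
  using wirtinger_unique[of "\<lambda>x. inverse (f x)" "- wdz f z / (f z)\<^sup>2" "- wdzb f z / (f z)\<^sup>2" z]
    Deriv.has_derivative_inverse[OF assms(2) wirtinger_has_derivative[OF assms(1)]]
  by (simp_all add: algebra_simps divide_inverse power2_eq_square)

lemma wirtinger_divide:
  assumes "f differentiable (at z)" "g differentiable (at z)" "g z \<noteq> 0"
  shows "wdz (\<lambda>x. f x / g x) z = wdz f z / g z - f z * wdz g z / (g z)\<^sup>2"
    "wdzb (\<lambda>x. f x / g x) z = wdzb f z / g z - f z * wdzb g z / (g z)\<^sup>2"
proof -
  have "(\<lambda>x. inverse (g x)) differentiable (at z)"
    using assms(2,3) by (intro derivative_intros) auto
  note m = wirtinger_mult[OF assms(1) this] wirtinger_inverse[OF assms(2,3)]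
  show "wdz (\<lambda>x. f x / g x) z = wdz f z / g z - f z * wdz g z / (g z)\<^sup>2"
    "wdzb (\<lambda>x. f x / g x) z = wdzb f z / g z - f z * wdzb g z / (g z)\<^sup>2"
    unfolding divide_inverse m(1,2) m(3,4) by (simp_all add: divide_inverse)
qed

lemma wirtinger_cnj:
  assumes "f differentiable (at z)"
  shows "wdz (\<lambda>x. cnj (f x)) z = cnj (wdzb f z)" "wdzb (\<lambda>x. cnj (f x)) z = cnj (wdz f z)"
  using wirtinger_unique[of "\<lambda>x. cnj (f x)" "cnj (wdzb f z)" "cnj (wdz f z)" z]
    bounded_linear.has_derivative[OF bounded_linear_cnj wirtinger_has_derivative[OF assms]]
  by (simp_all add: algebra_simps)

lemma wirtinger_field_derivative:
  assumes "(f has_field_derivative D) (at z)"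
  shows "wdz f z = D" "wdzb f z = 0"
  using wirtinger_unique[of f D 0 z] assms by (simp_all add: has_field_derivative_def mult_commute_abs)

lemma wirtinger_compose_holomorphic:
  assumes "(g has_field_derivative D) (at z)" "f differentiable (at (g z))"
  shows "wdz (\<lambda>x. f (g x)) z = wdz f (g z) * D" "wdzb (\<lambda>x. f (g x)) z = wdzb f (g z) * cnj D"
  using wirtinger_unique[of "\<lambda>x. f (g x)" "wdz f (g z) * D" "wdzb f (g z) * cnj D" z]
    has_derivative_compose[OF assms(1)[unfolded has_field_derivative_def] wirtinger_has_derivative[OF assms(2)]]
  by (simp_all add: algebra_simps)

lemma wirtinger_compose_outer:
  assumes "f differentiable (at z)" "(g has_field_derivative D) (at (f z))"
  shows "wdz (\<lambda>x. g (f x)) z = D * wdz f z" "wdzb (\<lambda>x. g (f x)) z = D * wdzb f z"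
  using wirtinger_unique[of "\<lambda>x. g (f x)" "D * wdz f z" "D * wdzb f z" z]
    has_derivative_compose[OF wirtinger_has_derivative[OF assms(1)] assms(2)[unfolded has_field_derivative_def]]
  by (simp_all add: algebra_simps)

lemma holomorphic_on_wdzb_zero:
  assumes "\<And>z. z \<in> S \<Longrightarrow> f differentiable (at z)" "\<And>z. z \<in> S \<Longrightarrow> wdzb f z = 0" "open S"
  shows "f holomorphic_on S"
proof -
  have "(f has_field_derivative wdz f z) (at z)" if "z \<in> S" for z
    using wirtinger_has_derivative[OF assms(1)[OF that]] assms(2)[OF that]
    by (simp add: has_field_derivative_def mult_commute_abs)
  then show ?thesis
    by (meson field_differentiable_at_within field_differentiable_def holomorphic_onI)
qed

lemma smooth_on_differentiable: "smooth_on S f \<Longrightarrow> x \<in> S \<Longrightarrow> f differentiable (at x)"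
  by (rule differentiableI[OF smooth_on_has_derivative])

lemma smooth_on_wdz: "open S \<Longrightarrow> smooth_on S f \<Longrightarrow> smooth_on S (wdz f)"
  and smooth_on_wdzb: "open S \<Longrightarrow> smooth_on S f \<Longrightarrow> smooth_on S (wdzb f)"
  unfolding wdz_def[abs_def] wdzb_def[abs_def]
  by (auto intro!: smooth_on_divide smooth_on_add smooth_on_diff smooth_on_mult smooth_on_frechet)

section \<open>The local solution of the inhomogeneous Cauchy--Riemann equation\<close>

definition test_fun :: "(complex \<Rightarrow> complex) \<Rightarrow> bool" where
  "test_fun f \<longleftrightarrow> smooth_on UNIV f \<and> (\<exists>R. \<forall>z. R \<le> norm z \<longrightarrow> f z = 0)"

lemma test_fun_radius:
  assumes "test_fun f"
  obtains R where "0 < R" "\<And>z. R \<le> norm z \<Longrightarrow> f z = 0"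
proof -
  obtain R where "\<forall>z. R \<le> norm z \<longrightarrow> f z = 0" using assms by (auto simp: test_fun_def)
  then show thesis by (intro that[of "max 1 R"]) auto
qed

lemma test_fun_smooth: "test_fun f \<Longrightarrow> smooth_on UNIV f"
  by (simp add: test_fun_def)

lemma test_fun_mult_left: "smooth_on UNIV g \<Longrightarrow> test_fun f \<Longrightarrow> test_fun (\<lambda>z. g z * f z)"
  unfolding test_fun_def by (auto intro!: smooth_on_mult)

text \<open>The function has to vanish on a whole neighbourhood of \<open>z\<close>, hence the
  strict inequality; supports of derivatives are accordingly enlarged by 1 below.\<close>

lemma frechet_derivative_zero_outside:
  fixes f :: "complex \<Rightarrow> complex"
  assumes "\<And>z. R \<le> norm z \<Longrightarrow> f z = 0" "R < norm z"
  shows "frechet_derivative f (at z) = (\<lambda>v. 0)"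
proof -
  have "open (- cball 0 R :: complex set)" by (simp add: closed_def[symmetric])
  then have "(f has_derivative (\<lambda>v. 0)) (at z)"
    by (rule has_derivative_transform_within_open[OF has_derivative_const[of 0]])
      (use assms in auto)
  then show ?thesis using frechet_derivative_at by metis
qed

lemma test_fun_frechet:
  assumes "test_fun f"
  shows "test_fun (\<lambda>z. frechet_derivative f (at z) v)"
proof -
  obtain R where "0 < R" "\<And>z. R \<le> norm z \<Longrightarrow> f z = 0" using test_fun_radius[OF assms] by blast
  then have "\<forall>z. R + 1 \<le> norm z \<longrightarrow> frechet_derivative f (at z) v = 0"
    using frechet_derivative_zero_outside[of R f] by fastforce
  then show ?thesis using assms smooth_on_frechet by (auto simp: test_fun_def)
qed

lemma test_fun_bounded:
  assumes "test_fun f"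
  obtains B where "0 < B" "\<And>z. norm (f z) \<le> B"
proof -
  obtain R where R: "0 < R" "\<And>z. R \<le> norm z \<Longrightarrow> f z = 0" using test_fun_radius[OF assms] by blast
  have "continuous_on UNIV f" using assms smooth_on_imp_continuous_on by (auto simp: test_fun_def)
  then have "compact (f ` cball 0 R)"
    by (intro compact_continuous_image continuous_on_subset[OF \<open>continuous_on UNIV f\<close>]) auto
  then obtain B where B: "\<And>z. z \<in> cball 0 R \<Longrightarrow> norm (f z) \<le> B"
    by (meson bounded_iff compact_imp_bounded imageI)
  show thesis
  proof
    show "norm (f z) \<le> max 1 B" for z
      using B[of z] R(2)[of z] by (cases "norm z \<le> R") (auto simp: max_def)
  qed simp
qed

lemma test_fun_uniformly_continuous:
  assumes "test_fun f" "0 < e"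
  obtains d where "0 < d" "\<And>x y. dist x y < d \<Longrightarrow> dist (f x) (f y) < e"
proof -
  obtain R where R: "0 < R" "\<And>z. R \<le> norm z \<Longrightarrow> f z = 0" using test_fun_radius[OF assms(1)] by blast
  \<comment> \<open>The margin 1 in the radius and in \<open>min d 1\<close> means that of two close
    points either both lie in the larger disk or both lie where \<open>f\<close> vanishes.\<close>
  have "continuous_on (cball 0 (R + 1)) f"
    by (rule continuous_on_subset[OF smooth_on_imp_continuous_on[OF test_fun_smooth[OF assms(1)]]]) simp
  then have "uniformly_continuous_on (cball 0 (R + 1)) f"
    by (simp add: compact_uniformly_continuous)
  then obtain d where d: "0 < d"
    "\<And>x y. x \<in> cball 0 (R+1) \<Longrightarrow> y \<in> cball 0 (R+1) \<Longrightarrow> dist y x < d \<Longrightarrow> dist (f y) (f x) < e"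
    using assms(2) unfolding uniformly_continuous_on_def by metis
  show thesis
  proof
    show "0 < min d 1" using d by simp
    fix x y :: complex assume xy: "dist x y < min d 1"
    show "dist (f x) (f y) < e"
    proof (cases "x \<in> cball 0 (R+1) \<and> y \<in> cball 0 (R+1)")
      case True
      then show ?thesis using d(2)[of y x] xy by simp
    next
      case False
      have "norm x \<le> norm y + dist x y" "norm y \<le> norm x + dist x y"
        using norm_triangle_sub[of x y] norm_triangle_sub[of y x] by (simp_all add: dist_norm norm_minus_commute)
      then have "R \<le> norm x" "R \<le> norm y" using False xy by auto
      then show ?thesis using R(2) assms(2) by simp
    qed
  qed
qed

text \<open>Local integrability is what convolution with a compactly supported function requires. It
  admits the two kernels of interest, \<open>1 / w\<close> and the constant \<open>1\<close>,
  neither of which is integrable on the plane.\<close>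

definition local_kernel :: "(complex \<Rightarrow> complex) \<Rightarrow> bool" where
  "local_kernel k \<longleftrightarrow> k \<in> borel_measurable borel \<and>
     (\<forall>R. integrable lborel (\<lambda>w. indicator (cball 0 R) w * norm (k w)))"

definition convol :: "(complex \<Rightarrow> complex) \<Rightarrow> (complex \<Rightarrow> complex) \<Rightarrow> complex \<Rightarrow> complex" where
  "convol f k z = (\<integral>w. f (z - w) * k w \<partial>lborel)"

lemma test_fun_measurable: "test_fun f \<Longrightarrow> f \<in> borel_measurable borel"
  by (simp add: borel_measurable_continuous_onI smooth_on_imp_continuous_on test_fun_def)

lemma local_kernel_integrable:
  assumes "local_kernel k" "g \<in> borel_measurable borel"
    and "\<And>w. norm (g w) \<le> B" "\<And>w. R < norm w \<Longrightarrow> g w = (0::complex)"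
  shows "integrable lborel (\<lambda>w. g w * k w)"
    and "norm (\<integral>w. g w * k w \<partial>lborel) \<le> B * (\<integral>w. indicator (cball 0 R) w * norm (k w) \<partial>lborel)"
proof -
  have i: "integrable lborel (\<lambda>w. B * (indicator (cball 0 R) w * norm (k w)))"
    using assms(1) by (auto simp: local_kernel_def)
  have le: "norm (g w * k w) \<le> B * (indicator (cball 0 R) w * norm (k w))" for w
    using assms(3)[of w] assms(4)[of w] by (auto simp: indicator_def norm_mult intro: mult_right_mono)
  show "integrable lborel (\<lambda>w. g w * k w)"
  proof (rule Bochner_Integration.integrable_bound[OF i])
    show "(\<lambda>w. g w * k w) \<in> borel_measurable lborel"
      using assms(1,2) by (auto simp: local_kernel_def)
    show "AE w in lborel. norm (g w * k w) \<le> norm (B * (indicator (cball 0 R) w * norm (k w)))"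
      using le by (intro AE_I2) (metis abs_ge_self order_trans real_norm_def)
  qed
  have "norm (\<integral>w. g w * k w \<partial>lborel) \<le> (\<integral>w. B * (indicator (cball 0 R) w * norm (k w)) \<partial>lborel)"
    by (rule Bochner_Integration.integral_norm_bound_integral[OF \<open>integrable lborel (\<lambda>w. g w * k w)\<close> i le])
  then show "norm (\<integral>w. g w * k w \<partial>lborel) \<le> B * (\<integral>w. indicator (cball 0 R) w * norm (k w) \<partial>lborel)"
    by simp
qed

lemma convol_integrable:
  assumes "local_kernel k" "test_fun f"
  shows "integrable lborel (\<lambda>w. f (z - w) * k w)"
proof -
  obtain B where B: "\<And>z. norm (f z) \<le> B" using test_fun_bounded[OF assms(2)] by blast
  obtain R where R: "0 < R" "\<And>z. R \<le> norm z \<Longrightarrow> f z = 0" using test_fun_radius[OF assms(2)] by blast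
  have z: "f (z - w) = 0" if "norm z + R < norm w" for w
    using that norm_triangle_ineq2[of w z] by (intro R(2)) (simp add: norm_minus_commute)
  have m: "(\<lambda>w. f (z - w)) \<in> borel_measurable borel"
    using test_fun_measurable[OF assms(2)] by measurable
  show ?thesis
    by (rule local_kernel_integrable(1)[OF assms(1) m B z])
qed

text \<open>The derivative is moved onto the smooth factor. The Taylor remainder of \<open>f\<close>
  is bounded by a small multiple of \<open>norm v\<close>, by uniform continuity of the two partial
  derivatives, and lives in a fixed ball, on which the kernel is integrable.\<close>

lemma convol_has_derivative:
  assumes k: "local_kernel k" and f: "test_fun f"
  shows "(convol f k has_derivative (\<lambda>v. convol (\<lambda>z. frechet_derivative f (at z) v) k z)) (at z)"
proof -
  define D where "D y = frechet_derivative f (at y)" for y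
  have D: "(f has_derivative D y) (at y)" for y
    using f smooth_on_has_derivative by (auto simp: D_def test_fun_def)
  have Dv: "D y v = Re v *\<^sub>R D y 1 + Im v *\<^sub>R D y \<i>" for y v
    by (rule has_derivative_complex_expand[OF D])
  have tD: "test_fun (\<lambda>y. D y v)" for v
    unfolding D_def by (rule test_fun_frechet[OF f])
  note iD = convol_integrable[OF k tD]
  obtain R where R: "0 < R" "\<And>z. R \<le> norm z \<Longrightarrow> f z = 0" using test_fun_radius[OF f] by blast
  \<comment> \<open>For \<open>norm (y - z) < 1\<close> this ball contains the support of the whole
    remainder as a function of \<open>w\<close>: \<open>R\<close> accounts for the support of
    \<open>f\<close>, the 2 for the shift from \<open>z\<close> to \<open>y\<close> and a strict
    margin.\<close>
  define R' where "R' = norm z + R + 2"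
  define M where "M = (\<integral>w. indicator (cball 0 R') w * norm (k w) \<partial>lborel)"
  have M: "M \<ge> 0" unfolding M_def by (rule integral_nonneg_AE) simp
  have lin: "convol (\<lambda>y. D y v) k z = Re v *\<^sub>R convol (\<lambda>y. D y 1) k z + Im v *\<^sub>R convol (\<lambda>y. D y \<i>) k z" for v
  proof -
    have "convol (\<lambda>y. D y v) k z = (\<integral>w. Re v *\<^sub>R (D (z - w) 1 * k w) + Im v *\<^sub>R (D (z - w) \<i> * k w) \<partial>lborel)"
      unfolding convol_def by (subst Dv) (simp add: algebra_simps)
    also have "\<dots> = Re v *\<^sub>R convol (\<lambda>y. D y 1) k z + Im v *\<^sub>R convol (\<lambda>y. D y \<i>) k z"
      unfolding convol_def
      by (subst Bochner_Integration.integral_add) (auto intro!: iD)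
    finally show ?thesis .
  qed
  have bl: "bounded_linear (\<lambda>v. convol (\<lambda>y. D y v) k z)"
  proof -
    define A B where "A = convol (\<lambda>y. D y 1) k z" and "B = convol (\<lambda>y. D y \<i>) k z"
    have "bounded_linear (\<lambda>v. Re v *\<^sub>R A + Im v *\<^sub>R B)"
      by (rule bounded_linear_add[OF bounded_linear_scaleR_const[OF bounded_linear_Re]
            bounded_linear_scaleR_const[OF bounded_linear_Im]])
    moreover have "(\<lambda>v. convol (\<lambda>y. D y v) k z) = (\<lambda>v. Re v *\<^sub>R A + Im v *\<^sub>R B)"
      unfolding A_def B_def by (rule ext) (rule lin)
    ultimately show ?thesis by metis
  qed
  show ?thesis
    unfolding has_derivative_at_alt D_def[symmetric]
  proof (intro conjI bl allI impI)
    fix e :: real assume e: "0 < e"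
    \<comment> \<open>The integrated bound is \<open>2 e' M norm v = e norm v M / (M + 1)\<close>;
      the \<open>+ 1\<close> also covers \<open>M = 0\<close>.\<close>
    define e' where "e' = e / (2 * (M + 1))"
    have e': "e' > 0" using e M by (simp add: e'_def)
    obtain d1 where d1: "0 < d1" "\<And>x y. dist x y < d1 \<Longrightarrow> dist (D x 1) (D y 1) < e'"
      using test_fun_uniformly_continuous[OF tD e'] by blast
    obtain d2 where d2: "0 < d2" "\<And>x y. dist x y < d2 \<Longrightarrow> dist (D x \<i>) (D y \<i>) < e'"
      using test_fun_uniformly_continuous[OF tD e'] by blast
    define d where "d = min 1 (min d1 d2)"
    have dpos: "0 < d" using d1 d2 by (simp add: d_def)
    have on: "onorm (\<lambda>v. D x v - D y v) \<le> 2 * e'" if "dist x y < d" for x y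
    proof (rule onorm_le)
      fix v
      have "D x v - D y v = Re v *\<^sub>R (D x 1 - D y 1) + Im v *\<^sub>R (D x \<i> - D y \<i>)"
        by (subst (1 2) Dv) (simp add: algebra_simps)
      then have "norm (D x v - D y v) \<le> \<bar>Re v\<bar> * norm (D x 1 - D y 1) + \<bar>Im v\<bar> * norm (D x \<i> - D y \<i>)"
        by (metis norm_scaleR norm_triangle_ineq)
      also have "\<dots> \<le> norm v * e' + norm v * e'"
        using that d1(2)[of x y] d2(2)[of x y] abs_Re_le_cmod[of v] abs_Im_le_cmod[of v]
        by (intro add_mono mult_mono) (auto simp: dist_norm d_def)
      finally show "norm (D x v - D y v) \<le> 2 * e' * norm v" by (simp add: algebra_simps)
    qed
    have est: "norm (f (y + v) - f y - D y v) \<le> norm v * (2 * e')" if "norm v < d" for y v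
    proof -
      have "norm (f (y + v) - f y - D y ((y + v) - y)) \<le> norm ((y + v) - y) * (2 * e')"
      proof (rule differentiable_bound_linearization[where S = "ball y d" and f' = D])
        show "y + t *\<^sub>R (y + v - y) \<in> ball y d" if "t \<in> {0..1}" for t
        proof -
          have "t * norm v \<le> 1 * norm v" using that by (intro mult_right_mono) auto
          then show ?thesis using that \<open>norm v < d\<close> by (auto simp: dist_norm)
        qed
        show "(f has_derivative D x) (at x within ball y d)" for x
          using D has_derivative_at_withinI by blast
        show "onorm (D x - D y) \<le> 2 * e'" if "x \<in> ball y d" for x
          using on that by (simp add: dist_commute fun_diff_def)
      qed (use dpos in auto)
      then show ?thesis by simp
    qed
    show "\<exists>d>0. \<forall>y. norm (y - z) < d \<longrightarrow>
        norm (convol f k y - convol f k z - convol (\<lambda>x. D x (y - z)) k z) \<le> e * norm (y - z)"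
    proof (intro exI[of _ d] conjI dpos allI impI)
      fix y assume y: "norm (y - z) < d"
      define v where "v = y - z"
      define g where "g w = f (y - w) - f (z - w) - D (z - w) v" for w
      have m: "g \<in> borel_measurable borel"
        using test_fun_measurable[OF f] test_fun_measurable[OF tD] unfolding g_def by measurable
      have b: "norm (g w) \<le> norm v * (2 * e')" for w
        using est[of v "z - w"] y by (simp add: g_def v_def algebra_simps)
      have g0: "g w = 0" if w: "R' < norm w" for w
      proof -
        have zw: "norm w - norm z \<le> norm (z - w)" "norm w - norm y \<le> norm (y - w)"
          by (metis norm_minus_commute norm_triangle_ineq2)+
        have "norm y \<le> norm z + norm (y - z)" by (metis norm_triangle_sub add.commute)
        then have "norm y \<le> norm z + 1" using y by (simp add: d_def)
        then have "R < norm (z - w)" "R \<le> norm (y - w)"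
          using w zw by (auto simp: R'_def)
        then show ?thesis
          using R(2) frechet_derivative_zero_outside[where z = "z - w" and R = R and f = f, OF R(2)] by (simp add: g_def D_def)
      qed
      have "convol f k y - convol f k z - convol (\<lambda>z. D z v) k z = (\<integral>w. g w * k w \<partial>lborel)"
        unfolding convol_def g_def left_diff_distrib
        by (subst Bochner_Integration.integral_diff, (intro Bochner_Integration.integrable_diff convol_integrable[OF k] f tD)+)+
          (rule refl)
      then have "norm (convol f k y - convol f k z - convol (\<lambda>z. D z v) k z) \<le> norm v * (2 * e') * M"
        unfolding M_def using local_kernel_integrable(2)[OF k m b g0] by simp
      also have "\<dots> = e * norm v * (M / (M + 1))"
        using M by (simp add: e'_def field_simps)
      also have "\<dots> \<le> e * norm v * 1"
        using M e by (intro mult_left_mono) auto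
      finally show "norm (convol f k y - convol f k z - convol (\<lambda>x. D x (y - z)) k z) \<le> e * norm (y - z)"
        by (simp add: v_def)
    qed
  qed
qed

lemma smooth_on_convol:
  assumes "local_kernel k" "test_fun f"
  shows "smooth_on UNIV (convol f k)"
  unfolding smooth_on_def
proof
  fix n show "Ck_on n UNIV (convol f k)"
    using assms(2)
  proof (induction n arbitrary: f)
    case 0
    then show ?case
      using convol_has_derivative[OF assms(1)]
      by (auto intro!: continuous_at_imp_continuous_on has_derivative_continuous)
  next
    case (Suc n)
    show ?case
      by (rule Ck_on_SucI[OF open_UNIV convol_has_derivative[OF assms(1) Suc.prems]])
        (rule Suc.IH[OF test_fun_frechet[OF Suc.prems]])
  qed
qed

lemma wirtinger_convol:
  assumes "local_kernel k" "test_fun f"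
  shows "wdz (convol f k) z = convol (wdz f) k z" "wdzb (convol f k) z = convol (wdzb f) k z"
proof -
  have D: "frechet_derivative (convol f k) (at z) v = convol (\<lambda>z. frechet_derivative f (at z) v) k z" for v
    using frechet_derivative_at[OF convol_has_derivative[OF assms, of z]] by metis
  note i = convol_integrable[OF assms(1) test_fun_frechet[OF assms(2)]]
  have 1: "convol (wdz f) k z = (\<integral>w. (frechet_derivative f (at (z - w)) 1 * k w
      - \<i> * (frechet_derivative f (at (z - w)) \<i> * k w)) / 2 \<partial>lborel)"
    unfolding convol_def wdz_def by (simp add: algebra_simps diff_divide_distrib)
  have 2: "convol (wdzb f) k z = (\<integral>w. (frechet_derivative f (at (z - w)) 1 * k w
      + \<i> * (frechet_derivative f (at (z - w)) \<i> * k w)) / 2 \<partial>lborel)"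
    unfolding convol_def wdzb_def by (simp add: algebra_simps add_divide_distrib)
  show "wdz (convol f k) z = convol (wdz f) k z"
    unfolding 1 by (simp add: wdz_def[of "convol f k"] D convol_def i)
  show "wdzb (convol f k) z = convol (wdzb f) k z"
    unfolding 2 by (simp add: wdzb_def[of "convol f k"] D convol_def i)
qed

section \<open>Integrals of derivatives, and integrability from dyadic shells\<close>

lemma lborel_integral_reflect:
  fixes f :: "complex \<Rightarrow> complex"
  assumes "f \<in> borel_measurable borel"
  shows "(\<integral>w. f (z - w) \<partial>lborel) = (\<integral>w. f w \<partial>lborel)"
proof -
  have "(\<integral>w. f w \<partial>lborel) = (\<integral>w. f w \<partial>(density (distr lborel borel (\<lambda>x. z + (-1) *\<^sub>R x)) (\<lambda>_. \<bar>-1::real\<bar>^DIM(complex))))"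
    by (subst lborel_affine[of "-1" z, symmetric]) simp_all
  also have "\<dots> = (\<integral>w. f w \<partial>(distr lborel borel (\<lambda>x. z - x)))"
    by (simp add: density_1 one_ennreal_def[symmetric])
  also have "\<dots> = (\<integral>w. f (z - w) \<partial>lborel)"
    by (rule integral_distr) (use assms in auto)
  finally show ?thesis by simp
qed

lemma local_kernel_const: "local_kernel (\<lambda>w. c)"
  unfolding local_kernel_def
  by (auto intro!: integrable_real_indicator emeasure_bounded_finite)

text \<open>Convolution with the kernel \<open>1\<close> is a constant function, its value being the
  integral of \<open>f\<close>. So its Wirtinger derivatives vanish; but these are the convolutions
  of \<open>wdz f\<close> and \<open>wdzb f\<close> with \<open>1\<close>, that is, their
  integrals.\<close>

lemma integral_wirtinger_test_fun:
  assumes "test_fun f"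
  shows "(\<integral>w. wdz f w \<partial>lborel) = 0" "(\<integral>w. wdzb f w \<partial>lborel) = 0"
proof -
  have m: "wdz f \<in> borel_measurable borel" "wdzb f \<in> borel_measurable borel"
    using assms smooth_on_wdz[OF open_UNIV] smooth_on_wdzb[OF open_UNIV]
    by (auto simp: test_fun_def intro!: borel_measurable_continuous_onI smooth_on_imp_continuous_on)
  have c: "convol f (\<lambda>w. 1) = (\<lambda>z. \<integral>w. f w \<partial>lborel)"
    unfolding convol_def using lborel_integral_reflect[OF test_fun_measurable[OF assms]] by simp
  have "convol (wdz f) (\<lambda>w. 1) 0 = 0" "convol (wdzb f) (\<lambda>w. 1) 0 = 0"
    using wirtinger_convol[OF local_kernel_const assms, of 1 0] by (simp_all add: c)
  then show "(\<integral>w. wdz f w \<partial>lborel) = 0" "(\<integral>w. wdzb f w \<partial>lborel) = 0"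
    using lborel_integral_reflect[OF m(1), of 0] lborel_integral_reflect[OF m(2), of 0]
    by (simp_all add: convol_def)
qed

text \<open>A substitute for polar coordinates: \<open>h\<close> is dominated by the step function
  that adds \<open>a n\<close> on the disk of radius \<open>r n\<close>, and its integral is
  \<open>pi\<close> times the given series.\<close>

lemma integrable_dominated_by_balls:
  fixes h :: "complex \<Rightarrow> real"
  assumes m: "h \<in> borel_measurable borel" and nn: "\<And>w. 0 \<le> h w"
    and a: "\<And>n. 0 \<le> a n" and r: "\<And>n. 0 \<le> r n" and s: "summable (\<lambda>n. a n * (r n)\<^sup>2)"
    and le: "\<And>w. h w \<noteq> 0 \<Longrightarrow> \<exists>n. norm w \<le> r n \<and> h w \<le> a n"
  shows "integrable lborel h"
proof -
  have "(\<integral>\<^sup>+w. ennreal (h w) \<partial>lborel) \<le> (\<integral>\<^sup>+(w::complex). (\<Sum>n. ennreal (a n) * indicator (cball 0 (r n)) w) \<partial>lborel)"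
  proof (rule nn_integral_mono)
    fix w :: complex
    show "ennreal (h w) \<le> (\<Sum>n. ennreal (a n) * indicator (cball 0 (r n)) w)"
    proof (cases "h w = 0")
      case False
      then obtain n where n: "norm w \<le> r n" "h w \<le> a n" using le by blast
      have "ennreal (h w) \<le> ennreal (a n) * indicator (cball 0 (r n)) w"
        using n by (simp add: ennreal_leI)
      also have "\<dots> = (\<Sum>k\<in>{n}. ennreal (a k) * indicator (cball 0 (r k)) w)"
        by (simp only: sum.insert[OF finite.emptyI] sum.empty empty_iff not_False_eq_True add_0_right)
      also have "\<dots> \<le> (\<Sum>n. ennreal (a n) * indicator (cball 0 (r n)) w)"
        by (rule sum_le_suminf) auto
      finally show ?thesis .
    qed simp
  qed
  also have "\<dots> = (\<Sum>n. ennreal (a n) * emeasure lborel (cball (0::complex) (r n)))"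
    by (subst nn_integral_suminf)
      (auto intro!: borel_measurable_times_ennreal borel_measurable_indicator simp: nn_integral_cmult_indicator)
  also have "\<dots> = (\<Sum>n. ennreal (pi * (a n * (r n)\<^sup>2)))"
    by (intro suminf_cong) (simp add: emeasure_cball r a unit_ball_vol_2 ennreal_mult'[symmetric] ac_simps)
  also have "\<dots> < \<infinity>"
    using a s by (subst suminf_ennreal2) (auto intro!: summable_mult)
  finally show ?thesis
    using m nn by (intro integrableI_nonneg) auto
qed

text \<open>On the shell between the radii \<open>R / 2^(n+1)\<close> and \<open>R / 2^n\<close> the
  function is at most \<open>2^(n+1) / R\<close>, so the series to be summed is the geometric series
  with terms \<open>2 R / 2^n\<close>.\<close>

lemma integrable_inverse_norm: "integrable lborel (\<lambda>w::complex. indicator (cball 0 R) w * norm (1 / w))"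
proof (cases "0 < R")
  case True
  show ?thesis
  proof (rule integrable_dominated_by_balls[where a = "\<lambda>n. 2 ^ (n + 1) / R" and r = "\<lambda>n. R / 2 ^ n"])
    show "(\<lambda>w::complex. indicator (cball 0 R) w * norm (1 / w)) \<in> borel_measurable borel"
      by (intro borel_measurable_times borel_measurable_indicator)
        (auto intro!: measurable_compose[OF _ borel_measurable_norm])
    have "(\<lambda>n. 2 ^ (n + 1) / R * (R / 2 ^ n)\<^sup>2) = (\<lambda>n. 2 * R * (1 / 2) ^ n)"
      using True by (simp add: fun_eq_iff power2_eq_square field_simps)
    then show "summable (\<lambda>n. 2 ^ (n + 1) / R * (R / 2 ^ n)\<^sup>2)"
      by (simp only:) (intro summable_mult summable_geometric, simp)
    fix w :: complex assume "indicator (cball 0 R) w * norm (1 / w) \<noteq> 0"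
    then have w: "w \<noteq> 0" "norm w \<le> R" by (auto simp: indicator_def split: if_splits)
    obtain N where N: "(1 / 2) ^ N < norm w / R"
      using real_arch_pow_inv[of "norm w / R" "1/2"] w True by auto
    define P where "P n \<longleftrightarrow> R / 2 ^ (n + 1) < norm w" for n
    have "P N"
      using N True by (simp add: P_def field_simps)
    then have L: "P (LEAST n. P n)" by (rule LeastI)
    \<comment> \<open>The least \<open>n\<close> with \<open>P n\<close> places \<open>w\<close> in
      its dyadic shell: failure of \<open>P\<close> at the predecessor is the upper bound on
      \<open>norm w\<close>.\<close>
    define n where "n = (LEAST n. P n)"
    have "norm w \<le> R / 2 ^ n"
    proof (cases n)
      case (Suc k)
      then have "\<not> P k" using not_less_Least[of k P] by (simp add: n_def)
      then show ?thesis by (simp add: P_def Suc)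
    qed (use w in simp)
    moreover have "norm (1 / w) \<le> 2 ^ (n + 1) / R"
      using L[folded n_def] True w by (simp add: P_def norm_divide field_simps)
    ultimately show "\<exists>n. norm w \<le> R / 2 ^ n \<and> indicator (cball 0 R) w * norm (1 / w) \<le> 2 ^ (n + 1) / R"
      using w by auto
  qed (use True in auto)
next
  case False
  then have "(\<lambda>w::complex. indicator (cball 0 R) w * norm (1 / w)) = (\<lambda>w. 0)"
    by (auto simp: indicator_def fun_eq_iff) (smt (verit) norm_le_zero_iff)
  then show ?thesis by simp
qed

lemma local_kernel_inverse: "local_kernel (\<lambda>w. 1 / w)"
  unfolding local_kernel_def using integrable_inverse_norm by auto

text \<open>This is the \<open>\<partial>/\<partial>cnj z\<close> derivative of
  \<open>cnj w / (1 + |w|^2)\<close>, the regularised Cauchy kernel at scale 1; its rescalings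
  concentrate at the origin.\<close>

definition bell :: "complex \<Rightarrow> real" where
  "bell w = 1 / (1 + (norm w)\<^sup>2)\<^sup>2"

lemma bell_pos: "bell w > 0"
proof -
  have "0 < 1 + (norm w)\<^sup>2" by (smt (verit) zero_le_power2)
  then show ?thesis by (simp add: bell_def)
qed

text \<open>On the shell between the radii \<open>2^(n-1)\<close> and \<open>2^n\<close> one has
  \<open>bell w \<le> 1 / 16^(n-1)\<close>; the factor 16 in the bound is this shift of the
  index.\<close>

lemma integrable_bell: "integrable lborel bell"
proof (rule integrable_dominated_by_balls[where a = "\<lambda>n. 16 / 16 ^ n" and r = "\<lambda>n. 2 ^ n"])
  show "bell \<in> borel_measurable borel"
    unfolding bell_def by measurable
  have "(\<lambda>n. 16 / 16 ^ n * (2 ^ n)\<^sup>2) = (\<lambda>n. 16 * (1 / 4 :: real) ^ n)"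
  proof
    fix n
    have "(16::real) ^ n = 4 ^ n * 4 ^ n" "((2::real) ^ n)\<^sup>2 = 4 ^ n"
      by (simp_all add: power_mult_distrib[symmetric] power_mult[symmetric] mult.commute[of n] power_mult[of 2 2])
    then show "16 / 16 ^ n * (2 ^ n)\<^sup>2 = 16 * (1 / 4 :: real) ^ n" by (simp add: field_simps)
  qed
  then show "summable (\<lambda>n. 16 / 16 ^ n * ((2::real) ^ n)\<^sup>2)"
    by (simp only:) (intro summable_mult summable_geometric, simp)
  fix w :: complex
  obtain N where "norm w < 2 ^ N" using real_arch_pow[of 2 "norm w"] by auto
  then have N: "norm w \<le> 2 ^ N" by simp
  define n where "n = (LEAST n. norm w \<le> 2 ^ n)"
  have n: "norm w \<le> 2 ^ n" unfolding n_def by (rule LeastI[of "\<lambda>n. norm w \<le> 2 ^ n", OF N])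
  have "bell w \<le> 16 / 16 ^ n"
  proof (cases n)
    case 0
    have "1 ^ 2 \<le> (1 + (norm w)\<^sup>2)\<^sup>2" by (intro power_mono) auto
    then have "bell w \<le> 1 / 1" unfolding bell_def using bell_pos[of w] by (intro divide_left_mono) (auto simp: bell_def)
    then show ?thesis by (simp add: 0)
  next
    case (Suc k)
    then have "\<not> norm w \<le> 2 ^ k" using not_less_Least[of k "\<lambda>n. norm w \<le> 2 ^ n"] by (simp add: n_def)
    then have "((2 ^ k)\<^sup>2)\<^sup>2 \<le> ((norm w)\<^sup>2)\<^sup>2" by (intro power_mono) auto
    also have "\<dots> \<le> (1 + (norm w)\<^sup>2)\<^sup>2" by (intro power_mono) auto
    finally have "16 ^ k \<le> (1 + (norm w)\<^sup>2)\<^sup>2"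
      by (simp add: power_mult[symmetric] mult.commute[of k] power_mult[of 2 4, simplified])
    then have "bell w \<le> 1 / 16 ^ k"
      unfolding bell_def using bell_pos[of w] by (intro divide_left_mono mult_pos_pos) (auto simp: bell_def)
    then show ?thesis by (simp add: Suc)
  qed
  then show "\<exists>n. norm w \<le> 2 ^ n \<and> bell w \<le> 16 / 16 ^ n" using n by blast
qed (auto simp: bell_def)

text \<open>The number is \<open>pi\<close>, the constant of the Cauchy kernel. Its positivity
  allows the division that normalises the solution of the inhomogeneous equation.\<close>

definition bell_mass :: real where "bell_mass = (\<integral>w. bell w \<partial>lborel)"

lemma bell_mass_pos: "bell_mass > 0"
proof -
  have "bell_mass \<noteq> 0"
  proof
    assume "bell_mass = 0"
    then have "AE w in lborel. bell w = 0"
      using integral_nonneg_eq_0_iff_AE[OF integrable_bell] bell_pos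
      by (simp add: bell_mass_def less_imp_le)
    then have "AE w in (lborel :: complex measure). False"
      using bell_pos by (auto elim!: eventually_mono) (metis less_irrefl)
    then have "emeasure lborel (UNIV :: complex set) = 0"
      using AE_iff_measurable[of UNIV "lborel :: complex measure" "\<lambda>_. False"] by simp
    then show False by simp
  qed
  moreover have "bell_mass \<ge> 0" unfolding bell_mass_def using bell_pos
    by (intro integral_nonneg_AE) (auto simp: less_imp_le)
  ultimately show ?thesis by simp
qed

section \<open>The Cauchy kernel inverts the Cauchy--Riemann operator on test functions\<close>

lemma smooth_on_extend_zero:
  fixes f :: "'v::real_normed_vector \<Rightarrow> 'w::real_normed_vector"
  assumes "open S" "closed K" "K \<subseteq> S" "smooth_on S f" "\<And>z. z \<in> S - K \<Longrightarrow> f z = 0"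
  shows "smooth_on UNIV (\<lambda>z. if z \<in> S then f z else 0)"
proof (rule smooth_on_local)
  fix x
  show "\<exists>T. open T \<and> x \<in> T \<and> smooth_on T (\<lambda>z. if z \<in> S then f z else 0)"
  proof (cases "x \<in> S")
    case True
    then show ?thesis using assms(1,4) smooth_on_cong[of S f "\<lambda>z. if z \<in> S then f z else 0"]
      by (intro exI[of _ S]) auto
  next
    case False
    have "smooth_on (- K) (\<lambda>z. if z \<in> S then f z else 0)"
      by (rule smooth_on_cong[THEN iffD2, of _ _ "\<lambda>z. 0"]) (use assms(2,5) in auto)
    then show ?thesis using False assms(2,3) by (intro exI[of _ "- K"]) auto
  qed
qed

lemma differentiable_ident_cnj: "(\<lambda>w. w) differentiable (at (z::complex))" "cnj differentiable (at z)"
  by (auto intro: bounded_linear_imp_differentiable bounded_linear_cnj)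

lemma wirtinger_ident: "wdz (\<lambda>w. w) z = 1" "wdzb (\<lambda>w. w) z = 0" "wdz cnj z = 0" "wdzb cnj z = 1"
  using wirtinger_unique[of "\<lambda>w. w" 1 0 z] wirtinger_unique[of cnj 0 1 z]
    bounded_linear_imp_has_derivative[OF bounded_linear_cnj, of "at z"]
  by (simp_all add: has_derivative_ident)

text \<open>The kernel \<open>1/w\<close> is the limit of the smooth kernels \<open>cnj w / (|w|\<^sup>2 + \<epsilon>\<^sup>2)\<close>, whose
  \<open>\<partial>/\<partial>cnj z\<close>-derivatives are rescalings of \<open>bell\<close>.\<close>

definition reg_kernel :: "real \<Rightarrow> complex \<Rightarrow> complex" where
  "reg_kernel e w = cnj w / (w * cnj w + of_real (e\<^sup>2))"

lemma reg_kernel_denom: "w * cnj w + of_real (e\<^sup>2) = of_real ((norm w)\<^sup>2 + e\<^sup>2)"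
  by (simp only: of_real_add complex_norm_square)

lemma reg_kernel_denom_nonzero: "e > 0 \<Longrightarrow> w * cnj w + of_real (e\<^sup>2) \<noteq> 0"
  unfolding reg_kernel_denom of_real_eq_0_iff by (smt (verit) zero_le_power2 zero_less_power2)

lemma smooth_on_reg_kernel: "e > 0 \<Longrightarrow> smooth_on UNIV (reg_kernel e)"
  unfolding reg_kernel_def
  by (intro smooth_on_divide smooth_on_add smooth_on_mult smooth_on_cnj smooth_on_ident smooth_on_const
      open_UNIV reg_kernel_denom_nonzero)

lemma wdzb_reg_kernel:
  assumes "e > 0"
  shows "wdzb (reg_kernel e) w = of_real (e\<^sup>2 / ((norm w)\<^sup>2 + e\<^sup>2)\<^sup>2)"
proof -
  note d = differentiable_ident_cnj
  have den: "(\<lambda>w. w * cnj w + of_real (e\<^sup>2)) differentiable (at w)"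
    by (intro differentiable_add differentiable_mult d differentiable_const)
  have "wdzb (\<lambda>w. w * cnj w + of_real (e\<^sup>2)) w = w"
    by (subst wirtinger_add) (auto intro!: differentiable_mult d simp: wirtinger_mult d wirtinger_ident)
  then have "wdzb (reg_kernel e) w = 1 / (w * cnj w + of_real (e\<^sup>2)) - cnj w * w / (w * cnj w + of_real (e\<^sup>2))\<^sup>2"
    unfolding reg_kernel_def
    by (subst wirtinger_divide[OF d(2) den reg_kernel_denom_nonzero[OF assms]]) (simp add: wirtinger_ident)
  also have "\<dots> = of_real (e\<^sup>2) / (w * cnj w + of_real (e\<^sup>2))\<^sup>2"
  proof -
    define d where "d = w * cnj w + of_real (e\<^sup>2)"
    have "d \<noteq> 0" unfolding d_def by (rule reg_kernel_denom_nonzero[OF assms])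
    then have "1 / d - cnj w * w / d\<^sup>2 = (d - cnj w * w) / d\<^sup>2"
      by (simp add: field_simps power2_eq_square)
    then show ?thesis by (simp add: d_def mult.commute)
  qed
  finally show ?thesis unfolding reg_kernel_denom by simp
qed

lemma wdzb_reg_kernel_scaled:
  assumes "e > 0"
  shows "of_real (e\<^sup>2) * wdzb (reg_kernel e) (e *\<^sub>R w) = of_real (bell w)"
proof -
  have "(norm (e *\<^sub>R w))\<^sup>2 + e\<^sup>2 = e\<^sup>2 * (1 + (norm w)\<^sup>2)"
    using assms by (simp add: power_mult_distrib algebra_simps)
  then have "e\<^sup>2 * (e\<^sup>2 / ((norm (e *\<^sub>R w))\<^sup>2 + e\<^sup>2)\<^sup>2) = bell w"
    using assms by (simp add: bell_def power_mult_distrib power2_eq_square)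
  then show ?thesis unfolding wdzb_reg_kernel[OF assms] by (metis of_real_mult)
qed

text \<open>This domination by the locally integrable \<open>1 / w\<close> is uniform in
  \<open>e\<close> and permits the limit under the integral.\<close>

lemma reg_kernel_le: "norm (reg_kernel e w) \<le> norm (1 / w)"
proof (cases "w = 0")
  case False
  have "norm (reg_kernel e w) = norm w / ((norm w)\<^sup>2 + e\<^sup>2)"
    unfolding reg_kernel_def reg_kernel_denom norm_divide norm_of_real by simp
  also have "\<dots> \<le> norm w / (norm w)\<^sup>2"
    using False by (intro divide_left_mono) (auto intro!: mult_pos_pos add_pos_nonneg)
  finally show ?thesis using False by (simp add: power2_eq_square norm_divide)
qed (simp add: reg_kernel_def)

lemma lborel_integral_scale:
  fixes f :: "complex \<Rightarrow> complex"
  assumes "f \<in> borel_measurable borel" "e > 0"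
  shows "(\<integral>w. f w \<partial>lborel) = (\<integral>w. of_real (e\<^sup>2) * f (e *\<^sub>R w) \<partial>lborel)"
proof -
  have "(\<integral>w. f w \<partial>lborel) = (\<integral>w. f w \<partial>(density (distr lborel borel (\<lambda>x. 0 + e *\<^sub>R x)) (\<lambda>_. \<bar>e\<bar>^DIM(complex))))"
    by (subst lborel_affine[of e 0, symmetric]) (use assms in simp_all)
  also have "\<dots> = (\<integral>w. e\<^sup>2 *\<^sub>R f w \<partial>(distr lborel borel (\<lambda>x. e *\<^sub>R x)))"
    using assms by (subst integral_density) auto
  also have "\<dots> = (\<integral>w. e\<^sup>2 *\<^sub>R f (e *\<^sub>R w) \<partial>lborel)"
    by (rule integral_distr) (use assms in auto)
  finally show ?thesis by (simp add: scaleR_conv_of_real)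
qed

lemma test_fun_reflect: "test_fun f \<Longrightarrow> test_fun (\<lambda>z. f (- z))"
  unfolding test_fun_def
  using smooth_on_compose[OF open_UNIV smooth_on_uminus[OF open_UNIV smooth_on_ident[OF open_UNIV]] open_UNIV, of f]
  by (metis norm_minus_cancel subset_UNIV)

text \<open>For the smooth kernels, integration by parts moves \<open>wdzb\<close> from
  \<open>g\<close> to the kernel. As the scale tends to 0, the left side converges by domination
  with \<open>|wdzb g w / w|\<close>. The right side, after rescaling \<open>w\<close>, integrates
  \<open>g (e w)\<close> against \<open>bell\<close> and tends to \<open>g 0\<close> times the
  mass.\<close>

lemma cauchy_pompeiu:
  assumes "test_fun g"
  shows "(\<integral>w. wdzb g w / w \<partial>lborel) = - of_real bell_mass * g 0"
proof -
  define e where "e n = 1 / real (Suc n)" for n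
  have e: "e n > 0" for n by (simp add: e_def)
  have e0: "e \<longlonglongrightarrow> 0" unfolding e_def using LIMSEQ_inverse_real_of_nat by (simp add: inverse_eq_divide)
  have sg: "smooth_on UNIV g" using assms by (rule test_fun_smooth)
  have dg: "g differentiable (at w)" for w using smooth_on_differentiable[OF sg] by simp
  have mg: "g \<in> borel_measurable borel" using assms by (rule test_fun_measurable)
  have cg: "continuous_on UNIV g" by (rule smooth_on_imp_continuous_on[OF sg])
  have tw: "test_fun (wdzb g)"
  proof -
    obtain R where R: "\<And>z. R \<le> norm z \<Longrightarrow> g z = 0" using test_fun_radius[OF assms] by blast
    have "wdzb g z = 0" if "R + 1 \<le> norm z" for z
      using frechet_derivative_zero_outside[where R = R and f = g and z = z, OF R] that by (simp add: wdzb_def)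
    then show ?thesis using smooth_on_wdzb[OF open_UNIV sg] by (auto simp: test_fun_def)
  qed
  have mk: "reg_kernel (e n) \<in> borel_measurable borel" "wdzb (reg_kernel (e n)) \<in> borel_measurable borel" for n
    using smooth_on_reg_kernel[OF e] smooth_on_wdzb[OF open_UNIV smooth_on_reg_kernel[OF e]]
    by (auto intro!: borel_measurable_continuous_onI smooth_on_imp_continuous_on)
  obtain B where B: "0 < B" "\<And>z. norm (g z) \<le> B" using test_fun_bounded[OF assms] by blast
  have idom: "integrable lborel (\<lambda>w. wdzb g w * (1 / w))"
    using convol_integrable[OF local_kernel_inverse test_fun_reflect[OF tw], of 0] by simp
  have bellg: "integrable lborel (\<lambda>w. B * bell w)" using integrable_bell by simp
  have 1: "(\<lambda>n. \<integral>w. reg_kernel (e n) w * wdzb g w \<partial>lborel) \<longlonglongrightarrow> (\<integral>w. wdzb g w * (1 / w) \<partial>lborel)"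
  proof (rule integral_dominated_convergence[where w = "\<lambda>w. norm (wdzb g w * (1 / w))"])
    show "AE w in lborel. (\<lambda>n. reg_kernel (e n) w * wdzb g w) \<longlonglongrightarrow> wdzb g w * (1 / w)"
    proof (rule AE_I2)
      fix w :: complex
      show "(\<lambda>n. reg_kernel (e n) w * wdzb g w) \<longlonglongrightarrow> wdzb g w * (1 / w)"
      proof (cases "w = 0")
        case False
        have "(\<lambda>n. cnj w / (w * cnj w + of_real ((e n)\<^sup>2)) * wdzb g w) \<longlonglongrightarrow> cnj w / (w * cnj w + of_real (0\<^sup>2)) * wdzb g w"
          by (intro tendsto_intros e0) (use False in auto)
        then show ?thesis using False by (simp add: reg_kernel_def mult.commute)
      qed (simp add: reg_kernel_def)
    qed
    show "AE w in lborel. norm (reg_kernel (e n) w * wdzb g w) \<le> norm (wdzb g w * (1 / w))" for n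
    proof (rule AE_I2)
      fix w
      show "norm (reg_kernel (e n) w * wdzb g w) \<le> norm (wdzb g w * (1 / w))"
        using mult_right_mono[OF reg_kernel_le[of "e n" w] norm_ge_zero[of "wdzb g w"]]
        by (simp only: norm_mult mult.commute)
    qed
  qed (use idom mk test_fun_measurable[OF tw] in auto)
  have 2: "(\<lambda>n. \<integral>w. g (e n *\<^sub>R w) * of_real (bell w) \<partial>lborel) \<longlonglongrightarrow> (\<integral>w. g 0 * of_real (bell w) \<partial>lborel)"
  proof (rule integral_dominated_convergence[where w = "\<lambda>w. B * bell w"])
    show "AE w in lborel. (\<lambda>n. g (e n *\<^sub>R w) * of_real (bell w)) \<longlonglongrightarrow> g 0 * of_real (bell w)"
    proof (rule AE_I2)
      fix w :: complex
      have "(\<lambda>n. e n *\<^sub>R w) \<longlonglongrightarrow> 0 *\<^sub>R w" by (intro tendsto_intros e0)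
      then have "(\<lambda>n. g (e n *\<^sub>R w)) \<longlonglongrightarrow> g 0"
        using continuous_on_tendsto_compose[OF cg] by simp
      then show "(\<lambda>n. g (e n *\<^sub>R w) * of_real (bell w)) \<longlonglongrightarrow> g 0 * of_real (bell w)"
        by (intro tendsto_intros)
    qed
    show "AE w in lborel. norm (g (e n *\<^sub>R w) * of_real (bell w)) \<le> B * bell w" for n
      using B bell_pos by (intro AE_I2) (simp add: norm_mult less_imp_le mult_right_mono)
  qed (use bellg mg in \<open>auto simp: bell_def\<close>)
  have eq: "(\<integral>w. reg_kernel (e n) w * wdzb g w \<partial>lborel) = - (\<integral>w. g (e n *\<^sub>R w) * of_real (bell w) \<partial>lborel)" for n
  proof -
    have t: "test_fun (\<lambda>w. reg_kernel (e n) w * g w)" "test_fun (\<lambda>w. reg_kernel (e n) w * wdzb g w)"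
      "test_fun (\<lambda>w. wdzb (reg_kernel (e n)) w * g w)"
      by (intro test_fun_mult_left smooth_on_wdzb smooth_on_reg_kernel e assms tw open_UNIV)+
    have i: "integrable lborel f" if "test_fun f" for f
      using convol_integrable[OF local_kernel_const[of 1] test_fun_reflect[OF that], of 0] by simp
    have "wdzb (\<lambda>w. reg_kernel (e n) w * g w) w = wdzb (reg_kernel (e n)) w * g w + reg_kernel (e n) w * wdzb g w" for w
      using smooth_on_differentiable[OF smooth_on_reg_kernel[OF e]] dg by (simp add: wirtinger_mult)
    then have "(\<integral>w. wdzb (reg_kernel (e n)) w * g w + reg_kernel (e n) w * wdzb g w \<partial>lborel) = 0"
      using integral_wirtinger_test_fun(2)[OF t(1)] by (simp cong: Bochner_Integration.integral_cong)
    then have "(\<integral>w. reg_kernel (e n) w * wdzb g w \<partial>lborel) = - (\<integral>w. wdzb (reg_kernel (e n)) w * g w \<partial>lborel)"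
      using i[OF t(2)] i[OF t(3)] by (simp add: add_eq_0_iff)
    also have "(\<integral>w. wdzb (reg_kernel (e n)) w * g w \<partial>lborel) =
        (\<integral>w. of_real ((e n)\<^sup>2) * (wdzb (reg_kernel (e n)) (e n *\<^sub>R w) * g (e n *\<^sub>R w)) \<partial>lborel)"
      by (rule lborel_integral_scale) (use mk mg e in auto)
    also have "\<dots> = (\<integral>w. g (e n *\<^sub>R w) * of_real (bell w) \<partial>lborel)"
      unfolding mult.assoc[symmetric] wdzb_reg_kernel_scaled[OF e] by (simp add: mult.commute)
    finally show ?thesis .
  qed
  have "(\<integral>w. wdzb g w * (1 / w) \<partial>lborel) = - (\<integral>w. g 0 * of_real (bell w) \<partial>lborel)"
    using 1 tendsto_minus[OF 2] unfolding eq by (rule LIMSEQ_unique)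
  also have "(\<integral>w. g 0 * of_real (bell w) \<partial>lborel) = g 0 * of_real bell_mass"
    by (simp add: bell_mass_def)
  finally show ?thesis by simp
qed

text \<open>The derivative falls on \<open>f\<close>, and \<open>g w = f (z - w)\<close> satisfies
  \<open>wdzb g w = - wdzb f (z - w)\<close>. The previous formula for \<open>g\<close> at the
  origin then applies, and the two signs cancel.\<close>

lemma wdzb_convol_inverse:
  assumes "test_fun f"
  shows "wdzb (convol f (\<lambda>w. 1 / w)) z = of_real bell_mass * f z"
proof -
  define g where "g w = f (z - w)" for w
  obtain R where R: "0 < R" "\<And>z. R \<le> norm z \<Longrightarrow> f z = 0" using test_fun_radius[OF assms] by blast
  have gw: "wdzb g w = - wdzb f (z - w)" for w
  proof -
    have "((\<lambda>w. z - w) has_field_derivative -1) (at w)" by (auto intro!: derivative_eq_intros)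
    then show ?thesis
      unfolding g_def using smooth_on_differentiable[OF test_fun_smooth[OF assms]]
      by (subst wirtinger_compose_holomorphic) auto
  qed
  have "test_fun g"
    unfolding test_fun_def
  proof
    show "smooth_on UNIV g" unfolding g_def
      by (rule smooth_on_compose[OF open_UNIV _ open_UNIV test_fun_smooth[OF assms]])
        (auto intro!: smooth_on_diff smooth_on_ident)
    have "g w = 0" if "norm z + R \<le> norm w" for w
      unfolding g_def using that norm_triangle_ineq2[of w z] by (intro R(2)) (simp add: norm_minus_commute)
    then show "\<exists>R. \<forall>z. R \<le> norm z \<longrightarrow> g z = 0" by blast
  qed
  from cauchy_pompeiu[OF this] show ?thesis
    unfolding wirtinger_convol(2)[OF local_kernel_inverse assms] gw
    by (simp add: convol_def g_def)
qed

text \<open>As only a solution near \<open>a\<close> is wanted, \<open>f\<close> may be cut off to a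
  test function. Its convolution with \<open>1 / w\<close>, divided by \<open>bell_mass\<close>,
  solves the equation where the cutoff is 1.\<close>

lemma dbar_locally_solvable:
  assumes "open S" "a \<in> S" "smooth_on S f"
  obtains r u where "0 < r" "ball a r \<subseteq> S" "smooth_on UNIV u" "\<And>z. z \<in> ball a r \<Longrightarrow> wdzb u z = f z"
proof -
  obtain r0 where r0: "0 < r0" "cball a r0 \<subseteq> S" using assms open_contains_cball by blast
  \<comment> \<open>Halved because the cutoff is 1 on radius \<open>r\<close> and vanishes only
    beyond \<open>2 * r\<close>, which must stay within \<open>r0\<close>.\<close>
  define r where "r = r0 / 2"
  obtain h :: "complex \<Rightarrow> real" where h: "smooth_on UNIV h" "\<And>z. z \<in> cball a r \<Longrightarrow> h z = 1"
    "\<And>z. z \<notin> ball a (2 * r) \<Longrightarrow> h z = 0"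
    using exists_cutoff[of r a] r0 unfolding r_def by (metis half_gt_zero)
  define F where "F z = (if z \<in> S then of_real (h z) * f z else 0)" for z
  have "smooth_on UNIV F"
    unfolding F_def
  proof (rule smooth_on_extend_zero[OF assms(1) closed_cball r0(2)])
    show "smooth_on S (\<lambda>z. of_real (h z) * f z)"
      by (intro smooth_on_mult smooth_on_of_real assms smooth_on_subset[OF h(1)] subset_UNIV)
    show "of_real (h z) * f z = 0" if "z \<in> S - cball a r0" for z
      using that h(3)[of z] by (simp add: r_def)
  qed
  moreover have "F z = 0" if "norm a + r0 \<le> norm z" for z
  proof -
    have "r0 \<le> dist a z" using that norm_triangle_ineq2[of z a] by (simp add: dist_norm norm_minus_commute)
    then show ?thesis using h(3)[of z] by (simp add: F_def r_def)
  qed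
  ultimately have t: "test_fun F" by (auto simp: test_fun_def)
  define u where "u z = inverse (of_real bell_mass) * convol F (\<lambda>w. 1 / w) z" for z
  have su: "smooth_on UNIV (convol F (\<lambda>w. 1 / w))" by (rule smooth_on_convol[OF local_kernel_inverse t])
  show thesis
  proof
    show "0 < r" "ball a r \<subseteq> S" using r0 by (auto simp: r_def)
    show "smooth_on UNIV u" unfolding u_def by (intro smooth_on_mult su smooth_on_const open_UNIV)
    show "wdzb u z = f z" if z: "z \<in> ball a r" for z
    proof -
      have "z \<in> S" using z r0 by (auto simp: r_def)
      then have "F z = f z" using h(2)[of z] z by (simp add: F_def)
      moreover have "wdzb u z = F z"
        unfolding u_def using smooth_on_differentiable[OF su] bell_mass_pos
        by (simp add: wirtinger_mult wdzb_convol_inverse[OF t])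
      ultimately show ?thesis by simp
    qed
  qed
qed

section \<open>Change of variables for injective holomorphic maps\<close>

text \<open>Jacobian determinants live on \<open>real ^ 2\<close>; this identification, which
  preserves \<open>lborel\<close>, transports the change of variables formula to the complex
  plane.\<close>

definition vec_complex :: "real ^ 2 \<Rightarrow> complex" where
  "vec_complex x = Complex (x $ 1) (x $ 2)"

definition complex_vec :: "complex \<Rightarrow> real ^ 2" where
  "complex_vec z = vector [Re z, Im z]"

lemma vec_complex_inverse [simp]: "vec_complex (complex_vec z) = z" "complex_vec (vec_complex x) = x"
  by (simp_all add: vec_complex_def complex_vec_def vec_eq_iff forall_2)

lemma bounded_linear_vec_complex: "bounded_linear vec_complex"
  by (rule linear_conv_bounded_linear[THEN iffD1])
    (rule linearI; simp add: vec_complex_def complex_eq_iff)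

lemma bounded_linear_complex_vec: "bounded_linear complex_vec"
  by (rule linear_conv_bounded_linear[THEN iffD1])
    (rule linearI; simp add: complex_vec_def vec_eq_iff forall_2)

lemma vec_complex_measurable [measurable]: "vec_complex \<in> borel_measurable borel"
  and complex_vec_measurable [measurable]: "complex_vec \<in> borel_measurable borel"
  by (intro borel_measurable_continuous_onI linear_continuous_on bounded_linear_vec_complex
      bounded_linear_complex_vec)+

lemma lborel_vec_complex: "distr lborel borel vec_complex = lborel"
proof (rule lborel_eqI[symmetric])
  fix l u :: complex
  assume le: "\<And>b. b \<in> Basis \<Longrightarrow> l \<bullet> b \<le> u \<bullet> b"
  have v: "vec_complex -` box l u = box (complex_vec l) (complex_vec u)"
    by (auto simp: box_def Basis_complex_def Basis_vec_def vec_complex_def complex_vec_def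
        inner_axis forall_2 inner_axis')
  have "emeasure (distr lborel borel vec_complex) (box l u) = emeasure lborel (box (complex_vec l) (complex_vec u))"
    by (subst emeasure_distr) (simp_all add: v)
  also have "\<dots> = (\<Prod>b\<in>Basis. (complex_vec u - complex_vec l) \<bullet> b)"
  proof (rule emeasure_lborel_box)
    fix b :: "real ^ 2" assume "b \<in> Basis"
    then obtain i where "b = axis i 1" by (auto simp: Basis_vec_def)
    moreover have "Re l \<le> Re u" "Im l \<le> Im u" using le[of 1] le[of \<i>] by (auto simp: Basis_complex_def)
    ultimately show "complex_vec l \<bullet> b \<le> complex_vec u \<bullet> b"
      using exhaust_2[of i] by (auto simp: complex_vec_def inner_axis)
  qed
  also have "(\<Prod>b\<in>Basis. (complex_vec u - complex_vec l) \<bullet> b) = (\<Prod>b\<in>Basis. (u - l) \<bullet> b)"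
  proof -
    have B: "(Basis :: (real^2) set) = {axis 1 1, axis 2 1}"
      unfolding Basis_vec_def using exhaust_2 by (auto, metis)
    have "axis 1 1 \<noteq> (axis 2 1 :: real^2)" by (simp add: axis_eq_axis)
    then show ?thesis
      by (simp add: B Basis_complex_def complex_vec_def inner_axis)
  qed
  finally show "emeasure (distr lborel borel vec_complex) (box l u) = ennreal (\<Prod>b\<in>Basis. (u - l) \<bullet> b)" .
qed simp

text \<open>The image is the preimage of \<open>A\<close> under the holomorphic inverse, which is
  continuous on the open image of \<open>S\<close>.\<close>

lemma holomorphic_image_borel:
  assumes "open S" "g holomorphic_on S" "inj_on g S" "A \<in> sets borel" "A \<subseteq> S"
  shows "g ` A \<in> sets borel"
proof -
  obtain h where h: "h holomorphic_on (g ` S)" "\<And>z. z \<in> S \<Longrightarrow> h (g z) = z"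
    using holomorphic_has_inverse[OF assms(2,1,3)] by metis
  have op: "open (g ` S)" using open_mapping_thm3[OF assms(2,1,3)] .
  have "g ` A = h -` A \<inter> g ` S"
  proof
    show "h -` A \<inter> g ` S \<subseteq> g ` A" using h(2) by auto
    show "g ` A \<subseteq> h -` A \<inter> g ` S" using h(2) assms(5) by auto
  qed
  moreover have "h \<in> measurable (restrict_space borel (g ` S)) borel"
    using holomorphic_on_imp_continuous_on[OF h(1)] by (rule borel_measurable_continuous_on_restrict)
  then have "h -` A \<inter> space (restrict_space borel (g ` S)) \<in> sets (restrict_space borel (g ` S))"
    using assms(4) measurable_sets by blast
  then have "h -` A \<inter> g ` S \<in> sets borel"
    using op by (simp add: space_restrict_space sets_restrict_space_iff)
  ultimately show ?thesis by simp
qed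

text \<open>As a real-linear map, multiplication by \<open>deriv g z\<close> has determinant
  \<open>|deriv g z|^2\<close>. The real formula is about images of finite measure, so infinite
  measure is treated separately.\<close>

lemma emeasure_holomorphic_image:
  assumes S: "open S" "g holomorphic_on S" "inj_on g S" and A: "A \<in> sets borel" "A \<subseteq> S"
  shows "emeasure lborel (g ` A) = (\<integral>\<^sup>+z. ennreal ((cmod (deriv g z))\<^sup>2) * indicator A z \<partial>lborel)"
proof -
  define G where "G x = complex_vec (g (vec_complex x))" for x
  define G' where "G' x = (\<lambda>v. complex_vec (deriv g (vec_complex x) * vec_complex v))" for x
  define B where "B = vec_complex -` A"
  define J where "J x = (cmod (deriv g (vec_complex x)))\<^sup>2" for x
  have B: "B \<in> sets borel"
    unfolding B_def using measurable_sets_borel[OF vec_complex_measurable A(1)] .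
  then have BL: "B \<in> sets lebesgue" by auto
  have gA: "g ` A \<in> sets borel" by (rule holomorphic_image_borel[OF assms])
  have GB: "vec_complex -` (g ` A) = G ` B"
  proof
    show "vec_complex -` g ` A \<subseteq> G ` B"
    proof
      fix x assume "x \<in> vec_complex -` g ` A"
      then obtain a where a: "a \<in> A" "vec_complex x = g a" by auto
      then have "x = G (complex_vec a)" using vec_complex_inverse(2)[of x] by (simp add: G_def)
      then show "x \<in> G ` B" using a by (auto simp: B_def)
    qed
  qed (auto simp: G_def B_def)
  have GBs: "G ` B \<in> sets borel"
    unfolding GB[symmetric] using measurable_sets_borel[OF vec_complex_measurable gA] .
  have der: "(G has_derivative G' x) (at x within B)" if "x \<in> B" for x
  proof -
    have "(g has_derivative (*) (deriv g (vec_complex x))) (at (vec_complex x))"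
      using holomorphic_derivI[OF S(2,1)] that A(2) by (auto simp: B_def has_field_derivative_def)
    then have "((\<lambda>x. g (vec_complex x)) has_derivative (\<lambda>v. deriv g (vec_complex x) * vec_complex v)) (at x)"
      by (rule has_derivative_compose[OF bounded_linear_imp_has_derivative[OF bounded_linear_vec_complex]])
    then show ?thesis
      unfolding G_def G'_def
      using bounded_linear.has_derivative[OF bounded_linear_complex_vec] has_derivative_at_withinI by blast
  qed
  have inj: "inj_on G B"
  proof (rule inj_onI)
    fix x y assume xy: "x \<in> B" "y \<in> B" "G x = G y"
    have "g (vec_complex x) = g (vec_complex y)"
      using arg_cong[OF xy(3), of vec_complex] by (simp add: G_def)
    then have "vec_complex x = vec_complex y"
      using S(3) xy(1,2) A(2) by (auto simp: B_def dest: inj_onD)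
    then show "x = y" by (metis vec_complex_inverse(2))
  qed
  have det: "\<bar>det (matrix (G' x))\<bar> = J x" for x
    unfolding J_def cmod_power2
    by (simp add: det_2 matrix_def G'_def complex_vec_def vec_complex_def axis_def power2_eq_square)
  have Jm: "(\<lambda>x. J x * indicator B x) \<in> borel_measurable borel"
  proof -
    have "continuous_on S (deriv g)"
      by (rule holomorphic_on_imp_continuous_on[OF holomorphic_deriv[OF S(2,1)]])
    then have "(\<lambda>z. indicator S z *\<^sub>R deriv g z) \<in> borel_measurable borel"
      using S(1) borel_measurable_continuous_on_indicator[of S "deriv g"] by auto
    then have m: "(\<lambda>x. indicator S (vec_complex x) *\<^sub>R deriv g (vec_complex x)) \<in> borel_measurable borel"
      using measurable_compose[OF vec_complex_measurable] by auto
    have e: "J x * indicator B x = (cmod (indicator S (vec_complex x) *\<^sub>R deriv g (vec_complex x)))\<^sup>2 * indicator B x" for x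
      using A(2) by (auto simp: J_def B_def indicator_def)
    show ?thesis
      unfolding e by (intro borel_measurable_times borel_measurable_indicator borel_measurable_power
          measurable_compose[OF m borel_measurable_norm] B)
  qed
  have "emeasure lborel (g ` A) = emeasure (distr lborel borel vec_complex) (g ` A)"
    by (simp add: lborel_vec_complex)
  also have "\<dots> = emeasure lborel (G ` B)"
    using gA by (subst emeasure_distr) (simp_all add: GB)
  also have "\<dots> = (\<integral>\<^sup>+x. ennreal (J x) * indicator B x \<partial>lborel)"
  proof (cases "G ` B \<in> lmeasurable")
    case True
    then have "((\<lambda>x. J x) has_integral measure lebesgue (G ` B)) B"
      using has_measure_differentiable_image[OF BL der inj, of "measure lebesgue (G ` B)"] det by simp
    then have "((\<lambda>x. J x * indicator B x) has_integral measure lebesgue (G ` B)) UNIV"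
      unfolding has_integral_restrict_UNIV[of B, symmetric]
      by (rule has_integral_cong[THEN iffD1, rotated]) (auto simp: indicator_def)
    then have "(\<integral>\<^sup>+x. ennreal (J x * indicator B x) \<partial>lborel) = ennreal (measure lebesgue (G ` B))"
      by (intro nn_integral_has_integral_lborel Jm) (auto simp: J_def)
    also have "\<dots> = emeasure lebesgue (G ` B)"
      using True by (simp add: emeasure_eq_measure2)
    also have "\<dots> = emeasure lborel (G ` B)" using GBs by (simp add: emeasure_completion)
    finally show ?thesis by (simp add: ennreal_mult' ennreal_indicator J_def)
  next
    \<comment> \<open>If the integral were finite, \<open>J\<close> would be integrable on
      \<open>B\<close>, and the image would have finite measure after all. So both sides are
      infinite.\<close>
    case False
    have inf: "emeasure lborel (G ` B) = \<infinity>"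
    proof (rule ccontr)
      assume "emeasure lborel (G ` B) \<noteq> \<infinity>"
      then have "G ` B \<in> lmeasurable" using GBs
        by (intro fmeasurableI) (auto simp: less_top)
      then show False using False by simp
    qed
    have "(\<integral>\<^sup>+x. ennreal (J x) * indicator B x \<partial>lborel) = \<infinity>"
    proof (rule ccontr)
      assume "(\<integral>\<^sup>+x. ennreal (J x) * indicator B x \<partial>lborel) \<noteq> \<infinity>"
      then have "(\<integral>\<^sup>+x. ennreal (J x * indicator B x) \<partial>lborel) < \<infinity>"
        by (simp add: ennreal_mult' ennreal_indicator J_def less_top)
      then have "integrable lborel (\<lambda>x. J x * indicator B x)"
        using Jm by (intro integrableI_nonneg) (auto simp: J_def)
      then have "(\<lambda>x. J x * indicator B x) integrable_on UNIV"
        by (rule integrable_on_lborel)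
      then have "J integrable_on B"
        unfolding integrable_restrict_UNIV[of B, symmetric]
        by (rule integrable_cong[THEN iffD1, rotated]) (auto simp: indicator_def)
      then show False
        using measurable_differentiable_image_eq[OF BL der inj] False det by simp
    qed
    then show ?thesis using inf by simp
  qed
  also have "\<dots> = (\<integral>\<^sup>+z. ennreal ((cmod (deriv g z))\<^sup>2) * indicator A z \<partial>(distr lborel borel vec_complex))"
  proof -
    have "continuous_on S (deriv g)"
      by (rule holomorphic_on_imp_continuous_on[OF holomorphic_deriv[OF S(2,1)]])
    then have m: "(\<lambda>z. indicator S z *\<^sub>R deriv g z) \<in> borel_measurable borel"
      using S(1) borel_measurable_continuous_on_indicator[of S "deriv g"] by auto
    have e: "ennreal ((cmod (deriv g z))\<^sup>2) * indicator A z =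
        ennreal ((cmod (indicator S z *\<^sub>R deriv g z))\<^sup>2) * indicator A z" for z
      using A(2) by (auto simp: indicator_def)
    have "(\<lambda>z. ennreal ((cmod (deriv g z))\<^sup>2) * indicator A z) \<in> borel_measurable borel"
      unfolding e by (intro borel_measurable_times_ennreal borel_measurable_indicator A(1)
        measurable_compose[OF _ measurable_ennreal] borel_measurable_power measurable_compose[OF m borel_measurable_norm])
    then show ?thesis
      by (subst nn_integral_distr) (auto simp: J_def B_def indicator_def)
  qed
  finally show ?thesis by (simp add: lborel_vec_complex)
qed

text \<open>The formula for sets says that two measures agree: the push-forward under
  \<open>g\<close> of the density \<open>|deriv g|^2\<close> on \<open>A\<close>, and Lebesgue
  measure restricted to the image. Integrating \<open>f\<close> against both gives the claim. The
  functions \<open>h\<close> and \<open>d\<close> are \<open>g\<close> and its derivative cut off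
  outside \<open>S\<close>, hence Borel on the whole plane.\<close>

lemma nn_integral_holomorphic_image:
  assumes S: "open S" "g holomorphic_on S" "inj_on g S" and A: "A \<in> sets borel" "A \<subseteq> S"
    and f: "f \<in> borel_measurable borel"
  shows "(\<integral>\<^sup>+w. f w * indicator (g ` A) w \<partial>lborel) =
    (\<integral>\<^sup>+z. f (g z) * ennreal ((cmod (deriv g z))\<^sup>2) * indicator A z \<partial>lborel)"
proof -
  define h where "h z = indicator S z *\<^sub>R g z" for z
  define d where "d z = indicator S z *\<^sub>R deriv g z" for z
  have "continuous_on S (deriv g)" "continuous_on S g"
    by (rule holomorphic_on_imp_continuous_on holomorphic_deriv S)+
  then have m: "h \<in> borel_measurable borel" "d \<in> borel_measurable borel"
    using S(1) borel_measurable_continuous_on_indicator[of S "deriv g"] borel_measurable_continuous_on_indicator[of S g]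
    by (auto simp: h_def[abs_def] d_def[abs_def])
  define N where "N = density lborel (\<lambda>z. ennreal ((cmod (d z))\<^sup>2) * indicator A z)"
  have gA: "g ` A \<in> sets borel" by (rule holomorphic_image_borel[OF S A])
  have "distr N borel h = density lborel (indicator (g ` A))"
  proof (rule measure_eqI)
    fix E assume "E \<in> sets (distr N borel h)"
    then have E: "E \<in> sets borel" by simp
    define A' where "A' = A \<inter> h -` E"
    have A': "A' \<in> sets borel" "A' \<subseteq> S"
      using A measurable_sets_borel[OF m(1) E] by (auto simp: A'_def)
    have gA': "g ` A' = E \<inter> g ` A"
      using A(2) by (auto simp: A'_def h_def)
    have "emeasure (distr N borel h) E = emeasure N (h -` E)"
      using m E by (subst emeasure_distr) (auto simp: N_def)
    also have "\<dots> = (\<integral>\<^sup>+z. ennreal ((cmod (d z))\<^sup>2) * indicator A z * indicator (h -` E) z \<partial>lborel)"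
      unfolding N_def using m A E measurable_sets_borel[OF m(1) E] by (intro emeasure_density) auto
    also have "\<dots> = (\<integral>\<^sup>+z. ennreal ((cmod (deriv g z))\<^sup>2) * indicator A' z \<partial>lborel)"
      using A(2) by (intro nn_integral_cong) (auto simp: A'_def d_def indicator_def)
    also have "\<dots> = emeasure lborel (E \<inter> g ` A)"
      using emeasure_holomorphic_image[OF S A'] gA' by simp
    also have "\<dots> = emeasure (density lborel (indicator (g ` A))) E"
      using gA E by (subst emeasure_density) (auto simp: nn_integral_indicator[symmetric] indicator_inter_arith mult.commute
        simp del: nn_integral_indicator)
    finally show "emeasure (distr N borel h) E = emeasure (density lborel (indicator (g ` A))) E" .
  qed simp
  then have "(\<integral>\<^sup>+w. f w \<partial>(density lborel (indicator (g ` A)))) = (\<integral>\<^sup>+w. f w \<partial>(distr N borel h))"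
    by simp
  also have "\<dots> = (\<integral>\<^sup>+z. f (h z) \<partial>N)"
    using m f by (intro nn_integral_distr) (auto simp: N_def)
  also have "\<dots> = (\<integral>\<^sup>+z. ennreal ((cmod (d z))\<^sup>2) * indicator A z * f (h z) \<partial>lborel)"
    unfolding N_def using m f A by (intro nn_integral_density) auto
  also have "\<dots> = (\<integral>\<^sup>+z. f (g z) * ennreal ((cmod (deriv g z))\<^sup>2) * indicator A z \<partial>lborel)"
    using A(2) by (intro nn_integral_cong) (auto simp: d_def h_def indicator_def mult.commute)
  finally show ?thesis
    using f gA by (subst (asm) nn_integral_density) (auto simp: mult.commute)
qed

section \<open>Analysis on the surface: coordinates, smooth functions and area\<close>

section \<open>Charts\<close>

lemma in_chart_o: "in_chart c (\<lambda>p. G (f p)) = (\<lambda>z. G (in_chart c f z))"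
  "in_chart c (\<lambda>p. H (f p) (g p)) = (\<lambda>z. H (in_chart c f z) (in_chart c g z))"
  by (simp_all add: in_chart_def fun_eq_iff)

lemma dz_eq: "dz c f p = wdz (in_chart c f) (snd c p)"
  and dzbar_eq: "dzbar c f p = wdzb (in_chart c f) (snd c p)"
  by (simp_all add: dz_def dzbar_def wdz_def wdzb_def dir_deriv_def)

locale atlas =
  fixes X :: "'a::t2_space chart set"
  assumes atlas: "complex_atlas X"
begin

lemma chart_open: "c \<in> X \<Longrightarrow> open (fst c)" "c \<in> X \<Longrightarrow> open (snd c ` fst c)"
  using atlas by (auto simp: complex_atlas_def)

lemma chart_cover: obtains c where "c \<in> X" "p \<in> fst c"
  using atlas unfolding complex_atlas_def by (metis UNIV_I UN_E)

lemma chart_homeo: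
  "c \<in> X \<Longrightarrow> homeomorphism (fst c) (snd c ` fst c) (snd c) (inv_into (fst c) (snd c))"
  using atlas by (auto simp: complex_atlas_def)

lemma chart_inv: "c \<in> X \<Longrightarrow> p \<in> fst c \<Longrightarrow> inv_into (fst c) (snd c) (snd c p) = p"
  using chart_homeo homeomorphism_apply1 by metis

lemma chart_inj: "c \<in> X \<Longrightarrow> inj_on (snd c) (fst c)"
  by (metis chart_inv inj_on_inverseI)

lemma chart_continuous: "c \<in> X \<Longrightarrow> continuous_on (fst c) (snd c)"
  "c \<in> X \<Longrightarrow> continuous_on (snd c ` fst c) (inv_into (fst c) (snd c))"
  using chart_homeo by (auto simp: homeomorphism_def)

lemma in_chart_apply [simp]: "c \<in> X \<Longrightarrow> p \<in> fst c \<Longrightarrow> in_chart c f (snd c p) = f p"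
  by (simp add: in_chart_def chart_inv)

lemma open_chart_image: "c \<in> X \<Longrightarrow> open V \<Longrightarrow> open (snd c ` (V \<inter> fst c))"
proof -
  assume c: "c \<in> X" and V: "open V"
  have "snd c ` (V \<inter> fst c) = snd c ` fst c \<inter> inv_into (fst c) (snd c) -` V"
    using chart_inv[OF c] by auto
  then show ?thesis
    using continuous_open_preimage[OF chart_continuous(2)[OF c] chart_open(2)[OF c] V] by simp
qed

lemma open_chart_image_sub: "c \<in> X \<Longrightarrow> open V \<Longrightarrow> V \<subseteq> fst c \<Longrightarrow> open (snd c ` V)"
  using open_chart_image[of c V] by (simp add: inf.absorb1)

lemma open_chart_preimage:
  assumes "c \<in> X" "open W" shows "open (fst c \<inter> snd c -` W)"
  using continuous_open_preimage[OF chart_continuous(1)[OF assms(1)] chart_open(1)[OF assms(1)] assms(2)] .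

lemma chart_inv_mem: "c \<in> X \<Longrightarrow> z \<in> snd c ` fst c \<Longrightarrow> inv_into (fst c) (snd c) z \<in> fst c"
  "c \<in> X \<Longrightarrow> z \<in> snd c ` fst c \<Longrightarrow> snd c (inv_into (fst c) (snd c) z) = z"
  by (auto simp: chart_inv)

text \<open>The filters \<open>at\<close> exclude the point itself, so injectivity of the chart
  enters besides continuity.\<close>

lemma filterlim_chart:
  assumes c: "c \<in> X" "p \<in> fst c"
  shows "filterlim (snd c) (at (snd c p)) (at p)"
    "filterlim (inv_into (fst c) (snd c)) (at p) (at (snd c p))"
proof -
  have "isCont (snd c) p"
    using chart_continuous(1)[OF c(1)] chart_open(1)[OF c(1)] c(2) continuous_on_eq_continuous_at by blast
  moreover have "eventually (\<lambda>q. q \<in> fst c \<and> q \<noteq> p) (at p)"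
    using chart_open(1)[OF c(1)] c(2) by (auto simp: eventually_at_topological)
  then have "eventually (\<lambda>q. snd c q \<noteq> snd c p) (at p)"
    by (rule eventually_mono) (use chart_inj[OF c(1)] c(2) in \<open>auto dest: inj_onD\<close>)
  ultimately show "filterlim (snd c) (at (snd c p)) (at p)"
    by (simp add: filterlim_at isCont_def)
  have "isCont (inv_into (fst c) (snd c)) (snd c p)"
    using chart_continuous(2)[OF c(1)] chart_open(2)[OF c(1)] c(2) continuous_on_eq_continuous_at by blast
  moreover have "eventually (\<lambda>z. z \<in> snd c ` fst c \<and> z \<noteq> snd c p) (at (snd c p))"
    using chart_open(2)[OF c(1)] c(2) by (auto simp: eventually_at_topological)
  then have "eventually (\<lambda>z. inv_into (fst c) (snd c) z \<noteq> p) (at (snd c p))"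
    by (rule eventually_mono) (use chart_inv_mem[OF c(1)] in metis)
  ultimately show "filterlim (inv_into (fst c) (snd c)) (at p) (at (snd c p))"
    by (simp add: filterlim_at isCont_def chart_inv[OF c])
qed

text \<open>A surface has no isolated points. Limits \<open>at p\<close> are therefore unique, on
  which the \<open>Lim\<close> in \<open>divisor_bundle\<close> rests, and so does the density of
  the set where \<open>dbar \<Psi>\<close> is nonzero.\<close>

lemma at_not_bot: "at (p::'a) \<noteq> bot"
proof
  assume bot: "at p = bot"
  obtain c where c: "c \<in> X" "p \<in> fst c" by (rule chart_cover)
  have "filtermap (inv_into (fst c) (snd c)) (at (snd c p)) \<le> at p"
    using filterlim_chart(2)[OF c] by (simp add: filterlim_def)
  then have "at (snd c p) = bot" using bot by (metis bot.extremum_uniqueI filtermap_bot_iff)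
  then show False by simp
qed

lemma tendsto_chart_iff:
  assumes c: "c \<in> X" "p \<in> fst c"
  shows "(in_chart c f \<longlongrightarrow> l) (at (snd c p)) \<longleftrightarrow> (f \<longlongrightarrow> l) (at p)"
proof
  assume "(in_chart c f \<longlongrightarrow> l) (at (snd c p))"
  then have t: "((\<lambda>q. in_chart c f (snd c q)) \<longlongrightarrow> l) (at p)"
    by (rule filterlim_compose[OF _ filterlim_chart(1)[OF c]])
  have "eventually (\<lambda>q. q \<in> fst c) (at p)"
    using chart_open(1)[OF c(1)] c(2) by (auto simp: eventually_at_topological)
  then have "eventually (\<lambda>q. in_chart c f (snd c q) = f q) (at p)"
    by (rule eventually_mono) (use c(1) in simp)
  then show "(f \<longlongrightarrow> l) (at p)" by (rule Lim_transform_eventually[OF t])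
next
  assume "(f \<longlongrightarrow> l) (at p)"
  then show "(in_chart c f \<longlongrightarrow> l) (at (snd c p))"
    unfolding in_chart_def comp_def by (rule filterlim_compose[OF _ filterlim_chart(2)[OF c]])
qed

subsection \<open>Coordinate changes\<close>

definition trn :: "'a chart \<Rightarrow> 'a chart \<Rightarrow> complex \<Rightarrow> complex" where
  "trn c c' = in_chart c (snd c')"

text \<open>The derivative \<open>dz'/dz\<close>, indexed by a point of the surface rather than by
  its coordinate: it is the transition function of the canonical bundle, and its squared modulus
  rescales conformal metrics.\<close>

definition jac :: "'a chart \<Rightarrow> 'a chart \<Rightarrow> 'a \<Rightarrow> complex" where
  "jac c c' p = deriv (in_chart c (snd c')) (snd c p)"

lemma open_overlap: "c \<in> X \<Longrightarrow> c' \<in> X \<Longrightarrow> open (snd c ` (fst c \<inter> fst c'))"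
  using open_chart_image[of c "fst c'"] chart_open by (simp add: Int_commute)

lemma trn_holomorphic:
  "c \<in> X \<Longrightarrow> c' \<in> X \<Longrightarrow> trn c c' holomorphic_on (snd c ` (fst c \<inter> fst c'))"
  using atlas by (auto simp: complex_atlas_def trn_def)

lemma trn_apply [simp]: "c \<in> X \<Longrightarrow> p \<in> fst c \<Longrightarrow> trn c c' (snd c p) = snd c' p"
  by (simp add: trn_def)

lemma trn_has_derivative:
  assumes "c \<in> X" "c' \<in> X" "p \<in> fst c \<inter> fst c'"
  shows "(trn c c' has_field_derivative jac c c' p) (at (snd c p))"
  unfolding jac_def trn_def[symmetric]
  by (rule holomorphic_derivI[OF trn_holomorphic[OF assms(1,2)] open_overlap[OF assms(1,2)]])
    (use assms in auto)

lemma in_chart_trans: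
  assumes "c \<in> X" "c' \<in> X" "z \<in> snd c ` (fst c \<inter> fst c')"
  shows "in_chart c f z = in_chart c' f (trn c c' z)"
  using assms by auto

lemma jac_mult:
  assumes "c \<in> X" "c' \<in> X" "c'' \<in> X" "p \<in> fst c \<inter> fst c' \<inter> fst c''"
  shows "jac c c'' p = jac c c' p * jac c' c'' p"
proof -
  have "((\<lambda>z. trn c' c'' (trn c c' z)) has_field_derivative jac c' c'' p * jac c c' p) (at (snd c p))"
    by (rule DERIV_chain2[OF _ trn_has_derivative]) (use assms trn_has_derivative[of c' c'' p] in auto)
  moreover have "open (snd c ` (fst c \<inter> (fst c' \<inter> fst c'')))"
    using open_chart_image[of c "fst c' \<inter> fst c''"] assms chart_open by (simp add: Int_commute open_Int)
  ultimately have "(trn c c'' has_field_derivative jac c' c'' p * jac c c' p) (at (snd c p))"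
    by (rule has_field_derivative_transform_within_open) (use assms in auto)
  then show ?thesis
    using DERIV_unique trn_has_derivative[of c c'' p] assms by (metis IntD1 IntD2 IntI mult.commute)
qed

lemma jac_self: "c \<in> X \<Longrightarrow> p \<in> fst c \<Longrightarrow> jac c c p = 1"
proof -
  assume c: "c \<in> X" "p \<in> fst c"
  have "((\<lambda>z. z) has_field_derivative 1) (at (snd c p))" by simp
  then have "(trn c c has_field_derivative 1) (at (snd c p))"
    by (rule has_field_derivative_transform_within_open[OF _ chart_open(2)[OF c(1)]]) (use c in auto)
  then show ?thesis
    using DERIV_unique trn_has_derivative[of c c p] c by blast
qed

lemma jac_nonzero: "c \<in> X \<Longrightarrow> c' \<in> X \<Longrightarrow> p \<in> fst c \<inter> fst c' \<Longrightarrow> jac c c' p \<noteq> 0"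
  using jac_mult[of c c' c p] jac_self[of c p] by auto

subsection \<open>Smooth functions\<close>

text \<open>\<open>smooth_fun\<close> tests all charts, whereas constructions live in one.
  Composition with the holomorphic coordinate change carries smoothness to every other
  chart.\<close>

lemma smooth_funI_local:
  assumes U: "open U"
    and loc: "\<And>p. p \<in> U \<Longrightarrow> \<exists>c\<in>X. \<exists>V. open V \<and> p \<in> V \<and> V \<subseteq> fst c \<and> smooth_on (snd c ` V) (in_chart c f)"
  shows "smooth_fun X U f"
  unfolding smooth_fun_def
proof
  fix c assume c: "c \<in> X"
  show "smooth_on (snd c ` (U \<inter> fst c)) (in_chart c f)"
  proof (rule smooth_on_local)
    fix x assume "x \<in> snd c ` (U \<inter> fst c)"
    then obtain p where p: "p \<in> U" "p \<in> fst c" "x = snd c p" by auto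
    obtain c' V where V: "c' \<in> X" "open V" "p \<in> V" "V \<subseteq> fst c'" "smooth_on (snd c' ` V) (in_chart c' f)"
      using loc[OF p(1)] by blast
    define T where "T = snd c ` (V \<inter> fst c)"
    have T: "open T" unfolding T_def by (rule open_chart_image[OF c V(2)])
    have TO: "T \<subseteq> snd c ` (fst c \<inter> fst c')" using V by (auto simp: T_def)
    have "smooth_on T (\<lambda>z. in_chart c' f (trn c c' z))"
    proof (rule smooth_on_compose[OF T _ _ V(5)])
      show "smooth_on T (trn c c')"
        by (rule smooth_on_subset[OF smooth_on_holomorphic[OF open_overlap trn_holomorphic] TO]) (use c V in auto)
      show "open (snd c' ` V)" using open_chart_image[of c' V] V by (simp add: inf.absorb1)
      show "trn c c' ` T \<subseteq> snd c' ` V" using c by (auto simp: T_def)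
    qed
    then have "smooth_on T (in_chart c f)"
      by (rule smooth_on_cong[OF T, THEN iffD1, rotated])
        (use in_chart_trans[OF c V(1), symmetric] TO in blast)
    then show "\<exists>T. open T \<and> x \<in> T \<and> smooth_on T (in_chart c f)"
      using T p V by (intro exI[of _ T]) (auto simp: T_def)
  qed
qed

lemma smooth_funD: "smooth_fun X U f \<Longrightarrow> c \<in> X \<Longrightarrow> smooth_on (snd c ` (U \<inter> fst c)) (in_chart c f)"
  by (simp add: smooth_fun_def)

lemma smooth_fun_subset: "smooth_fun X U f \<Longrightarrow> V \<subseteq> U \<Longrightarrow> smooth_fun X V f"
  unfolding smooth_fun_def by (meson Int_mono image_mono order_refl smooth_on_subset)

lemma smooth_fun_continuous:
  assumes "open U" "smooth_fun X U f"
  shows "continuous_on U f"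
proof -
  have "isCont f p" if p: "p \<in> U" for p
  proof -
    obtain c where c: "c \<in> X" "p \<in> fst c" by (rule chart_cover)
    have "continuous_on (snd c ` (U \<inter> fst c)) (in_chart c f)"
      by (rule smooth_on_imp_continuous_on[OF smooth_funD[OF assms(2) c(1)]])
    then have "isCont (in_chart c f) (snd c p)"
      using open_chart_image[OF c(1) assms(1)] c(2) p continuous_on_eq_continuous_at by blast
    then have "(in_chart c f \<longlongrightarrow> f p) (at (snd c p))"
      using c by (simp add: isCont_def)
    then show ?thesis unfolding isCont_def by (rule tendsto_chart_iff[OF c, THEN iffD1])
  qed
  then show ?thesis by (simp add: continuous_at_imp_continuous_on)
qed

lemma smooth_fun_in_chart_differentiable:
  assumes "smooth_fun X U f" "c \<in> X" "p \<in> U \<inter> fst c"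
  shows "in_chart c f differentiable (at (snd c p))"
  using smooth_on_differentiable[OF smooth_funD[OF assms(1,2)]] assms(3) by auto

text \<open>Coordinate changes are holomorphic, so they do not mix the two Wirtinger
  derivatives.\<close>

lemma chart_change_wirtinger:
  assumes "c \<in> X" "c' \<in> X" "p \<in> fst c \<inter> fst c'" "in_chart c' f differentiable (at (snd c' p))"
  shows "dz c f p = dz c' f p * jac c c' p" "dzbar c f p = dzbar c' f p * cnj (jac c c' p)"
proof -
  have d: "in_chart c' f differentiable (at (trn c c' (snd c p)))" using assms by simp
  note w = wirtinger_compose_holomorphic[OF trn_has_derivative[OF assms(1-3)] d]
  have "snd c p \<in> snd c ` (fst c \<inter> fst c')" using assms by auto
  then have cg: "wdz (in_chart c f) (snd c p) = wdz (\<lambda>z. in_chart c' f (trn c c' z)) (snd c p)"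
    "wdzb (in_chart c f) (snd c p) = wdzb (\<lambda>z. in_chart c' f (trn c c' z)) (snd c p)"
    by (auto intro!: wirtinger_cong[OF open_overlap[OF assms(1,2)]] in_chart_trans[OF assms(1,2)])
  show "dz c f p = dz c' f p * jac c c' p" "dzbar c f p = dzbar c' f p * cnj (jac c c' p)"
    using w cg assms by (simp_all add: dz_eq dzbar_eq)
qed

lemma holo_fun_iff:
  assumes "open U" "smooth_fun X U f"
  shows "holo_fun X U f \<longleftrightarrow> (\<forall>c\<in>X. \<forall>p\<in>U \<inter> fst c. dzbar c f p = 0)"
proof
  assume h: "holo_fun X U f"
  show "\<forall>c\<in>X. \<forall>p\<in>U \<inter> fst c. dzbar c f p = 0"
  proof (intro ballI)
    fix c p assume c: "c \<in> X" "p \<in> U \<inter> fst c"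
    have "in_chart c f holomorphic_on (snd c ` (U \<inter> fst c))" using h c by (simp add: holo_fun_def)
    then show "dzbar c f p = 0"
      unfolding dzbar_eq
      by (intro wirtinger_field_derivative(2)[OF holomorphic_derivI[OF _ open_chart_image[OF c(1) assms(1)]]])
        (use c in auto)
  qed
next
  assume d: "\<forall>c\<in>X. \<forall>p\<in>U \<inter> fst c. dzbar c f p = 0"
  show "holo_fun X U f"
    unfolding holo_fun_def
  proof
    fix c assume c: "c \<in> X"
    show "in_chart c f holomorphic_on (snd c ` (U \<inter> fst c))"
      by (rule holomorphic_on_wdzb_zero[OF smooth_on_differentiable[OF smooth_funD[OF assms(2) c]] _
            open_chart_image[OF c assms(1)]])
        (use d c in \<open>auto simp: dzbar_eq\<close>)
  qed
qed

lemma holo_fun_smooth: "open U \<Longrightarrow> holo_fun X U f \<Longrightarrow> smooth_fun X U f"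
  unfolding smooth_fun_def holo_fun_def by (auto intro!: smooth_on_holomorphic open_chart_image)

lemma holo_funI_local:
  assumes U: "open U"
    and loc: "\<And>p. p \<in> U \<Longrightarrow> \<exists>c\<in>X. \<exists>V. open V \<and> p \<in> V \<and> V \<subseteq> fst c \<and> in_chart c f holomorphic_on (snd c ` V)"
  shows "holo_fun X U f"
proof -
  have s: "smooth_fun X U f"
  proof (rule smooth_funI_local[OF U])
    fix p assume "p \<in> U"
    then obtain c V where V: "c \<in> X" "open V" "p \<in> V" "V \<subseteq> fst c" "in_chart c f holomorphic_on (snd c ` V)"
      using loc by blast
    then show "\<exists>c\<in>X. \<exists>V. open V \<and> p \<in> V \<and> V \<subseteq> fst c \<and> smooth_on (snd c ` V) (in_chart c f)"
      using smooth_on_holomorphic[OF open_chart_image_sub[OF V(1,2,4)]] by blast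
  qed
  have "dzbar c f p = 0" if c: "c \<in> X" "p \<in> U \<inter> fst c" for c p
  proof -
    obtain c' V where V: "c' \<in> X" "open V" "p \<in> V" "V \<subseteq> fst c'" "in_chart c' f holomorphic_on (snd c' ` V)"
      using loc c by blast
    have pc: "p \<in> fst c \<inter> fst c'" using c V by auto
    have d: "in_chart c' f differentiable (at (snd c' p))"
      using smooth_fun_in_chart_differentiable[OF s V(1), of p] c V by auto
    have "(in_chart c' f has_field_derivative deriv (in_chart c' f) (snd c' p)) (at (snd c' p))"
      using holomorphic_derivI[OF V(5) open_chart_image_sub[OF V(1,2,4)]] V(3) by auto
    then have "dzbar c' f p = 0" unfolding dzbar_eq by (rule wirtinger_field_derivative)
    then show ?thesis using chart_change_wirtinger(2)[OF c(1) V(1) pc d] by simp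
  qed
  then show ?thesis using holo_fun_iff[OF U s] by blast
qed

lemma holo_fun_subset: "holo_fun X U f \<Longrightarrow> V \<subseteq> U \<Longrightarrow> holo_fun X V f"
  unfolding holo_fun_def by (meson Int_mono holomorphic_on_subset image_mono order_refl)

lemma holo_fun_cong:
  assumes "open U" "\<And>p. p \<in> U \<Longrightarrow> f p = g p" "holo_fun X U f"
  shows "holo_fun X U g"
  unfolding holo_fun_def
proof
  fix c assume c: "c \<in> X"
  have "in_chart c f holomorphic_on (snd c ` (U \<inter> fst c))" using assms(3) c by (simp add: holo_fun_def)
  then show "in_chart c g holomorphic_on (snd c ` (U \<inter> fst c))"
    by (rule holomorphic_transform) (use assms(2) c in auto)
qed

lemma in_chart_image_nonzero:
  "c \<in> X \<Longrightarrow> (\<And>p. p \<in> U \<Longrightarrow> f p \<noteq> 0) \<Longrightarrow> z \<in> snd c ` (U \<inter> fst c) \<Longrightarrow> in_chart c f z \<noteq> 0"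
  by force

lemma holo_fun_mult: "holo_fun X U f \<Longrightarrow> holo_fun X U g \<Longrightarrow> holo_fun X U (\<lambda>p. f p * g p)"
  unfolding holo_fun_def in_chart_o by (auto intro: holomorphic_intros)

lemma holo_fun_inverse:
  "holo_fun X U f \<Longrightarrow> (\<And>p. p \<in> U \<Longrightarrow> f p \<noteq> 0) \<Longrightarrow> holo_fun X U (\<lambda>p. inverse (f p))"
  unfolding holo_fun_def in_chart_o
  by (intro ballI holomorphic_on_inverse in_chart_image_nonzero) auto

lemma smooth_fun_const: "smooth_fun X U (\<lambda>p. k)"
  unfolding smooth_fun_def in_chart_def by (simp add: comp_def)

lemma smooth_fun_mult:
  fixes f g :: "'a \<Rightarrow> complex"
  assumes "open U" "smooth_fun X U f" "smooth_fun X U g"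
  shows "smooth_fun X U (\<lambda>p. f p * g p)"
  unfolding smooth_fun_def in_chart_o
  using assms by (auto intro!: smooth_on_mult open_chart_image smooth_funD)

lemma smooth_fun_divide:
  fixes f g :: "'a \<Rightarrow> complex"
  assumes "open U" "smooth_fun X U f" "smooth_fun X U g" "\<And>p. p \<in> U \<Longrightarrow> g p \<noteq> 0"
  shows "smooth_fun X U (\<lambda>p. f p / g p)"
  unfolding smooth_fun_def in_chart_o
  by (intro ballI smooth_on_divide open_chart_image smooth_funD assms in_chart_image_nonzero) (use assms(4) in auto)

lemma smooth_fun_cnj:
  assumes "open U" "smooth_fun X U f"
  shows "smooth_fun X U (\<lambda>p. cnj (f p))"
  unfolding smooth_fun_def in_chart_o
  using assms by (auto intro!: smooth_on_cnj open_chart_image smooth_funD)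

lemma smooth_fun_herm:
  assumes "open U" "smooth_fun X U f" "smooth_fun X U g"
  shows "smooth_fun X U (\<lambda>p. herm (f p) (g p))"
  unfolding smooth_fun_def in_chart_o
  using assms by (auto intro!: smooth_on_herm open_chart_image smooth_funD)

lemma smooth_fun_vec_nth:
  fixes f :: "'a \<Rightarrow> complex ^ 'n"
  assumes "open U" "smooth_fun X U f"
  shows "smooth_fun X U (\<lambda>p. f p $ i)"
  unfolding smooth_fun_def in_chart_o(1)[of _ "\<lambda>v. v $ i"]
  using assms by (auto intro!: smooth_on_vec_nth open_chart_image smooth_funD)

lemma smooth_fun_vec_scale:
  fixes f :: "'a \<Rightarrow> complex"
  assumes "open U" "smooth_fun X U f" "smooth_fun X U g"
  shows "smooth_fun X U (\<lambda>p. f p *s g p)"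
  unfolding smooth_fun_def in_chart_o
  using assms by (auto intro!: smooth_on_vec_scale open_chart_image smooth_funD)

end

section \<open>The area measure\<close>

locale compact_surface = atlas X for X :: "'a::t2_space chart set" +
  fixes g :: "'a conf_metric"
  assumes compact: "compact (UNIV :: 'a set)" and metric: "conformal_metric X g"
begin

definition chart_area :: "'a chart \<Rightarrow> 'a set \<Rightarrow> ennreal" where
  "chart_area c A = (\<integral>\<^sup>+ z\<in>snd c ` A. ennreal (in_chart c (g c) z) \<partial>lborel)"

lemma metric_pos: "c \<in> X \<Longrightarrow> p \<in> fst c \<Longrightarrow> 0 < g c p"
  using metric unfolding conformal_metric_def by blast

lemma metric_change:
  "c \<in> X \<Longrightarrow> c' \<in> X \<Longrightarrow> p \<in> fst c \<inter> fst c' \<Longrightarrow> g c p = g c' p * (cmod (jac c c' p))\<^sup>2"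
  using metric unfolding conformal_metric_def jac_def by blast

lemma metric_smooth: "c \<in> X \<Longrightarrow> smooth_fun X (fst c) (g c)"
  using metric unfolding conformal_metric_def by blast

lemma metric_continuous: "c \<in> X \<Longrightarrow> continuous_on (snd c ` fst c) (in_chart c (g c))"
  using smooth_on_imp_continuous_on[OF smooth_funD[OF metric_smooth], of c c] by simp

text \<open>The cutoff outside the coordinate image, where \<open>in_chart\<close> has arbitrary
  values, makes this a Borel function on the whole plane.\<close>

definition chart_density :: "'a chart \<Rightarrow> complex \<Rightarrow> real" where
  "chart_density c z = indicator (snd c ` fst c) z *\<^sub>R in_chart c (g c) z"

lemma chart_density_measurable: "c \<in> X \<Longrightarrow> chart_density c \<in> borel_measurable borel"
  unfolding chart_density_def[abs_def]
  using borel_measurable_continuous_on_indicator[OF _ metric_continuous] chart_open by auto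

lemma chart_density_nonneg: "c \<in> X \<Longrightarrow> 0 \<le> chart_density c z"
  using metric_pos[of c] by (auto simp: chart_density_def indicator_def less_imp_le)

lemma chart_image_borel:
  assumes "c \<in> X" "A \<in> sets borel" "A \<subseteq> fst c"
  shows "snd c ` A \<in> sets borel"
proof -
  let ?h = "inv_into (fst c) (snd c)"
  have "snd c ` A = ?h -` A \<inter> snd c ` fst c"
    using chart_inv[OF assms(1)] assms(3) by force
  moreover have "?h \<in> measurable (restrict_space borel (snd c ` fst c)) borel"
    using chart_continuous(2)[OF assms(1)] by (rule borel_measurable_continuous_on_restrict)
  then have "?h -` A \<inter> space (restrict_space borel (snd c ` fst c)) \<in> sets (restrict_space borel (snd c ` fst c))"
    using assms(2) measurable_sets by blast
  then have "?h -` A \<inter> snd c ` fst c \<in> sets borel"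
    using chart_open(2)[OF assms(1)] by (simp add: space_restrict_space sets_restrict_space_iff)
  ultimately show ?thesis by simp
qed

lemma chart_area_density:
  assumes "c \<in> X" "A \<in> sets borel" "A \<subseteq> fst c"
  shows "chart_area c A = emeasure (density lborel (\<lambda>z. ennreal (chart_density c z))) (snd c ` A)"
proof -
  have "emeasure (density lborel (\<lambda>z. ennreal (chart_density c z))) (snd c ` A) =
      (\<integral>\<^sup>+ z. ennreal (chart_density c z) * indicator (snd c ` A) z \<partial>lborel)"
    using chart_image_borel[OF assms] chart_density_measurable[OF assms(1)] by (intro emeasure_density) auto
  also have "\<dots> = chart_area c A"
    unfolding chart_area_def
  proof (rule nn_integral_cong)
    fix z
    show "ennreal (chart_density c z) * indicator (snd c ` A) z = ennreal (in_chart c (g c) z) * indicator (snd c ` A) z"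
      using image_mono[OF assms(3), of "snd c"] by (cases "z \<in> snd c ` A") (auto simp: chart_density_def)
  qed
  finally show ?thesis ..
qed

text \<open>The metric coefficient changes by \<open>|dz'/dz|^2\<close>, which is exactly the real
  Jacobian of the coordinate change.\<close>

lemma chart_area_change:
  assumes c: "c \<in> X" "c' \<in> X" and A: "A \<in> sets borel" "A \<subseteq> fst c \<inter> fst c'"
  shows "chart_area c A = chart_area c' A"
proof -
  let ?S = "snd c ` (fst c \<inter> fst c')"
  have B: "snd c ` A \<in> sets borel" "snd c ` A \<subseteq> ?S"
    using chart_image_borel[of c A] c A by auto
  have inj: "inj_on (trn c c') ?S"
    using chart_inj[OF c(2)] c by (auto simp: inj_on_def)
  have im: "trn c c' ` snd c ` A = snd c' ` A"
    using c A by (force simp: image_image)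
  have "chart_area c' A = (\<integral>\<^sup>+ w. ennreal (chart_density c' w) * indicator (snd c' ` A) w \<partial>lborel)"
    unfolding chart_area_def using A by (intro nn_integral_cong) (auto simp: chart_density_def indicator_def)
  also have "\<dots> = (\<integral>\<^sup>+ z. ennreal (chart_density c' (trn c c' z)) * ennreal ((cmod (deriv (trn c c') z))\<^sup>2)
      * indicator (snd c ` A) z \<partial>lborel)"
    using nn_integral_holomorphic_image[OF open_overlap[OF c] trn_holomorphic[OF c] inj B,
        of "\<lambda>z. ennreal (chart_density c' z)"] chart_density_measurable[OF c(2)]
    unfolding im by simp
  also have "\<dots> = chart_area c A"
    unfolding chart_area_def
  proof (rule nn_integral_cong)
    fix z
    show "ennreal (chart_density c' (trn c c' z)) * ennreal ((cmod (deriv (trn c c') z))\<^sup>2) * indicator (snd c ` A) z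
      = ennreal (in_chart c (g c) z) * indicator (snd c ` A) z"
    proof (cases "z \<in> snd c ` A")
      case True
      then obtain p where p: "p \<in> A" "z = snd c p" by auto
      then have pc: "p \<in> fst c" "p \<in> fst c'" using A by auto
      have "deriv (trn c c') z = jac c c' p" by (simp add: p jac_def trn_def)
      moreover have "chart_density c' (trn c c' z) = g c' p"
        using pc c by (simp add: p chart_density_def)
      ultimately show ?thesis
        using metric_change[OF c, of p] pc c metric_pos[OF c(2) pc(2)] p
        by (simp add: ennreal_mult'[symmetric] less_imp_le)
    qed simp
  qed
  finally show ?thesis ..
qed

lemma chart_area_countably_additive:
  assumes c: "c \<in> X" and A: "range A \<subseteq> sets borel" "disjoint_family A" "\<And>n. A n \<subseteq> fst c"
  shows "(\<Sum>n::nat. chart_area c (A n)) = chart_area c (\<Union>n. A n)"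
proof -
  have m: "A n \<in> sets borel" for n using A(1) by auto
  have "disjoint_family (\<lambda>n. snd c ` A n)"
    unfolding disjoint_family_on_def
  proof (intro ballI impI)
    fix m n :: nat assume "m \<noteq> n"
    then have "A m \<inter> A n = {}" using A(2) by (auto simp: disjoint_family_on_def)
    then show "snd c ` A m \<inter> snd c ` A n = {}"
      using inj_on_image_Int[OF chart_inj[OF c] A(3) A(3), of m n] by auto
  qed
  then have "(\<Sum>n. emeasure (density lborel (\<lambda>z. ennreal (chart_density c z))) (snd c ` A n)) =
      emeasure (density lborel (\<lambda>z. ennreal (chart_density c z))) (\<Union>n. snd c ` A n)"
    using chart_image_borel[OF c m A(3)] by (intro suminf_emeasure) auto
  moreover have "(\<Union>n. A n) \<in> sets borel" using m by auto
  ultimately show ?thesis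
    using chart_area_density[OF c m A(3)] chart_area_density[OF c, of "\<Union>n. A n"] A(3)
    by (simp add: image_UN UN_subset_iff)
qed

lemma chart_area_empty [simp]: "chart_area c {} = 0"
  by (simp add: chart_area_def)

lemma chart_area_finite_additive:
  assumes c: "c \<in> X" and I: "finite I" and A: "\<And>i. i \<in> I \<Longrightarrow> A i \<in> sets borel" "\<And>i. i \<in> I \<Longrightarrow> A i \<subseteq> fst c"
    "disjoint_family_on A I"
  shows "(\<Sum>i\<in>I. chart_area c (A i)) = chart_area c (\<Union>i\<in>I. A i)"
proof -
  have "disjoint_family_on (\<lambda>i. snd c ` A i) I"
    unfolding disjoint_family_on_def
  proof (intro ballI impI)
    fix m n assume mn: "m \<in> I" "n \<in> I" "m \<noteq> n"
    then have "A m \<inter> A n = {}" using A(3) by (auto simp: disjoint_family_on_def)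
    then show "snd c ` A m \<inter> snd c ` A n = {}"
      using inj_on_image_Int[OF chart_inj[OF c] A(2)[OF mn(1)] A(2)[OF mn(2)]] by auto
  qed
  then have "(\<Sum>i\<in>I. emeasure (density lborel (\<lambda>z. ennreal (chart_density c z))) (snd c ` A i)) =
      emeasure (density lborel (\<lambda>z. ennreal (chart_density c z))) (\<Union>i\<in>I. snd c ` A i)"
    using chart_image_borel[OF c A(1) A(2)] I by (intro sum_emeasure) auto
  moreover have "(\<Union>i\<in>I. A i) \<in> sets borel" using A I by auto
  ultimately show ?thesis
    using chart_area_density[OF c A(1) A(2)] chart_area_density[OF c, of "\<Union>i\<in>I. A i"] A(2)
    by (simp add: image_UN UN_subset_iff)
qed

text \<open>A disjoint Borel refinement of finitely many chart domains lets a measure on the surface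
  be written as a finite sum of chart areas.\<close>

lemma finite_chart_partition:
  assumes "finite C" "C \<subseteq> X"
  shows "\<exists>B. (\<forall>c\<in>C. B c \<in> sets borel \<and> B c \<subseteq> fst c) \<and> disjoint_family_on B C \<and>
    (\<Union>c\<in>C. B c) = (\<Union>c\<in>C. fst c)"
  using assms
proof (induction C)
  case (insert c C)
  then obtain B where B: "\<forall>c\<in>C. B c \<in> sets borel \<and> B c \<subseteq> fst c" "disjoint_family_on B C"
    "(\<Union>c\<in>C. B c) = (\<Union>c\<in>C. fst c)" by auto
  have op: "fst c \<in> sets borel" "(\<Union>c\<in>C. fst c) \<in> sets borel"
    using chart_open(1) insert.prems by (auto intro!: borel_open open_UN)
  define B' where "B' = B(c := fst c - (\<Union>c\<in>C. fst c))"
  have eq: "B' d = B d" if "d \<in> C" for d using that insert.hyps by (auto simp: B'_def)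
  have "disjoint_family_on B' (insert c C)"
    unfolding disjoint_family_on_def
  proof (intro ballI impI)
    fix d e assume de: "d \<in> insert c C" "e \<in> insert c C" "d \<noteq> e"
    have dB: "B' c \<inter> B d = {}" if "d \<in> C" for d using B(3) that by (auto simp: B'_def)
    from de consider "d = c" "e \<in> C" | "e = c" "d \<in> C" | "d \<in> C" "e \<in> C" by blast
    then show "B' d \<inter> B' e = {}"
    proof cases
      case 1
      then show ?thesis using dB[of e] eq[of e] by simp
    next
      case 2
      then show ?thesis using dB[of d] eq[of d] by (simp add: Int_commute)
    next
      case 3
      then show ?thesis using eq[of d] eq[of e] disjoint_family_onD[OF B(2), of d e] de(3) by simp
    qed
  qed
  moreover have "(\<Union>d\<in>insert c C. B' d) = (\<Union>d\<in>insert c C. fst d)"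
  proof -
    have "(\<Union>d\<in>C. B' d) = (\<Union>d\<in>C. fst d)" using B(3) by (simp add: eq)
    moreover have "B' c = fst c - (\<Union>c\<in>C. fst c)" by (simp add: B'_def)
    ultimately show ?thesis by simp
  qed
  moreover have "\<forall>d\<in>insert c C. B' d \<in> sets borel \<and> B' d \<subseteq> fst d"
    using B(1) eq op by (auto simp: B'_def)
  ultimately show ?case by blast
qed (auto simp: disjoint_family_on_def)

lemma finite_chart_cover: obtains C where "finite C" "C \<subseteq> X" "(\<Union>c\<in>C. fst c) = UNIV"
proof -
  have "\<exists>C\<subseteq>X. finite C \<and> UNIV \<subseteq> (\<Union>c\<in>C. fst c)"
    using compactE_image[OF compact, of X fst] chart_open(1) chart_cover
    by (metis UNIV_I UN_iff subsetI)
  then show thesis using that by blast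
qed

definition is_area_measure :: "'a measure \<Rightarrow> bool" where
  "is_area_measure \<mu> \<longleftrightarrow> sets \<mu> = sets borel \<and>
     (\<forall>c\<in>X. \<forall>A\<in>sets borel. A \<subseteq> fst c \<longrightarrow> emeasure \<mu> A = chart_area c A)"

text \<open>By compactness finitely many chart domains cover the surface, and chart areas are summed
  over a disjoint refinement. Invariance under coordinate changes shows that the result is correct
  in every chart, also in those outside the chosen cover.\<close>

lemma area_measure_ex: "\<exists>\<mu>. is_area_measure \<mu>"
proof -
  obtain C where C: "finite C" "C \<subseteq> X" "(\<Union>c\<in>C. fst c) = UNIV" by (rule finite_chart_cover)
  obtain B where B: "\<forall>c\<in>C. B c \<in> sets borel \<and> B c \<subseteq> fst c" "disjoint_family_on B C"
    "(\<Union>c\<in>C. B c) = UNIV" using finite_chart_partition[OF C(1,2)] C(3) by auto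
  define m where "m A = (\<Sum>c\<in>C. chart_area c (A \<inter> B c))" for A
  define \<mu> where "\<mu> = measure_of (UNIV :: 'a set) (sets borel) m"
  have s: "sets \<mu> = sets borel"
    unfolding \<mu>_def using sets.sigma_sets_eq[of "borel :: 'a measure"] by (simp add: sets_measure_of_conv)
  have "countably_additive (sets \<mu>) m"
  proof (rule countably_additiveI)
    fix A :: "nat \<Rightarrow> 'a set" assume A: "range A \<subseteq> sets \<mu>" "disjoint_family A"
    have "(\<Sum>n. m (A n)) = (\<Sum>c\<in>C. \<Sum>n. chart_area c (A n \<inter> B c))"
      unfolding m_def by (rule suminf_sum) auto
    also have "\<dots> = (\<Sum>c\<in>C. chart_area c (\<Union>n. A n \<inter> B c))"
    proof (rule sum.cong[OF refl], rule chart_area_countably_additive)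
      fix c assume c: "c \<in> C"
      show "c \<in> X" using c C by auto
      show "range (\<lambda>n. A n \<inter> B c) \<subseteq> sets borel" using A(1) B(1) c s by auto
      show "disjoint_family (\<lambda>n. A n \<inter> B c)" using A(2) by (auto simp: disjoint_family_on_def)
      show "A n \<inter> B c \<subseteq> fst c" for n using B(1) c by auto
    qed
    finally show "(\<Sum>n. m (A n)) = m (\<Union>n. A n)" by (simp add: m_def)
  qed
  moreover have "positive (sets \<mu>) m" by (simp add: positive_def m_def)
  ultimately have em: "emeasure \<mu> A = m A" if "A \<in> sets borel" for A
    using emeasure_measure_of[OF \<mu>_def, of A] that s by auto
  have "emeasure \<mu> A = chart_area c A" if c: "c \<in> X" and A: "A \<in> sets borel" "A \<subseteq> fst c" for c A
  proof -
    have "m A = (\<Sum>d\<in>C. chart_area c (A \<inter> B d))"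
      unfolding m_def
    proof (rule sum.cong[OF refl])
      fix d assume d: "d \<in> C"
      show "chart_area d (A \<inter> B d) = chart_area c (A \<inter> B d)"
        by (rule chart_area_change) (use d C c A B(1) in auto)
    qed
    also have "\<dots> = chart_area c (\<Union>d\<in>C. A \<inter> B d)"
    proof (rule chart_area_finite_additive[OF c C(1)])
      show "disjoint_family_on (\<lambda>d. A \<inter> B d) C"
        using B(2) unfolding disjoint_family_on_def by blast
    qed (use A B in auto)
    also have "(\<Union>d\<in>C. A \<inter> B d) = A" using B(3) by auto
    finally show ?thesis using em[OF A(1)] by simp
  qed
  then show ?thesis using s by (auto simp: is_area_measure_def)
qed

lemma area_measure_unique:
  assumes "is_area_measure \<mu>" "is_area_measure \<nu>"
  shows "\<mu> = \<nu>"
proof (rule measure_eqI)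
  show "sets \<mu> = sets \<nu>" using assms by (simp add: is_area_measure_def)
  fix A assume "A \<in> sets \<mu>"
  then have A: "A \<in> sets borel" using assms by (simp add: is_area_measure_def)
  obtain C where C: "finite C" "C \<subseteq> X" "(\<Union>c\<in>C. fst c) = UNIV" by (rule finite_chart_cover)
  obtain B where B: "\<forall>c\<in>C. B c \<in> sets borel \<and> B c \<subseteq> fst c" "disjoint_family_on B C"
    "(\<Union>c\<in>C. B c) = UNIV" using finite_chart_partition[OF C(1,2)] C(3) by auto
  have "emeasure \<kappa> A = (\<Sum>c\<in>C. chart_area c (A \<inter> B c))" if k: "is_area_measure \<kappa>" for \<kappa>
  proof -
    have "(\<Sum>c\<in>C. emeasure \<kappa> (A \<inter> B c)) = emeasure \<kappa> (\<Union>c\<in>C. A \<inter> B c)"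
    proof (rule sum_emeasure)
      show "disjoint_family_on (\<lambda>d. A \<inter> B d) C"
        using B(2) unfolding disjoint_family_on_def by blast
    qed (use k A B C in \<open>auto simp: is_area_measure_def\<close>)
    moreover have "(\<Union>c\<in>C. A \<inter> B c) = A" using B(3) by auto
    moreover have "emeasure \<kappa> (A \<inter> B c) = chart_area c (A \<inter> B c)" if "c \<in> C" for c
    proof -
      have "c \<in> X" "A \<inter> B c \<in> sets borel" "A \<inter> B c \<subseteq> fst c" using that C B A by auto
      then show ?thesis using k by (simp add: is_area_measure_def)
    qed
    ultimately show ?thesis by simp
  qed
  then show "emeasure \<mu> A = emeasure \<nu> A" using assms by simp
qed

lemma is_area_measure: "is_area_measure (area_measure X g)"
proof -
  have "area_measure X g = (THE \<mu>. is_area_measure \<mu>)"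
    by (simp add: area_measure_def is_area_measure_def chart_area_def)
  then show ?thesis
    using theI'[of is_area_measure] area_measure_ex area_measure_unique by auto
qed

lemma sets_area: "sets (area_measure X g) = sets borel"
  using is_area_measure by (simp add: is_area_measure_def)

lemma space_area: "space (area_measure X g) = UNIV"
  using sets_eq_imp_space_eq[OF sets_area] by simp

lemma emeasure_area:
  "c \<in> X \<Longrightarrow> A \<in> sets borel \<Longrightarrow> A \<subseteq> fst c \<Longrightarrow> emeasure (area_measure X g) A = chart_area c A"
  using is_area_measure by (simp add: is_area_measure_def)

text \<open>Every point has a neighbourhood of finite area, corresponding to a coordinate disk on
  which the density is bounded; finitely many of them cover.\<close>

lemma area_finite: "emeasure (area_measure X g) UNIV < \<infinity>"
proof -
  have "\<exists>V. open V \<and> p \<in> V \<and> emeasure (area_measure X g) V < \<infinity>" for p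
  proof -
    obtain c where c: "c \<in> X" "p \<in> fst c" by (rule chart_cover)
    obtain r where r: "0 < r" "cball (snd c p) r \<subseteq> snd c ` fst c"
      using open_contains_cball chart_open(2)[OF c(1)] c(2) by blast
    define V where "V = fst c \<inter> snd c -` ball (snd c p) r"
    have V: "open V" "V \<subseteq> fst c" "p \<in> V"
      using open_chart_preimage[OF c(1), of "ball (snd c p) r"] c r by (auto simp: V_def)
    have "compact (in_chart c (g c) ` cball (snd c p) r)"
      by (intro compact_continuous_image continuous_on_subset[OF metric_continuous[OF c(1)] r(2)]) simp
    then obtain b where b: "\<And>z. z \<in> cball (snd c p) r \<Longrightarrow> \<bar>in_chart c (g c) z\<bar> \<le> b"
      using compact_imp_bounded bounded_iff by (metis imageI real_norm_def)
    have "chart_area c V \<le> (\<integral>\<^sup>+ z. ennreal b * indicator (cball (snd c p) r) z \<partial>lborel)"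
      unfolding chart_area_def
    proof (rule nn_integral_mono)
      fix z
      show "ennreal (in_chart c (g c) z) * indicator (snd c ` V) z \<le> ennreal b * indicator (cball (snd c p) r) z"
        using b[of z] by (auto simp: V_def indicator_def intro!: ennreal_leI)
    qed
    also have "\<dots> = ennreal b * emeasure lborel (cball (snd c p) r)"
      by (simp add: nn_integral_cmult_indicator)
    also have "\<dots> < \<infinity>"
      using emeasure_bounded_finite[of "cball (snd c p) r"] by (simp add: ennreal_mult_less_top)
    finally show ?thesis using V emeasure_area[OF c(1) _ V(2)] by (intro exI[of _ V]) auto
  qed
  then obtain V where V: "\<And>p. open (V p)" "\<And>p. p \<in> V p" "\<And>p. emeasure (area_measure X g) (V p) < \<infinity>"
    by metis
  obtain P where P: "finite P" "UNIV \<subseteq> (\<Union>p\<in>P. V p)"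
    using compactE_image[OF compact, of UNIV V] V by (metis UNIV_I UN_iff subsetI)
  have "emeasure (area_measure X g) UNIV \<le> emeasure (area_measure X g) (\<Union>p\<in>P. V p)"
    using P V(1) by (intro emeasure_mono) (auto simp: sets_area)
  also have "\<dots> \<le> (\<Sum>p\<in>P. emeasure (area_measure X g) (V p))"
    using P V(1) by (intro emeasure_subadditive_finite) (auto simp: sets_area)
  also have "\<dots> < \<infinity>" using P V(3) by simp
  finally show ?thesis .
qed

lemma integrable_area_continuous:
  fixes f :: "'a \<Rightarrow> real"
  assumes "continuous_on UNIV f"
  shows "integrable (area_measure X g) f"
proof -
  interpret finite_measure "area_measure X g"
    by (rule finite_measureI) (use area_finite in \<open>simp add: space_area less_top\<close>)
  have "compact (f ` UNIV)" by (rule compact_continuous_image[OF assms compact])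
  then obtain b where b: "\<And>p. \<bar>f p\<bar> \<le> b"
    using compact_imp_bounded bounded_iff by (metis UNIV_I imageI real_norm_def)
  have "f \<in> borel_measurable (area_measure X g)"
    using borel_measurable_continuous_onI[OF assms] sets_area measurable_cong_sets by blast
  then show ?thesis
    by (rule integrable_const_bound[rotated]) (use b in auto)
qed

text \<open>Restricted to the chart domain, the area measure is the push-forward, under the inverse
  chart, of the measure with density \<open>chart_density c\<close> in the plane.\<close>

lemma integral_area_chart:
  fixes f :: "'a \<Rightarrow> real"
  assumes c: "c \<in> X" and f: "f \<in> borel_measurable borel" "\<And>p. p \<notin> fst c \<Longrightarrow> f p = 0"
  shows "(\<integral>p. f p \<partial>area_measure X g) =
    (\<integral>z. indicator (snd c ` fst c) z *\<^sub>R (in_chart c (g c) z * in_chart c f z) \<partial>lborel)"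
proof -
  obtain p0 where "p0 \<in> fst c \<or> fst c = {}" by auto
  \<comment> \<open>A total Borel inverse of the chart. Its value \<open>p0\<close> off the image
    carries no mass, since \<open>chart_density\<close> vanishes there.\<close>
  define h where "h z = (if z \<in> snd c ` fst c then inv_into (fst c) (snd c) z else p0)" for z
  have h: "h \<in> measurable borel borel"
    unfolding h_def
    using borel_measurable_continuous_on_restrict[OF chart_continuous(2)[OF c]] chart_open(2)[OF c]
    by (intro measurable_If_restrict_space_iff[THEN iffD2]) auto
  define N where "N = density lborel (\<lambda>z. ennreal (chart_density c z))"
  have N: "sets N = sets borel" by (simp add: N_def)
  have hN: "h \<in> measurable N borel" using h N measurable_cong_sets by blast
  have fc: "fst c \<in> sets borel" using chart_open(1)[OF c] by simp
  have eq: "density (area_measure X g) (indicator (fst c)) = distr N borel h"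
  proof (rule measure_eqI)
    show "sets (density (area_measure X g) (indicator (fst c))) = sets (distr N borel h)"
      by (simp add: sets_area)
    fix A assume "A \<in> sets (density (area_measure X g) (indicator (fst c)))"
    then have A: "A \<in> sets borel" by (simp add: sets_area)
    have "emeasure (density (area_measure X g) (indicator (fst c))) A = emeasure (area_measure X g) (A \<inter> fst c)"
    proof -
      have "emeasure (density (area_measure X g) (indicator (fst c))) A =
          (\<integral>\<^sup>+p. indicator (fst c) p * indicator A p \<partial>area_measure X g)"
        using A fc by (intro emeasure_density) (auto simp: sets_area intro!: borel_measurable_indicator)
      also have "\<dots> = (\<integral>\<^sup>+p. indicator (A \<inter> fst c) p \<partial>area_measure X g)"
        by (intro nn_integral_cong) (auto simp: indicator_def)
      finally show ?thesis using A fc by (simp add: sets_area)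
    qed
    also have "\<dots> = emeasure N (snd c ` (A \<inter> fst c))"
      unfolding N_def using A fc c by (subst emeasure_area[of c]) (auto intro!: chart_area_density)
    also have "\<dots> = emeasure N (h -` A)"
    proof -
      have hA: "h -` A \<in> sets borel" using measurable_sets_borel[OF h A] .
      have sA: "snd c ` (A \<inter> fst c) \<in> sets borel" using chart_image_borel[OF c, of "A \<inter> fst c"] A fc by auto
      have "ennreal (chart_density c z) * indicator (snd c ` (A \<inter> fst c)) z = ennreal (chart_density c z) * indicator (h -` A) z" for z
      proof (cases "z \<in> snd c ` fst c")
        case True
        then obtain p where p: "p \<in> fst c" "z = snd c p" by auto
        then have "h z = p" using chart_inv[OF c] by (auto simp: h_def)
        moreover have "z \<in> snd c ` (A \<inter> fst c) \<longleftrightarrow> p \<in> A"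
          using p chart_inj[OF c] by (auto dest: inj_onD)
        ultimately show ?thesis by (simp add: indicator_def)
      qed (simp add: chart_density_def)
      then show ?thesis
        unfolding N_def using hA sA chart_density_measurable[OF c] by (simp add: emeasure_density)
    qed
    also have "\<dots> = emeasure (distr N borel h) A"
      using A by (subst emeasure_distr[OF hN]) (auto simp: N_def)
    finally show "emeasure (density (area_measure X g) (indicator (fst c))) A = emeasure (distr N borel h) A" .
  qed
  have fm: "f \<in> borel_measurable (area_measure X g)" using f(1) sets_area measurable_cong_sets by blast
  have "(\<integral>p. f p \<partial>area_measure X g) = (\<integral>p. indicator (fst c) p *\<^sub>R f p \<partial>area_measure X g)"
    using f(2) by (intro Bochner_Integration.integral_cong) (auto simp: indicator_def)
  also have "\<dots> = (\<integral>p. f p \<partial>(density (area_measure X g) (\<lambda>p. ennreal (indicator (fst c) p))))"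
    using fm fc by (intro integral_density[symmetric]) (auto simp: sets_area intro!: borel_measurable_indicator)
  also have "(\<lambda>p. ennreal (indicator (fst c) p)) = indicator (fst c)" by (simp add: ennreal_indicator fun_eq_iff)
  also have "(\<integral>p. f p \<partial>(density (area_measure X g) (indicator (fst c)))) = (\<integral>z. f (h z) \<partial>N)"
    unfolding eq by (rule integral_distr[OF hN f(1)])
  also have "\<dots> = (\<integral>z. chart_density c z *\<^sub>R f (h z) \<partial>lborel)"
    unfolding N_def using chart_density_measurable[OF c] chart_density_nonneg[OF c] measurable_compose[OF h f(1)]
    by (intro integral_density) auto
  also have "\<dots> = (\<integral>z. indicator (snd c ` fst c) z *\<^sub>R (in_chart c (g c) z * in_chart c f z) \<partial>lborel)"
    by (intro Bochner_Integration.integral_cong) (auto simp: chart_density_def h_def in_chart_def indicator_def)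
  finally show ?thesis .
qed

end

section \<open>Lifts to projective space: algebra, derivatives and the energy density\<close>

section \<open>Hermitian and quaternionic algebra\<close>

lemma herm_add [simp]: "herm (u + v) w = herm u w + herm v w" "herm w (u + v) = herm w u + herm w v"
  by (simp_all add: herm_def sum.distrib algebra_simps)

lemma herm_scale [simp]: "herm (a *s v) w = a * herm v w" "herm v (a *s w) = cnj a * herm v w"
  by (simp_all add: herm_def sum_distrib_left algebra_simps)

lemma herm_zero [simp]: "herm 0 w = 0" "herm w 0 = 0"
  by (simp_all add: herm_def)

lemma herm_minus [simp]: "herm (- v) w = - herm v w" "herm v (- w) = - herm v w"
  by (simp_all add: herm_def sum_negf)

lemma herm_diff [simp]: "herm (u - v) w = herm u w - herm v w" "herm w (u - v) = herm w u - herm w v"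
  by (simp_all add: herm_def sum_subtractf algebra_simps)

lemma cnj_herm: "cnj (herm v w) = herm w v"
  by (simp add: herm_def mult.commute)

lemma herm_self: "herm v v = of_real ((norm v)\<^sup>2)"
proof -
  have "(norm v)\<^sup>2 = (\<Sum>i\<in>UNIV. (norm (v $ i))\<^sup>2)"
    by (simp add: norm_vec_def L2_set_def sum_nonneg)
  then show ?thesis by (simp only: herm_def of_real_sum complex_norm_square)
qed

lemma herm_self_eq_0 [simp]: "herm v v = 0 \<longleftrightarrow> v = 0"
  by (simp add: herm_self)

lemma norm_cscale [simp]: "norm (a *s v) = norm a * norm (v :: complex ^ 'n)"
proof -
  have "herm (a *s v) (a *s v) = (a * cnj a) * herm v v" by simp
  then have "complex_of_real ((norm (a *s v))\<^sup>2) = of_real ((norm a * norm v)\<^sup>2)"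
    by (simp only: power_mult_distrib of_real_mult complex_norm_square herm_self)
  then have "(norm (a *s v))\<^sup>2 = (norm a * norm v)\<^sup>2" by (simp only: of_real_eq_iff)
  then show ?thesis by (simp add: power2_eq_iff_nonneg)
qed

lemma sum_prod_2: "(\<Sum>i\<in>UNIV. f i) = (\<Sum>j\<in>UNIV. f (j, 1) + f (j, 2 :: 2))"
proof -
  have "(\<Sum>i\<in>UNIV. f i) = (\<Sum>j\<in>UNIV. \<Sum>k\<in>UNIV. f (j, k))"
    by (simp add: sum.cartesian_product)
  then show ?thesis by (simp add: UNIV_2)
qed

lemma quat_I_add [simp]: "quat_I (v + w) = quat_I v + quat_I w"
  and quat_I_scale [simp]: "quat_I (a *s v) = cnj a *s quat_I v"
  and quat_I_zero [simp]: "quat_I 0 = 0"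
  by (simp_all add: quat_I_def vec_eq_iff)

lemma not_one_2: "(k :: 2) \<noteq> 1 \<longleftrightarrow> k = 2"
  using exhaust_2[of k] by auto

lemma quat_I_quat_I [simp]: "quat_I (quat_I v) = - v"
  by (auto simp: quat_I_def vec_eq_iff not_one_2)

text \<open>The pairing of \<open>v\<close> with \<open>quat_I w\<close> is complex bilinear: up to
  sign it is the standard symplectic form, hence skew. This is why \<open>quat_I v\<close> is
  orthogonal to \<open>v\<close>.\<close>

lemma herm_quat_I_swap: "herm v (quat_I w) = - herm w (quat_I v)"
  unfolding herm_def sum_prod_2 by (simp add: quat_I_def sum_negf[symmetric] algebra_simps)

lemma herm_quat_I_self [simp]: "herm v (quat_I v) = 0" "herm (quat_I v) v = 0"
proof -
  show 1: "herm v (quat_I v) = 0" using herm_quat_I_swap[of v v] by simp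
  show "herm (quat_I v) v = 0" using 1 cnj_herm[of v "quat_I v"] by simp
qed

lemma herm_quat_I_quat_I [simp]: "herm (quat_I v) (quat_I w) = herm w v"
  using herm_quat_I_swap[of "quat_I v" w] by simp

lemma norm_quat_I [simp]: "norm (quat_I v) = norm v"
proof -
  have "complex_of_real ((norm (quat_I v))\<^sup>2) = of_real ((norm v)\<^sup>2)"
    unfolding herm_self[symmetric] by simp
  then have "(norm (quat_I v))\<^sup>2 = (norm v)\<^sup>2" by (simp only: of_real_eq_iff)
  then show ?thesis by (simp add: power2_eq_iff_nonneg)
qed

lemma perp_scale_right: "perp v (a *s w) = a *s perp v w"
  by (simp add: perp_def vec_eq_iff algebra_simps)

lemma perp_add_right: "perp v (u + w) = perp v u + perp v w"
  by (simp add: perp_def vec_eq_iff algebra_simps add_divide_distrib)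

lemma perp_self [simp]: "perp v (a *s v) = 0"
  by (cases "v = 0") (simp_all add: perp_def)

lemma perp_scale_left: "a \<noteq> 0 \<Longrightarrow> perp (a *s v) w = perp v w"
  by (cases "v = 0") (simp_all add: perp_def vec_eq_iff field_simps)

lemma perp_orth: "herm (perp v w) v = 0"
  by (cases "v = 0") (simp_all add: perp_def)

lemma perp_eq: "herm w v = 0 \<Longrightarrow> perp v w = w"
  by (simp add: perp_def)

text \<open>Pythagoras. In this form the length is visibly smooth where \<open>v \<noteq> 0\<close>,
  and its dependence on a parameter can be differentiated.\<close>

lemma norm_perp: "(norm (perp v w))\<^sup>2 = (norm w)\<^sup>2 - (cmod (herm w v))\<^sup>2 / (norm v)\<^sup>2"
proof (cases "v = 0")
  case False
  have n: "herm v v \<noteq> 0" using False by simp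
  have "herm (perp v w) (perp v w) = herm (perp v w) w"
    unfolding perp_def[of v w] using perp_orth[of v w] by (simp add: perp_def[symmetric])
      (simp add: perp_def field_simps n)
  also have "\<dots> = herm w w - herm w v * cnj (herm w v) / herm v v"
    by (simp add: perp_def cnj_herm)
  finally have "complex_of_real ((norm (perp v w))\<^sup>2) =
      of_real ((norm w)\<^sup>2 - (cmod (herm w v))\<^sup>2 / (norm v)\<^sup>2)"
    unfolding herm_self complex_norm_square[symmetric] by simp
  then show ?thesis by (simp only: of_real_eq_iff)
qed (simp add: perp_def)

lemma cline_eqD:
  assumes "cline v = cline w" "w \<noteq> 0"
  obtains a where "a \<noteq> 0" "w = a *s v"
proof -
  have "w \<in> cline w" unfolding cline_def by (rule CollectI, rule exI[of _ 1]) simp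
  then obtain a where "w = a *s v" using assms by (auto simp: cline_def)
  moreover then have "a \<noteq> 0" using assms(2) by auto
  ultimately show thesis using that by blast
qed

lemma cline_scale: "a \<noteq> 0 \<Longrightarrow> cline (a *s v) = cline v"
proof
  assume a: "a \<noteq> 0"
  show "cline (a *s v) \<subseteq> cline v" by (auto simp: cline_def)
  show "cline v \<subseteq> cline (a *s v)"
  proof
    fix w assume "w \<in> cline v"
    then obtain b where "w = b *s v" by (auto simp: cline_def)
    then have "w = (b / a) *s (a *s v)" using a by simp
    then show "w \<in> cline (a *s v)" unfolding cline_def by blast
  qed
qed

lemma cline_memI: "v \<in> cline v"
  unfolding cline_def by (rule CollectI, rule exI[of _ 1]) simp

section \<open>Wirtinger derivatives of vector-valued maps\<close>

definition wdz_vec :: "(complex \<Rightarrow> complex ^ 'n) \<Rightarrow> complex \<Rightarrow> complex ^ 'n" where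
  "wdz_vec F z = (\<chi> i. wdz (\<lambda>x. F x $ i) z)"

definition wdzb_vec :: "(complex \<Rightarrow> complex ^ 'n) \<Rightarrow> complex \<Rightarrow> complex ^ 'n" where
  "wdzb_vec F z = (\<chi> i. wdzb (\<lambda>x. F x $ i) z)"

lemma differentiable_vec_nth:
  fixes F :: "'v::real_normed_vector \<Rightarrow> complex ^ 'n"
  shows "F differentiable (at z) \<Longrightarrow> (\<lambda>x. F x $ i) differentiable (at z)"
  unfolding differentiable_def using bounded_linear.has_derivative[OF bounded_linear_vec_nth] by blast

lemma frechet_vec_nth:
  fixes F :: "'v::real_normed_vector \<Rightarrow> complex ^ 'n"
  assumes "F differentiable (at z)"
  shows "frechet_derivative F (at z) v $ i = frechet_derivative (\<lambda>x. F x $ i) (at z) v"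
proof -
  have "((\<lambda>x. F x $ i) has_derivative (\<lambda>v. frechet_derivative F (at z) v $ i)) (at z)"
    using assms frechet_derivative_works bounded_linear.has_derivative[OF bounded_linear_vec_nth] by blast
  from frechet_derivative_at[OF this] show ?thesis by metis
qed

lemma frechet_wirtinger_vec:
  fixes F :: "complex \<Rightarrow> complex ^ 'n"
  assumes "F differentiable (at z)"
  shows "frechet_derivative F (at z) 1 = wdz_vec F z + wdzb_vec F z"
    "frechet_derivative F (at z) \<i> = \<i> *s (wdz_vec F z - wdzb_vec F z)"
  by (simp_all add: vec_eq_iff frechet_vec_nth[OF assms] wdz_vec_def wdzb_vec_def wdz_def wdzb_def field_simps)

lemma wirtinger_herm:
  assumes "F differentiable (at z)" "G differentiable (at z)"
  shows "wdz (\<lambda>x. herm (F x) (G x)) z = herm (wdz_vec F z) (G z) + herm (F z) (wdzb_vec G z)"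
    "wdzb (\<lambda>x. herm (F x) (G x)) z = herm (wdzb_vec F z) (G z) + herm (F z) (wdz_vec G z)"
proof -
  note d = differentiable_vec_nth[OF assms(1)] differentiable_vec_nth[OF assms(2)]
  have c: "(\<lambda>x. cnj (G x $ i)) differentiable (at z)" for i
    using d(2) differentiable_def bounded_linear.has_derivative[OF bounded_linear_cnj] by metis
  have m: "(\<lambda>x. F x $ i * cnj (G x $ i)) differentiable (at z)" for i
    by (intro differentiable_mult d c)
  have s: "wdz (\<lambda>x. herm (F x) (G x)) z = (\<Sum>i\<in>UNIV. wdz (\<lambda>x. F x $ i * cnj (G x $ i)) z)"
    "wdzb (\<lambda>x. herm (F x) (G x)) z = (\<Sum>i\<in>UNIV. wdzb (\<lambda>x. F x $ i * cnj (G x $ i)) z)"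
    unfolding herm_def using wirtinger_sum[of UNIV "\<lambda>i x. F x $ i * cnj (G x $ i)" z] m by auto
  show "wdz (\<lambda>x. herm (F x) (G x)) z = herm (wdz_vec F z) (G z) + herm (F z) (wdzb_vec G z)"
    "wdzb (\<lambda>x. herm (F x) (G x)) z = herm (wdzb_vec F z) (G z) + herm (F z) (wdz_vec G z)"
    unfolding s by (simp_all add: wirtinger_mult d c wirtinger_cnj herm_def wdz_vec_def wdzb_vec_def sum.distrib)
qed

lemma wirtinger_vec_scale:
  assumes "a differentiable (at z)" "F differentiable (at z)"
  shows "wdz_vec (\<lambda>x. a x *s F x) z = wdz a z *s F z + a z *s wdz_vec F z"
    "wdzb_vec (\<lambda>x. a x *s F x) z = wdzb a z *s F z + a z *s wdzb_vec F z"
  by (simp_all add: vec_eq_iff wdz_vec_def wdzb_vec_def wirtinger_mult[OF assms(1) differentiable_vec_nth[OF assms(2)]])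

text \<open>\<open>quat_I\<close> is conjugate linear with constant coefficients, and conjugation
  exchanges the two Wirtinger derivatives.\<close>

lemma wirtinger_quat_I:
  assumes "F differentiable (at z)"
  shows "wdz_vec (\<lambda>x. quat_I (F x)) z = quat_I (wdzb_vec F z)"
    "wdzb_vec (\<lambda>x. quat_I (F x)) z = quat_I (wdz_vec F z)"
proof -
  have d: "(\<lambda>x. F x $ i) differentiable (at z)" "(\<lambda>x. cnj (F x $ i)) differentiable (at z)" for i
    using differentiable_vec_nth[OF assms] differentiable_def bounded_linear.has_derivative[OF bounded_linear_cnj] by metis+
  show "wdz_vec (\<lambda>x. quat_I (F x)) z = quat_I (wdzb_vec F z)"
    "wdzb_vec (\<lambda>x. quat_I (F x)) z = quat_I (wdz_vec F z)"
    by (auto simp: vec_eq_iff wdz_vec_def wdzb_vec_def quat_I_def wirtinger_cnj wirtinger_minus d)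
qed

lemma bounded_linear_quat_I: "bounded_linear quat_I"
proof (rule linear_conv_bounded_linear[THEN iffD1], rule linearI)
  show "quat_I (r *\<^sub>R v) = r *\<^sub>R quat_I v" for r and v :: "complex ^ ('m::finite \<times> 2)"
    by (simp add: quat_I_def vec_eq_iff)
qed simp

lemma smooth_on_quat_I: "open S \<Longrightarrow> smooth_on S F \<Longrightarrow> smooth_on S (\<lambda>x. quat_I (F x))"
  by (rule smooth_on_bounded_linear_comp[OF bounded_linear_quat_I])

lemma smooth_on_wdz_vec: "open S \<Longrightarrow> smooth_on S F \<Longrightarrow> smooth_on S (wdz_vec F)"
  and smooth_on_wdzb_vec: "open S \<Longrightarrow> smooth_on S F \<Longrightarrow> smooth_on S (wdzb_vec F)"
  unfolding wdz_vec_def[abs_def] wdzb_vec_def[abs_def]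
  by (auto intro!: smooth_on_vec_lambda smooth_on_wdz smooth_on_wdzb smooth_on_vec_nth)

section \<open>Symmetry of second derivatives\<close>

text \<open>Two applications of the mean value theorem express the second difference quotient as the
  iterated derivative at an intermediate point. As the quotient is symmetric in \<open>u\<close> and
  \<open>v\<close>, its limit yields the symmetry of second derivatives.\<close>

lemma second_difference_tendsto:
  fixes f :: "complex \<Rightarrow> real"
  assumes S: "open S" "z \<in> S" and f: "smooth_on S f"
  shows "((\<lambda>h. (f (z + h *\<^sub>R u + h *\<^sub>R v) - f (z + h *\<^sub>R u) - f (z + h *\<^sub>R v) + f z) / h\<^sup>2)
    \<longlongrightarrow> frechet_derivative (\<lambda>x. frechet_derivative f (at x) u) (at z) v) (at_right 0)"
proof -
  define fu where "fu x = frechet_derivative f (at x) u" for x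
  define fuv where "fuv x = frechet_derivative fu (at x) v" for x
  have fu: "smooth_on S fu" unfolding fu_def by (rule smooth_on_frechet[OF f])
  have fuv: "smooth_on S fuv" unfolding fuv_def by (rule smooth_on_frechet[OF fu])
  have D: "((\<lambda>t. f (w + t *\<^sub>R u)) has_real_derivative fu (w + t *\<^sub>R u)) (at t)" if "w + t *\<^sub>R u \<in> S" for w t
  proof -
    have "((\<lambda>t. f (w + t *\<^sub>R u)) has_derivative (\<lambda>s. frechet_derivative f (at (w + t *\<^sub>R u)) (s *\<^sub>R u))) (at t)"
      by (rule has_derivative_compose[where g = f and f = "\<lambda>t. w + t *\<^sub>R u", OF _ smooth_on_has_derivative[OF f that]]) (auto intro!: derivative_eq_intros)
    moreover have "frechet_derivative f (at (w + t *\<^sub>R u)) (s *\<^sub>R u) = fu (w + t *\<^sub>R u) * s" for s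
      using linear_cmul[OF has_derivative_linear[OF smooth_on_has_derivative[OF f that]]] by (simp add: fu_def)
    ultimately show ?thesis by (simp add: has_field_derivative_def)
  qed
  have D2: "((\<lambda>t. fu (w + t *\<^sub>R v)) has_real_derivative fuv (w + t *\<^sub>R v)) (at t)" if "w + t *\<^sub>R v \<in> S" for w t
  proof -
    have "((\<lambda>t. fu (w + t *\<^sub>R v)) has_derivative (\<lambda>s. frechet_derivative fu (at (w + t *\<^sub>R v)) (s *\<^sub>R v))) (at t)"
      by (rule has_derivative_compose[where g = fu and f = "\<lambda>t. w + t *\<^sub>R v", OF _ smooth_on_has_derivative[OF fu that]]) (auto intro!: derivative_eq_intros)
    moreover have "frechet_derivative fu (at (w + t *\<^sub>R v)) (s *\<^sub>R v) = fuv (w + t *\<^sub>R v) * s" for s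
      using linear_cmul[OF has_derivative_linear[OF smooth_on_has_derivative[OF fu that]]] by (simp add: fuv_def)
    ultimately show ?thesis by (simp add: has_field_derivative_def)
  qed
  have "isCont fuv z"
    using smooth_on_imp_continuous_on[OF fuv] S continuous_on_eq_continuous_at by blast
  show ?thesis
    unfolding fu_def[symmetric] fuv_def[symmetric]
  proof (rule tendstoI)
    fix e :: real assume "0 < e"
    then obtain d where d: "0 < d" "\<And>x. dist x z < d \<Longrightarrow> dist (fuv x) (fuv z) < e"
      using \<open>isCont fuv z\<close> unfolding continuous_at_eps_delta by metis
    obtain r where r: "0 < r" "ball z r \<subseteq> S" using S open_contains_ball by blast
    define h0 where "h0 = min d r / (norm u + norm v + 1)"
    have k: "0 < norm u + norm v + 1" by (smt (verit) norm_ge_zero)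
    then have h0: "0 < h0" using d r by (simp add: h0_def)
    have small: "dist (z + s *\<^sub>R u + t *\<^sub>R v) z < min d r" if "0 \<le> s" "s \<le> h" "0 \<le> t" "t \<le> h" "h < h0" for s t h
    proof -
      have "dist (z + s *\<^sub>R u + t *\<^sub>R v) z \<le> s * norm u + t * norm v"
        using norm_triangle_ineq[of "s *\<^sub>R u" "t *\<^sub>R v"] that by (simp add: dist_norm add.assoc)
      also have "\<dots> \<le> h * norm u + h * norm v" using that by (intro add_mono mult_right_mono) auto
      also have "\<dots> \<le> h * (norm u + norm v + 1)" using that by (simp add: algebra_simps)
      also have "\<dots> < h0 * (norm u + norm v + 1)" using that k by (intro mult_strict_right_mono) auto
      also have "\<dots> = min d r" using k by (simp add: h0_def)
      finally show ?thesis .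
    qed
    have inS: "z + s *\<^sub>R u + t *\<^sub>R v \<in> S" if "0 \<le> s" "s \<le> h" "0 \<le> t" "t \<le> h" "h < h0" for s t h
      using small[OF that] r(2) by (auto simp: dist_commute subset_iff)
    have "dist ((f (z + h *\<^sub>R u + h *\<^sub>R v) - f (z + h *\<^sub>R u) - f (z + h *\<^sub>R v) + f z) / h\<^sup>2) (fuv z) < e"
      if h: "0 < h" "h < h0" for h
    proof -
      define \<phi> where "\<phi> s = f (z + h *\<^sub>R v + s *\<^sub>R u) - f (z + s *\<^sub>R u)" for s
      have "\<exists>x. 0 < x \<and> x < h \<and> \<phi> h - \<phi> 0 = (h - 0) * (fu (z + h *\<^sub>R v + x *\<^sub>R u) - fu (z + x *\<^sub>R u))"
      proof (rule MVT2[OF h(1)])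
        fix x assume x: "0 \<le> x" "x \<le> h"
        show "(\<phi> has_real_derivative fu (z + h *\<^sub>R v + x *\<^sub>R u) - fu (z + x *\<^sub>R u)) (at x)"
          unfolding \<phi>_def
          using inS[of x h h] inS[of x h 0] x h by (intro DERIV_diff D) (auto simp: ac_simps)
      qed
      then obtain x where x: "0 < x" "x < h"
        "\<phi> h - \<phi> 0 = h * (fu (z + x *\<^sub>R u + h *\<^sub>R v) - fu (z + x *\<^sub>R u + 0 *\<^sub>R v))" by (auto simp: ac_simps)
      have "\<exists>y. 0 < y \<and> y < h \<and> fu (z + x *\<^sub>R u + h *\<^sub>R v) - fu (z + x *\<^sub>R u + 0 *\<^sub>R v) =
          (h - 0) * fuv (z + x *\<^sub>R u + y *\<^sub>R v)"
        by (rule MVT2[OF h(1)], rule D2) (use inS[of x h] x h in auto)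
      then obtain y where y: "0 < y" "y < h"
        "fu (z + x *\<^sub>R u + h *\<^sub>R v) - fu (z + x *\<^sub>R u + 0 *\<^sub>R v) = h * fuv (z + x *\<^sub>R u + y *\<^sub>R v)"
        by auto
      have "\<phi> h - \<phi> 0 = h\<^sup>2 * fuv (z + x *\<^sub>R u + y *\<^sub>R v)"
        using x(3) y(3) by (simp add: power2_eq_square)
      then have "(f (z + h *\<^sub>R u + h *\<^sub>R v) - f (z + h *\<^sub>R u) - f (z + h *\<^sub>R v) + f z) / h\<^sup>2 = fuv (z + x *\<^sub>R u + y *\<^sub>R v)"
        using h by (simp add: \<phi>_def field_simps)
      then show ?thesis using d(2)[of "z + x *\<^sub>R u + y *\<^sub>R v"] small[of x h y] x y h by simp
    qed
    then show "\<forall>\<^sub>F h in at_right 0. dist ((f (z + h *\<^sub>R u + h *\<^sub>R v) - f (z + h *\<^sub>R u) - f (z + h *\<^sub>R v) + f z) / h\<^sup>2) (fuv z) < e"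
      unfolding eventually_at_right_field using h0 by (intro exI[of _ h0]) auto
  qed
qed

lemma frechet_symmetric_real:
  fixes f :: "complex \<Rightarrow> real"
  assumes "open S" "z \<in> S" "smooth_on S f"
  shows "frechet_derivative (\<lambda>x. frechet_derivative f (at x) u) (at z) v =
    frechet_derivative (\<lambda>x. frechet_derivative f (at x) v) (at z) u"
proof -
  have e: "(\<lambda>h. (f (z + h *\<^sub>R v + h *\<^sub>R u) - f (z + h *\<^sub>R v) - f (z + h *\<^sub>R u) + f z) / h\<^sup>2) =
      (\<lambda>h. (f (z + h *\<^sub>R u + h *\<^sub>R v) - f (z + h *\<^sub>R u) - f (z + h *\<^sub>R v) + f z) / h\<^sup>2)"
    by (simp add: fun_eq_iff algebra_simps)
  show ?thesis
    by (rule tendsto_unique[OF _ second_difference_tendsto[OF assms] second_difference_tendsto[OF assms, of v u, unfolded e]]) simp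
qed

lemma frechet_bounded_linear_comp:
  assumes "bounded_linear L" "f differentiable (at x)"
  shows "frechet_derivative (\<lambda>x. L (f x)) (at x) v = L (frechet_derivative f (at x) v)"
  using frechet_derivative_at[OF bounded_linear.has_derivative[OF assms(1)
    frechet_derivative_works[THEN iffD1, OF assms(2)]]] by metis

lemma frechet_cong:
  assumes "open S" "z \<in> S" "\<And>x. x \<in> S \<Longrightarrow> f x = g x"
  shows "frechet_derivative f (at z) = frechet_derivative g (at z)"
proof -
  have "(f has_derivative D) (at z) \<longleftrightarrow> (g has_derivative D) (at z)" for D
    using has_derivative_transform_within_open[of f D z UNIV S g] has_derivative_transform_within_open[of g D z UNIV S f]
      assms by auto
  then show ?thesis by (simp add: frechet_derivative_def)
qed

text \<open>The mean value argument is for real-valued functions, so real and imaginary parts are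
  treated separately.\<close>

lemma frechet_symmetric:
  fixes f :: "complex \<Rightarrow> complex"
  assumes S: "open S" "z \<in> S" "smooth_on S f"
  shows "frechet_derivative (\<lambda>x. frechet_derivative f (at x) u) (at z) v =
    frechet_derivative (\<lambda>x. frechet_derivative f (at x) v) (at z) u"
proof -
  have *: "L (frechet_derivative (\<lambda>x. frechet_derivative f (at x) u) (at z) v) =
      L (frechet_derivative (\<lambda>x. frechet_derivative f (at x) v) (at z) u)"
    if L: "bounded_linear L" for L :: "complex \<Rightarrow> real"
  proof -
    have 1: "L (frechet_derivative (\<lambda>x. frechet_derivative f (at x) a) (at z) b) =
        frechet_derivative (\<lambda>x. frechet_derivative (\<lambda>x. L (f x)) (at x) a) (at z) b" for a b
    proof -
      have "frechet_derivative (\<lambda>x. frechet_derivative (\<lambda>x. L (f x)) (at x) a) (at z) =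
          frechet_derivative (\<lambda>x. L (frechet_derivative f (at x) a)) (at z)"
        by (rule frechet_cong[OF S(1,2)], rule frechet_bounded_linear_comp[OF L smooth_on_differentiable[OF S(3)]])
      then show ?thesis
        using frechet_bounded_linear_comp[OF L smooth_on_differentiable[OF smooth_on_frechet[OF S(3)] S(2)]] by simp
    qed
    show ?thesis
      unfolding 1 by (rule frechet_symmetric_real[OF S(1,2) smooth_on_bounded_linear_comp[OF L S(1,3)]])
  qed
  show ?thesis
    using *[OF bounded_linear_Re] *[OF bounded_linear_Im] by (rule complex_eqI)
qed

lemma wdz_wdzb_commute:
  assumes S: "open S" "z \<in> S" "smooth_on S f"
  shows "wdz (wdzb f) z = wdzb (wdz f) z"
proof -
  define f1 where "f1 x = frechet_derivative f (at x) 1" for x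
  define f2 where "f2 x = frechet_derivative f (at x) \<i>" for x
  have d: "f1 differentiable (at z)" "f2 differentiable (at z)"
    unfolding f1_def f2_def using smooth_on_differentiable[OF smooth_on_frechet[OF S(3)] S(2)] by auto
  have h: "(wdzb f has_derivative (\<lambda>v. (frechet_derivative f1 (at z) v + \<i> * frechet_derivative f2 (at z) v) / 2)) (at z)"
    "(wdz f has_derivative (\<lambda>v. (frechet_derivative f1 (at z) v - \<i> * frechet_derivative f2 (at z) v) / 2)) (at z)"
    unfolding wdzb_def[abs_def] wdz_def[abs_def] f1_def[symmetric] f2_def[symmetric]
    using d[unfolded frechet_derivative_works] by (auto intro!: derivative_eq_intros)
  have e: "frechet_derivative (wdzb f) (at z) v = (frechet_derivative f1 (at z) v + \<i> * frechet_derivative f2 (at z) v) / 2"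
    "frechet_derivative (wdz f) (at z) v = (frechet_derivative f1 (at z) v - \<i> * frechet_derivative f2 (at z) v) / 2" for v
    using fun_cong[OF frechet_derivative_at[OF h(1)], symmetric] fun_cong[OF frechet_derivative_at[OF h(2)], symmetric]
    by blast+
  have s: "frechet_derivative f1 (at z) \<i> = frechet_derivative f2 (at z) 1"
    unfolding f1_def f2_def by (rule frechet_symmetric[OF S])
  show ?thesis
    unfolding wdz_def[of "wdzb f"] wdzb_def[of "wdz f"] e s by (simp add: field_simps)
qed

lemma wdz_wdzb_vec_commute:
  assumes S: "open S" "z \<in> S" "smooth_on S F"
  shows "wdz_vec (wdzb_vec F) z = wdzb_vec (wdz_vec F) z"
  using wdz_wdzb_commute[OF S(1,2) smooth_on_vec_nth[OF S(1,3)]]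
  by (simp add: wdz_vec_def wdzb_vec_def vec_eq_iff)

section \<open>Maps to projective space in terms of local lifts\<close>

lemma in_chart_vec_nth: "in_chart c (\<lambda>q. F q $ i) = (\<lambda>z. in_chart c (F :: 'a \<Rightarrow> complex ^ 'n) z $ i)"
  by (rule in_chart_o(1)[of _ "\<lambda>v. v $ i"])

lemma dzbar_vec_eq: "dzbar_vec c F p = wdzb_vec (in_chart c F) (snd c p)"
  by (simp add: dzbar_vec_def wdzb_vec_def dzbar_eq in_chart_vec_nth)

lemma perp_self_one [simp]: "perp v v = 0"
  using perp_self[of v 1] by simp

lemma fs4_sq_scale: "a \<noteq> 0 \<Longrightarrow> fs4_sq (a *s v) (a *s w) = fs4_sq v w"
  by (simp add: fs4_sq_def power_mult_distrib)

text \<open>For a metric \<open>\<rho> (dx^2 + dy^2)\<close> this is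
  \<open>\<rho> |d\<Psi>|^2\<close>: a factor 4 comes from \<open>4g_FS\<close>, a factor 2 from the
  parallelogram law, which trades the real partial derivatives for Wirtinger derivatives. That
  \<open>\<rho>\<close> does not occur in it is the conformal invariance of the energy.\<close>

definition energy_density :: "(complex \<Rightarrow> complex ^ 'n) \<Rightarrow> complex \<Rightarrow> real" where
  "energy_density f z =
     8 * ((norm (perp (f z) (wdz_vec f z)))\<^sup>2 + (norm (perp (f z) (wdzb_vec f z)))\<^sup>2) / (norm (f z))\<^sup>2"

lemma parallelogram: "(norm (v + w))\<^sup>2 + (norm (v - w))\<^sup>2 = 2 * ((norm v)\<^sup>2 + (norm (w :: 'b::real_inner))\<^sup>2)"
  by (simp add: power2_norm_eq_inner inner_simps inner_commute)

lemma fs4_sq_sum: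
  "fs4_sq v (perp v (x + y)) + fs4_sq v (perp v (\<i> *s (x - y))) =
    8 * ((norm (perp v x))\<^sup>2 + (norm (perp v y))\<^sup>2) / (norm v)\<^sup>2"
proof -
  have m: "perp v (x - y) = perp v x - perp v y"
    using perp_add_right[of v x "(-1) *s y"] perp_scale_right[of v "-1" y] by simp
  have "fs4_sq v (perp v (x + y)) + fs4_sq v (perp v (\<i> *s (x - y))) =
      4 * ((norm (perp v x + perp v y))\<^sup>2 + (norm (perp v x - perp v y))\<^sup>2) / (norm v)\<^sup>2"
    unfolding fs4_sq_def perp_scale_right m norm_cscale perp_add_right
    by (simp add: add_divide_distrib)
  then show ?thesis by (simp add: parallelogram)
qed

context atlas
begin

lemma smooth_liftD:
  assumes "smooth_lift X \<Psi> U F"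
  shows "open U" "smooth_fun X U F" "\<And>q. q \<in> U \<Longrightarrow> F q \<noteq> 0" "\<And>q. q \<in> U \<Longrightarrow> \<Psi> q = cline (F q)"
  using assms by (auto simp: smooth_lift_def)

lemma smooth_lift_subset: "smooth_lift X \<Psi> U F \<Longrightarrow> open V \<Longrightarrow> V \<subseteq> U \<Longrightarrow> smooth_lift X \<Psi> V F"
  unfolding smooth_lift_def using smooth_fun_subset by blast

lemma smooth_lift_scale:
  assumes "smooth_lift X \<Psi> U F" "smooth_fun X U l" "\<And>q. q \<in> U \<Longrightarrow> l q \<noteq> 0"
  shows "smooth_lift X \<Psi> U (\<lambda>q. l q *s F q)"
  unfolding smooth_lift_def
  using assms(2,3) smooth_liftD[OF assms(1)]
  by (auto intro!: smooth_fun_vec_scale simp: cline_scale)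

text \<open>The factor is an explicit quotient of Hermitian products, from which its smoothness is
  read off.\<close>

lemma lift_ratio:
  assumes F: "smooth_lift X \<Psi> U F" and G: "smooth_lift X \<Psi> V G"
  obtains l where "smooth_fun X (U \<inter> V) l" "\<And>q. q \<in> U \<inter> V \<Longrightarrow> l q \<noteq> 0"
    "\<And>q. q \<in> U \<inter> V \<Longrightarrow> G q = l q *s F q" "\<And>q. l q = herm (G q) (F q) / herm (F q) (F q)"
proof -
  define l where "l q = herm (G q) (F q) / herm (F q) (F q)" for q
  note D = smooth_liftD[OF F] smooth_liftD[OF G]
  have op: "open (U \<inter> V)" using D by auto
  have "G q = l q *s F q \<and> l q \<noteq> 0" if q: "q \<in> U \<inter> V" for q
  proof -
    have "cline (F q) = cline (G q)" using D(4)[of q] D(8)[of q] q by (metis IntD1 IntD2)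
    moreover have "F q \<noteq> 0" "G q \<noteq> 0" using D q by auto
    ultimately obtain a where "a \<noteq> 0" "G q = a *s F q" by (metis cline_eqD)
    moreover then have "l q = a" using \<open>F q \<noteq> 0\<close> by (simp add: l_def)
    ultimately show ?thesis by simp
  qed
  moreover have "smooth_fun X (U \<inter> V) l"
    unfolding l_def
    by (intro smooth_fun_divide smooth_fun_herm op smooth_fun_subset[OF D(2)] smooth_fun_subset[OF D(6)])
      (use D(3) in auto)
  ultimately show thesis using that l_def by blast
qed

text \<open>Abstracts what makes \<open>perp (F p) (\<delta> F)\<close> depend on the lift only
  through \<open>F p\<close>: a product rule modulo multiples of \<open>F p\<close>, and locality.
  The real and the Wirtinger derivatives in a chart all satisfy it.\<close>

definition leibniz :: "(('a \<Rightarrow> complex ^ 'n) \<Rightarrow> complex ^ 'n) \<Rightarrow> 'a \<Rightarrow> bool" where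
  "leibniz \<delta> p \<longleftrightarrow>
     (\<forall>U F l. open U \<longrightarrow> p \<in> U \<longrightarrow> smooth_fun X U F \<longrightarrow> smooth_fun X U l \<longrightarrow>
        (\<exists>k. \<delta> (\<lambda>q. l q *s F q) = l p *s \<delta> F + k *s F p)) \<and>
     (\<forall>U F G. open U \<longrightarrow> p \<in> U \<longrightarrow> (\<forall>q\<in>U. F q = G q) \<longrightarrow> \<delta> F = \<delta> G)"

lemma leibniz_mult:
  assumes "leibniz \<delta> p" "open U" "p \<in> U" "smooth_fun X U F" "smooth_fun X U l"
  shows "\<exists>k. \<delta> (\<lambda>q. l q *s F q) = l p *s \<delta> F + k *s F p"
  using assms(1)[unfolded leibniz_def, THEN conjunct1] assms(2-5) by blast

lemma leibniz_cong:
  assumes "leibniz \<delta> p" "open U" "p \<in> U" "\<And>q. q \<in> U \<Longrightarrow> F q = G q"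
  shows "\<delta> F = \<delta> G"
  using assms(1)[unfolded leibniz_def, THEN conjunct2] assms(2-4) by blast

text \<open>Lifts that are proportional at \<open>p\<close> differ by a scalar function; the extra
  term of the product rule is a multiple of \<open>F p\<close> and is killed by \<open>perp\<close>.
  So the description in \<open>hom_value\<close> has a unique solution, computable from any single
  lift.\<close>

lemma hom_value_lift:
  assumes L: "leibniz \<delta> p" and F: "smooth_lift X \<Psi> U F" and p: "p \<in> U"
  shows "hom_value X \<Psi> \<delta> p (a *s F p) = a *s perp (F p) (\<delta> F)"
proof (cases "a = 0")
  case False
  note D = smooth_liftD[OF F]
  have nz: "a *s F p \<noteq> 0" using False D(3)[OF p] by simp
  have key: "perp (a *s F p) (\<delta> G) = a *s perp (F p) (\<delta> F)"
    if G: "smooth_lift X \<Psi> V G" "p \<in> V" "G p = a *s F p" for V G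
  proof -
    obtain l where l: "smooth_fun X (U \<inter> V) l" "\<And>q. q \<in> U \<inter> V \<Longrightarrow> G q = l q *s F q"
      by (rule lift_ratio[OF F G(1)]) blast
    have op: "open (U \<inter> V)" using D(1) smooth_liftD(1)[OF G(1)] by auto
    have lp: "l p = a" using l(2)[of p] G p D(3)[OF p] by simp
    have "\<delta> G = \<delta> (\<lambda>q. l q *s F q)"
      by (rule leibniz_cong[OF L op]) (use l(2) p G(2) in auto)
    moreover obtain k where "\<delta> (\<lambda>q. l q *s F q) = l p *s \<delta> F + k *s F p"
      using leibniz_mult[OF L op _ smooth_fun_subset[OF D(2)] l(1)] p G(2) by blast
    ultimately have "\<delta> G = a *s \<delta> F + k *s F p" using lp by simp
    then show ?thesis using False by (simp add: perp_scale_left perp_add_right perp_scale_right)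
  qed
  have ex: "smooth_lift X \<Psi> U (\<lambda>q. a *s F q)"
    by (rule smooth_lift_scale[OF F smooth_fun_const]) (use False in auto)
  have "(THE w. \<exists>U G. p \<in> U \<and> smooth_lift X \<Psi> U G \<and> G p = a *s F p \<and> w = perp (a *s F p) (\<delta> G)) =
      a *s perp (F p) (\<delta> F)"
  proof (rule the_equality)
    show "\<exists>U G. p \<in> U \<and> smooth_lift X \<Psi> U G \<and> G p = a *s F p \<and> a *s perp (F p) (\<delta> F) = perp (a *s F p) (\<delta> G)"
      using ex p key[OF ex p] by (intro exI[of _ U] exI[of _ "\<lambda>q. a *s F q"]) auto
  qed (use key in auto)
  then show ?thesis using nz by (simp add: hom_value_def)
qed (simp add: hom_value_def)

lemma in_chart_cong_on:
  assumes "c \<in> X" "\<forall>q\<in>U. F q = G q" "z \<in> snd c ` (U \<inter> fst c)"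
  shows "in_chart c F z = in_chart c G z"
  using assms by auto

lemma leibniz_wirtinger:
  assumes c: "c \<in> X" "p \<in> fst c"
  shows "leibniz (\<lambda>F. wdz_vec (in_chart c F) (snd c p)) p"
    "leibniz (\<lambda>F. wdzb_vec (in_chart c F) (snd c p)) p"
proof -
  have cong: "wdz_vec (in_chart c F) (snd c p) = wdz_vec (in_chart c G) (snd c p) \<and>
      wdzb_vec (in_chart c F) (snd c p) = wdzb_vec (in_chart c G) (snd c p)"
    if "open U" "p \<in> U" "\<forall>q\<in>U. F q = G q" for U and F G :: "'a \<Rightarrow> complex ^ 'n"
  proof -
    have "wdz (\<lambda>x. in_chart c F x $ i) (snd c p) = wdz (\<lambda>x. in_chart c G x $ i) (snd c p) \<and>
        wdzb (\<lambda>x. in_chart c F x $ i) (snd c p) = wdzb (\<lambda>x. in_chart c G x $ i) (snd c p)" for i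
      using in_chart_cong_on[OF c(1) that(3)] c that
      by (intro conjI wirtinger_cong[OF open_chart_image[OF c(1) that(1)]]) auto
    then show ?thesis by (simp add: wdz_vec_def wdzb_vec_def)
  qed
  have prod: "wdz_vec (in_chart c (\<lambda>q. l q *s F q)) (snd c p) = l p *s wdz_vec (in_chart c F) (snd c p) + wdz (in_chart c l) (snd c p) *s F p \<and>
      wdzb_vec (in_chart c (\<lambda>q. l q *s F q)) (snd c p) = l p *s wdzb_vec (in_chart c F) (snd c p) + wdzb (in_chart c l) (snd c p) *s F p"
    if "open U" "p \<in> U" "smooth_fun X U F" "smooth_fun X U l" for U l and F :: "'a \<Rightarrow> complex ^ 'n"
    unfolding in_chart_o(2)[of _ "\<lambda>a v. a *s v"]
    using c that by (simp add: wirtinger_vec_scale smooth_fun_in_chart_differentiable add.commute)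
  show "leibniz (\<lambda>F. wdz_vec (in_chart c F) (snd c p)) p"
    "leibniz (\<lambda>F. wdzb_vec (in_chart c F) (snd c p)) p"
    unfolding leibniz_def using cong prod by blast+
qed

lemma dbar_Psi_lift:
  assumes F: "smooth_lift X \<Psi> U F" and c: "c \<in> X" and p: "p \<in> U \<inter> fst c"
  shows "dbar_Psi X \<Psi> c p (a *s F p) = a *s perp (F p) (wdzb_vec (in_chart c F) (snd c p))"
  unfolding dbar_Psi_def dzbar_vec_eq
  using hom_value_lift[OF leibniz_wirtinger(2) F] c p by blast

lemma dPsi_lift:
  assumes F: "smooth_lift X \<Psi> U F" and c: "c \<in> X" and p: "p \<in> U \<inter> fst c"
  shows "dPsi X \<Psi> c 1 p (a *s F p) =
      a *s perp (F p) (wdz_vec (in_chart c F) (snd c p) + wdzb_vec (in_chart c F) (snd c p))" (is ?one)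
    "dPsi X \<Psi> c \<i> p (a *s F p) =
      a *s perp (F p) (\<i> *s (wdz_vec (in_chart c F) (snd c p) - wdzb_vec (in_chart c F) (snd c p)))" (is ?i)
proof -
  let ?z = "snd c p"
  have cp: "p \<in> fst c" "p \<in> U" using p by auto
  have diff: "in_chart c G differentiable (at ?z)" if "smooth_fun X V G" "p \<in> V" for V and G :: "'a \<Rightarrow> complex ^ 'n"
    using smooth_fun_in_chart_differentiable[OF that(1) c] that(2) cp by auto
  have smF: "smooth_fun X V (\<lambda>q. l q *s G q)" if "open V" "smooth_fun X V G" "smooth_fun X V l"
    for V l and G :: "'a \<Rightarrow> complex ^ 'n" using smooth_fun_vec_scale[OF that(1,3,2)] .
  have cong: "dir_deriv c \<xi> G p = dir_deriv c \<xi> H p" if "open V" "p \<in> V" "\<forall>q\<in>V. G q = H q"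
    for V \<xi> and G H :: "'a \<Rightarrow> complex ^ 'n"
    unfolding dir_deriv_def
    using frechet_cong[OF open_chart_image[OF c that(1)], of ?z "in_chart c G" "in_chart c H"]
      in_chart_cong_on[OF c that(3)] cp that by auto
  note w = leibniz_wirtinger[OF c cp(1), unfolded leibniz_def]
  have "\<exists>k. dir_deriv c 1 (\<lambda>q. l q *s G q) p = l p *s dir_deriv c 1 G p + k *s G p \<and>
      dir_deriv c \<i> (\<lambda>q. l q *s G q) p = l p *s dir_deriv c \<i> G p + k' *s G p"
    if V: "open V" "p \<in> V" "smooth_fun X V G" "smooth_fun X V l"
      "k' = dir_deriv c \<i> l p" for V l k' and G :: "'a \<Rightarrow> complex ^ 'n"
  proof -
    have dl: "in_chart c l differentiable (at ?z)"
      using smooth_fun_in_chart_differentiable[OF V(4) c] V cp by auto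
    have dirl: "dir_deriv c \<i> l p = \<i> * (wdz (in_chart c l) ?z - wdzb (in_chart c l) ?z)"
      by (simp add: dir_deriv_def wdz_def wdzb_def field_simps)
    note e = wirtinger_vec_scale[OF dl diff[OF V(3,2)]]
    show ?thesis
      unfolding V(5) dirl
      unfolding dir_deriv_def frechet_wirtinger_vec[OF diff[OF smF[OF V(1,3,4)] V(2)]]
        frechet_wirtinger_vec[OF diff[OF V(3,2)]]
      unfolding in_chart_o(2)[of _ "\<lambda>a v. a *s v"] e
      using c cp
      by (intro exI[of _ "wdz (in_chart c l) ?z + wdzb (in_chart c l) ?z"]) (simp add: vec_eq_iff algebra_simps)
  qed
  then have L: "leibniz (\<lambda>F. dir_deriv c 1 F p) p" "leibniz (\<lambda>F. dir_deriv c \<i> F p) p"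
    unfolding leibniz_def using cong by blast+
  show ?one ?i
    unfolding dPsi_def hom_value_lift[OF L(1) F cp(2)] hom_value_lift[OF L(2) F cp(2)]
    using frechet_wirtinger_vec[OF diff[OF smooth_liftD(2)[OF F] cp(2)]] by (simp_all add: dir_deriv_def)
qed

lemma wirtinger_vec_chart_change:
  assumes F: "smooth_fun X U F" and c: "c \<in> X" "c' \<in> X" and p: "p \<in> U" "p \<in> fst c \<inter> fst c'"
  shows "wdz_vec (in_chart c F) (snd c p) = jac c c' p *s wdz_vec (in_chart c' F) (snd c' p)"
    "wdzb_vec (in_chart c F) (snd c p) = cnj (jac c c' p) *s wdzb_vec (in_chart c' F) (snd c' p)"
proof -
  have d: "in_chart c' (\<lambda>q. F q $ i) differentiable (at (snd c' p))" for i
    unfolding in_chart_vec_nth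
    by (rule differentiable_vec_nth) (use smooth_fun_in_chart_differentiable[OF F c(2)] p in auto)
  show "wdz_vec (in_chart c F) (snd c p) = jac c c' p *s wdz_vec (in_chart c' F) (snd c' p)"
    "wdzb_vec (in_chart c F) (snd c p) = cnj (jac c c' p) *s wdzb_vec (in_chart c' F) (snd c' p)"
    using chart_change_wirtinger[OF c p(2) d]
    by (simp_all add: vec_eq_iff wdz_vec_def wdzb_vec_def dz_eq dzbar_eq in_chart_vec_nth mult.commute)
qed

lemma conformal_metricD:
  assumes "conformal_metric X g"
  shows "c \<in> X \<Longrightarrow> p \<in> fst c \<Longrightarrow> 0 < g c p"
    "c \<in> X \<Longrightarrow> c' \<in> X \<Longrightarrow> p \<in> fst c \<inter> fst c' \<Longrightarrow> g c p = g c' p * (cmod (jac c c' p))\<^sup>2"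
    "c \<in> X \<Longrightarrow> smooth_fun X (fst c) (g c)"
  using assms unfolding conformal_metric_def jac_def by blast+

text \<open>The described numbers do not depend on the chart, as the squared derivatives and the
  metric coefficient both scale by \<open>|jac|^2\<close>, nor on \<open>v\<close>, as
  \<open>fs4_sq\<close> is invariant under a common scaling of its arguments.\<close>

lemma norm_sq_lift:
  assumes g: "conformal_metric X g" and F: "smooth_lift X \<Psi> U F" and c: "c \<in> X" and p: "p \<in> U \<inter> fst c"
  shows "dPsi_norm_sq X g \<Psi> p = energy_density (in_chart c F) (snd c p) / g c p" (is ?thesis1)
    "dbar_norm_sq X g \<Psi> p = fs4_sq (F p) (perp (F p) (wdzb_vec (in_chart c F) (snd c p))) / g c p" (is ?thesis2)
proof -
  note D = smooth_liftD[OF F]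
  have Fp: "F p \<noteq> 0" "\<Psi> p = cline (F p)" using D p by auto
  have gp: "g c p > 0" using conformal_metricD(1)[OF g c] p by auto
  define e1 where "e1 c' = 8 * ((norm (perp (F p) (wdz_vec (in_chart c' F) (snd c' p))))\<^sup>2 +
    (norm (perp (F p) (wdzb_vec (in_chart c' F) (snd c' p))))\<^sup>2) / (norm (F p))\<^sup>2" for c'
  define e2 where "e2 c' = fs4_sq (F p) (perp (F p) (wdzb_vec (in_chart c' F) (snd c' p)))" for c'
  have chg: "e1 c' / g c' p = e1 c / g c p" "e2 c' / g c' p = e2 c / g c p" if c': "c' \<in> X" "p \<in> fst c'" for c'
  proof -
    define j where "j = jac c' c p"
    have j: "j \<noteq> 0" unfolding j_def using jac_nonzero[of c' c p] c c' p by auto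
    have w: "wdz_vec (in_chart c' F) (snd c' p) = j *s wdz_vec (in_chart c F) (snd c p)"
      "wdzb_vec (in_chart c' F) (snd c' p) = cnj j *s wdzb_vec (in_chart c F) (snd c p)"
      using wirtinger_vec_chart_change[OF D(2) c'(1) c] c' p by (auto simp: j_def)
    have "g c' p = g c p * (cmod j)\<^sup>2"
      using conformal_metricD(2)[OF g c'(1) c, of p] c' p by (auto simp: j_def)
    moreover have "e1 c' = e1 c * (cmod j)\<^sup>2" "e2 c' = e2 c * (cmod j)\<^sup>2"
      by (simp_all add: e1_def e2_def fs4_sq_def w perp_scale_right power_mult_distrib algebra_simps add_divide_distrib)
    ultimately show "e1 c' / g c' p = e1 c / g c p" "e2 c' / g c' p = e2 c / g c p"
      using j by simp_all
  qed
  have v1: "fs4_sq v (dPsi X \<Psi> c' 1 p v) + fs4_sq v (dPsi X \<Psi> c' \<i> p v) = e1 c'"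
    and v2: "fs4_sq v (dbar_Psi X \<Psi> c' p v) = e2 c'"
    if c': "c' \<in> X" "p \<in> fst c'" and v: "v \<in> \<Psi> p" "v \<noteq> 0" for c' v
  proof -
    obtain a where a: "v = a *s F p" using v Fp by (auto simp: cline_def)
    then have a0: "a \<noteq> 0" using v by auto
    have pc: "p \<in> U \<inter> fst c'" using p c' by auto
    show "fs4_sq v (dPsi X \<Psi> c' 1 p v) + fs4_sq v (dPsi X \<Psi> c' \<i> p v) = e1 c'"
      unfolding a dPsi_lift[OF F c'(1) pc] fs4_sq_scale[OF a0] fs4_sq_sum e1_def ..
    show "fs4_sq v (dbar_Psi X \<Psi> c' p v) = e2 c'"
      unfolding a dbar_Psi_lift[OF F c'(1) pc] fs4_sq_scale[OF a0] e2_def ..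
  qed
  have Fm: "F p \<in> \<Psi> p" using Fp cline_memI by metis
  have "dPsi_norm_sq X g \<Psi> p = e1 c / g c p"
    unfolding dPsi_norm_sq_def
  proof (rule the_equality)
    show "\<exists>c'\<in>X. p \<in> fst c' \<and> (\<exists>v\<in>\<Psi> p. v \<noteq> 0 \<and>
        e1 c / g c p = (fs4_sq v (dPsi X \<Psi> c' 1 p v) + fs4_sq v (dPsi X \<Psi> c' \<i> p v)) / g c' p)"
      using v1[OF c _ Fm] Fm Fp p c by (intro bexI[of _ c] conjI bexI[of _ "F p"]) auto
  qed (use v1 chg(1) in metis)
  then show ?thesis1 using c p by (simp add: e1_def energy_density_def)
  have "dbar_norm_sq X g \<Psi> p = e2 c / g c p"
    unfolding dbar_norm_sq_def
  proof (rule the_equality)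
    show "\<exists>c'\<in>X. p \<in> fst c' \<and> (\<exists>v\<in>\<Psi> p. v \<noteq> 0 \<and> e2 c / g c p = fs4_sq v (dbar_Psi X \<Psi> c' p v) / g c' p)"
      using v2[OF c _ Fm] Fm Fp p c by (intro bexI[of _ c] conjI bexI[of _ "F p"]) auto
  qed (use v2 chg(2) in metis)
  then show ?thesis2 by (simp add: e2_def)
qed

lemma smooth_on_energy_density:
  assumes "open S" "smooth_on S f" "\<And>z. z \<in> S \<Longrightarrow> f z \<noteq> 0"
  shows "continuous_on S (energy_density f)"
proof -
  have c: "continuous_on S f" "continuous_on S (wdz_vec f)" "continuous_on S (wdzb_vec f)"
    by (intro smooth_on_imp_continuous_on assms smooth_on_wdz_vec smooth_on_wdzb_vec)+
  have h: "continuous_on S (\<lambda>z. herm (a z) (f z))" if "continuous_on S a" for a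
    unfolding herm_def by (intro continuous_intros that c)
  show ?thesis
    unfolding energy_density_def norm_perp
    by (intro continuous_intros c h) (use assms(3) in auto)
qed

text \<open>On the compact surface continuity gives integrability, so that the energies of two maps
  can be subtracted under the integral sign.\<close>

lemma continuous_dPsi_norm_sq:
  assumes g: "conformal_metric X g" and \<Psi>: "smooth_map_CP X \<Psi>"
  shows "continuous_on UNIV (dPsi_norm_sq X g \<Psi>)"
proof -
  have "isCont (dPsi_norm_sq X g \<Psi>) p" for p
  proof -
    obtain U F where F: "p \<in> U" "smooth_lift X \<Psi> U F" using \<Psi> unfolding smooth_map_CP_def by blast
    obtain c where c: "c \<in> X" "p \<in> fst c" by (rule chart_cover)
    note D = smooth_liftD[OF F(2)]
    have op: "open (U \<inter> fst c)" using D(1) chart_open(1)[OF c(1)] by auto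
    have "continuous_on (snd c ` (U \<inter> fst c)) (energy_density (in_chart c F))"
      by (rule smooth_on_energy_density[OF open_chart_image[OF c(1) D(1)] smooth_funD[OF D(2) c(1)]])
        (rule in_chart_image_nonzero[OF c(1) D(3)])
    moreover have "continuous_on (U \<inter> fst c) (snd c)"
      by (rule continuous_on_subset[OF chart_continuous(1)[OF c(1)]]) auto
    ultimately have "continuous_on (U \<inter> fst c) (\<lambda>q. energy_density (in_chart c F) (snd c q))"
      by (rule continuous_on_compose2) auto
    moreover have "continuous_on (U \<inter> fst c) (g c)"
      by (rule continuous_on_subset[OF smooth_fun_continuous[OF chart_open(1)[OF c(1)] conformal_metricD(3)[OF g c(1)]]]) auto
    moreover have "g c q \<noteq> 0" if "q \<in> U \<inter> fst c" for q
      using conformal_metricD(1)[OF g c(1)] that by (metis IntD2 less_irrefl)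
    ultimately have "continuous_on (U \<inter> fst c) (\<lambda>q. energy_density (in_chart c F) (snd c q) / g c q)"
      by (intro continuous_on_divide) auto
    then have "continuous_on (U \<inter> fst c) (dPsi_norm_sq X g \<Psi>)"
      by (rule continuous_on_eq) (use norm_sq_lift(1)[OF g F(2) c(1)] in auto)
    then show ?thesis using op F(1) c(2) continuous_on_eq_continuous_at by blast
  qed
  then show ?thesis by (simp add: continuous_at_imp_continuous_on)
qed

end

section \<open>First variation of the energy\<close>

section \<open>First variation of the energy in a chart\<close>

lemma norm_sq_Re_herm: "(norm v)\<^sup>2 = Re (herm v v)"
  by (simp add: herm_self)

lemma Re_herm_commute: "Re (herm v w) = Re (herm w v)"
  using arg_cong[OF cnj_herm[of v w], of Re] by simp

lemma norm_sq_add_scale: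
  "(norm (v + of_real t *s w))\<^sup>2 = (norm v)\<^sup>2 + 2 * t * Re (herm v w) + t\<^sup>2 * (norm w)\<^sup>2"
  unfolding norm_sq_Re_herm using Re_herm_commute[of v w]
  by (simp add: power2_eq_square algebra_simps)

text \<open>The energy density along the variation, in real terms. \<open>n, r, s\<close> and
  \<open>n', r', s'\<close> are the coefficients of the squared norms of the two moving derivatives;
  the quadratic polynomials are real and imaginary parts of their products with the moving point.
  The denominator \<open>h + t^2 w\<close> has no linear term because the variation is orthogonal to
  the map.\<close>

lemma energy_variation_deriv_real:
  assumes "(h::real) \<noteq> 0"
  shows "((\<lambda>t. 8 * ((n + 2 * t * r + t\<^sup>2 * s - ((x0 + t * x1 + t\<^sup>2 * x2)\<^sup>2 + (y0 + t * y1 + t\<^sup>2 * y2)\<^sup>2) / (h + t\<^sup>2 * w)) +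
       (n' + 2 * t * r' + t\<^sup>2 * s' - ((u0 + t * u1 + t\<^sup>2 * u2)\<^sup>2 + (v0 + t * v1 + t\<^sup>2 * v2)\<^sup>2) / (h + t\<^sup>2 * w))) / (h + t\<^sup>2 * w))
     has_real_derivative 16 * ((r + r') / h - (x0 * x1 + y0 * y1 + (u0 * u1 + v0 * v1)) / h\<^sup>2)) (at 0)"
  using assms by (auto intro!: derivative_eq_intros simp: field_simps power2_eq_square)

lemma energy_variation_deriv:
  fixes f W A B a b :: "complex ^ 'n"
  assumes "f \<noteq> 0" "herm f W = 0"
  shows "((\<lambda>t. 8 * ((norm (perp (f + of_real t *s W) (A + of_real t *s a)))\<^sup>2 +
        (norm (perp (f + of_real t *s W) (B + of_real t *s b)))\<^sup>2) / (norm (f + of_real t *s W))\<^sup>2)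
      has_real_derivative
        16 * (Re (herm A a + herm B b) / (norm f)\<^sup>2 -
          Re (cnj (herm A f) * (herm a f + herm A W) + cnj (herm B f) * (herm b f + herm B W)) / ((norm f)\<^sup>2)\<^sup>2)) (at 0)"
proof -
  have c: "(cmod (herm (A + of_real t *s a) (f + of_real t *s W)))\<^sup>2 =
      (Re (herm A f) + t * Re (herm a f + herm A W) + t\<^sup>2 * Re (herm a W))\<^sup>2 +
      (Im (herm A f) + t * Im (herm a f + herm A W) + t\<^sup>2 * Im (herm a W))\<^sup>2" for A a :: "complex ^ 'n" and t :: real
    unfolding cmod_power2 by (simp add: power2_eq_square algebra_simps)
  have h: "(norm (f + of_real t *s W))\<^sup>2 = (norm f)\<^sup>2 + t\<^sup>2 * (norm W)\<^sup>2" for t :: real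
    using assms(2) by (simp add: norm_sq_add_scale)
  have nz: "(norm f)\<^sup>2 \<noteq> 0" using assms(1) by simp
  show ?thesis
    unfolding norm_perp c h norm_sq_add_scale[of A] norm_sq_add_scale[of B]
    by (rule DERIV_cong[OF energy_variation_deriv_real[OF nz]]) (simp add: algebra_simps)
qed

lemma smooth_on_energy_quotient:
  fixes f A B :: "'v::real_normed_vector \<Rightarrow> complex ^ 'n"
  assumes S: "open S" and f: "smooth_on S f" "\<And>x. x \<in> S \<Longrightarrow> f x \<noteq> 0" and A: "smooth_on S A" "smooth_on S B"
  shows "smooth_on S (\<lambda>x. 8 * ((norm (perp (f x) (A x)))\<^sup>2 + (norm (perp (f x) (B x)))\<^sup>2) / (norm (f x))\<^sup>2)"
proof -
  have n: "smooth_on S (\<lambda>x. (norm (v x))\<^sup>2)" if "smooth_on S v" for v :: "'v \<Rightarrow> complex ^ 'n"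
    unfolding norm_sq_Re_herm by (intro smooth_on_Re smooth_on_herm S that)
  have c: "smooth_on S (\<lambda>x. (cmod (u x))\<^sup>2)" if "smooth_on S u" for u :: "'v \<Rightarrow> complex"
  proof -
    have "(cmod (u x))\<^sup>2 = Re (u x * cnj (u x))" for x
      by (simp add: complex_mult_cnj cmod_power2)
    then show ?thesis by (simp only:) (intro smooth_on_Re smooth_on_mult smooth_on_cnj S that)
  qed
  show ?thesis
    unfolding norm_perp
    by (intro smooth_on_divide smooth_on_mult smooth_on_add smooth_on_diff n c smooth_on_herm smooth_on_const S f A)
      (use f(2) in auto)
qed

lemma open_Times_UNIV: "open D \<Longrightarrow> open (D \<times> (UNIV :: real set))"
  by (rule open_Times) auto

lemma smooth_on_fst_comp: "open D \<Longrightarrow> smooth_on D f \<Longrightarrow> smooth_on (D \<times> (UNIV :: real set)) (\<lambda>p. f (fst p))"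
  for f :: "complex \<Rightarrow> 'w::real_normed_vector"
  by (rule smooth_on_compose[of _ fst D]) (auto intro!: smooth_on_bounded_linear bounded_linear_fst open_Times_UNIV)

lemma smooth_on_snd: "open D \<Longrightarrow> smooth_on (D \<times> (UNIV :: real set)) (\<lambda>p :: complex \<times> real. complex_of_real (snd p))"
  by (intro smooth_on_of_real open_Times_UNIV smooth_on_bounded_linear bounded_linear_snd)

text \<open>The direction is orthogonal to \<open>f z\<close>, so where
  \<open>f z \<noteq> 0\<close> the varied lift vanishes for no \<open>t\<close>, and its squared
  length has no term linear in \<open>t\<close>.\<close>

definition vary :: "(complex \<Rightarrow> complex ^ ('m::finite \<times> 2)) \<Rightarrow> (complex \<Rightarrow> complex) \<Rightarrow> real \<Rightarrow> complex \<Rightarrow> complex ^ ('m \<times> 2)" where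
  "vary f \<phi> t z = f z + of_real t *s (\<phi> z *s quat_I (f z))"

lemma vary_nonzero:
  assumes "f z \<noteq> 0"
  shows "vary f \<phi> t z \<noteq> 0"
proof
  assume "vary f \<phi> t z = 0"
  then have "herm (vary f \<phi> t z) (f z) = 0" by simp
  then show False using assms by (simp add: vary_def)
qed

lemma wirtinger_vary:
  assumes "open D" "z \<in> D" "smooth_on D f" "smooth_on D \<phi>"
  shows "wdz_vec (vary f \<phi> t) z = wdz_vec f z + of_real t *s wdz_vec (\<lambda>z. \<phi> z *s quat_I (f z)) z"
    "wdzb_vec (vary f \<phi> t) z = wdzb_vec f z + of_real t *s wdzb_vec (\<lambda>z. \<phi> z *s quat_I (f z)) z"
proof -
  have s: "smooth_on D (\<lambda>z. \<phi> z *s quat_I (f z))"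
    by (intro smooth_on_vec_scale smooth_on_quat_I assms)
  note d = differentiable_vec_nth[OF smooth_on_differentiable[OF s assms(2)]]
    differentiable_vec_nth[OF smooth_on_differentiable[OF assms(3,2)]]
  have m: "(\<lambda>x. of_real t * ((\<phi> x *s quat_I (f x)) $ i)) differentiable (at z)" for i
    by (intro differentiable_mult d differentiable_const)
  have "wdz (\<lambda>x. f x $ i + of_real t * ((\<phi> x *s quat_I (f x)) $ i)) z = wdz (\<lambda>x. f x $ i) z + of_real t * wdz (\<lambda>x. (\<phi> x *s quat_I (f x)) $ i) z"
    "wdzb (\<lambda>x. f x $ i + of_real t * ((\<phi> x *s quat_I (f x)) $ i)) z = wdzb (\<lambda>x. f x $ i) z + of_real t * wdzb (\<lambda>x. (\<phi> x *s quat_I (f x)) $ i) z" for i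
    unfolding wirtinger_add[OF d(2) m] wirtinger_mult[OF differentiable_const d(1)] by simp_all
  then show "wdz_vec (vary f \<phi> t) z = wdz_vec f z + of_real t *s wdz_vec (\<lambda>z. \<phi> z *s quat_I (f z)) z"
    "wdzb_vec (vary f \<phi> t) z = wdzb_vec f z + of_real t *s wdzb_vec (\<lambda>z. \<phi> z *s quat_I (f z)) z"
    unfolding wdz_vec_def wdzb_vec_def vec_eq_iff vary_def by (simp_all add: mult.assoc)
qed

lemma smooth_on_vary_joint:
  assumes "open D" "smooth_on D f" "smooth_on D \<phi>"
  shows "smooth_on (D \<times> (UNIV :: real set)) (\<lambda>p. vary f \<phi> (snd p) (fst p))"
  unfolding vary_def
  by (intro smooth_on_add smooth_on_vec_scale smooth_on_quat_I smooth_on_snd smooth_on_fst_comp open_Times_UNIV assms)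

lemma vary_energy_smooth:
  assumes D: "open D" and f: "smooth_on D f" "\<And>z. z \<in> D \<Longrightarrow> f z \<noteq> 0" and \<phi>: "smooth_on D \<phi>"
  shows "smooth_on (D \<times> (UNIV :: real set)) (\<lambda>p. energy_density (vary f \<phi> (snd p)) (fst p))"
proof -
  let ?W = "\<lambda>z. \<phi> z *s quat_I (f z)"
  let ?O = "D \<times> (UNIV :: real set)"
  have s: "smooth_on D ?W" by (intro smooth_on_vec_scale smooth_on_quat_I assms)
  have "smooth_on ?O (\<lambda>p. 8 * ((norm (perp (vary f \<phi> (snd p) (fst p)) (wdz_vec f (fst p) + of_real (snd p) *s wdz_vec ?W (fst p))))\<^sup>2 +
      (norm (perp (vary f \<phi> (snd p) (fst p)) (wdzb_vec f (fst p) + of_real (snd p) *s wdzb_vec ?W (fst p))))\<^sup>2) /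
      (norm (vary f \<phi> (snd p) (fst p)))\<^sup>2)"
    by (rule smooth_on_energy_quotient[OF open_Times_UNIV[OF D] smooth_on_vary_joint[OF D f(1) \<phi>]])
      (auto intro!: smooth_on_add smooth_on_vec_scale smooth_on_snd smooth_on_fst_comp open_Times_UNIV D
        smooth_on_wdz_vec smooth_on_wdzb_vec f(1) s vary_nonzero f(2))
  then show ?thesis
    by (rule smooth_on_cong[OF open_Times_UNIV[OF D], THEN iffD1, rotated])
      (auto simp: energy_density_def wirtinger_vary[OF D _ f(1) \<phi>])
qed

text \<open>The density is smooth jointly in point and parameter, so its \<open>t\<close>-derivative
  is continuous and may be taken under the integral. \<open>e\<close> stands for any pointwise
  formula for that derivative at 0.\<close>

lemma vary_energy_leibniz:
  assumes D: "open D" "cbox l u \<subseteq> D" and f: "smooth_on D f" "\<And>z. z \<in> D \<Longrightarrow> f z \<noteq> 0" and \<phi>: "smooth_on D \<phi>"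
    and e: "\<And>z. z \<in> D \<Longrightarrow> ((\<lambda>t. energy_density (vary f \<phi> t) z) has_real_derivative e z) (at 0)"
  shows "((\<lambda>t. integral (cbox l u) (energy_density (vary f \<phi> t))) has_real_derivative integral (cbox l u) e) (at 0)"
    "continuous_on D e"
proof -
  define E where "E p = energy_density (vary f \<phi> (snd p)) (fst p)" for p :: "complex \<times> real"
  have E: "smooth_on (D \<times> UNIV) E"
    unfolding E_def by (rule vary_energy_smooth[OF D(1) f \<phi>])
  define E' where "E' t z = frechet_derivative E (at (z, t)) (0, 1)" for t z
  have d: "((\<lambda>t. energy_density (vary f \<phi> t) z) has_real_derivative E' t z) (at t)" if z: "z \<in> D" for t z
  proof -
    have "(E has_derivative frechet_derivative E (at (z, t))) (at (z, t))"
      by (rule smooth_on_has_derivative[OF E]) (use z in auto)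
    moreover have "((\<lambda>t. (z, t)) has_derivative (\<lambda>s. (0, s))) (at t)"
      by (auto intro!: derivative_eq_intros)
    ultimately have "((\<lambda>t. E (z, t)) has_derivative (\<lambda>s. frechet_derivative E (at (z, t)) (0, s))) (at t)"
      using has_derivative_compose[of "\<lambda>t. (z, t)" "\<lambda>s. (0, s)" t UNIV E "frechet_derivative E (at (z, t))"] by simp
    moreover have "frechet_derivative E (at (z, t)) (0, s) = E' t z * s" for s
    proof -
      have "linear (frechet_derivative E (at (z, t)))"
        using \<open>(E has_derivative frechet_derivative E (at (z, t))) (at (z, t))\<close> has_derivative_linear by blast
      from linear_cmul[OF this, of s "(0, 1)"] show ?thesis by (simp add: E'_def mult.commute)
    qed
    ultimately show ?thesis by (simp add: has_field_derivative_def E_def)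
  qed
  have c: "continuous_on (UNIV \<times> D) (\<lambda>(t, z). E' t z)"
  proof -
    have "continuous_on (D \<times> UNIV) (\<lambda>p. frechet_derivative E (at p) (0, 1))"
      by (rule smooth_on_imp_continuous_on[OF smooth_on_frechet[OF E]])
    moreover have "continuous_on (UNIV \<times> D) (\<lambda>p. (snd p, fst p) :: complex \<times> real)"
      by (intro continuous_intros)
    ultimately have "continuous_on (UNIV \<times> D) (\<lambda>p. frechet_derivative E (at (snd p, fst p)) (0, 1))"
      by (rule continuous_on_compose2) auto
    then show ?thesis by (simp add: E'_def case_prod_beta)
  qed
  have e0: "E' 0 z = e z" if "z \<in> D" for z
    using DERIV_unique[OF d[OF that] e[OF that]] .
  have int: "energy_density (vary f \<phi> t) integrable_on cbox l u" for t
  proof (rule integrable_continuous)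
    have "continuous_on (D \<times> UNIV) E" by (rule smooth_on_imp_continuous_on[OF E])
    moreover have "continuous_on (cbox l u) (\<lambda>z. (z, t))" by (intro continuous_intros)
    ultimately have "continuous_on (cbox l u) (\<lambda>z. E (z, t))"
      by (rule continuous_on_compose2) (use D in auto)
    then show "continuous_on (cbox l u) (energy_density (vary f \<phi> t))" by (simp add: E_def)
  qed
  have "((\<lambda>t. integral (cbox l u) (energy_density (vary f \<phi> t))) has_real_derivative integral (cbox l u) (E' 0)) (at 0 within UNIV)"
    by (rule leibniz_rule_field_derivative[where U = UNIV])
      (use d D(2) int continuous_on_subset[OF c] in \<open>auto simp: subset_iff\<close>)
  moreover have "integral (cbox l u) (E' 0) = integral (cbox l u) e"
    by (rule integral_cong) (use e0 D in auto)
  ultimately show "((\<lambda>t. integral (cbox l u) (energy_density (vary f \<phi> t))) has_real_derivative integral (cbox l u) e) (at 0)"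
    by simp
  have "continuous_on D (\<lambda>z. (0 :: real, z))" by (intro continuous_intros)
  with c have "continuous_on D (\<lambda>z. case (0, z) of (t, z) \<Rightarrow> E' t z)"
    by (rule continuous_on_compose2) auto
  then show "continuous_on D e" by (rule continuous_on_eq) (use e0 in auto)
qed

text \<open>The pointwise derivative contains derivatives of \<open>\<phi>\<close>. Absorbing them
  into two exact terms leaves a term linear in \<open>cnj \<phi>\<close>, and its coefficient is the
  Euler--Lagrange expression. The inputs are \<open>wdzb f = \<beta> I(f)\<close>, its consequence
  for \<open>I(f)\<close>, and the symmetry of mixed derivatives.\<close>

lemma vary_derivative_formula:
  fixes f :: "complex \<Rightarrow> complex ^ ('m::finite \<times> 2)"
  assumes D: "open D" "z \<in> D" and f: "smooth_on D f" "\<And>z. z \<in> D \<Longrightarrow> f z \<noteq> 0"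
    and \<beta>: "smooth_on D \<beta>" "\<And>z. z \<in> D \<Longrightarrow> wdzb_vec f z = \<beta> z *s quat_I (f z)" and \<phi>: "smooth_on D \<phi>"
  defines "h \<equiv> \<lambda>z. herm (f z) (f z)" and "q \<equiv> \<lambda>z. herm (wdz_vec f z) (quat_I (f z))"
  shows "((\<lambda>t. energy_density (vary f \<phi> t) z) has_real_derivative
    16 * Re (wdz (\<lambda>z. cnj (\<phi> z) * \<beta> z) z + wdzb (\<lambda>z. cnj (\<phi> z) / h z * q z) z
      - 2 * (cnj (\<phi> z) * (h z * wdz (\<lambda>z. \<beta> z / h z) z)))) (at 0)"
proof -
  define v A B where "v = f z" and "A = wdz_vec f z" and "B = wdzb_vec f z"
  define H x b e where "H = (norm v)\<^sup>2" and "x = herm A v" and "b = \<beta> z" and "e = cnj (\<phi> z)"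
  let ?W = "\<lambda>z. \<phi> z *s quat_I (f z)"
  have v: "v \<noteq> 0" using f(2) D(2) by (simp add: v_def)
  have H: "H \<noteq> 0" using v by (simp add: H_def)
  have hv: "herm v v = of_real H" by (simp add: H_def herm_self)
  have B: "B = b *s quat_I v" using \<beta>(2)[OF D(2)] by (simp add: B_def b_def v_def)
  note d\<phi> = smooth_on_differentiable[OF \<phi> D(2)] and d\<beta> = smooth_on_differentiable[OF \<beta>(1) D(2)]
    and df = smooth_on_differentiable[OF f(1) D(2)]
  have dI: "(\<lambda>z. quat_I (f z)) differentiable (at z)"
    by (rule smooth_on_differentiable[OF smooth_on_quat_I[OF D(1) f(1)] D(2)])
  have d\<eta>: "(\<lambda>z. cnj (\<phi> z)) differentiable (at z)"
    by (rule smooth_on_differentiable[OF smooth_on_cnj[OF D(1) \<phi>] D(2)])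
  have dh: "h differentiable (at z)"
    unfolding h_def by (rule smooth_on_differentiable[OF smooth_on_herm[OF D(1) f(1) f(1)] D(2)])
  have sA: "smooth_on D (wdz_vec f)" by (rule smooth_on_wdz_vec[OF D(1) f(1)])
  have dq: "q differentiable (at z)"
    unfolding q_def by (rule smooth_on_differentiable[OF smooth_on_herm[OF D(1) sA smooth_on_quat_I[OF D(1) f(1)]] D(2)])
  have hz: "h z = of_real H" "h z \<noteq> 0" using hv H by (simp_all add: h_def v_def)
  have qz: "q z = herm A (quat_I v)" by (simp add: q_def A_def v_def)
  \<comment> \<open>\<open>I(\<beta> I(f)) = cnj \<beta> I(I(f)) = - cnj \<beta> f\<close>.\<close>
  have IB: "wdz_vec (\<lambda>z. quat_I (f z)) z = (- cnj b) *s v"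
    using wirtinger_quat_I(1)[OF df] by (simp add: B_def[symmetric] B)
  have IA: "wdzb_vec (\<lambda>z. quat_I (f z)) z = quat_I A"
    using wirtinger_quat_I(2)[OF df] by (simp add: A_def)
  have Wz: "wdz_vec ?W z = wdz \<phi> z *s quat_I v + \<phi> z *s ((- cnj b) *s v)"
    "wdzb_vec ?W z = wdzb \<phi> z *s quat_I v + \<phi> z *s quat_I A"
    unfolding wirtinger_vec_scale[OF d\<phi> dI] IB IA by (simp_all add: v_def)
  \<comment> \<open>The contribution of \<open>B\<close> drops out because \<open>B\<close> is a
    multiple of \<open>I(v)\<close>, which is orthogonal to \<open>v\<close>.\<close>
  have hd: "wdz h z = x" "wdzb h z = cnj x"
    unfolding h_def wirtinger_herm[OF df df]
    by (simp_all add: A_def[symmetric] B_def[symmetric] v_def[symmetric] B x_def cnj_herm)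
  have Bz: "wdz_vec (wdzb_vec f) z = wdz \<beta> z *s quat_I v + b *s ((- cnj b) *s v)"
  proof -
    have "wdz (\<lambda>x. wdzb_vec f x $ i) z = wdz (\<lambda>x. (\<beta> x *s quat_I (f x)) $ i) z" for i
      by (rule wirtinger_cong(1)[OF D]) (simp only: \<beta>(2))
    then have "wdz_vec (wdzb_vec f) z = wdz_vec (\<lambda>z. \<beta> z *s quat_I (f z)) z"
      by (simp only: wdz_vec_def)
    then show ?thesis unfolding wirtinger_vec_scale[OF d\<beta> dI] IB by (simp add: v_def b_def)
  qed
  \<comment> \<open>The mixed second derivative of \<open>f\<close> is evaluated in the other order,
    as the \<open>wdz\<close> derivative of \<open>\<beta> I(f)\<close>.\<close>
  have qd: "wdzb q z = wdz \<beta> z * of_real H - b * x"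
  proof -
    have "wdzb q z = herm (wdzb_vec (wdz_vec f) z) (quat_I v) + herm A ((- cnj b) *s v)"
      unfolding q_def wirtinger_herm(2)[OF smooth_on_differentiable[OF sA D(2)] dI] IB by (simp add: A_def v_def)
    then show ?thesis
      unfolding wdz_wdzb_vec_commute[OF D f(1), symmetric] Bz by (simp add: hv x_def)
  qed
  have \<eta>d: "wdz (\<lambda>z. cnj (\<phi> z)) z = cnj (wdzb \<phi> z)" "wdzb (\<lambda>z. cnj (\<phi> z)) z = cnj (wdz \<phi> z)"
    by (rule wirtinger_cnj[OF d\<phi>])+
  have d\<theta>: "(\<lambda>z. cnj (\<phi> z) / h z) differentiable (at z)"
    by (rule differentiable_divide[OF d\<eta> dh hz(2)])
  have rhs: "wdz (\<lambda>z. cnj (\<phi> z) * \<beta> z) z + wdzb (\<lambda>z. cnj (\<phi> z) / h z * q z) z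
      - 2 * (cnj (\<phi> z) * (h z * wdz (\<lambda>z. \<beta> z / h z) z)) =
      cnj (wdz \<phi> z) * q z / H + b * cnj (wdzb \<phi> z) + x * e * b / H - cnj x * e * q z / H\<^sup>2"
    unfolding wirtinger_mult(1)[OF d\<eta> d\<beta>] wirtinger_mult(2)[OF d\<theta> dq] wirtinger_divide(1)[OF d\<beta> dh hz(2)]
      wirtinger_divide(2)[OF d\<eta> dh hz(2)] \<eta>d qd hd hz(1)
    using H by (simp add: b_def[symmetric] e_def[symmetric] field_simps power2_eq_square)
  have lhs1: "herm A (wdz_vec ?W z) + herm B (wdzb_vec ?W z) = cnj (wdz \<phi> z) * q z + b * cnj (wdzb \<phi> z) * H"
    unfolding Wz B by (simp add: qz x_def hv e_def algebra_simps)
  have lhs2: "cnj (herm A v) * (herm (wdz_vec ?W z) v + herm A (\<phi> z *s quat_I v)) +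
      cnj (herm B v) * (herm (wdzb_vec ?W z) v + herm B (\<phi> z *s quat_I v)) =
      cnj x * e * q z - cnj (x * e * b) * H"
    unfolding Wz B by (simp add: qz x_def hv e_def algebra_simps)
  have "herm v (\<phi> z *s quat_I v) = 0" by simp
  note der = energy_variation_deriv[OF v this, of A "wdz_vec ?W z" B "wdzb_vec ?W z"]
  have eq: "energy_density (vary f \<phi> t) z =
      8 * ((norm (perp (v + of_real t *s (\<phi> z *s quat_I v)) (A + of_real t *s wdz_vec ?W z)))\<^sup>2 +
        (norm (perp (v + of_real t *s (\<phi> z *s quat_I v)) (B + of_real t *s wdzb_vec ?W z)))\<^sup>2) /
        (norm (v + of_real t *s (\<phi> z *s quat_I v)))\<^sup>2" for t
    unfolding energy_density_def wirtinger_vary[OF D f(1) \<phi>] A_def B_def v_def vary_def ..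
  \<comment> \<open>One term of \<open>lhs2\<close> is the conjugate of the wanted one, which is
    enough since only real parts are compared.\<close>
  have fin: "16 * (Re (herm A (wdz_vec ?W z) + herm B (wdzb_vec ?W z)) / (norm v)\<^sup>2 -
      Re (cnj (herm A v) * (herm (wdz_vec ?W z) v + herm A (\<phi> z *s quat_I v)) +
        cnj (herm B v) * (herm (wdzb_vec ?W z) v + herm B (\<phi> z *s quat_I v))) / ((norm v)\<^sup>2)\<^sup>2) =
      16 * Re (cnj (wdz \<phi> z) * q z / H + b * cnj (wdzb \<phi> z) + x * e * b / H - cnj x * e * q z / H\<^sup>2)"
  proof -
    have r: "Re (u / of_real H) = Re u / H" "Re (u / (of_real H)\<^sup>2) = Re u / H\<^sup>2" for u :: complex
      by (simp_all add: Re_divide_of_real flip: of_real_power)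
    have c: "Re (cnj u * of_real H) = Re u * H" for u :: complex by simp
    show ?thesis
      unfolding lhs1 lhs2 H_def[symmetric] plus_complex.sel minus_complex.sel r c
      using H by (simp add: field_simps power2_eq_square)
  qed
  show ?thesis
    unfolding eq rhs using der unfolding fin .
qed

text \<open>With \<open>\<phi>\<close> a cutoff \<open>\<eta>\<close> times the Euler--Lagrange
  expression \<open>\<kappa>\<close>, the linear term becomes \<open>\<eta> |\<kappa>|^2\<close>.
  The exact terms integrate to zero, so the integral of this continuous nonnegative function
  vanishes, and with it \<open>\<kappa>\<close> at the centre of the cutoff.\<close>

lemma euler_lagrange_plane:
  fixes f :: "complex \<Rightarrow> complex ^ ('m::finite \<times> 2)"
  assumes D: "open D" "a \<in> D" and f: "smooth_on D f" "\<And>z. z \<in> D \<Longrightarrow> f z \<noteq> 0"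
    and \<beta>: "smooth_on D \<beta>" "\<And>z. z \<in> D \<Longrightarrow> wdzb_vec f z = \<beta> z *s quat_I (f z)"
    and crit: "\<And>\<phi> l u K. smooth_on D \<phi> \<Longrightarrow> cbox l u \<subseteq> D \<Longrightarrow> compact K \<Longrightarrow> K \<subseteq> cbox l u \<Longrightarrow>
      (\<And>z. z \<in> D - K \<Longrightarrow> \<phi> z = 0) \<Longrightarrow>
      ((\<lambda>t. integral (cbox l u) (energy_density (vary f \<phi> t))) has_real_derivative 0) (at 0)"
  shows "wdz (\<lambda>z. \<beta> z / herm (f z) (f z)) a = 0"
proof -
  define h where "h z = herm (f z) (f z)" for z
  define q where "q z = herm (wdz_vec f z) (quat_I (f z))" for z
  define \<kappa> where "\<kappa> z = h z * wdz (\<lambda>z. \<beta> z / h z) z" for z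
  have h: "smooth_on D h" "\<And>z. z \<in> D \<Longrightarrow> h z \<noteq> 0"
    using smooth_on_herm[OF D(1) f(1) f(1)] f(2) by (auto simp: h_def[abs_def])
  have q: "smooth_on D q" unfolding q_def
    by (intro smooth_on_herm smooth_on_wdz_vec smooth_on_quat_I D f)
  have \<kappa>: "smooth_on D \<kappa>" unfolding \<kappa>_def
    by (intro smooth_on_mult smooth_on_wdz smooth_on_divide D h \<beta>)
  obtain l u where lu: "cbox l u \<subseteq> D" "a \<in> box l u" by (rule open_contains_cbox[OF D])
  obtain s where s: "0 < s" "cball a s \<subseteq> box l u" using lu(2) open_contains_cball open_box by blast
  obtain \<eta> :: "complex \<Rightarrow> real" where \<eta>: "smooth_on UNIV \<eta>" "\<And>z. 0 \<le> \<eta> z"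
    "\<And>z. z \<in> cball a (s / 2) \<Longrightarrow> \<eta> z = 1" "\<And>z. z \<notin> ball a (2 * (s / 2)) \<Longrightarrow> \<eta> z = 0"
    using exists_cutoff[of "s / 2" a] s(1) by (metis half_gt_zero)
  define K where "K = cball a s"
  have K: "compact K" "closed K" "K \<subseteq> cbox l u" "K \<subseteq> D"
    using s(2) lu box_subset_cbox[of l u] by (auto simp: K_def)
  have \<eta>0: "\<eta> z = 0" if "z \<notin> K" for z using \<eta>(4)[of z] that by (auto simp: K_def)
  define \<phi> where "\<phi> z = of_real (\<eta> z) * \<kappa> z" for z
  have \<phi>: "smooth_on D \<phi>" unfolding \<phi>_def
    by (intro smooth_on_mult smooth_on_of_real smooth_on_subset[OF \<eta>(1)] \<kappa> D subset_UNIV)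
  define P Q where "P z = cnj (\<phi> z) * \<beta> z" and "Q z = cnj (\<phi> z) / h z * q z" for z
  have PQ: "smooth_on D P" "smooth_on D Q"
    unfolding P_def Q_def by (intro smooth_on_mult smooth_on_divide smooth_on_cnj \<phi> \<beta> h q D)+
  have PQ0: "P z = 0" "Q z = 0" if "z \<notin> K" for z
    using \<eta>0[OF that] by (simp_all add: P_def Q_def \<phi>_def)
  define e where "e z = 16 * Re (wdz P z + wdzb Q z - 2 * (cnj (\<phi> z) * \<kappa> z))" for z
  have de: "((\<lambda>t. energy_density (vary f \<phi> t) z) has_real_derivative e z) (at 0)" if "z \<in> D" for z
    using vary_derivative_formula[OF D(1) that f \<beta> \<phi>]
    unfolding e_def P_def[abs_def] Q_def[abs_def] \<kappa>_def h_def[abs_def] q_def[abs_def] by simp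
  note L = vary_energy_leibniz[OF D(1) lu(1) f \<phi> de]
  have "((\<lambda>t. integral (cbox l u) (energy_density (vary f \<phi> t))) has_real_derivative 0) (at 0)"
    by (rule crit[OF \<phi> lu(1) K(1,3)]) (use \<eta>0 in \<open>auto simp: \<phi>_def\<close>)
  then have ie: "integral (cbox l u) e = 0" using DERIV_unique[OF L(1)] by simp
  \<comment> \<open>Extended by zero these are test functions on the whole plane, so the integrals
    of their derivatives vanish without boundary terms.\<close>
  define P' Q' where "P' z = (if z \<in> D then P z else 0)" and "Q' z = (if z \<in> D then Q z else 0)" for z
  have sPQ: "smooth_on UNIV P'" "smooth_on UNIV Q'"
  proof -
    show "smooth_on UNIV P'" unfolding P'_def
      by (rule smooth_on_extend_zero[OF D(1) K(2,4) PQ(1)]) (use PQ0 in auto)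
    show "smooth_on UNIV Q'" unfolding Q'_def
      by (rule smooth_on_extend_zero[OF D(1) K(2,4) PQ(2)]) (use PQ0 in auto)
  qed
  have P'0: "P' z = 0" "Q' z = 0" if "z \<notin> K" for z using PQ0[OF that] by (auto simp: P'_def Q'_def)
  have "bounded K" using K(1) compact_imp_bounded by blast
  then obtain R where R: "\<And>z. z \<in> K \<Longrightarrow> norm z \<le> R" using bounded_iff by blast
  have "\<forall>z. R + 1 \<le> norm z \<longrightarrow> z \<notin> K" using R by force
  then have t: "test_fun P'" "test_fun Q'"
    unfolding test_fun_def using sPQ P'0 by blast+
  have wP: "wdz P' z = wdz P z" "wdzb Q' z = wdzb Q z" if "z \<in> D" for z
    using wirtinger_cong[OF D(1) that, of P' P] wirtinger_cong[OF D(1) that, of Q' Q] by (auto simp: P'_def Q'_def)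
  have w0: "wdz P' z = 0" "wdzb Q' z = 0" if "z \<notin> K" for z
  proof -
    have "open (- K)" "z \<in> - K" using K(2) that by auto
    then show "wdz P' z = 0" "wdzb Q' z = 0"
      using wirtinger_cong[of "- K" z P' "\<lambda>z. 0"] wirtinger_cong[of "- K" z Q' "\<lambda>z. 0"] P'0 by auto
  qed
  define r where "r z = Re (wdz P' z + wdzb Q' z)" for z
  have cr: "continuous_on UNIV r"
    unfolding r_def by (intro smooth_on_imp_continuous_on smooth_on_Re smooth_on_add smooth_on_wdz smooth_on_wdzb sPQ open_UNIV)
  have ir: "integral (cbox l u) r = 0"
  proof -
    have int: "integrable lborel (\<lambda>z. wdz P' z)" "integrable lborel (\<lambda>z. wdzb Q' z)"
    proof -
      have "wdz P' = (\<lambda>x. indicator K x *\<^sub>R wdz P' x)" "wdzb Q' = (\<lambda>x. indicator K x *\<^sub>R wdzb Q' x)"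
        using w0 by (auto simp: indicator_def fun_eq_iff)
      moreover have "continuous_on K (wdz P')" "continuous_on K (wdzb Q')"
        using continuous_on_subset[OF smooth_on_imp_continuous_on[OF smooth_on_wdz[OF open_UNIV sPQ(1)]]]
          continuous_on_subset[OF smooth_on_imp_continuous_on[OF smooth_on_wdzb[OF open_UNIV sPQ(2)]]]
        by blast+
      ultimately show "integrable lborel (\<lambda>z. wdz P' z)" "integrable lborel (\<lambda>z. wdzb Q' z)"
        using borel_integrable_compact[OF K(1)] by metis+
    qed
    have si: "set_integrable lborel (cbox l u) r"
      unfolding set_integrable_def by (rule borel_integrable_compact[OF compact_cbox continuous_on_subset[OF cr]]) simp
    have "integral (cbox l u) r = (LINT z : cbox l u | lborel. r z)"
      by (rule set_borel_integral_eq_integral(2)[OF si, symmetric])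
    also have "\<dots> = (\<integral>z. Re (wdz P' z + wdzb Q' z) \<partial>lborel)"
      unfolding set_lebesgue_integral_def
    proof (rule Bochner_Integration.integral_cong[OF refl])
      show "indicator (cbox l u) z *\<^sub>R r z = Re (wdz P' z + wdzb Q' z)" for z
      proof (cases "z \<in> cbox l u")
        case False
        then have "z \<notin> K" using K(3) by blast
        then show ?thesis using False by (simp add: w0)
      qed (simp add: r_def)
    qed
    also have "\<dots> = Re (\<integral>z. wdz P' z + wdzb Q' z \<partial>lborel)"
      using int by (intro integral_Re) auto
    also have "\<dots> = 0"
      using int integral_wirtinger_test_fun(1)[OF t(1)] integral_wirtinger_test_fun(2)[OF t(2)] by simp
    finally show ?thesis .
  qed
  define k where "k z = \<eta> z * (cmod (\<kappa> z))\<^sup>2" for z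
  have ck: "continuous_on (cbox l u) k"
    unfolding k_def using continuous_on_subset[OF smooth_on_imp_continuous_on[OF \<kappa>] lu(1)]
      continuous_on_subset[OF smooth_on_imp_continuous_on[OF \<eta>(1)]]
    by (intro continuous_intros) auto
  have "e z = 16 * (r z - 2 * k z)" if "z \<in> cbox l u" for z
  proof -
    have "cnj (\<phi> z) * \<kappa> z = of_real (k z)"
      using complex_norm_square[of "\<kappa> z"] by (simp add: \<phi>_def k_def mult.commute)
    then show ?thesis using wP[of z] lu(1) that by (auto simp: e_def r_def)
  qed
  then have "integral (cbox l u) e = integral (cbox l u) (\<lambda>z. 16 * (r z - 2 * k z))"
    by (rule integral_cong)
  also have "\<dots> = 16 * (integral (cbox l u) r - 2 * integral (cbox l u) k)"
  proof -
    have "r integrable_on cbox l u" "k integrable_on cbox l u"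
      using continuous_on_subset[OF cr] ck by (auto intro!: integrable_continuous)
    then show ?thesis
      by (simp add: Henstock_Kurzweil_Integration.integral_diff)
  qed
  finally have "integral (cbox l u) k = 0" using ie ir by simp
  moreover have "box l u \<noteq> {}" using lu(2) by auto
  moreover have "k z \<ge> 0" for z using \<eta>(2) by (simp add: k_def)
  ultimately have "k a = 0"
    using integral_cbox_eq_0_iff[OF ck] lu(2) box_subset_cbox[of l u] by blast
  moreover have "\<eta> a = 1" using \<eta>(3)[of a] s(1) by simp
  ultimately have "\<kappa> a = 0" by (simp add: k_def)
  then show ?thesis using h(2)[OF D(2)] by (simp add: \<kappa>_def h_def[abs_def])
qed

section \<open>The Euler--Lagrange equation on the surface\<close>

lemma energy_density_cong:
  assumes "open S" "z \<in> S" "\<And>x. x \<in> S \<Longrightarrow> f x = g x"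
  shows "energy_density f z = energy_density g z"
proof -
  have "wdz (\<lambda>x. f x $ i) z = wdz (\<lambda>x. g x $ i) z \<and> wdzb (\<lambda>x. f x $ i) z = wdzb (\<lambda>x. g x $ i) z" for i
    by (intro conjI wirtinger_cong[OF assms(1,2)]) (simp_all add: assms(3))
  then show ?thesis
    unfolding energy_density_def wdz_vec_def wdzb_vec_def using assms(2,3) by simp
qed

lemma smooth_on_vary: "open D \<Longrightarrow> smooth_on D f \<Longrightarrow> smooth_on D \<phi> \<Longrightarrow> smooth_on D (vary f \<phi> t)"
  unfolding vary_def[abs_def]
  by (intro smooth_on_add smooth_on_vec_scale smooth_on_quat_I smooth_on_const)

context compact_surface
begin

context
  fixes \<Psi> :: "'a \<Rightarrow> (complex ^ ('m::finite \<times> 2)) set" and U :: "'a set" and F :: "'a \<Rightarrow> complex ^ ('m \<times> 2)"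
    and c :: "'a chart" and \<phi> :: "complex \<Rightarrow> complex" and l u :: complex and K D :: "complex set"
    and f :: "complex \<Rightarrow> complex ^ ('m \<times> 2)"
  assumes crit: "\<And>\<epsilon> \<Phi>. smooth_variation X \<Psi> \<epsilon> \<Phi> \<Longrightarrow> ((\<lambda>t. energy X g (\<Phi> t)) has_real_derivative 0) (at 0)"
    and smooth: "smooth_map_CP X \<Psi>" and lift: "smooth_lift X \<Psi> U F" and c: "c \<in> X" and Uc: "U \<subseteq> fst c"
    and f: "f = in_chart c F" and D: "D = snd c ` U"
    and \<phi>: "smooth_on D \<phi>" and box: "cbox l u \<subseteq> D" and K: "compact K" "K \<subseteq> cbox l u"
    and \<phi>0: "\<And>z. z \<in> D - K \<Longrightarrow> \<phi> z = 0"
begin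

definition var_lift :: "real \<Rightarrow> 'a \<Rightarrow> complex ^ ('m \<times> 2)" where
  "var_lift t q = F q + of_real t *s (\<phi> (snd c q) *s quat_I (F q))"

text \<open>Glued to \<open>\<Psi>\<close> outside the coordinate patch; the pieces fit smoothly
  because \<open>\<phi>\<close> vanishes off a compact subset of the patch.\<close>

definition var_map :: "real \<Rightarrow> 'a \<Rightarrow> (complex ^ ('m \<times> 2)) set" where
  "var_map t q = (if q \<in> U then cline (var_lift t q) else \<Psi> q)"

lemma open_D: "open D"
  unfolding D by (rule open_chart_image_sub[OF c smooth_liftD(1)[OF lift] Uc])

lemma smooth_f: "smooth_on D f" "z \<in> D \<Longrightarrow> f z \<noteq> 0"
  using smooth_funD[OF smooth_liftD(2)[OF lift] c] smooth_liftD(3)[OF lift] Uc c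
  by (auto simp: f D inf.absorb1 subset_iff)

lemma in_chart_var_lift: "z \<in> D \<Longrightarrow> in_chart c (var_lift t) z = vary f \<phi> t z"
  using Uc c by (auto simp: D f var_lift_def vary_def subset_iff)

lemma var_lift_smooth_lift: "smooth_lift X (var_map t) U (var_lift t)"
  unfolding smooth_lift_def
proof (intro conjI ballI)
  show "open U" by (rule smooth_liftD(1)[OF lift])
  show "smooth_fun X U (var_lift t)"
  proof (rule smooth_funI_local[OF \<open>open U\<close>])
    fix p assume "p \<in> U"
    have "smooth_on D (in_chart c (var_lift t))"
      by (rule smooth_on_cong[OF open_D in_chart_var_lift, THEN iffD2, OF _ smooth_on_vary[OF open_D smooth_f(1) \<phi>]])
    then have "smooth_on (snd c ` U) (in_chart c (var_lift t))" by (simp add: D)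
    then show "\<exists>c\<in>X. \<exists>V. open V \<and> p \<in> V \<and> V \<subseteq> fst c \<and> smooth_on (snd c ` V) (in_chart c (var_lift t))"
      using c Uc \<open>open U\<close> \<open>p \<in> U\<close> by blast
  qed
  fix q assume q: "q \<in> U"
  then show "var_map t q = cline (var_lift t q)" by (simp add: var_map_def)
  show "var_lift t q \<noteq> 0"
  proof
    assume "var_lift t q = 0"
    then have "herm (var_lift t q) (F q) = 0" by simp
    then show False using smooth_liftD(3)[OF lift q] by (simp add: var_lift_def)
  qed
qed

definition var_supp :: "'a set" where "var_supp = inv_into (fst c) (snd c) ` K"

text \<open>Closedness in the surface is the point: the inverse chart maps \<open>K\<close> to a
  compact set, which is closed by the Hausdorff property, so the complement is an open set on which
  nothing moves.\<close>

lemma var_supp: "closed var_supp" "var_supp \<subseteq> U" "q \<in> U \<Longrightarrow> q \<notin> var_supp \<Longrightarrow> snd c q \<notin> K"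
proof -
  have KD: "K \<subseteq> D" using K box by blast
  then have "K \<subseteq> snd c ` fst c" using Uc by (auto simp: D)
  then have "compact var_supp" unfolding var_supp_def
    by (intro compact_continuous_image continuous_on_subset[OF chart_continuous(2)[OF c]] K)
  then show "closed var_supp" by (rule compact_imp_closed)
  show "var_supp \<subseteq> U"
    using KD Uc chart_inv[OF c] by (force simp: var_supp_def D)
  show "q \<in> U \<Longrightarrow> q \<notin> var_supp \<Longrightarrow> snd c q \<notin> K"
    using chart_inv[OF c] Uc by (metis image_eqI subsetD var_supp_def)
qed

lemma var_map_outside: "q \<notin> var_supp \<Longrightarrow> var_map t q = \<Psi> q"
proof (cases "q \<in> U")
  case True
  assume "q \<notin> var_supp"
  then have "\<phi> (snd c q) = 0" using True var_supp(3) by (intro \<phi>0) (auto simp: D)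
  then show ?thesis using True smooth_liftD(4)[OF lift] by (simp add: var_map_def var_lift_def)
qed (simp add: var_map_def)

text \<open>One lift serves all parameters at once, so the family is constant near \<open>p\<close>.
  This gives joint smoothness there and makes the energy densities cancel.\<close>

lemma lift_outside:
  assumes "p \<notin> var_supp"
  obtains V G where "p \<in> V" "V \<inter> var_supp = {}" "smooth_lift X \<Psi> V G" "\<forall>t. smooth_lift X (var_map t) V G"
proof -
  obtain V0 G where V0: "p \<in> V0" "smooth_lift X \<Psi> V0 G" using smooth unfolding smooth_map_CP_def by blast
  define V where "V = V0 - var_supp"
  have V: "open V" "p \<in> V" "V \<subseteq> V0" "V \<inter> var_supp = {}"
    using smooth_liftD(1)[OF V0(2)] var_supp(1) V0(1) assms by (auto simp: V_def open_Diff)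
  have 1: "smooth_lift X \<Psi> V G" by (rule smooth_lift_subset[OF V0(2) V(1,3)])
  have "smooth_lift X (var_map t) V G" for t
    using smooth_liftD[OF 1] var_map_outside[of _ t] V(4) unfolding smooth_lift_def by (metis disjoint_iff)
  then show thesis using that V 1 by blast
qed

lemma smooth_map_var_map: "smooth_map_CP X (var_map t)"
  unfolding smooth_map_CP_def
proof
  fix p
  show "\<exists>V G. p \<in> V \<and> smooth_lift X (var_map t) V G"
  proof (cases "p \<in> var_supp")
    case True
    then show ?thesis using var_supp(2) var_lift_smooth_lift by blast
  next
    case False
    obtain V G where V: "p \<in> V" "V \<inter> var_supp = {}" "smooth_lift X \<Psi> V G"
      "\<forall>t. smooth_lift X (var_map t) V G" by (rule lift_outside[OF False])
    then show ?thesis by blast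
  qed
qed

text \<open>At points of the support the varied lift is smooth jointly in point and parameter;
  elsewhere a constant family of lifts works. The formula makes sense for all \<open>t\<close>, and
  \<open>1\<close> is an arbitrary bound.\<close>

lemma var_map_variation: "smooth_variation X \<Psi> 1 var_map"
  unfolding smooth_variation_def
proof (intro conjI allI impI)
  show "var_map 0 = \<Psi>"
    using smooth_liftD(4)[OF lift] by (auto simp: var_map_def var_lift_def fun_eq_iff)
  fix t0 :: real and p0 :: 'a
  show "\<exists>c\<in>X. \<exists>V \<delta> G. open V \<and> p0 \<in> V \<and> V \<subseteq> fst c \<and> 0 < \<delta> \<and>
      smooth_on (snd c ` V \<times> {t0 - \<delta><..<t0 + \<delta>}) (\<lambda>(z, t). in_chart c (G t) z) \<and>
      (\<forall>t\<in>{t0 - \<delta><..<t0 + \<delta>}. \<forall>q\<in>V. G t q \<noteq> 0 \<and> var_map t q = cline (G t q))"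
  proof (cases "p0 \<in> var_supp")
    case True
    have "smooth_on (D \<times> UNIV) (\<lambda>(z, t). in_chart c (var_lift t) z)"
      by (rule smooth_on_cong[OF open_Times_UNIV[OF open_D], THEN iffD1, OF _ smooth_on_vary_joint[OF open_D smooth_f(1) \<phi>]])
        (auto simp: in_chart_var_lift)
    then have "smooth_on (snd c ` U \<times> {t0 - 1<..<t0 + 1}) (\<lambda>(z, t). in_chart c (var_lift t) z)"
      by (rule smooth_on_subset) (auto simp: D)
    moreover have "\<forall>t. \<forall>q\<in>U. var_lift t q \<noteq> 0 \<and> var_map t q = cline (var_lift t q)"
      using smooth_liftD(3,4)[OF var_lift_smooth_lift] by blast
    ultimately show ?thesis
      using c Uc True var_supp(2) smooth_liftD(1)[OF lift]
      by (intro bexI[OF _ c] exI[of _ U] exI[of _ 1] exI[of _ var_lift]) auto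
  next
    case False
    obtain V G where "p0 \<in> V" "V \<inter> var_supp = {}" "smooth_lift X \<Psi> V G"
      "\<forall>t. smooth_lift X (var_map t) V G" by (rule lift_outside[OF False])
    then have V: "p0 \<in> V" "smooth_lift X \<Psi> V G" "\<And>t. smooth_lift X (var_map t) V G" by auto
    obtain c' where c': "c' \<in> X" "p0 \<in> fst c'" by (rule chart_cover)
    let ?V = "V \<inter> fst c'"
    have op: "open (snd c' ` ?V)" by (rule open_chart_image[OF c'(1) smooth_liftD(1)[OF V(2)]])
    have "smooth_on (snd c' ` ?V \<times> (UNIV :: real set)) (\<lambda>p. in_chart c' G (fst p))"
      by (rule smooth_on_fst_comp[OF op smooth_funD[OF smooth_liftD(2)[OF V(2)] c'(1)]])
    then have "smooth_on (snd c' ` ?V \<times> {t0 - 1<..<t0 + 1}) (\<lambda>p. in_chart c' G (fst p))"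
      by (rule smooth_on_subset) auto
    moreover have "\<forall>t. \<forall>q\<in>?V. G q \<noteq> 0 \<and> var_map t q = cline (G q)"
      using smooth_liftD(3,4)[OF V(3)] by blast
    ultimately show ?thesis
      using V(1) c' smooth_liftD(1)[OF V(2)] chart_open(1)[OF c'(1)]
      by (intro bexI[OF _ c'(1)] exI[of _ ?V] exI[of _ 1] exI[of _ "\<lambda>t. G"]) (auto simp: case_prod_unfold)
  qed
qed simp

text \<open>Unlike the energies, their difference has an integrand supported in the patch, so it can
  be computed in one chart. The metric coefficient of the area form cancels the one in the
  norm.\<close>

lemma energy_difference:
  "2 * (energy X g (var_map t) - energy X g \<Psi>) =
    integral (cbox l u) (energy_density (vary f \<phi> t)) - integral (cbox l u) (energy_density f)"
proof -
  define d where "d p = dPsi_norm_sq X g (var_map t) p - dPsi_norm_sq X g \<Psi> p" for p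
  have cont: "continuous_on UNIV (dPsi_norm_sq X g (var_map t))" "continuous_on UNIV (dPsi_norm_sq X g \<Psi>)"
    by (intro continuous_dPsi_norm_sq metric smooth_map_var_map smooth)+
  have out: "d p = 0" if p: "p \<notin> var_supp" for p
  proof -
    obtain V G where "p \<in> V" "V \<inter> var_supp = {}" "smooth_lift X \<Psi> V G"
      "\<forall>t. smooth_lift X (var_map t) V G" by (rule lift_outside[OF p])
    then have V: "p \<in> V" "smooth_lift X \<Psi> V G" "\<And>t. smooth_lift X (var_map t) V G" by auto
    obtain c' where c': "c' \<in> X" "p \<in> fst c'" by (rule chart_cover)
    have "p \<in> V \<inter> fst c'" using V c' by auto
    from norm_sq_lift(1)[OF metric V(2) c'(1) this] norm_sq_lift(1)[OF metric V(3) c'(1) this]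
    show ?thesis by (simp add: d_def)
  qed
  have inU: "g c p * d p = energy_density (vary f \<phi> t) (snd c p) - energy_density f (snd c p)" if p: "p \<in> U" for p
  proof -
    have pc: "p \<in> U \<inter> fst c" using p Uc by auto
    have gp: "g c p \<noteq> 0" using metric_pos[OF c] pc by (metis IntD2 less_irrefl)
    have "energy_density (in_chart c (var_lift t)) (snd c p) = energy_density (vary f \<phi> t) (snd c p)"
      by (rule energy_density_cong[OF open_D _ in_chart_var_lift]) (use p in \<open>auto simp: D\<close>)
    then show ?thesis
      using norm_sq_lift(1)[OF metric var_lift_smooth_lift c pc] norm_sq_lift(1)[OF metric lift c pc] gp
      by (simp add: d_def f algebra_simps)
  qed
  have si: "set_integrable lborel (cbox l u) (\<lambda>z. energy_density (vary f \<phi> t) z - energy_density f z)"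
    and int: "energy_density (vary f \<phi> t) integrable_on cbox l u" "energy_density f integrable_on cbox l u"
  proof -
    have "continuous_on D (energy_density (vary f \<phi> t))"
      by (rule smooth_on_energy_density[OF open_D smooth_on_vary[OF open_D smooth_f(1) \<phi>]])
        (rule vary_nonzero[OF smooth_f(2)])
    moreover have "continuous_on D (energy_density f)"
      by (rule smooth_on_energy_density[OF open_D smooth_f])
    ultimately have cc: "continuous_on (cbox l u) (energy_density (vary f \<phi> t))" "continuous_on (cbox l u) (energy_density f)"
      using box continuous_on_subset by blast+
    show "set_integrable lborel (cbox l u) (\<lambda>z. energy_density (vary f \<phi> t) z - energy_density f z)"
      unfolding set_integrable_def
      by (rule borel_integrable_compact[OF compact_cbox continuous_on_diff[OF cc]])
    show "energy_density (vary f \<phi> t) integrable_on cbox l u" "energy_density f integrable_on cbox l u"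
      using cc by (auto intro!: integrable_continuous)
  qed
  have "2 * (energy X g (var_map t) - energy X g \<Psi>) = (\<integral>p. d p \<partial>area_measure X g)"
    unfolding energy_def d_def using integrable_area_continuous[OF cont(1)] integrable_area_continuous[OF cont(2)]
    by simp
  also have "\<dots> = (\<integral>z. indicator (snd c ` fst c) z *\<^sub>R (in_chart c (g c) z * in_chart c d z) \<partial>lborel)"
  proof (rule integral_area_chart[OF c])
    show "d \<in> borel_measurable borel"
      unfolding d_def using cont by (intro borel_measurable_continuous_onI continuous_on_diff)
    show "d p = 0" if "p \<notin> fst c" for p using out var_supp(2) Uc that by blast
  qed
  also have "\<dots> = (LINT z : cbox l u | lborel. energy_density (vary f \<phi> t) z - energy_density f z)"
    unfolding set_lebesgue_integral_def
  proof (rule Bochner_Integration.integral_cong[OF refl])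
    fix z
    show "indicator (snd c ` fst c) z *\<^sub>R (in_chart c (g c) z * in_chart c d z) =
        indicator (cbox l u) z *\<^sub>R (energy_density (vary f \<phi> t) z - energy_density f z)"
    proof (cases "z \<in> snd c ` fst c")
      case True
      then obtain p where p: "p \<in> fst c" "z = snd c p" by auto
      have lhs: "in_chart c (g c) z * in_chart c d z = g c p * d p" using c p by simp
      show ?thesis
      proof (cases "z \<in> cbox l u")
        case zb: True
        then obtain p' where "p' \<in> U" "z = snd c p'" using box by (auto simp: D)
        then have "p \<in> U" using p Uc chart_inj[OF c] by (metis inj_onD subsetD)
        then show ?thesis using True zb lhs inU p by simp
      next
        case False
        then have "z \<notin> K" using K by blast
        then have "p \<notin> var_supp"
          using p c chart_inv_mem(2)[OF c] K box Uc by (force simp: var_supp_def D)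
        then show ?thesis using lhs out False by simp
      qed
    next
      case False
      then have "z \<notin> cbox l u" using box Uc by (auto simp: D)
      then show ?thesis using False by simp
    qed
  qed
  also have "\<dots> = integral (cbox l u) (\<lambda>z. energy_density (vary f \<phi> t) z - energy_density f z)"
    by (rule set_borel_integral_eq_integral(2)[OF si])
  finally show ?thesis
    using int by (simp add: Henstock_Kurzweil_Integration.integral_diff)
qed

lemma critical_in_chart:
  "((\<lambda>t. integral (cbox l u) (energy_density (vary f \<phi> t))) has_real_derivative 0) (at 0)"
proof -
  have "((\<lambda>t. energy X g (var_map t)) has_real_derivative 0) (at 0)"
    by (rule crit[OF var_map_variation])
  then have "((\<lambda>t. integral (cbox l u) (energy_density f) + 2 * (energy X g (var_map t) - energy X g \<Psi>)) has_real_derivative 0) (at 0)"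
    by (auto intro!: derivative_eq_intros)
  then show ?thesis unfolding energy_difference by simp
qed

end

lemma euler_lagrange:
  fixes \<Psi> :: "'a \<Rightarrow> (complex ^ ('m::finite \<times> 2)) set"
  assumes crit: "\<And>\<epsilon> \<Phi>. smooth_variation X \<Psi> \<epsilon> \<Phi> \<Longrightarrow> ((\<lambda>t. energy X g (\<Phi> t)) has_real_derivative 0) (at 0)"
    and smooth: "smooth_map_CP X \<Psi>" and lift: "smooth_lift X \<Psi> U F" and c: "c \<in> X" "U \<subseteq> fst c"
    and \<beta>: "smooth_on (snd c ` U) \<beta>"
      "\<And>z. z \<in> snd c ` U \<Longrightarrow> wdzb_vec (in_chart c F) z = \<beta> z *s quat_I (in_chart c F z)"
    and z: "z \<in> snd c ` U"
  shows "wdz (\<lambda>z. \<beta> z / herm (in_chart c F z) (in_chart c F z)) z = 0"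
proof (rule euler_lagrange_plane[OF _ z _ _ \<beta>])
  show "open (snd c ` U)" by (rule open_chart_image_sub[OF c(1) smooth_liftD(1)[OF lift] c(2)])
  show "smooth_on (snd c ` U) (in_chart c F)"
    using smooth_funD[OF smooth_liftD(2)[OF lift] c(1)] c(2) by (simp add: inf.absorb1)
  show "in_chart c F z \<noteq> 0" if "z \<in> snd c ` U" for z
    using that smooth_liftD(3)[OF lift] c by (auto simp: subset_iff)
  fix \<phi> :: "complex \<Rightarrow> complex" and l u K
  assume a: "smooth_on (snd c ` U) \<phi>" "cbox l u \<subseteq> snd c ` U" "compact K" "K \<subseteq> cbox l u"
    "\<And>z. z \<in> snd c ` U - K \<Longrightarrow> \<phi> z = 0"
  show "((\<lambda>t. integral (cbox l u) (energy_density (vary (in_chart c F) \<phi> t))) has_real_derivative 0) (at 0)"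
    by (rule critical_in_chart[OF _ smooth lift c refl refl a(1-4)]) (erule crit, erule a(5))
qed

end

section \<open>Orders of zeros and holomorphy of the coefficient of \<open>A\<close>\<close>

section \<open>Orders of zeros\<close>

text \<open>Measured by moduli, the order is the same for a function and its conjugate and is
  insensitive to nonvanishing continuous factors. So it can compare the anti-holomorphic
  \<open>dbar \<Psi>\<close>, expressed in merely smooth lifts, with the holomorphic coefficient of
  \<open>A\<close>.\<close>

definition lim_order :: "(complex \<Rightarrow> complex) \<Rightarrow> complex \<Rightarrow> nat \<Rightarrow> bool" where
  "lim_order f z k \<longleftrightarrow> (\<exists>m>0. ((\<lambda>w. cmod (f w) / cmod (w - z) ^ k) \<longlongrightarrow> m) (at z))"

lemma eventually_at_neq: "eventually (\<lambda>w. w \<noteq> z) (at z)"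
  by (simp add: eventually_at_filter)

lemma lim_order_le:
  assumes "lim_order f z k" "lim_order f z n"
  shows "k \<le> n"
proof (rule ccontr)
  assume "\<not> k \<le> n"
  then have kn: "n < k" by simp
  obtain m m' where m: "m > 0" "((\<lambda>w. cmod (f w) / cmod (w - z) ^ k) \<longlongrightarrow> m) (at z)"
    and m': "m' > 0" "((\<lambda>w. cmod (f w) / cmod (w - z) ^ n) \<longlongrightarrow> m') (at z)"
    using assms by (auto simp: lim_order_def)
  have "((\<lambda>w. cmod (w - z) ^ (k - n)) \<longlongrightarrow> cmod (z - z) ^ (k - n)) (at z)"
    by (intro tendsto_intros)
  then have "((\<lambda>w. cmod (f w) / cmod (w - z) ^ k * cmod (w - z) ^ (k - n)) \<longlongrightarrow> m * cmod (z - z) ^ (k - n)) (at z)"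
    by (intro tendsto_mult m)
  moreover have "eventually (\<lambda>w. cmod (f w) / cmod (w - z) ^ k * cmod (w - z) ^ (k - n) = cmod (f w) / cmod (w - z) ^ n) (at z)"
    using eventually_at_neq
  proof eventually_elim
    case (elim w)
    then have "cmod (w - z) ^ k = cmod (w - z) ^ n * cmod (w - z) ^ (k - n)"
      using kn by (simp add: power_add[symmetric])
    then show ?case using elim by simp
  qed
  ultimately have "((\<lambda>w. cmod (f w) / cmod (w - z) ^ n) \<longlongrightarrow> m * cmod (z - z) ^ (k - n)) (at z)"
    by (rule Lim_transform_eventually)
  from tendsto_unique[OF _ m'(2) this] show False using m'(1) kn by (simp add: power_0_left)
qed

lemma lim_order_unique: "lim_order f z k \<Longrightarrow> lim_order f z n \<Longrightarrow> k = n"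
  using lim_order_le by (simp add: order_antisym)

lemma lim_order_mult:
  assumes "lim_order f z k" "lim_order g z n"
  shows "lim_order (\<lambda>w. f w * g w) z (k + n)"
proof -
  obtain m m' where m: "m > 0" "((\<lambda>w. cmod (f w) / cmod (w - z) ^ k) \<longlongrightarrow> m) (at z)"
    and m': "m' > 0" "((\<lambda>w. cmod (g w) / cmod (w - z) ^ n) \<longlongrightarrow> m') (at z)"
    using assms by (auto simp: lim_order_def)
  have "((\<lambda>w. cmod (f w * g w) / cmod (w - z) ^ (k + n)) \<longlongrightarrow> m * m') (at z)"
    using tendsto_mult[OF m(2) m'(2)] by (simp add: norm_mult power_add)
  then show ?thesis using m(1) m'(1) unfolding lim_order_def by (intro exI[of _ "m * m'"]) simp
qed

lemma lim_order_cong: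
  assumes "eventually (\<lambda>w. f w = g w) (at z)" "lim_order f z k"
  shows "lim_order g z k"
proof -
  obtain m where m: "m > 0" "((\<lambda>w. cmod (f w) / cmod (w - z) ^ k) \<longlongrightarrow> m) (at z)"
    using assms by (auto simp: lim_order_def)
  have "((\<lambda>w. cmod (g w) / cmod (w - z) ^ k) \<longlongrightarrow> m) (at z)"
    by (rule Lim_transform_eventually[OF m(2)]) (use assms(1) in \<open>auto elim: eventually_mono\<close>)
  then show ?thesis using m(1) by (auto simp: lim_order_def)
qed

lemma lim_order_0: "isCont f z \<Longrightarrow> f z \<noteq> 0 \<Longrightarrow> lim_order f z 0"
  unfolding lim_order_def isCont_def
  by (intro exI[of _ "cmod (f z)"]) (auto intro!: tendsto_norm)

lemma lim_order_frequently:
  assumes "lim_order f z k"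
  shows "eventually (\<lambda>w. f w \<noteq> 0) (at z)"
proof -
  obtain m where m: "m > 0" "((\<lambda>w. cmod (f w) / cmod (w - z) ^ k) \<longlongrightarrow> m) (at z)"
    using assms by (auto simp: lim_order_def)
  show ?thesis using order_tendstoD(1)[OF m(2,1)] by eventually_elim auto
qed

lemma lim_order_of_factor:
  assumes "open S" "z \<in> S" "continuous_on S g" "g z \<noteq> 0" "\<And>w. w \<in> S \<Longrightarrow> f w = g w * (w - z) ^ k"
  shows "lim_order f z k"
proof -
  have c: "isCont g z" using assms(1-3) continuous_on_eq_continuous_at by blast
  have "eventually (\<lambda>w. w \<in> S \<and> w \<noteq> z) (at z)"
    using assms(1,2) by (auto simp: eventually_at_topological)
  then have "eventually (\<lambda>w. cmod (g w) = cmod (f w) / cmod (w - z) ^ k) (at z)"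
    by eventually_elim (simp add: assms(5) norm_mult norm_power)
  moreover have "((\<lambda>w. cmod (g w)) \<longlongrightarrow> cmod (g z)) (at z)"
    using c by (auto simp: isCont_def intro: tendsto_norm)
  ultimately have "((\<lambda>w. cmod (f w) / cmod (w - z) ^ k) \<longlongrightarrow> cmod (g z)) (at z)"
    by (rule Lim_transform_eventually[rotated])
  then show ?thesis using assms(4) unfolding lim_order_def by (intro exI[of _ "cmod (g z)"]) simp
qed

lemma holomorphic_zero_factor:
  assumes f: "f holomorphic_on S" "open S" "z \<in> S" and nz: "\<exists>\<^sub>F w in at z. f w \<noteq> 0"
  obtains r g n where "0 < r" "ball z r \<subseteq> S" "g holomorphic_on ball z r" "zorder f z = int n"
    "\<And>w. w \<in> ball z r \<Longrightarrow> f w = g w * (w - z) ^ n" "\<And>w. w \<in> ball z r \<Longrightarrow> g w \<noteq> 0"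
proof -
  obtain e where e: "0 < e" "ball z e \<subseteq> S" using f(2,3) open_contains_ball by blast
  have "\<exists>w\<in>ball z e. f w \<noteq> 0"
  proof -
    have "eventually (\<lambda>w. w \<in> ball z e) (at z)" using e(1) by (auto simp: eventually_at dist_commute)
    then show ?thesis using frequently_eventually_conj[OF nz] frequently_ex by fastforce
  qed
  then have "\<exists>r>0. cball z r \<subseteq> ball z e \<and> zor_poly f z holomorphic_on cball z r \<and>
      (\<forall>w\<in>cball z r. f w = zor_poly f z w * (w - z) ^ nat (zorder f z) \<and> zor_poly f z w \<noteq> 0)"
    and n: "if f z = 0 then zorder f z > 0 else zorder f z = 0"
    using zorder_exist_zero[OF holomorphic_on_subset[OF f(1) e(2)] open_ball convex_connected[OF convex_ball], of z] e(1)
    by auto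
  then obtain r where r: "0 < r" "cball z r \<subseteq> ball z e" "zor_poly f z holomorphic_on cball z r"
    "\<forall>w\<in>cball z r. f w = zor_poly f z w * (w - z) ^ nat (zorder f z) \<and> zor_poly f z w \<noteq> 0" by blast
  show thesis
  proof (rule that[of r "zor_poly f z" "nat (zorder f z)"])
    show "ball z r \<subseteq> S" using r(2) e(2) ball_subset_cball by blast
    show "zor_poly f z holomorphic_on ball z r" by (rule holomorphic_on_subset[OF r(3) ball_subset_cball])
    show "zorder f z = int (nat (zorder f z))" using n by (auto split: if_splits)
  qed (use r in auto)
qed

text \<open>The link to \<open>zorder\<close>, in whose terms \<open>local_equation\<close> is
  stated: a holomorphic function that is not zero near \<open>z\<close> is a nonvanishing one times
  a power of \<open>w - z\<close>.\<close>

lemma lim_order_iff_zorder: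
  assumes f: "f holomorphic_on S" "open S" "z \<in> S"
  shows "lim_order f z k \<longleftrightarrow> (\<exists>\<^sub>F w in at z. f w \<noteq> 0) \<and> zorder f z = int k"
proof
  assume L: "lim_order f z k"
  have fr: "\<exists>\<^sub>F w in at z. f w \<noteq> 0"
    using lim_order_frequently[OF L] by (simp add: eventually_frequently)
  obtain r g n where g: "0 < r" "ball z r \<subseteq> S" "g holomorphic_on ball z r" "zorder f z = int n"
    "\<And>w. w \<in> ball z r \<Longrightarrow> f w = g w * (w - z) ^ n" "\<And>w. w \<in> ball z r \<Longrightarrow> g w \<noteq> 0"
    by (rule holomorphic_zero_factor[OF f fr]) blast
  have "lim_order f z n"
    by (rule lim_order_of_factor[OF open_ball _ holomorphic_on_imp_continuous_on[OF g(3)]]) (use g in auto)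
  then show "(\<exists>\<^sub>F w in at z. f w \<noteq> 0) \<and> zorder f z = int k"
    using fr g(4) lim_order_unique[OF L] by blast
next
  assume "(\<exists>\<^sub>F w in at z. f w \<noteq> 0) \<and> zorder f z = int k"
  then have fr: "\<exists>\<^sub>F w in at z. f w \<noteq> 0" and k: "zorder f z = int k" by auto
  obtain r g n where g: "0 < r" "ball z r \<subseteq> S" "g holomorphic_on ball z r" "zorder f z = int n"
    "\<And>w. w \<in> ball z r \<Longrightarrow> f w = g w * (w - z) ^ n" "\<And>w. w \<in> ball z r \<Longrightarrow> g w \<noteq> 0"
    by (rule holomorphic_zero_factor[OF f fr]) blast
  have "lim_order f z n"
    by (rule lim_order_of_factor[OF open_ball _ holomorphic_on_imp_continuous_on[OF g(3)]]) (use g in auto)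
  then show "lim_order f z k" using k g(4) by simp
qed

lemma tendsto_difference_quotient_norm:
  assumes "(f has_field_derivative d) (at z)"
  shows "((\<lambda>w. cmod (f w - f z) / cmod (w - z)) \<longlongrightarrow> cmod d) (at z)"
  using tendsto_norm[OF assms[unfolded has_field_derivative_iff]] by (simp add: norm_divide)

section \<open>The local structure of quaternionic harmonic maps\<close>

lemma quat_I_cline: "quat_I ` cline v = cline (quat_I v)"
proof
  show "quat_I ` cline v \<subseteq> cline (quat_I v)" by (auto simp: cline_def)
  show "cline (quat_I v) \<subseteq> quat_I ` cline v"
  proof
    fix w assume "w \<in> cline (quat_I v)"
    then obtain a where "w = quat_I (cnj a *s v)" by (auto simp: cline_def)
    then show "w \<in> quat_I ` cline v" unfolding cline_def by blast
  qed
qed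

text \<open>The coefficient of \<open>A\<close> in the frame dual to \<open>F\<close>. That coframe
  is represented by \<open>F / |F|^2\<close>, once in each argument of \<open>A\<close>, which
  explains the squared denominator.\<close>

definition A_coeff :: "('a \<Rightarrow> complex ^ ('m::finite \<times> 2)) \<Rightarrow> 'a chart \<Rightarrow> 'a \<Rightarrow> complex" where
  "A_coeff F c p = cnj (herm (dzbar_vec c F p) (quat_I (F p))) / (herm (F p) (F p))\<^sup>2"

locale quat_surface = compact_surface X g for X :: "'a::t2_space chart set" and g +
  fixes \<Psi> :: "'a \<Rightarrow> (complex ^ ('m::finite \<times> 2)) set"
  assumes crit: "\<And>\<epsilon> \<Phi>. smooth_variation X \<Psi> \<epsilon> \<Phi> \<Longrightarrow> ((\<lambda>t. energy X g (\<Phi> t)) has_real_derivative 0) (at 0)"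
    and smooth: "smooth_map_CP X \<Psi>"
    and L_minus1: "is_L_minus1 X \<Psi> (\<lambda>p. quat_I ` \<Psi> p)"
    and even_order: "\<And>p. dbar_vanishes X \<Psi> p \<Longrightarrow> even (dbar_order X \<Psi> p)"
begin

lemma L0_frameD:
  assumes "L0_frame X \<Psi> U F"
  shows "smooth_lift X \<Psi> U F" "open U" "smooth_fun X U F" "\<And>q. q \<in> U \<Longrightarrow> F q \<noteq> 0"
    "\<And>q. q \<in> U \<Longrightarrow> \<Psi> q = cline (F q)"
    "\<And>c q. c \<in> X \<Longrightarrow> q \<in> U \<inter> fst c \<Longrightarrow> herm (dzbar_vec c F q) (F q) = 0"
proof -
  have l: "smooth_lift X \<Psi> U F" using assms by (simp add: L0_frame_def)
  show "smooth_lift X \<Psi> U F" "open U" "smooth_fun X U F" "\<And>q. q \<in> U \<Longrightarrow> F q \<noteq> 0"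
    "\<And>q. q \<in> U \<Longrightarrow> \<Psi> q = cline (F q)"
    using l smooth_liftD[OF l] by blast+
  show "\<And>c q. c \<in> X \<Longrightarrow> q \<in> U \<inter> fst c \<Longrightarrow> herm (dzbar_vec c F q) (F q) = 0"
    using assms unfolding L0_frame_def by blast
qed

lemma dzbar_vec_chart_change:
  assumes "smooth_fun X U F" "c \<in> X" "c' \<in> X" "p \<in> U" "p \<in> fst c \<inter> fst c'"
  shows "dzbar_vec c F p = cnj (jac c c' p) *s dzbar_vec c' F p"
  unfolding dzbar_vec_eq by (rule wirtinger_vec_chart_change(2)[OF assms])

lemma dzbar_vec_scale:
  assumes "smooth_fun X U F" "smooth_fun X U l" "c \<in> X" "p \<in> U \<inter> fst c"
  shows "dzbar_vec c (\<lambda>q. l q *s F q) p = dzbar c l p *s F p + l p *s dzbar_vec c F p"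
  unfolding dzbar_vec_eq in_chart_o(2)[of _ "\<lambda>a v. a *s v"] dzbar_eq
  using assms by (simp add: wirtinger_vec_scale smooth_fun_in_chart_differentiable)

lemma dzbar_vec_cong:
  assumes "open U" "c \<in> X" "p \<in> U \<inter> fst c" "\<And>q. q \<in> U \<Longrightarrow> F q = G q"
  shows "dzbar_vec c F p = dzbar_vec c G p"
proof -
  have "dzbar c (\<lambda>q. F q $ i) p = dzbar c (\<lambda>q. G q $ i) p" for i
    unfolding dzbar_eq
    by (rule wirtinger_cong(2)[OF open_chart_image[OF assms(2,1)]]) (use assms in auto)
  then show ?thesis by (simp add: dzbar_vec_def)
qed

text \<open>For \<open>exp u\<close> times a given lift the orthogonality condition becomes the
  scalar equation \<open>\<partial>u/\<partial>cnj z = s\<close>, solvable near the point; the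
  exponential keeps the new lift nonvanishing.\<close>

lemma L0_frame_exists:
  obtains U F where "p \<in> U" "L0_frame X \<Psi> U F"
proof -
  obtain U0 F0 where F0: "p \<in> U0" "smooth_lift X \<Psi> U0 F0" using smooth unfolding smooth_map_CP_def by blast
  obtain c where c: "c \<in> X" "p \<in> fst c" by (rule chart_cover)
  note D = smooth_liftD[OF F0(2)]
  let ?D = "snd c ` (U0 \<inter> fst c)"
  define f where "f = in_chart c F0"
  have oD: "open ?D" by (rule open_chart_image[OF c(1) D(1)])
  have sf: "smooth_on ?D f" unfolding f_def by (rule smooth_funD[OF D(2) c(1)])
  have f0: "f z \<noteq> 0" if "z \<in> ?D" for z unfolding f_def using in_chart_image_nonzero[OF c(1) D(3) that] .
  define s where "s z = - herm (wdzb_vec f z) (f z) / herm (f z) (f z)" for z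
  have ss: "smooth_on ?D s"
    unfolding s_def by (intro smooth_on_divide smooth_on_uminus smooth_on_herm smooth_on_wdzb_vec oD sf) (simp add: f0)
  have "snd c p \<in> ?D" using c F0 by auto
  then obtain r u where r: "0 < r" "ball (snd c p) r \<subseteq> ?D" "smooth_on UNIV u"
    "\<And>z. z \<in> ball (snd c p) r \<Longrightarrow> wdzb u z = s z"
    using dbar_locally_solvable[OF oD _ ss] by metis
  define U where "U = U0 \<inter> (fst c \<inter> snd c -` ball (snd c p) r)"
  have U: "open U" "p \<in> U" "U \<subseteq> U0" "U \<subseteq> fst c" "snd c ` U \<subseteq> ball (snd c p) r"
    using open_chart_preimage[OF c(1) open_ball] D(1) c F0(1) r(1) by (auto simp: U_def open_Int)
  define E where "E q = exp (u (snd c q))" for q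
  have sE: "smooth_fun X U E"
  proof (rule smooth_funI_local[OF U(1)])
    fix q assume "q \<in> U"
    have op: "open (snd c ` U)" by (rule open_chart_image_sub[OF c(1) U(1,4)])
    have "smooth_on (snd c ` U) (\<lambda>z. exp (u z))"
      by (intro smooth_on_exp op smooth_on_subset[OF r(3)]) simp
    then have "smooth_on (snd c ` U) (in_chart c E)"
      by (rule smooth_on_cong[OF op, THEN iffD2, rotated]) (use c U in \<open>auto simp: E_def subset_iff\<close>)
    then show "\<exists>c\<in>X. \<exists>V. open V \<and> q \<in> V \<and> V \<subseteq> fst c \<and> smooth_on (snd c ` V) (in_chart c E)"
      using c U \<open>q \<in> U\<close> by blast
  qed
  have lift: "smooth_lift X \<Psi> U (\<lambda>q. E q *s F0 q)"
    by (rule smooth_lift_scale[OF smooth_lift_subset[OF F0(2) U(1,3)] sE]) (simp add: E_def)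
  have key: "herm (dzbar_vec c (\<lambda>q. E q *s F0 q) q) (E q *s F0 q) = 0" if q: "q \<in> U" for q
  proof -
    have qc: "q \<in> fst c" "q \<in> U0" using q U by auto
    have zb: "snd c q \<in> ball (snd c p) r" using q U(5) by auto
    have "dzbar c E q = E q * s (snd c q)"
    proof -
      have "dzbar c E q = wdzb (\<lambda>z. exp (u z)) (snd c q)"
        unfolding dzbar_eq
        by (rule wirtinger_cong(2)[OF open_chart_image_sub[OF c(1) U(1,4)]])
          (use q U c in \<open>auto simp: E_def subset_iff\<close>)
      also have "\<dots> = exp (u (snd c q)) * wdzb u (snd c q)"
        by (rule wirtinger_compose_outer(2)[OF smooth_on_differentiable[OF r(3)] DERIV_exp]) simp
      finally show ?thesis using r(4)[OF zb] by (simp add: E_def)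
    qed
    then have "dzbar_vec c (\<lambda>q. E q *s F0 q) q = E q *s (s (snd c q) *s F0 q + dzbar_vec c F0 q)"
      using dzbar_vec_scale[OF smooth_fun_subset[OF D(2) U(3)] sE c(1), of q] q qc
      by (simp add: vec_eq_iff algebra_simps)
    moreover have "s (snd c q) = - herm (dzbar_vec c F0 q) (F0 q) / herm (F0 q) (F0 q)"
      using qc c by (simp add: s_def f_def dzbar_vec_eq)
    ultimately show ?thesis using D(3)[OF qc(2)] by simp
  qed
  have "L0_frame X \<Psi> U (\<lambda>q. E q *s F0 q)"
    unfolding L0_frame_def
  proof (intro conjI lift ballI)
    fix c' q assume c': "c' \<in> X" "q \<in> U \<inter> fst c'"
    then have "dzbar_vec c' (\<lambda>q. E q *s F0 q) q = cnj (jac c' c q) *s dzbar_vec c (\<lambda>q. E q *s F0 q) q"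
      using U by (intro dzbar_vec_chart_change[OF smooth_liftD(2)[OF lift] c'(1) c(1)]) auto
    then show "herm (dzbar_vec c' (\<lambda>q. E q *s F0 q) q) (E q *s F0 q) = 0"
      using key[of q] c' by (auto simp: E_def)
  qed
  then show thesis using that U(2) by blast
qed

lemma L0_frame_subset: "L0_frame X \<Psi> U F \<Longrightarrow> open V \<Longrightarrow> V \<subseteq> U \<Longrightarrow> L0_frame X \<Psi> V F"
  unfolding L0_frame_def using smooth_lift_subset by blast

lemma dbar_Psi_frame:
  assumes F: "L0_frame X \<Psi> U F" and c: "c \<in> X" "p \<in> U \<inter> fst c"
  shows "dbar_Psi X \<Psi> c p (a *s F p) = a *s dzbar_vec c F p"
  using dbar_Psi_lift[OF L0_frameD(1)[OF F] c] L0_frameD(6)[OF F c]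
  by (simp add: dzbar_vec_eq perp_eq)

lemma dbar_Psi_chart_change:
  assumes c: "c \<in> X" "c' \<in> X" "p \<in> fst c \<inter> fst c'" and v: "v \<in> \<Psi> p"
  shows "dbar_Psi X \<Psi> c p v = cnj (jac c c' p) *s dbar_Psi X \<Psi> c' p v"
proof -
  obtain U F where F: "p \<in> U" "L0_frame X \<Psi> U F" by (rule L0_frame_exists)
  obtain a where a: "v = a *s F p" using v L0_frameD(5)[OF F(2,1)] by (auto simp: cline_def)
  have "p \<in> U \<inter> fst c" "p \<in> U \<inter> fst c'" using F c by auto
  then show ?thesis
    unfolding a using dzbar_vec_chart_change[OF L0_frameD(3)[OF F(2)] c(1,2) F(1) c(3)] c
    by (simp add: dbar_Psi_frame[OF F(2)] mult.commute)
qed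

text \<open>The value of \<open>dbar \<Psi>\<close> at \<open>p\<close> lies on the line
  \<open>I(\<Psi> p)\<close>, also at a zero, where it is the zero vector. So the derivative is a
  multiple of \<open>I(F p)\<close>, and pairing with \<open>I(F p)\<close> determines the
  factor.\<close>

lemma dzbar_frame:
  assumes F: "L0_frame X \<Psi> U F" and c: "c \<in> X" "p \<in> U \<inter> fst c"
  shows "dzbar_vec c F p = (herm (dzbar_vec c F p) (quat_I (F p)) / herm (F p) (F p)) *s quat_I (F p)"
proof -
  have Fp: "F p \<noteq> 0" "\<Psi> p = cline (F p)" using L0_frameD(4,5)[OF F] c by auto
  obtain k where "dbar_leading X \<Psi> p k (quat_I ` \<Psi> p)" using L_minus1 by (auto simp: is_L_minus1_def)
  then obtain c0 U0 F0 G where G: "c0 \<in> X" "p \<in> U0" "U0 \<subseteq> fst c0" "smooth_lift X \<Psi> U0 F0"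
    "\<forall>q\<in>U0. dbar_Psi X \<Psi> c0 q (F0 q) = cnj (snd c0 q - snd c0 p) ^ k *s G q"
    "quat_I ` \<Psi> p = cline (G p)"
    unfolding dbar_leading_def by blast
  have pc: "p \<in> fst c0 \<inter> fst c" "p \<in> U \<inter> fst c0" using G c by auto
  have "F0 p \<in> \<Psi> p" "F0 p \<noteq> 0" using smooth_liftD(3,4)[OF G(4) G(2)] cline_memI by auto
  then obtain a where a: "F0 p = a *s F p" "a \<noteq> 0" using Fp by (auto simp: cline_def)
  have "dbar_Psi X \<Psi> c0 p (F0 p) = a *s dzbar_vec c0 F p"
    unfolding a(1) by (rule dbar_Psi_frame[OF F G(1) pc(2)])
  also have "dzbar_vec c0 F p = cnj (jac c0 c p) *s dzbar_vec c F p"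
    by (rule dzbar_vec_chart_change[OF L0_frameD(3)[OF F] G(1) c(1)]) (use c pc in auto)
  \<comment> \<open>At \<open>q = p\<close> the power is \<open>0 ^ k\<close>, equal to 1 for
    \<open>k = 0\<close> and to 0 otherwise; in both cases the right side stays on the line of
    \<open>G p\<close>.\<close>
  finally have 1: "(a * cnj (jac c0 c p)) *s dzbar_vec c F p = cnj (snd c0 p - snd c0 p) ^ k *s G p"
    using G(5,2) by simp
  have nz: "a * cnj (jac c0 c p) \<noteq> 0" using a(2) jac_nonzero[OF G(1) c(1) pc(1)] by simp
  have "cnj (snd c0 p - snd c0 p) ^ k *s G p \<in> quat_I ` \<Psi> p"
    unfolding G(6) by (auto simp: cline_def)
  then obtain b where b: "cnj (snd c0 p - snd c0 p) ^ k *s G p = b *s quat_I (F p)"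
    unfolding Fp(2) quat_I_cline by (auto simp: cline_def)
  define d where "d = b / (a * cnj (jac c0 c p))"
  have "dzbar_vec c F p = d *s quat_I (F p)"
  proof -
    have "dzbar_vec c F p = inverse (a * cnj (jac c0 c p)) *s ((a * cnj (jac c0 c p)) *s dzbar_vec c F p)"
      by (simp only: vector_smult_assoc left_inverse[OF nz] vector_smult_lid)
    also have "\<dots> = d *s quat_I (F p)" unfolding 1 b by (simp add: d_def divide_inverse mult.commute)
    finally show ?thesis .
  qed
  then show ?thesis using Fp(1) by simp
qed

lemma smooth_fun_dzbar_vec:
  assumes "smooth_fun X U F" "open U" "c \<in> X"
  shows "smooth_on (snd c ` (U \<inter> fst c)) (wdzb_vec (in_chart c F))"
  by (rule smooth_on_wdzb_vec[OF open_chart_image[OF assms(3,2)] smooth_funD[OF assms(1,3)]])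

lemma A_coeff_in_chart:
  assumes "c \<in> X" "z \<in> snd c ` fst c"
  shows "in_chart c (A_coeff F c) z = cnj (herm (wdzb_vec (in_chart c F) z) (quat_I (in_chart c F z))) /
    (herm (in_chart c F z) (in_chart c F z))\<^sup>2"
  using assms by (auto simp: A_coeff_def dzbar_vec_eq)

text \<open>\<open>A_coeff\<close> is the conjugate of \<open>\<beta> / |F|^2\<close>, and the
  Euler--Lagrange equation says that \<open>wdz\<close> of the latter vanishes.\<close>

lemma holo_A_coeff:
  assumes F: "L0_frame X \<Psi> U F" and c: "c \<in> X"
  shows "holo_fun X (U \<inter> fst c) (A_coeff F c)"
proof -
  define V where "V = U \<inter> fst c"
  have V: "open V" "V \<subseteq> fst c" "V \<inter> fst c = V" using L0_frameD(2)[OF F] chart_open(1)[OF c] by (auto simp: V_def)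
  have FV: "L0_frame X \<Psi> V F" by (rule L0_frame_subset[OF F V(1)]) (simp add: V_def)
  note D = L0_frameD[OF FV]
  let ?D = "snd c ` V"
  define f where "f = in_chart c F"
  have oD: "open ?D" by (rule open_chart_image_sub[OF c V(1,2)])
  have sf: "smooth_on ?D f" "smooth_on ?D (wdzb_vec f)"
    using smooth_funD[OF D(3) c] smooth_fun_dzbar_vec[OF D(3) V(1) c] by (simp_all add: f_def V(3))
  have f0: "f z \<noteq> 0" if "z \<in> ?D" for z
    unfolding f_def using in_chart_image_nonzero[where U = V and z = z, OF c D(4)] that V(3) by simp
  define \<beta> where "\<beta> z = herm (wdzb_vec f z) (quat_I (f z)) / herm (f z) (f z)" for z
  have \<beta>: "smooth_on ?D \<beta>"
    unfolding \<beta>_def by (intro smooth_on_divide smooth_on_herm smooth_on_quat_I oD sf) (simp add: f0)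
  have b: "wdzb_vec f z = \<beta> z *s quat_I (f z)" if z: "z \<in> ?D" for z
  proof -
    obtain p where p: "p \<in> V" "z = snd c p" using z by auto
    then show ?thesis
      using dzbar_frame[OF FV c, of p] V(2) c by (auto simp: \<beta>_def f_def dzbar_vec_eq subset_iff)
  qed
  define k where "k z = \<beta> z / herm (f z) (f z)" for z
  have k: "smooth_on ?D k"
    unfolding k_def by (intro smooth_on_divide smooth_on_herm oD sf \<beta>) (simp add: f0)
  have EL: "wdz k z = 0" if "z \<in> ?D" for z
    unfolding k_def f_def
    by (rule euler_lagrange[OF _ smooth D(1) c V(2)])
      (use crit \<beta> b that in \<open>auto simp: f_def\<close>)
  have "(\<lambda>z. cnj (k z)) holomorphic_on ?D"
    by (rule holomorphic_on_wdzb_zero[OF _ _ oD])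
      (use smooth_on_differentiable[OF smooth_on_cnj[OF oD k]] smooth_on_differentiable[OF k] EL in \<open>auto simp: wirtinger_cnj\<close>)
  moreover have "cnj (k z) = in_chart c (A_coeff F c) z" if "z \<in> ?D" for z
  proof -
    have "cnj (herm (f z) (f z)) = herm (f z) (f z)" by (rule cnj_herm)
    then show ?thesis
      using that V(2) by (subst A_coeff_in_chart[OF c]) (auto simp: k_def \<beta>_def f_def power2_eq_square)
  qed
  ultimately have "in_chart c (A_coeff F c) holomorphic_on ?D" by (rule holomorphic_transform)
  then show ?thesis
    unfolding V_def[symmetric] using c V by (intro holo_funI_local[OF V(1)]) blast
qed

lemma A_coeff_chart_change:
  assumes F: "L0_frame X \<Psi> U F" and c: "c \<in> X" "c' \<in> X" and p: "p \<in> U" "p \<in> fst c \<inter> fst c'"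
  shows "A_coeff F c p = jac c c' p * A_coeff F c' p"
  using dzbar_vec_chart_change[OF L0_frameD(3)[OF F] c p] by (simp add: A_coeff_def)

text \<open>For \<open>G = l F\<close> the two orthogonality conditions leave
  \<open>(\<partial>l/\<partial>cnj z) cnj l |F|^2 = 0\<close>. Thus the frames of
  \<open>L\<^sub>0\<close> do define a holomorphic structure.\<close>

lemma L0_ratio_holomorphic:
  assumes F: "L0_frame X \<Psi> U F" and G: "L0_frame X \<Psi> V G"
  obtains l where "holo_fun X (U \<inter> V) l" "\<And>q. q \<in> U \<inter> V \<Longrightarrow> l q \<noteq> 0" "\<And>q. q \<in> U \<inter> V \<Longrightarrow> G q = l q *s F q"
proof -
  note DF = L0_frameD[OF F] and DG = L0_frameD[OF G]
  obtain l where l: "smooth_fun X (U \<inter> V) l" "\<And>q. q \<in> U \<inter> V \<Longrightarrow> l q \<noteq> 0"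
    "\<And>q. q \<in> U \<inter> V \<Longrightarrow> G q = l q *s F q"
    by (rule lift_ratio[OF DF(1) DG(1)]) blast
  have op: "open (U \<inter> V)" using DF(2) DG(2) by auto
  have "dzbar c l p = 0" if c: "c \<in> X" "p \<in> U \<inter> V \<inter> fst c" for c p
  proof -
    have "dzbar_vec c G p = dzbar c l p *s F p + l p *s dzbar_vec c F p"
      using dzbar_vec_cong[OF op c(1), of p G "\<lambda>q. l q *s F q"] l(3) c
        dzbar_vec_scale[OF smooth_fun_subset[OF DF(3)] l(1) c(1), of p] by auto
    then have "dzbar c l p * cnj (l p) * herm (F p) (F p) = 0"
      using DG(6)[OF c(1), of p] DF(6)[OF c(1), of p] c l(3)[of p] by auto
    then show ?thesis using l(2)[of p] DF(4)[of p] c by auto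
  qed
  then have "holo_fun X (U \<inter> V) l" using holo_fun_iff[OF op l(1)] by blast
  then show thesis using that l by blast
qed

end

context atlas
begin

lemma smooth_fun_isCont: "open U \<Longrightarrow> smooth_fun X U f \<Longrightarrow> p \<in> U \<Longrightarrow> isCont f p"
  using smooth_fun_continuous continuous_on_eq_continuous_at by blast

lemma lim_order_chart:
  assumes c: "c \<in> X" "p \<in> fst c"
  shows "lim_order (in_chart c f) (snd c p) k \<longleftrightarrow>
    (\<exists>m>0. ((\<lambda>q. cmod (f q) / cmod (snd c q - snd c p) ^ k) \<longlongrightarrow> m) (at p))"
proof -
  let ?h = "\<lambda>q. cmod (f q) / cmod (snd c q - snd c p) ^ k"
  have "eventually (\<lambda>w. w \<in> snd c ` fst c) (at (snd c p))"
    using chart_open(2)[OF c(1)] c(2) by (auto simp: eventually_at_topological)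
  then have e: "eventually (\<lambda>w. in_chart c ?h w = cmod (in_chart c f w) / cmod (w - snd c p) ^ k) (at (snd c p))"
    by (rule eventually_mono) (use c in auto)
  have "((\<lambda>w. cmod (in_chart c f w) / cmod (w - snd c p) ^ k) \<longlongrightarrow> m) (at (snd c p)) \<longleftrightarrow> (?h \<longlongrightarrow> m) (at p)" for m
    unfolding tendsto_chart_iff[OF c, symmetric] by (rule filterlim_cong[OF refl refl eventually_mono[OF e]]) simp
  then show ?thesis by (simp add: lim_order_def)
qed

lemma tendsto_chart_ratio:
  assumes c: "c \<in> X" "c' \<in> X" "p \<in> fst c \<inter> fst c'"
  shows "((\<lambda>q. cmod (snd c' q - snd c' p) / cmod (snd c q - snd c p)) \<longlongrightarrow> cmod (jac c c' p)) (at p)"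
proof -
  have pc: "p \<in> fst c" using c by auto
  have "((\<lambda>q. cmod (trn c c' (snd c q) - trn c c' (snd c p)) / cmod (snd c q - snd c p)) \<longlongrightarrow> cmod (jac c c' p)) (at p)"
    by (rule filterlim_compose[OF tendsto_difference_quotient_norm[OF trn_has_derivative[OF c]] filterlim_chart(1)[OF c(1) pc]])
  moreover have "eventually (\<lambda>q. q \<in> fst c) (at p)"
    using chart_open(1)[OF c(1)] pc by (auto simp: eventually_at_topological)
  then have "eventually (\<lambda>q. cmod (trn c c' (snd c q) - trn c c' (snd c p)) / cmod (snd c q - snd c p) =
      cmod (snd c' q - snd c' p) / cmod (snd c q - snd c p)) (at p)"
    by (rule eventually_mono) (use c pc in simp)
  ultimately show ?thesis by (rule Lim_transform_eventually)
qed

text \<open>The quotient of the two coordinate differences at \<open>p\<close> tends in modulus to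
  that of the Jacobian, which is nonzero, so orders do not depend on the chart.\<close>

lemma lim_order_chart_change:
  assumes c: "c \<in> X" "c' \<in> X" "p \<in> fst c \<inter> fst c'" and f: "lim_order (in_chart c f) (snd c p) k"
  shows "lim_order (in_chart c' f) (snd c' p) k"
proof -
  have pc: "p \<in> fst c" "p \<in> fst c'" "p \<in> fst c' \<inter> fst c" using c by auto
  obtain m where m: "m > 0" "((\<lambda>q. cmod (f q) / cmod (snd c q - snd c p) ^ k) \<longlongrightarrow> m) (at p)"
    using f lim_order_chart[OF c(1) pc(1)] by blast
  have "((\<lambda>q. cmod (f q) / cmod (snd c q - snd c p) ^ k * (cmod (snd c q - snd c p) / cmod (snd c' q - snd c' p)) ^ k)
      \<longlongrightarrow> m * cmod (jac c' c p) ^ k) (at p)"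
    by (intro tendsto_mult m tendsto_power tendsto_chart_ratio c pc)
  moreover have "eventually (\<lambda>q. q \<in> fst c \<and> q \<noteq> p) (at p)"
    using chart_open(1)[OF c(1)] pc by (auto simp: eventually_at_topological)
  then have "eventually (\<lambda>q. cmod (f q) / cmod (snd c q - snd c p) ^ k * (cmod (snd c q - snd c p) / cmod (snd c' q - snd c' p)) ^ k
      = cmod (f q) / cmod (snd c' q - snd c' p) ^ k) (at p)"
  proof eventually_elim
    case (elim q)
    then have "snd c q \<noteq> snd c p" using chart_inj[OF c(1)] pc by (auto dest: inj_onD)
    then show ?case by (simp add: power_divide)
  qed
  ultimately have "((\<lambda>q. cmod (f q) / cmod (snd c' q - snd c' p) ^ k) \<longlongrightarrow> m * cmod (jac c' c p) ^ k) (at p)"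
    by (rule Lim_transform_eventually)
  moreover have "m * cmod (jac c' c p) ^ k > 0" using m(1) jac_nonzero[OF c(2,1) pc(3)] by simp
  ultimately show ?thesis unfolding lim_order_chart[OF c(2) pc(2)] by blast
qed

lemma jac_tendsto:
  assumes c: "c \<in> X" "c' \<in> X" "p \<in> fst c \<inter> fst c'"
  shows "(jac c c' \<longlongrightarrow> jac c c' p) (at p)"
proof -
  have pc: "p \<in> fst c" using c by auto
  have "deriv (trn c c') holomorphic_on snd c ` (fst c \<inter> fst c')"
    by (rule holomorphic_deriv[OF trn_holomorphic[OF c(1,2)] open_overlap[OF c(1,2)]])
  then have "isCont (deriv (trn c c')) (snd c p)"
    using holomorphic_on_imp_continuous_on open_overlap[OF c(1,2)] c(3) continuous_on_eq_continuous_at by blast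
  then have "((\<lambda>q. deriv (trn c c') (snd c q)) \<longlongrightarrow> deriv (trn c c') (snd c p)) (at p)"
    unfolding isCont_def by (rule filterlim_compose[OF _ filterlim_chart(1)[OF c(1) pc]])
  then show ?thesis by (simp add: jac_def[abs_def] trn_def)
qed

end

context quat_surface
begin

text \<open>As \<open>dzbar_vec c F p\<close> is a multiple of \<open>I(F p)\<close>, the
  Cauchy--Schwarz inequality for these two vectors is an equality. Hence the coefficient of
  \<open>A\<close> vanishes where \<open>dbar \<Psi>\<close> does, and to the same order.\<close>

lemma norm_A_coeff:
  assumes F: "L0_frame X \<Psi> U F" and c: "c \<in> X" "p \<in> U \<inter> fst c"
  shows "cmod (A_coeff F c p) = norm (dzbar_vec c F p) / norm (F p) ^ 3"
proof -
  have Fp: "F p \<noteq> 0" using L0_frameD(4)[OF F] c by auto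
  define b where "b = herm (dzbar_vec c F p) (quat_I (F p)) / herm (F p) (F p)"
  have e: "dzbar_vec c F p = b *s quat_I (F p)" unfolding b_def by (rule dzbar_frame[OF F c])
  have "cmod (herm (dzbar_vec c F p) (quat_I (F p))) = norm (dzbar_vec c F p) * norm (F p)"
    unfolding e by (simp add: norm_mult herm_self power2_eq_square)
  then show ?thesis
    using Fp by (simp add: A_coeff_def norm_divide norm_mult herm_self power2_eq_square power3_eq_cube)
qed

text \<open>The data in \<open>dbar_leading\<close> refer to some chart and some lift. Passing to
  \<open>c\<close> and \<open>F\<close> introduces only factors with nonzero limits at
  \<open>p\<close>, collected in \<open>e\<close>, so the exponent is the order of
  \<open>A_coeff\<close>.\<close>

lemma dbar_leading_lim_order:
  assumes L: "dbar_leading X \<Psi> p k N" and F: "L0_frame X \<Psi> U F" and c: "c \<in> X" "p \<in> U \<inter> fst c"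
  shows "lim_order (in_chart c (A_coeff F c)) (snd c p) k"
proof -
  obtain c0 U0 F0 G where G: "c0 \<in> X" "p \<in> U0" "U0 \<subseteq> fst c0" "smooth_lift X \<Psi> U0 F0" "continuous_on U0 G" "G p \<noteq> 0"
    "\<forall>q\<in>U0. dbar_Psi X \<Psi> c0 q (F0 q) = cnj (snd c0 q - snd c0 p) ^ k *s G q"
    using L unfolding dbar_leading_def by blast
  note D = L0_frameD[OF F] and D0 = smooth_liftD[OF G(4)]
  have p: "p \<in> U" "p \<in> fst c" "p \<in> fst c \<inter> fst c0" using c G by auto
  define e where "e q = cmod (jac c c0 q) * (norm (F q) / norm (F0 q)) * norm (G q) / norm (F q) ^ 3 *
    (cmod (snd c0 q - snd c0 p) / cmod (snd c q - snd c p)) ^ k" for q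
  have t: "(F \<longlongrightarrow> F p) (at p)" "(F0 \<longlongrightarrow> F0 p) (at p)" "(G \<longlongrightarrow> G p) (at p)"
    using smooth_fun_isCont[OF D(2,3) p(1)] smooth_fun_isCont[OF D0(1,2) G(2)]
      G(5) D0(1) G(2) continuous_on_eq_continuous_at[of U0 G] by (auto simp: isCont_def)
  have nz: "F p \<noteq> 0" "F0 p \<noteq> 0" "jac c c0 p \<noteq> 0"
    using D(4) D0(3) p G(2) jac_nonzero[OF c(1) G(1) p(3)] by auto
  have "(e \<longlongrightarrow> cmod (jac c c0 p) * (norm (F p) / norm (F0 p)) * norm (G p) / norm (F p) ^ 3 * cmod (jac c c0 p) ^ k) (at p)"
    unfolding e_def
    by (intro tendsto_mult tendsto_divide tendsto_norm tendsto_power t jac_tendsto tendsto_chart_ratio c(1) G(1) p)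
      (use nz in auto)
  moreover have "eventually (\<lambda>q. q \<in> U \<inter> U0 \<inter> fst c \<and> q \<noteq> p) (at p)"
    using chart_open(1)[OF c(1)] D(2) D0(1) G(2) p unfolding eventually_at_topological
    by (intro exI[of _ "U \<inter> U0 \<inter> fst c"]) auto
  then have "eventually (\<lambda>q. e q = cmod (A_coeff F c q) / cmod (snd c q - snd c p) ^ k) (at p)"
  proof eventually_elim
    case (elim q)
    then have q: "q \<in> U" "q \<in> U0" "q \<in> fst c" "q \<in> fst c0" "q \<in> U \<inter> fst c" "q \<in> U0 \<inter> fst c" "q \<in> fst c \<inter> fst c0" using G(3) by auto
    obtain a where a: "a \<noteq> 0" "F q = a *s F0 q"
      using cline_eqD[of "F0 q" "F q"] D(4,5)[OF q(1)] D0(4)[OF q(2)] by metis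
    have "dzbar_vec c F q = dbar_Psi X \<Psi> c q (F q)"
      using dbar_Psi_frame[OF F c(1) q(5), of 1] by simp
    also have "\<dots> = a *s dbar_Psi X \<Psi> c q (F0 q)"
      unfolding a(2) using dbar_Psi_lift[OF G(4) c(1) q(6), of a] dbar_Psi_lift[OF G(4) c(1) q(6), of 1] by simp
    also have "dbar_Psi X \<Psi> c q (F0 q) = cnj (jac c c0 q) *s dbar_Psi X \<Psi> c0 q (F0 q)"
      by (rule dbar_Psi_chart_change[OF c(1) G(1) q(7)]) (use D0(4)[OF q(2)] cline_memI in auto)
    finally have n: "norm (dzbar_vec c F q) = cmod a * (cmod (jac c c0 q) * (cmod (snd c0 q - snd c0 p) ^ k * norm (G q)))"
      using G(7) q(2) by (simp add: norm_mult norm_power flip: complex_cnj_diff)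
    have "cmod a = norm (F q) / norm (F0 q)" using a D0(3)[OF q(2)] by simp
    then show ?case
      unfolding norm_A_coeff[OF F c(1) q(5)] n e_def by (simp add: power_divide)
  qed
  ultimately have "((\<lambda>q. cmod (A_coeff F c q) / cmod (snd c q - snd c p) ^ k) \<longlongrightarrow>
      cmod (jac c c0 p) * (norm (F p) / norm (F0 p)) * norm (G p) / norm (F p) ^ 3 * cmod (jac c c0 p) ^ k) (at p)"
    by (rule Lim_transform_eventually)
  moreover have "cmod (jac c c0 p) * (norm (F p) / norm (F0 p)) * norm (G p) / norm (F p) ^ 3 * cmod (jac c c0 p) ^ k > 0"
    using nz G(6) by simp
  ultimately show ?thesis unfolding lim_order_chart[OF c(1) p(2)] by blast
qed

text \<open>The exponent inherits uniqueness from the order of \<open>A_coeff\<close>; this is what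
  gives the description in \<open>dbar_order\<close> its value.\<close>

lemma dbar_leading_unique:
  assumes "dbar_leading X \<Psi> p k N" "dbar_leading X \<Psi> p k' N'"
  shows "k = k'"
proof -
  obtain U F where F: "p \<in> U" "L0_frame X \<Psi> U F" by (rule L0_frame_exists)
  obtain c where c: "c \<in> X" "p \<in> fst c" by (rule chart_cover)
  have p: "p \<in> U \<inter> fst c" using F c by auto
  show ?thesis
    by (rule lim_order_unique[OF dbar_leading_lim_order[OF assms(1) F(2) c(1) p] dbar_leading_lim_order[OF assms(2) F(2) c(1) p]])
qed

lemma dbar_leading_order: "dbar_leading X \<Psi> p (dbar_order X \<Psi> p) (quat_I ` \<Psi> p)"
proof -
  obtain k where k: "dbar_leading X \<Psi> p k (quat_I ` \<Psi> p)" using L_minus1 by (auto simp: is_L_minus1_def)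
  have "dbar_order X \<Psi> p = k"
    unfolding dbar_order_def by (rule the_equality) (use k dbar_leading_unique in blast)+
  then show ?thesis using k by simp
qed

lemma A_coeff_order:
  assumes "L0_frame X \<Psi> U F" "c \<in> X" "p \<in> U \<inter> fst c"
  shows "lim_order (in_chart c (A_coeff F c)) (snd c p) (dbar_order X \<Psi> p)"
  by (rule dbar_leading_lim_order[OF dbar_leading_order assms])

lemma dbar_vanishes_iff:
  assumes F: "L0_frame X \<Psi> U F" and c: "c \<in> X" "p \<in> U \<inter> fst c"
  shows "dbar_vanishes X \<Psi> p \<longleftrightarrow> dzbar_vec c F p = 0"
proof
  have m: "F p \<in> \<Psi> p" using L0_frameD(5)[OF F] c cline_memI by auto
  assume "dbar_vanishes X \<Psi> p"
  then show "dzbar_vec c F p = 0"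
    using m c dbar_Psi_frame[OF F c, of 1] by (simp add: dbar_vanishes_def)
next
  assume 0: "dzbar_vec c F p = 0"
  show "dbar_vanishes X \<Psi> p"
    unfolding dbar_vanishes_def
  proof (intro ballI impI)
    fix c' v assume c': "c' \<in> X" "p \<in> fst c'" and v: "v \<in> \<Psi> p"
    obtain a where "v = a *s F p" using v L0_frameD(5)[OF F] c by (auto simp: cline_def)
    then have "dbar_Psi X \<Psi> c p v = 0" using dbar_Psi_frame[OF F c, of a] 0 by simp
    then show "dbar_Psi X \<Psi> c' p v = 0"
      using dbar_Psi_chart_change[OF c'(1) c(1) _ v] c c' by simp
  qed
qed

text \<open>A positive exponent would make \<open>dbar \<Psi>\<close> vanish at \<open>p\<close>.
  Since the parity assumption speaks of zeros only, this completes it to evenness at every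
  point.\<close>

lemma dbar_order_nonvanishing:
  assumes "\<not> dbar_vanishes X \<Psi> p"
  shows "dbar_order X \<Psi> p = 0"
proof (rule ccontr)
  assume "dbar_order X \<Psi> p \<noteq> 0"
  then obtain k where k: "dbar_order X \<Psi> p = Suc k" using not0_implies_Suc by blast
  obtain c U F G where G: "c \<in> X" "p \<in> U" "U \<subseteq> fst c" "smooth_lift X \<Psi> U F"
    "\<forall>q\<in>U. dbar_Psi X \<Psi> c q (F q) = cnj (snd c q - snd c p) ^ Suc k *s G q"
    using dbar_leading_order[of p] unfolding dbar_leading_def k by blast
  obtain V H where H: "p \<in> V" "L0_frame X \<Psi> V H" by (rule L0_frame_exists)
  have p: "p \<in> V \<inter> fst c" using G H by auto
  obtain a where a: "a \<noteq> 0" "F p = a *s H p"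
    using cline_eqD[of "H p" "F p"] smooth_liftD(3,4)[OF G(4,2)] L0_frameD(5)[OF H(2,1)] by metis
  have "dbar_Psi X \<Psi> c p (F p) = 0" using G(5,2) by simp
  then have "a *s dzbar_vec c H p = 0"
    unfolding a(2) dbar_Psi_frame[OF H(2) G(1) p] .
  then have "dzbar_vec c H p = 0" using a(1) by simp
  then show False using assms dbar_vanishes_iff[OF H(2) G(1) p] by simp
qed

lemma even_dbar_order: "even (dbar_order X \<Psi> p)"
  using even_order dbar_order_nonvanishing by (cases "dbar_vanishes X \<Psi> p") auto

lemma coframe_eq: "F p \<noteq> 0 \<Longrightarrow> coframe F p (a *s F p) = a"
  unfolding coframe_def by (rule the_equality) (auto simp: vector_mul_rcancel)

lemma riesz_coframe:
  assumes "F p \<noteq> 0" "\<Psi> p = cline (F p)"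
  shows "riesz_vector \<Psi> p (coframe F p) = (1 / herm (F p) (F p)) *s F p"
  unfolding riesz_vector_def
proof (rule the_equality)
  have r: "cnj (herm (F p) (F p)) = herm (F p) (F p)" by (rule cnj_herm)
  show "(1 / herm (F p) (F p)) *s F p \<in> \<Psi> p \<and> (\<forall>w\<in>\<Psi> p. coframe F p w = herm w ((1 / herm (F p) (F p)) *s F p))"
    unfolding assms(2) using assms(1) r by (auto simp: cline_def coframe_eq)
  fix v assume v: "v \<in> \<Psi> p \<and> (\<forall>w\<in>\<Psi> p. coframe F p w = herm w v)"
  then obtain b where b: "v = b *s F p" unfolding assms(2) by (auto simp: cline_def)
  have "F p \<in> \<Psi> p" unfolding assms(2) by (rule cline_memI)
  then have "coframe F p (1 *s F p) = herm (1 *s F p) v" using v by simp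
  then have "cnj b * herm (F p) (F p) = 1" unfolding coframe_eq[of F p, OF assms(1)] b by simp
  then have "cnj (cnj b * herm (F p) (F p)) = 1" by simp
  then have "b * herm (F p) (F p) = 1" by (simp add: r)
  then have "b = 1 / herm (F p) (F p)" using assms(1) by (simp add: field_simps)
  then show "v = (1 / herm (F p) (F p)) *s F p" using b by simp
qed

text \<open>Replacing the second frame by \<open>l F\<close> multiplies \<open>I\<close> of it by
  \<open>cnj l\<close> and its squared length by \<open>l cnj l\<close>; after conjugation the
  factor \<open>1 / l\<close> remains, as it must for the dual frame.\<close>

lemma A_hom_eq:
  assumes F: "L0_frame X \<Psi> U F" and G: "L0_frame X \<Psi> V G" and c: "c \<in> X" "p \<in> U \<inter> V \<inter> fst c"
    and l: "G p = l *s F p"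
  shows "A_hom X \<Psi> ((U, F), (V, G)) c p = A_coeff F c p / l"
proof -
  have p: "p \<in> U" "p \<in> V" "p \<in> U \<inter> fst c" using c by auto
  note DF = L0_frameD(4,5)[OF F p(1)] and DG = L0_frameD(4,5)[OF G p(2)]
  have l0: "l \<noteq> 0" using l DG(1) by auto
  have hG: "herm (G p) (G p) = l * cnj l * herm (F p) (F p)" by (simp add: l)
  have r: "cnj (herm (F p) (F p)) = herm (F p) (F p)" by (rule cnj_herm)
  have "A_hom X \<Psi> ((U, F), (V, G)) c p =
      cnj (herm ((1 / herm (F p) (F p)) *s dzbar_vec c F p) (quat_I ((1 / herm (G p) (G p)) *s G p)))"
    by (simp add: A_hom_def A_value_def riesz_coframe[of F, OF DF] riesz_coframe[of G, OF DG] dbar_Psi_frame[OF F c(1) p(3)])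
  also have "\<dots> = A_coeff F c p / l"
    using l0 DF(1) by (simp add: hG l A_coeff_def r power2_eq_square)
  finally show ?thesis .
qed

end

section \<open>Line bundles, the spin structure and the eigenspinors\<close>

section \<open>Line bundles and divisors\<close>

lemma line_bundle_sel_tensor [simp]:
  "frame_set (tensor_bundle L N) = frame_set L \<times> frame_set N"
  "frame_dom (tensor_bundle L N) = (\<lambda>i. frame_dom L (fst i) \<inter> frame_dom N (snd i))"
  "transition (tensor_bundle L N) = (\<lambda>i j p. transition L (fst i) (fst j) p * transition N (snd i) (snd j) p)"
  by (simp_all add: tensor_bundle_def)

lemma line_bundle_sel_dual [simp]:
  "frame_set (dual_bundle L) = frame_set L" "frame_dom (dual_bundle L) = frame_dom L"
  "transition (dual_bundle L) = (\<lambda>i j p. inverse (transition L i j p))"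
  by (simp_all add: dual_bundle_def)

lemma line_bundle_sel_conj [simp]:
  "frame_set (conj_bundle L) = frame_set L" "frame_dom (conj_bundle L) = frame_dom L"
  "transition (conj_bundle L) = (\<lambda>i j p. cnj (transition L i j p))"
  by (simp_all add: conj_bundle_def)

lemma line_bundle_sel_canonical [simp]:
  "frame_set (canonical_bundle X) = X" "frame_dom (canonical_bundle X) = fst"
  by (simp_all add: canonical_bundle_def)

lemma line_bundle_sel_L0 [simp]:
  "frame_set (L0_bundle X \<Psi>) = {(U, F). L0_frame X \<Psi> U F}" "frame_dom (L0_bundle X \<Psi>) = fst"
  by (simp_all add: L0_bundle_def)

lemma transition_L0: "transition (L0_bundle X \<Psi>) = (\<lambda>i j p. THE a. snd j p = a *s snd i p)"
  by (simp add: L0_bundle_def)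

lemma line_bundle_sel_divisor [simp]:
  "frame_set (divisor_bundle X E) = {(V, f). local_equation X E V f}" "frame_dom (divisor_bundle X E) = fst"
  "transition (divisor_bundle X E) = (\<lambda>i j p. Lim (at p) (\<lambda>q. snd i q / snd j q))"
  by (simp_all add: divisor_bundle_def)

lemma line_bundleD:
  assumes "holomorphic_line_bundle X L"
  shows "i \<in> frame_set L \<Longrightarrow> open (frame_dom L i)"
    "(\<Union>i\<in>frame_set L. frame_dom L i) = UNIV"
    "i \<in> frame_set L \<Longrightarrow> j \<in> frame_set L \<Longrightarrow> holo_fun X (frame_dom L i \<inter> frame_dom L j) (transition L i j)"
    "i \<in> frame_set L \<Longrightarrow> j \<in> frame_set L \<Longrightarrow> p \<in> frame_dom L i \<inter> frame_dom L j \<Longrightarrow> transition L i j p \<noteq> 0"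
    "i \<in> frame_set L \<Longrightarrow> p \<in> frame_dom L i \<Longrightarrow> transition L i i p = 1"
    "i \<in> frame_set L \<Longrightarrow> j \<in> frame_set L \<Longrightarrow> k \<in> frame_set L \<Longrightarrow>
      p \<in> frame_dom L i \<inter> frame_dom L j \<inter> frame_dom L k \<Longrightarrow> transition L i k p = transition L i j p * transition L j k p"
  using assms unfolding holomorphic_line_bundle_def by blast+

context atlas
begin

lemma holomorphic_line_bundle_dual:
  assumes "holomorphic_line_bundle X L"
  shows "holomorphic_line_bundle X (dual_bundle L)"
  unfolding holomorphic_line_bundle_def line_bundle_sel_dual
proof (intro conjI ballI)
  note D = line_bundleD[OF assms]
  fix i j assume ij: "i \<in> frame_set L" "j \<in> frame_set L"
  show "holo_fun X (frame_dom L i \<inter> frame_dom L j) (\<lambda>p. inverse (transition L i j p))"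
    by (rule holo_fun_inverse[OF D(3)[OF ij] D(4)[OF ij]])
  show "inverse (transition L i j p) \<noteq> 0" if "p \<in> frame_dom L i \<inter> frame_dom L j" for p
    using D(4)[OF ij that] by simp
  fix k p assume k: "k \<in> frame_set L" "p \<in> frame_dom L i \<inter> frame_dom L j \<inter> frame_dom L k"
  show "inverse (transition L i k p) = inverse (transition L i j p) * inverse (transition L j k p)"
    unfolding D(6)[OF ij k] by simp
qed (use line_bundleD(1,2,5)[OF assms] in auto)

lemma holomorphic_line_bundle_tensor:
  assumes "holomorphic_line_bundle X L" "holomorphic_line_bundle X N"
  shows "holomorphic_line_bundle X (tensor_bundle L N)"
  unfolding holomorphic_line_bundle_def line_bundle_sel_tensor
proof (intro conjI ballI)
  note D = line_bundleD[OF assms(1)] and E = line_bundleD[OF assms(2)]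
  show "(\<Union>i\<in>frame_set L \<times> frame_set N. frame_dom L (fst i) \<inter> frame_dom N (snd i)) = UNIV"
  proof (intro equalityI subset_UNIV subsetI)
    fix p
    obtain i j where "i \<in> frame_set L" "p \<in> frame_dom L i" "j \<in> frame_set N" "p \<in> frame_dom N j"
      using D(2) E(2) by blast
    then show "p \<in> (\<Union>i\<in>frame_set L \<times> frame_set N. frame_dom L (fst i) \<inter> frame_dom N (snd i))"
      by (intro UN_I[of "(i, j)"]) auto
  qed
  fix i assume i: "i \<in> frame_set L \<times> frame_set N"
  then have i': "fst i \<in> frame_set L" "snd i \<in> frame_set N" by auto
  show "open (frame_dom L (fst i) \<inter> frame_dom N (snd i))" by (rule open_Int[OF D(1)[OF i'(1)] E(1)[OF i'(2)]])
  show "transition L (fst i) (fst i) p * transition N (snd i) (snd i) p = 1"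
    if "p \<in> frame_dom L (fst i) \<inter> frame_dom N (snd i)" for p
    using D(5)[OF i'(1), of p] E(5)[OF i'(2), of p] that by simp
  fix j assume "j \<in> frame_set L \<times> frame_set N"
  then have j': "fst j \<in> frame_set L" "snd j \<in> frame_set N" by auto
  show "holo_fun X (frame_dom L (fst i) \<inter> frame_dom N (snd i) \<inter> (frame_dom L (fst j) \<inter> frame_dom N (snd j)))
      (\<lambda>p. transition L (fst i) (fst j) p * transition N (snd i) (snd j) p)"
    by (intro holo_fun_mult holo_fun_subset[OF D(3)[OF i'(1) j'(1)]] holo_fun_subset[OF E(3)[OF i'(2) j'(2)]]) auto
  show "transition L (fst i) (fst j) p * transition N (snd i) (snd j) p \<noteq> 0"
    if "p \<in> frame_dom L (fst i) \<inter> frame_dom N (snd i) \<inter> (frame_dom L (fst j) \<inter> frame_dom N (snd j))" for p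
    using D(4)[OF i'(1) j'(1), of p] E(4)[OF i'(2) j'(2), of p] that by simp
  fix k p assume "k \<in> frame_set L \<times> frame_set N" and p: "p \<in> frame_dom L (fst i) \<inter> frame_dom N (snd i) \<inter>
      (frame_dom L (fst j) \<inter> frame_dom N (snd j)) \<inter> (frame_dom L (fst k) \<inter> frame_dom N (snd k))"
  then have k': "fst k \<in> frame_set L" "snd k \<in> frame_set N" by auto
  show "transition L (fst i) (fst k) p * transition N (snd i) (snd k) p =
      transition L (fst i) (fst j) p * transition N (snd i) (snd j) p *
      (transition L (fst j) (fst k) p * transition N (snd j) (snd k) p)"
    using D(6)[OF i'(1) j'(1) k'(1), of p] E(6)[OF i'(2) j'(2) k'(2), of p] p by simp
qed

lemma local_equation_iff:
  "local_equation X E V f \<longleftrightarrow> open V \<and> holo_fun X V f \<and>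
     (\<forall>c\<in>X. \<forall>p\<in>V \<inter> fst c. lim_order (in_chart c f) (snd c p) (E p))"
proof -
  have "lim_order (in_chart c f) (snd c p) (E p) \<longleftrightarrow>
      (\<exists>\<^sub>F z in at (snd c p). in_chart c f z \<noteq> 0) \<and> zorder (in_chart c f) (snd c p) = int (E p)"
    if "open V" "holo_fun X V f" "c \<in> X" "p \<in> V \<inter> fst c" for c p
    by (rule lim_order_iff_zorder[of _ "snd c ` (V \<inter> fst c)"])
      (use that open_chart_image in \<open>auto simp: holo_fun_def\<close>)
  then show ?thesis unfolding local_equation_def by meson
qed

lemma local_equationI:
  assumes "open V" "holo_fun X V f"
    and "\<And>p. p \<in> V \<Longrightarrow> \<exists>c\<in>X. p \<in> fst c \<and> lim_order (in_chart c f) (snd c p) (E p)"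
  shows "local_equation X E V f"
  unfolding local_equation_iff
proof (intro conjI assms(1,2) ballI)
  fix c p assume c: "c \<in> X" "p \<in> V \<inter> fst c"
  then obtain c' where "c' \<in> X" "p \<in> fst c'" "lim_order (in_chart c' f) (snd c' p) (E p)"
    using assms(3) by blast
  then show "lim_order (in_chart c f) (snd c p) (E p)"
    using lim_order_chart_change[of c' c p f "E p"] c by auto
qed

lemma local_equationD:
  assumes "local_equation X E V f"
  shows "open V" "holo_fun X V f" "\<And>c p. c \<in> X \<Longrightarrow> p \<in> V \<inter> fst c \<Longrightarrow> lim_order (in_chart c f) (snd c p) (E p)"
  using assms unfolding local_equation_iff by blast+

lemma local_equation_subset:
  assumes "local_equation X E V f" "open W" "W \<subseteq> V"
  shows "local_equation X E W f"
  unfolding local_equation_iff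
  using local_equationD[OF assms(1)] holo_fun_subset[OF _ assms(3)] assms(2,3) by auto

lemma local_equation_mult:
  assumes "local_equation X E V f" "local_equation X E' V g" "\<And>p. p \<in> V \<Longrightarrow> E'' p = E p + E' p"
  shows "local_equation X E'' V (\<lambda>p. f p * g p)"
  unfolding local_equation_iff in_chart_o
  using local_equationD[OF assms(1)] local_equationD[OF assms(2)] assms(3) lim_order_mult
  by (auto intro: holo_fun_mult)

lemma local_equation_unit:
  assumes "open V" "holo_fun X V f" "\<And>p. p \<in> V \<Longrightarrow> f p \<noteq> 0"
  shows "local_equation X (\<lambda>p. 0) V f"
proof (rule local_equationI[OF assms(1,2)])
  fix p assume p: "p \<in> V"
  obtain c where c: "c \<in> X" "p \<in> fst c" by (rule chart_cover)
  have "isCont (in_chart c f) (snd c p)"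
    using holomorphic_on_imp_continuous_on[of "in_chart c f" "snd c ` (V \<inter> fst c)"] assms(2) c p
      open_chart_image[OF c(1) assms(1)] continuous_on_eq_continuous_at[of "snd c ` (V \<inter> fst c)"]
    by (auto simp: holo_fun_def)
  then have "lim_order (in_chart c f) (snd c p) 0"
    by (rule lim_order_0) (use assms(3) p c in simp)
  then show "\<exists>c\<in>X. p \<in> fst c \<and> lim_order (in_chart c f) (snd c p) 0" using c by blast
qed

lemma local_equation_nonzero_near:
  assumes "local_equation X E V f" "p \<in> V"
  shows "eventually (\<lambda>q. f q \<noteq> 0) (at p)"
proof -
  obtain c where c: "c \<in> X" "p \<in> fst c" by (rule chart_cover)
  have "eventually (\<lambda>w. in_chart c f w \<noteq> 0) (at (snd c p))"
    using lim_order_frequently[OF local_equationD(3)[OF assms(1) c(1)]] assms(2) c by auto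
  then have "eventually (\<lambda>q. in_chart c f (snd c q) \<noteq> 0) (at p)"
    by (rule eventually_compose_filterlim[OF _ filterlim_chart(1)[OF c]])
  moreover have "eventually (\<lambda>q. q \<in> fst c) (at p)"
    using chart_open(1)[OF c(1)] c(2) by (auto simp: eventually_at_topological)
  ultimately show ?thesis by eventually_elim (use c in simp)
qed

text \<open>The limit fills in removable singularities: at a common zero the pointwise quotient
  would be the default value 0, while the limit is the value of the unit that relates two equations
  of the same divisor.\<close>

definition quot :: "('a \<Rightarrow> complex) \<Rightarrow> ('a \<Rightarrow> complex) \<Rightarrow> 'a \<Rightarrow> complex" where
  "quot f g p = Lim (at p) (\<lambda>q. f q / g q)"

text \<open>Equal orders mean that the same power of the coordinate splits off from \<open>f\<close>
  and \<open>g\<close>. It cancels, and the quotient extends as that of the nonvanishing holomorphic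
  cofactors.\<close>

lemma quot_local:
  assumes f: "local_equation X E V f" and g: "local_equation X E' V g" and E: "\<And>p. p \<in> V \<Longrightarrow> E p = E' p"
    and p: "p \<in> V"
  obtains c W where "c \<in> X" "open W" "p \<in> W" "W \<subseteq> fst c" "W \<subseteq> V"
    "in_chart c (quot f g) holomorphic_on snd c ` W"
    "\<And>q. q \<in> W \<Longrightarrow> quot f g q \<noteq> 0 \<and> f q = quot f g q * g q \<and> ((\<lambda>x. f x / g x) \<longlongrightarrow> quot f g q) (at q)"
proof -
  obtain c where c: "c \<in> X" "p \<in> fst c" by (rule chart_cover)
  let ?S = "snd c ` (V \<inter> fst c)" and ?z = "snd c p"
  have S: "open ?S" "?z \<in> ?S" using open_chart_image[OF c(1) local_equationD(1)[OF f]] p c by auto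
  have hf: "in_chart c f holomorphic_on ?S" "in_chart c g holomorphic_on ?S"
    using local_equationD(2)[OF f] local_equationD(2)[OF g] c(1) by (auto simp: holo_fun_def)
  have of: "lim_order (in_chart c f) ?z (E p)" "lim_order (in_chart c g) ?z (E p)"
    using local_equationD(3)[OF f c(1), of p] local_equationD(3)[OF g c(1), of p] p c E[OF p] by auto
  note zf = of(1)[unfolded lim_order_iff_zorder[OF hf(1) S]] and zg = of(2)[unfolded lim_order_iff_zorder[OF hf(2) S]]
  obtain r1 f1 n1 where f1: "0 < r1" "ball ?z r1 \<subseteq> ?S" "f1 holomorphic_on ball ?z r1" "zorder (in_chart c f) ?z = int n1"
    "\<And>w. w \<in> ball ?z r1 \<Longrightarrow> in_chart c f w = f1 w * (w - ?z) ^ n1" "\<And>w. w \<in> ball ?z r1 \<Longrightarrow> f1 w \<noteq> 0"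
    by (rule holomorphic_zero_factor[OF hf(1) S zf[THEN conjunct1]]) blast
  obtain r2 g1 n2 where g1: "0 < r2" "ball ?z r2 \<subseteq> ?S" "g1 holomorphic_on ball ?z r2" "zorder (in_chart c g) ?z = int n2"
    "\<And>w. w \<in> ball ?z r2 \<Longrightarrow> in_chart c g w = g1 w * (w - ?z) ^ n2" "\<And>w. w \<in> ball ?z r2 \<Longrightarrow> g1 w \<noteq> 0"
    by (rule holomorphic_zero_factor[OF hf(2) S zg[THEN conjunct1]]) blast
  have n: "n1 = n2" using zf zg f1(4) g1(4) by simp
  define r where "r = min r1 r2"
  have r: "0 < r" "ball ?z r \<subseteq> ball ?z r1" "ball ?z r \<subseteq> ball ?z r2" using f1(1) g1(1) by (auto simp: r_def)
  define h where "h w = f1 w / g1 w" for w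
  have h: "h holomorphic_on ball ?z r"
    unfolding h_def using holomorphic_on_subset[OF f1(3) r(2)] holomorphic_on_subset[OF g1(3) r(3)] g1(6) r(3)
    by (intro holomorphic_on_divide) auto
  have lim: "((\<lambda>x. in_chart c f x / in_chart c g x) \<longlongrightarrow> h w) (at w)" if w: "w \<in> ball ?z r" for w
  proof -
    have "isCont h w"
      using holomorphic_on_imp_continuous_on[OF h] w continuous_on_eq_continuous_at[OF open_ball] by blast
    then have "(h \<longlongrightarrow> h w) (at w)" by (simp add: isCont_def)
    moreover have "eventually (\<lambda>x. x \<in> ball ?z r \<and> x \<noteq> ?z) (at w)"
    proof (cases "w = ?z")
      case True
      then show ?thesis using r(1) by (auto simp: eventually_at_topological intro!: exI[of _ "ball ?z r"])
    next
      case False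
      then show ?thesis using w unfolding eventually_at_topological
        by (intro exI[of _ "ball ?z r - {?z}"]) (auto simp: open_Diff)
    qed
    then have "eventually (\<lambda>x. h x = in_chart c f x / in_chart c g x) (at w)"
      by (rule eventually_mono) (use f1(5) g1(5) n r in \<open>auto simp: h_def subset_iff\<close>)
    ultimately show ?thesis by (rule Lim_transform_eventually)
  qed
  define W where "W = V \<inter> (fst c \<inter> snd c -` ball ?z r)"
  have W: "open W" "p \<in> W" "W \<subseteq> fst c" "W \<subseteq> V"
    using open_chart_preimage[OF c(1) open_ball] local_equationD(1)[OF f] p c r(1) by (auto simp: W_def open_Int)
  have tq: "((\<lambda>x. f x / g x) \<longlongrightarrow> h (snd c q)) (at q)" "quot f g q = h (snd c q)" if q: "q \<in> W" for q
  proof -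
    have qb: "q \<in> fst c" "snd c q \<in> ball ?z r" using q by (auto simp: W_def)
    show t: "((\<lambda>x. f x / g x) \<longlongrightarrow> h (snd c q)) (at q)"
      by (rule tendsto_chart_iff[OF c(1) qb(1), THEN iffD1]) (use lim[OF qb(2)] in \<open>simp add: in_chart_o(2)\<close>)
    show "quot f g q = h (snd c q)" unfolding quot_def by (rule tendsto_Lim[OF at_not_bot t])
  qed
  show thesis
  proof (rule that[OF c(1) W])
    have "h holomorphic_on snd c ` W" by (rule holomorphic_on_subset[OF h]) (auto simp: W_def)
    then show "in_chart c (quot f g) holomorphic_on snd c ` W"
      by (rule holomorphic_transform) (use tq(2) W c in auto)
    fix q assume q: "q \<in> W"
    then have qb: "q \<in> fst c" "snd c q \<in> ball ?z r" by (auto simp: W_def)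
    have "f q = f1 (snd c q) * (snd c q - ?z) ^ n1" "g q = g1 (snd c q) * (snd c q - ?z) ^ n1"
      using f1(5)[of "snd c q"] g1(5)[of "snd c q"] qb r n c(1) by auto
    moreover have "f1 (snd c q) \<noteq> 0" "g1 (snd c q) \<noteq> 0" using f1(6) g1(6) qb(2) r by auto
    ultimately show "quot f g q \<noteq> 0 \<and> f q = quot f g q * g q \<and> ((\<lambda>x. f x / g x) \<longlongrightarrow> quot f g q) (at q)"
      using tq[OF q] by (simp add: h_def)
  qed
qed

lemma quot_unit:
  assumes f: "local_equation X E V f" and g: "local_equation X E' V g" and E: "\<And>p. p \<in> V \<Longrightarrow> E p = E' p"
  shows "holo_fun X V (quot f g)" "\<And>p. p \<in> V \<Longrightarrow> quot f g p \<noteq> 0" "\<And>p. p \<in> V \<Longrightarrow> f p = quot f g p * g p"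
    "\<And>p. p \<in> V \<Longrightarrow> ((\<lambda>x. f x / g x) \<longlongrightarrow> quot f g p) (at p)"
proof -
  have *: "quot f g p \<noteq> 0 \<and> f p = quot f g p * g p \<and> ((\<lambda>x. f x / g x) \<longlongrightarrow> quot f g p) (at p)" if p: "p \<in> V" for p
    by (rule quot_local[OF f g E p]) blast+
  then show "\<And>p. p \<in> V \<Longrightarrow> quot f g p \<noteq> 0" "\<And>p. p \<in> V \<Longrightarrow> f p = quot f g p * g p"
    "\<And>p. p \<in> V \<Longrightarrow> ((\<lambda>x. f x / g x) \<longlongrightarrow> quot f g p) (at p)" by blast+
  show "holo_fun X V (quot f g)"
  proof (rule holo_funI_local[OF local_equationD(1)[OF f]])
    fix p assume p: "p \<in> V"
    show "\<exists>c\<in>X. \<exists>W. open W \<and> p \<in> W \<and> W \<subseteq> fst c \<and> in_chart c (quot f g) holomorphic_on snd c ` W"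
      by (rule quot_local[OF f g E p]) blast+
  qed
qed

lemma quot_eqI: "((\<lambda>x. f x / g x) \<longlongrightarrow> l) (at p) \<Longrightarrow> quot f g p = l"
  unfolding quot_def by (rule tendsto_Lim[OF at_not_bot])

lemma transition_divisor: "transition (divisor_bundle X E) i j = quot (snd i) (snd j)"
  by (simp add: quot_def fun_eq_iff)

lemma holomorphic_line_bundle_divisor:
  assumes cover: "\<And>p. \<exists>V f. p \<in> V \<and> local_equation X E V f"
  shows "holomorphic_line_bundle X (divisor_bundle X E)"
proof -
  let ?L = "divisor_bundle X E"
  have q: "holo_fun X (fst i \<inter> fst j) (quot (snd i) (snd j))"
    "\<And>p. p \<in> fst i \<inter> fst j \<Longrightarrow> quot (snd i) (snd j) p \<noteq> 0"
    "\<And>p. p \<in> fst i \<inter> fst j \<Longrightarrow> ((\<lambda>x. snd i x / snd j x) \<longlongrightarrow> quot (snd i) (snd j) p) (at p)"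
    if ij: "i \<in> frame_set ?L" "j \<in> frame_set ?L" for i j
  proof -
    have ei: "local_equation X E (fst i) (snd i)" "local_equation X E (fst j) (snd j)" using ij by auto
    have op: "open (fst i \<inter> fst j)" using local_equationD(1)[OF ei(1)] local_equationD(1)[OF ei(2)] by auto
    note qq = quot_unit[OF local_equation_subset[OF ei(1) op] local_equation_subset[OF ei(2) op] refl, simplified]
    show "holo_fun X (fst i \<inter> fst j) (quot (snd i) (snd j))"
      "\<And>p. p \<in> fst i \<inter> fst j \<Longrightarrow> quot (snd i) (snd j) p \<noteq> 0"
      "\<And>p. p \<in> fst i \<inter> fst j \<Longrightarrow> ((\<lambda>x. snd i x / snd j x) \<longlongrightarrow> quot (snd i) (snd j) p) (at p)"
      using qq(1,2,4) by auto
  qed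
  show ?thesis
    unfolding holomorphic_line_bundle_def transition_divisor
  proof (intro conjI ballI)
    show "open (frame_dom ?L i)" if "i \<in> frame_set ?L" for i
      using that local_equationD(1) by auto
    show "(\<Union>i\<in>frame_set ?L. frame_dom ?L i) = UNIV"
    proof (intro equalityI subset_UNIV subsetI)
      fix p
      obtain V f where "p \<in> V" "local_equation X E V f" using cover by blast
      then show "p \<in> (\<Union>i\<in>frame_set ?L. frame_dom ?L i)" by (intro UN_I[of "(V, f)"]) auto
    qed
    fix i assume i: "i \<in> frame_set ?L"
    have ei: "local_equation X E (fst i) (snd i)" using i by auto
    show "quot (snd i) (snd i) p = 1" if p: "p \<in> frame_dom ?L i" for p
    proof (rule quot_eqI, rule tendsto_eventually)
      show "\<forall>\<^sub>F x in at p. snd i x / snd i x = 1"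
        using local_equation_nonzero_near[OF ei, of p] p by (auto elim!: eventually_mono)
    qed
    fix j assume j: "j \<in> frame_set ?L"
    show "holo_fun X (frame_dom ?L i \<inter> frame_dom ?L j) (quot (snd i) (snd j))" using q(1)[OF i j] by simp
    show "quot (snd i) (snd j) p \<noteq> 0" if "p \<in> frame_dom ?L i \<inter> frame_dom ?L j" for p
      using q(2)[OF i j] that by simp
    fix k p assume k: "k \<in> frame_set ?L" and p: "p \<in> frame_dom ?L i \<inter> frame_dom ?L j \<inter> frame_dom ?L k"
    have ej: "local_equation X E (fst j) (snd j)" using j by auto
    show "quot (snd i) (snd k) p = quot (snd i) (snd j) p * quot (snd j) (snd k) p"
    \<comment> \<open>The cocycle identity for pointwise quotients holds where the middle equation
      \<open>snd j\<close> is nonzero, that is, in a punctured neighbourhood of \<open>p\<close>,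
      and passes to the limit.\<close>
    proof (rule quot_eqI)
      have "((\<lambda>x. snd i x / snd j x * (snd j x / snd k x)) \<longlongrightarrow> quot (snd i) (snd j) p * quot (snd j) (snd k) p) (at p)"
        using q(3)[OF i j, of p] q(3)[OF j k, of p] p by (intro tendsto_mult) auto
      moreover have "\<forall>\<^sub>F x in at p. snd i x / snd j x * (snd j x / snd k x) = snd i x / snd k x"
        using local_equation_nonzero_near[OF ej, of p] p by (auto elim!: eventually_mono)
      ultimately show "((\<lambda>x. snd i x / snd k x) \<longlongrightarrow> quot (snd i) (snd j) p * quot (snd j) (snd k) p) (at p)"
        by (rule Lim_transform_eventually)
    qed
  qed
qed

end

context quat_surface
begin

abbreviation L0 where "L0 \<equiv> L0_bundle X \<Psi>"

lemma L0_transition: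
  assumes F: "L0_frame X \<Psi> U F" and G: "L0_frame X \<Psi> V G" and p: "p \<in> U \<inter> V"
  shows "G p = transition L0 (U, F) (V, G) p *s F p" "transition L0 (U, F) (V, G) p \<noteq> 0"
proof -
  have Fp: "F p \<noteq> 0" "G p \<noteq> 0" using L0_frameD(4)[OF F] L0_frameD(4)[OF G] p by auto
  obtain l where l: "G p = l *s F p"
    using cline_eqD[of "F p" "G p"] L0_frameD(5)[OF F] L0_frameD(5)[OF G] p Fp by (metis IntD1 IntD2)
  have "transition L0 (U, F) (V, G) p = l"
    unfolding transition_L0 snd_conv
  proof (rule the_equality)
    show "G p = l *s F p" by (rule l)
    show "a = l" if "G p = a *s F p" for a using that l Fp(1) by (simp add: vector_mul_rcancel)
  qed
  then show "G p = transition L0 (U, F) (V, G) p *s F p" "transition L0 (U, F) (V, G) p \<noteq> 0" using l Fp by auto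
qed

lemma L0_transition_eq:
  assumes "L0_frame X \<Psi> U F" "L0_frame X \<Psi> V G" "p \<in> U \<inter> V" "G p = a *s F p"
  shows "transition L0 (U, F) (V, G) p = a"
proof -
  have "transition L0 (U, F) (V, G) p *s F p = a *s F p"
    by (rule trans[OF L0_transition(1)[OF assms(1-3), symmetric] assms(4)])
  moreover have "F p \<noteq> 0" using L0_frameD(4)[OF assms(1)] assms(3) by auto
  ultimately show ?thesis by (metis vector_mul_rcancel)
qed

lemma holomorphic_line_bundle_L0: "holomorphic_line_bundle X L0"
proof -
  have tr: "i \<in> frame_set L0 \<Longrightarrow> L0_frame X \<Psi> (fst i) (snd i)" for i by auto
  note t = L0_transition[OF tr tr, unfolded prod.collapse]
  note teq = L0_transition_eq[OF tr tr, unfolded prod.collapse]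
  have fd: "frame_dom L0 = fst" by simp
  show ?thesis
    unfolding holomorphic_line_bundle_def fd
  proof (intro conjI ballI)
    show "open (fst i)" if "i \<in> frame_set L0" for i
      using L0_frameD(2)[OF tr[OF that]] .
    show "(\<Union>i\<in>frame_set L0. fst i) = UNIV"
    proof (intro equalityI subset_UNIV subsetI)
      fix p
      obtain U F where "p \<in> U" "L0_frame X \<Psi> U F" by (rule L0_frame_exists)
      then show "p \<in> (\<Union>i\<in>frame_set L0. fst i)" by (intro UN_I[of "(U, F)"]) auto
    qed
    fix i assume i: "i \<in> frame_set L0"
    show "transition L0 i i p = 1" if "p \<in> fst i" for p
      using teq[OF i i, of p 1] that by simp
    fix j assume j: "j \<in> frame_set L0"
    show "transition L0 i j p \<noteq> 0" if "p \<in> fst i \<inter> fst j" for p using t(2)[OF i j that] .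
    obtain l where l: "holo_fun X (fst i \<inter> fst j) l" "\<And>q. q \<in> fst i \<inter> fst j \<Longrightarrow> l q \<noteq> 0"
      "\<And>q. q \<in> fst i \<inter> fst j \<Longrightarrow> snd j q = l q *s snd i q"
      by (rule L0_ratio_holomorphic[OF tr[OF i] tr[OF j]]) blast
    have op: "open (fst i \<inter> fst j)" using L0_frameD(2)[OF tr[OF i]] L0_frameD(2)[OF tr[OF j]] by auto
    show "holo_fun X (fst i \<inter> fst j) (transition L0 i j)"
      by (rule holo_fun_cong[OF op teq[OF i j, symmetric] l(1)]) (use l(3) in auto)
    fix k p assume k: "k \<in> frame_set L0" and p: "p \<in> fst i \<inter> fst j \<inter> fst k"
    show "transition L0 i k p = transition L0 i j p * transition L0 j k p"
    proof (rule teq[OF i k])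
      show "snd k p = (transition L0 i j p * transition L0 j k p) *s snd i p"
        using t(1)[OF i j, of p] t(1)[OF j k, of p] p by (simp add: mult.commute)
    qed (use p in auto)
  qed
qed

end

section \<open>The spin structure\<close>

context quat_surface
begin

lemma transition_canonical: "transition (canonical_bundle X) = jac"
  by (simp add: canonical_bundle_def jac_def fun_eq_iff)

text \<open>\<open>A_hom\<close> is \<open>A_coeff\<close> divided by the nonvanishing holomorphic
  ratio of the two frames, so it inherits both holomorphy and order.\<close>

lemma A_hom_local_equation:
  assumes F: "L0_frame X \<Psi> U F" and G: "L0_frame X \<Psi> V G" and c: "c \<in> X"
  shows "local_equation X (dbar_order X \<Psi>) (U \<inter> V \<inter> fst c) (A_hom X \<Psi> ((U, F), (V, G)) c)"
proof -
  define W where "W = U \<inter> V \<inter> fst c"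
  have W: "open W" "W \<subseteq> U \<inter> V" "W \<subseteq> U \<inter> fst c"
    using L0_frameD(2)[OF F] L0_frameD(2)[OF G] chart_open(1)[OF c] by (auto simp: W_def)
  obtain l where l: "holo_fun X (U \<inter> V) l" "\<And>q. q \<in> U \<inter> V \<Longrightarrow> l q \<noteq> 0" "\<And>q. q \<in> U \<inter> V \<Longrightarrow> G q = l q *s F q"
    by (rule L0_ratio_holomorphic[OF F G]) blast
  have 1: "local_equation X (dbar_order X \<Psi>) W (A_coeff F c)"
    by (rule local_equationI[OF W(1) holo_fun_subset[OF holo_A_coeff[OF F c] W(3)]])
      (use A_coeff_order[OF F c] c W in blast)
  have 2: "holo_fun X W (\<lambda>q. inverse (l q))"
    by (rule holo_fun_inverse[OF holo_fun_subset[OF l(1) W(2)]]) (use l(2) W(2) in blast)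
  have 3: "local_equation X (dbar_order X \<Psi>) W (\<lambda>q. A_coeff F c q * inverse (l q))"
    by (rule local_equation_mult[OF 1 local_equation_unit[OF W(1) 2]]) (use l(2) W(2) in auto)
  have e: "A_coeff F c q * inverse (l q) = A_hom X \<Psi> ((U, F), (V, G)) c q" if "q \<in> W" for q
    using A_hom_eq[OF F G c, of q "l q"] l(3)[of q] that by (auto simp: W_def divide_inverse)
  have h: "holo_fun X W (A_hom X \<Psi> ((U, F), (V, G)) c)"
    by (rule holo_fun_cong[OF W(1) e local_equationD(2)[OF 3]])
  show ?thesis
    unfolding W_def[symmetric]
  proof (rule local_equationI[OF W(1) h])
    fix p assume p: "p \<in> W"
    have pc: "p \<in> fst c" using p by (auto simp: W_def)
    have "eventually (\<lambda>w. w \<in> snd c ` W) (at (snd c p))"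
      using open_chart_image_sub[OF c W(1)] p by (auto simp: eventually_at_topological W_def)
    then have "eventually (\<lambda>w. in_chart c (\<lambda>q. A_coeff F c q * inverse (l q)) w = in_chart c (A_hom X \<Psi> ((U, F), (V, G)) c) w) (at (snd c p))"
    proof (rule eventually_mono)
      fix w assume "w \<in> snd c ` W"
      then obtain q where q: "q \<in> W" "w = snd c q" by auto
      then have "q \<in> fst c" by (auto simp: W_def)
      then show "in_chart c (\<lambda>q. A_coeff F c q * inverse (l q)) w = in_chart c (A_hom X \<Psi> ((U, F), (V, G)) c) w"
        using e[OF q(1)] c q(2) by simp
    qed
    then have "lim_order (in_chart c (A_hom X \<Psi> ((U, F), (V, G)) c)) (snd c p) (dbar_order X \<Psi> p)"
      by (rule lim_order_cong) (use local_equationD(3)[OF 3 c] p pc in auto)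
    then show "\<exists>c'\<in>X. p \<in> fst c' \<and> lim_order (in_chart c' (A_hom X \<Psi> ((U, F), (V, G)) c)) (snd c' p) (dbar_order X \<Psi> p)"
      using c pc by blast
  qed
qed

lemma A_hom_frame_change:
  assumes F: "L0_frame X \<Psi> U F" and F': "L0_frame X \<Psi> U' F'" and G: "L0_frame X \<Psi> V G" and G': "L0_frame X \<Psi> V' G'"
    and c: "c \<in> X" and p: "p \<in> U" "p \<in> U'" "p \<in> V" "p \<in> V'" "p \<in> fst c"
  shows "A_hom X \<Psi> ((U', F'), (V', G')) c p =
    inverse (transition L0 (U, F) (U', F') p) * inverse (transition L0 (V, G) (V', G') p) * A_hom X \<Psi> ((U, F), (V, G)) c p"
proof -
  define a b l where "a = transition L0 (U, F) (U', F') p" and "b = transition L0 (V, G) (V', G') p"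
    and "l = transition L0 (U, F) (V, G) p"
  have a: "F' p = a *s F p" "a \<noteq> 0" and b: "G' p = b *s G p" "b \<noteq> 0" and l: "G p = l *s F p" "l \<noteq> 0"
    unfolding a_def b_def l_def using L0_transition[OF F F'] L0_transition[OF G G'] L0_transition[OF F G] p by auto
  have pp: "p \<in> U \<inter> V \<inter> fst c" "p \<in> U' \<inter> V' \<inter> fst c" "p \<in> U \<inter> U' \<inter> fst c" "p \<in> U' \<inter> U \<inter> fst c" using p by auto
  \<comment> \<open>The ratio of the frames is holomorphic, so \<open>dzbar_vec\<close> scales by
    \<open>a\<close> alone. Together with \<open>I(a F) = cnj a I(F)\<close> and the fourth power of
    \<open>|a|\<close> in the denominator this leaves \<open>1 / a^2\<close>.\<close>
  have "A_coeff F' c p = A_coeff F c p / (a * a)"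
  proof -
    obtain m where m: "holo_fun X (U \<inter> U') m" "\<And>q. q \<in> U \<inter> U' \<Longrightarrow> m q \<noteq> 0" "\<And>q. q \<in> U \<inter> U' \<Longrightarrow> F' q = m q *s F q"
      by (rule L0_ratio_holomorphic[OF F F']) blast
    have op: "open (U \<inter> U')" using L0_frameD(2)[OF F] L0_frameD(2)[OF F'] by auto
    have sm: "smooth_fun X (U \<inter> U') m" by (rule holo_fun_smooth[OF op m(1)])
    have Fp: "F p \<noteq> 0" using L0_frameD(4)[OF F p(1)] .
    have "m p *s F p = a *s F p" by (rule trans[OF m(3)[symmetric] a(1)]) (use p in auto)
    then have ma: "m p = a" using Fp by (simp add: vector_mul_rcancel)
    have "dzbar c m p = 0" using holo_fun_iff[OF op sm] m(1) c p by blast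
    then have "dzbar_vec c F' p = a *s dzbar_vec c F p"
      using dzbar_vec_cong[OF op c, of p F' "\<lambda>q. m q *s F q"] m(3) p ma
        dzbar_vec_scale[OF smooth_fun_subset[OF L0_frameD(3)[OF F]] sm c, of p] by auto
    then show ?thesis
      using a(2) Fp by (simp add: A_coeff_def a(1) power2_eq_square)
  qed
  moreover have "G' p = (b * l / a) *s F' p" using a b l by simp
  note A_hom_eq[OF F' G' c pp(2) this]
  ultimately show ?thesis
    unfolding A_hom_eq[OF F G c pp(1) l(1)] a_def[symmetric] b_def[symmetric]
    using a(2) b(2) l(2) by (simp add: field_simps)
qed

lemma A_hom_chart_change:
  assumes F: "L0_frame X \<Psi> U F" and G: "L0_frame X \<Psi> V G" and c: "c \<in> X" "c' \<in> X"
    and p: "p \<in> U \<inter> V" "p \<in> fst c \<inter> fst c'"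
  shows "A_hom X \<Psi> ((U, F), (V, G)) c p = jac c c' p * A_hom X \<Psi> ((U, F), (V, G)) c' p"
proof -
  have l: "G p = transition L0 (U, F) (V, G) p *s F p" by (rule L0_transition(1)[OF F G p(1)])
  have pp: "p \<in> U \<inter> V \<inter> fst c" "p \<in> U \<inter> V \<inter> fst c'" "p \<in> U" using p by auto
  show ?thesis
    unfolding A_hom_eq[OF F G c(1) pp(1) l] A_hom_eq[OF F G c(2) pp(2) l] A_coeff_chart_change[OF F c pp(3) p(2)]
    by simp
qed

lemma A_hom_holomorphic:
  "holomorphic_hom_with_divisor X (tensor_bundle (dual_bundle L0) (dual_bundle L0))
    (canonical_bundle X) (A_hom X \<Psi>) (dbar_order X \<Psi>)"
  unfolding holomorphic_hom_with_divisor_def holomorphic_hom_def transition_canonical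
proof (intro conjI ballI)
  let ?T = "tensor_bundle (dual_bundle L0) (dual_bundle L0)"
  fix i c assume i: "i \<in> frame_set ?T" and c: "c \<in> frame_set (canonical_bundle X)"
  obtain U F V G where i': "i = ((U, F), (V, G))" by (metis prod.exhaust)
  have FG: "L0_frame X \<Psi> U F" "L0_frame X \<Psi> V G" using i by (auto simp: i')
  have cX: "c \<in> X" using c by simp
  show 1: "local_equation X (dbar_order X \<Psi>) (frame_dom ?T i \<inter> frame_dom (canonical_bundle X) c) (A_hom X \<Psi> i c)"
    using A_hom_local_equation[OF FG cX] by (simp add: i')
  show "holo_fun X (frame_dom ?T i \<inter> frame_dom (canonical_bundle X) c) (A_hom X \<Psi> i c)"
    by (rule local_equationD(2)[OF 1])
next
  let ?T = "tensor_bundle (dual_bundle L0) (dual_bundle L0)"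
  fix i j c p assume i: "i \<in> frame_set ?T" and j: "j \<in> frame_set ?T" and c: "c \<in> frame_set (canonical_bundle X)"
    and p: "p \<in> frame_dom ?T i \<inter> frame_dom ?T j \<inter> frame_dom (canonical_bundle X) c"
  obtain U F V G where i': "i = ((U, F), (V, G))" by (metis prod.exhaust)
  obtain U' F' V' G' where j': "j = ((U', F'), (V', G'))" by (metis prod.exhaust)
  show "A_hom X \<Psi> j c p = transition ?T i j p * A_hom X \<Psi> i c p"
    using A_hom_frame_change[of U F U' F' V G V' G' c p] i j c p by (auto simp: i' j')
next
  let ?T = "tensor_bundle (dual_bundle L0) (dual_bundle L0)"
  fix i c c' p assume i: "i \<in> frame_set ?T" and c: "c \<in> frame_set (canonical_bundle X)" "c' \<in> frame_set (canonical_bundle X)"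
    and p: "p \<in> frame_dom ?T i \<inter> frame_dom (canonical_bundle X) c \<inter> frame_dom (canonical_bundle X) c'"
  obtain U F V G where i': "i = ((U, F), (V, G))" by (metis prod.exhaust)
  have FG: "L0_frame X \<Psi> U F" "L0_frame X \<Psi> V G" "c \<in> X" "c' \<in> X" using i c by (auto simp: i')
  show "A_hom X \<Psi> i c p = jac c c' p * A_hom X \<Psi> i c' p"
    unfolding i' by (rule A_hom_chart_change[OF FG]) (use p in \<open>auto simp: i'\<close>)
qed

abbreviation half where "half \<equiv> half_divisor X \<Psi>"

text \<open>Evenness enters here: halving with \<open>div\<close> loses nothing, so two half
  divisors add up to the zero divisor of \<open>dbar \<Psi>\<close>.\<close>

lemma half_double: "half p + half p = dbar_order X \<Psi> p"
  using even_dbar_order[of p] by (auto elim!: evenE simp: half_divisor_def)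

text \<open>The coefficient of \<open>A\<close> has a finite order at every point, hence is nonzero
  in a punctured neighbourhood.\<close>

lemma nonvanishing_near: "eventually (\<lambda>q. \<not> dbar_vanishes X \<Psi> q) (at p)"
proof -
  obtain U F where F: "p \<in> U" "L0_frame X \<Psi> U F" by (rule L0_frame_exists)
  obtain c where c: "c \<in> X" "p \<in> fst c" by (rule chart_cover)
  have pc: "p \<in> U \<inter> U \<inter> fst c" using F c by auto
  have "eventually (\<lambda>q. A_hom X \<Psi> ((U, F), (U, F)) c q \<noteq> 0) (at p)"
    by (rule local_equation_nonzero_near[OF A_hom_local_equation[OF F(2) F(2) c(1)] pc])
  moreover have "open (U \<inter> fst c)" using L0_frameD(2)[OF F(2)] chart_open(1)[OF c(1)] by auto
  then have "eventually (\<lambda>q. q \<in> U \<inter> fst c) (at p)"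
    using pc unfolding eventually_at_topological by blast
  ultimately show ?thesis
  proof eventually_elim
    case (elim q)
    then have "A_coeff F c q \<noteq> 0"
      using A_hom_eq[OF F(2) F(2) c(1), of q 1] by auto
    then have "dzbar_vec c F q \<noteq> 0" by (auto simp: A_coeff_def)
    then show ?case using dbar_vanishes_iff[OF F(2) c(1), of q] elim by auto
  qed
qed

text \<open>Zeros of \<open>dbar \<Psi>\<close> are isolated, so near \<open>p\<close> the half
  divisor is concentrated at \<open>p\<close>, and a power of the centred coordinate is an equation
  for it.\<close>

lemma half_divisor_cover: "\<exists>V f. p \<in> V \<and> local_equation X half V f"
proof -
  obtain c where c: "c \<in> X" "p \<in> fst c" by (rule chart_cover)
  obtain S where S: "open S" "p \<in> S" "\<And>q. q \<in> S \<Longrightarrow> q \<noteq> p \<Longrightarrow> \<not> dbar_vanishes X \<Psi> q"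
    using nonvanishing_near[of p] unfolding eventually_at_topological by blast
  define V where "V = S \<inter> fst c"
  have V: "open V" "p \<in> V" "V \<subseteq> fst c" using S chart_open(1)[OF c(1)] c by (auto simp: V_def)
  define f where "f q = (snd c q - snd c p) ^ half p" for q
  have hf: "in_chart c f holomorphic_on snd c ` V"
  proof (rule holomorphic_transform)
    show "(\<lambda>w. (w - snd c p) ^ half p) holomorphic_on snd c ` V" by (intro holomorphic_intros)
  qed (use V c in \<open>auto simp: f_def\<close>)
  have h: "holo_fun X V f"
    by (rule holo_funI_local[OF V(1)]) (use hf V c in blast)
  have "local_equation X half V f"
  proof (rule local_equationI[OF V(1) h])
    fix q assume q: "q \<in> V"
    have op: "open (snd c ` V)" by (rule open_chart_image_sub[OF c(1) V(1,3)])
    have "lim_order (in_chart c f) (snd c q) (half q)"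
    proof (cases "q = p")
      case True
      show ?thesis
        unfolding True
        by (rule lim_order_of_factor[OF op _ continuous_on_const[of _ 1]]) (use V c in \<open>auto simp: f_def\<close>)
    next
      case False
      have "half q = 0"
        using dbar_order_nonvanishing[OF S(3)[of q]] q False by (simp add: V_def half_divisor_def)
      moreover have "isCont (in_chart c f) (snd c q)"
        using holomorphic_on_imp_continuous_on[OF hf] op q continuous_on_eq_continuous_at by blast
      moreover have "f q \<noteq> 0"
        using False q V c chart_inj[OF c(1)] by (auto simp: f_def dest: inj_onD)
      ultimately show ?thesis using lim_order_0[where f = "in_chart c f" and z = "snd c q"] q V(3) c(1) by auto
    qed
    then show "\<exists>c\<in>X. q \<in> fst c \<and> lim_order (in_chart c f) (snd c q) (half q)" using c(1) q V(3) by blast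
  qed
  then show ?thesis using V(2) by blast
qed

abbreviation S where "S \<equiv> S_Psi X \<Psi>"

lemma S_sel:
  "frame_set S = {(U, F). L0_frame X \<Psi> U F} \<times> {(V, f). local_equation X half V f}"
  "frame_dom S i = fst (fst i) \<inter> fst (snd i)"
  "transition S i j p = inverse (transition L0 (fst i) (fst j) p) * quot (snd (snd i)) (snd (snd j)) p"
  by (simp_all add: S_Psi_def quot_def)

lemma holomorphic_line_bundle_S: "holomorphic_line_bundle X S"
  unfolding S_Psi_def
  by (intro holomorphic_line_bundle_tensor holomorphic_line_bundle_dual holomorphic_line_bundle_L0
      holomorphic_line_bundle_divisor half_divisor_cover)

text \<open>\<open>\<iota>(e\<^sub>i \<otimes> e\<^sub>j)\<close> for \<open>e\<^sub>i = F\<^sub>i\<^sup>* \<otimes> e\<^bsub>f\<^esub>\<close> is \<open>A(F\<^sub>i\<^sup>* \<otimes> F\<^sub>j\<^sup>*) / (f\<^sub>i f\<^sub>j)\<close>, continued over the zeros.\<close>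

definition spin_iso ::
  "('a, 'm \<times> 2) spin_frame \<times> ('a, 'm \<times> 2) spin_frame \<Rightarrow> 'a chart \<Rightarrow> 'a \<Rightarrow> complex" where
  "spin_iso i c = quot (A_hom X \<Psi> (fst (fst i), fst (snd i)) c)
     (\<lambda>q. snd (snd (fst i)) q * snd (snd (snd i)) q)"

text \<open>Numerator and denominator are equations of the same divisor: \<open>A\<close> vanishes
  on that of \<open>dbar \<Psi>\<close>, and each of the two frames contributes one half. The
  quotient is therefore a holomorphic unit.\<close>

lemma spin_iso_props:
  assumes i: "i \<in> frame_set S" and j: "j \<in> frame_set S" and c: "c \<in> X"
  defines "W \<equiv> frame_dom S i \<inter> frame_dom S j \<inter> fst c"
  shows "holo_fun X W (spin_iso (i, j) c)" "\<And>p. p \<in> W \<Longrightarrow> spin_iso (i, j) c p \<noteq> 0"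
    "\<And>p. p \<in> W \<Longrightarrow> A_hom X \<Psi> (fst i, fst j) c p = spin_iso (i, j) c p * (snd (snd i) p * snd (snd j) p)"
    "\<And>p. p \<in> W \<Longrightarrow> ((\<lambda>q. A_hom X \<Psi> (fst i, fst j) c q / (snd (snd i) q * snd (snd j) q)) \<longlongrightarrow> spin_iso (i, j) c p) (at p)"
proof -
  obtain U F V f where i': "i = ((U, F), (V, f))" by (metis prod.exhaust)
  obtain U' F' V' f' where j': "j = ((U', F'), (V', f'))" by (metis prod.exhaust)
  have L: "L0_frame X \<Psi> U F" "L0_frame X \<Psi> U' F'" "local_equation X half V f" "local_equation X half V' f'"
    using i j by (auto simp: i' j' S_sel)
  have W: "open W" "W \<subseteq> U \<inter> U' \<inter> fst c" "W \<subseteq> V" "W \<subseteq> V'"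
    using L0_frameD(2)[OF L(1)] L0_frameD(2)[OF L(2)] local_equationD(1)[OF L(3)] local_equationD(1)[OF L(4)]
      chart_open(1)[OF c] by (auto simp: W_def i' j' S_sel)
  have A: "local_equation X (dbar_order X \<Psi>) W (A_hom X \<Psi> (fst i, fst j) c)"
    using local_equation_subset[OF A_hom_local_equation[OF L(1,2) c] W(1,2)] by (simp add: i' j')
  have f: "local_equation X (dbar_order X \<Psi>) W (\<lambda>q. snd (snd i) q * snd (snd j) q)"
    using local_equation_mult[OF local_equation_subset[OF L(3) W(1,3)] local_equation_subset[OF L(4) W(1,4)] half_double[symmetric]]
    by (simp add: i' j')
  note q = quot_unit[OF A f refl]
  show "holo_fun X W (spin_iso (i, j) c)" "\<And>p. p \<in> W \<Longrightarrow> spin_iso (i, j) c p \<noteq> 0"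
    "\<And>p. p \<in> W \<Longrightarrow> A_hom X \<Psi> (fst i, fst j) c p = spin_iso (i, j) c p * (snd (snd i) p * snd (snd j) p)"
    "\<And>p. p \<in> W \<Longrightarrow> ((\<lambda>q. A_hom X \<Psi> (fst i, fst j) c q / (snd (snd i) q * snd (snd j) q)) \<longlongrightarrow> spin_iso (i, j) c p) (at p)"
    using q by (simp_all add: spin_iso_def)
qed

lemma induced_by_spin_iso: "induced_by_A X \<Psi> spin_iso"
  unfolding induced_by_A_def
proof (intro ballI)
  fix i j c p assume "i \<in> frame_set S" "j \<in> frame_set S" "c \<in> X" "p \<in> frame_dom S i \<inter> frame_dom S j \<inter> fst c"
  then show "snd (snd i) p * snd (snd j) p * spin_iso (i, j) c p = A_hom X \<Psi> (fst i, fst j) c p"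
    using spin_iso_props(3) by (simp add: mult.commute)
qed

lemma L0_transition_tendsto:
  assumes F: "L0_frame X \<Psi> U F" and G: "L0_frame X \<Psi> V G" and p: "p \<in> U \<inter> V"
  shows "((\<lambda>q. inverse (transition L0 (U, F) (V, G) q)) \<longlongrightarrow> inverse (transition L0 (U, F) (V, G) p)) (at p)"
proof -
  have "holo_fun X (U \<inter> V) (transition L0 (U, F) (V, G))"
    using line_bundleD(3)[OF holomorphic_line_bundle_L0, of "(U, F)" "(V, G)"] F G by simp
  moreover have op: "open (U \<inter> V)" using L0_frameD(2)[OF F] L0_frameD(2)[OF G] by auto
  ultimately have "isCont (transition L0 (U, F) (V, G)) p"
    using smooth_fun_isCont[OF op holo_fun_smooth[OF op] p] by blast
  then show ?thesis
    unfolding isCont_def using L0_transition(2)[OF assms] by (rule tendsto_inverse)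
qed

lemma quot_half_tendsto:
  assumes f: "local_equation X half V f" and f': "local_equation X half V' f'" and p: "p \<in> V \<inter> V'"
  shows "((\<lambda>q. f q / f' q) \<longlongrightarrow> quot f f' p) (at p)"
proof -
  have op: "open (V \<inter> V')" using local_equationD(1)[OF f] local_equationD(1)[OF f'] by auto
  show ?thesis
    by (rule quot_unit(4)[OF local_equation_subset[OF f op] local_equation_subset[OF f' op] refl p]) auto
qed

text \<open>Off the zeros the rule is the one for \<open>A_hom\<close> divided by the local
  equations. Each factor has a limit at \<open>p\<close>, so the rule passes to the continued
  values.\<close>

lemma spin_iso_frame_change:
  assumes i: "i1 \<in> frame_set S" "i2 \<in> frame_set S" and j: "j1 \<in> frame_set S" "j2 \<in> frame_set S" and c: "c \<in> X"
    and p: "p \<in> frame_dom S i1 \<inter> frame_dom S i2" "p \<in> frame_dom S j1 \<inter> frame_dom S j2" "p \<in> fst c"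
  shows "spin_iso (j1, j2) c p = transition S i1 j1 p * transition S i2 j2 p * spin_iso (i1, i2) c p"
proof -
  obtain U1 F1 V1 f1 where i1: "i1 = ((U1, F1), (V1, f1))" by (metis prod.exhaust)
  obtain U2 F2 V2 f2 where i2: "i2 = ((U2, F2), (V2, f2))" by (metis prod.exhaust)
  obtain U3 F3 V3 f3 where j1: "j1 = ((U3, F3), (V3, f3))" by (metis prod.exhaust)
  obtain U4 F4 V4 f4 where j2: "j2 = ((U4, F4), (V4, f4))" by (metis prod.exhaust)
  have L: "L0_frame X \<Psi> U1 F1" "L0_frame X \<Psi> U2 F2" "L0_frame X \<Psi> U3 F3" "L0_frame X \<Psi> U4 F4"
    "local_equation X half V1 f1" "local_equation X half V2 f2" "local_equation X half V3 f3" "local_equation X half V4 f4"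
    using i j by (auto simp: i1 i2 j1 j2 S_sel)
  have pp: "p \<in> U1" "p \<in> U2" "p \<in> U3" "p \<in> U4" "p \<in> V1" "p \<in> V2" "p \<in> V3" "p \<in> V4"
    using p by (auto simp: i1 i2 j1 j2 S_sel)
  let ?a = "\<lambda>q. inverse (transition L0 (U1, F1) (U3, F3) q)" and ?b = "\<lambda>q. inverse (transition L0 (U2, F2) (U4, F4) q)"
  let ?A = "A_hom X \<Psi> ((U1, F1), (U2, F2)) c" and ?A' = "A_hom X \<Psi> ((U3, F3), (U4, F4)) c"
  have "((\<lambda>q. (?a q * (f1 q / f3 q)) * (?b q * (f2 q / f4 q)) * (?A q / (f1 q * f2 q))) \<longlongrightarrow>
      (?a p * quot f1 f3 p) * (?b p * quot f2 f4 p) * spin_iso (i1, i2) c p) (at p)"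
  proof -
    have a: "(?a \<longlongrightarrow> ?a p) (at p)" by (rule L0_transition_tendsto[OF L(1,3)]) (use pp in simp)
    have b: "(?b \<longlongrightarrow> ?b p) (at p)" by (rule L0_transition_tendsto[OF L(2,4)]) (use pp in simp)
    have q1: "((\<lambda>q. f1 q / f3 q) \<longlongrightarrow> quot f1 f3 p) (at p)" by (rule quot_half_tendsto[OF L(5,7)]) (use pp in simp)
    have q2: "((\<lambda>q. f2 q / f4 q) \<longlongrightarrow> quot f2 f4 p) (at p)" by (rule quot_half_tendsto[OF L(6,8)]) (use pp in simp)
    have s: "((\<lambda>q. ?A q / (f1 q * f2 q)) \<longlongrightarrow> spin_iso (i1, i2) c p) (at p)"
      using spin_iso_props(4)[OF i c, of p] p by (simp add: i1 i2)
    show ?thesis by (rule tendsto_mult[OF tendsto_mult[OF tendsto_mult[OF a q1] tendsto_mult[OF b q2]] s])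
  qed
  moreover have "eventually (\<lambda>q. q \<in> U1 \<inter> U2 \<inter> U3 \<inter> U4 \<inter> fst c) (at p)"
    using pp p(3) L0_frameD(2)[OF L(1)] L0_frameD(2)[OF L(2)] L0_frameD(2)[OF L(3)] L0_frameD(2)[OF L(4)] chart_open(1)[OF c]
    unfolding eventually_at_topological by (intro exI[of _ "U1 \<inter> U2 \<inter> U3 \<inter> U4 \<inter> fst c"]) auto
  then have "eventually (\<lambda>q. (?a q * (f1 q / f3 q)) * (?b q * (f2 q / f4 q)) * (?A q / (f1 q * f2 q)) = ?A' q / (f3 q * f4 q)) (at p)"
    using local_equation_nonzero_near[OF L(5) pp(5)] local_equation_nonzero_near[OF L(6) pp(6)]
  proof eventually_elim
    case (elim q)
    have "?A' q = ?a q * ?b q * ?A q"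
      by (rule A_hom_frame_change[OF L(1,3,2,4) c]) (use elim in auto)
    then show ?case using elim by (simp add: field_simps)
  qed
  ultimately have "((\<lambda>q. ?A' q / (f3 q * f4 q)) \<longlongrightarrow> (?a p * quot f1 f3 p) * (?b p * quot f2 f4 p) * spin_iso (i1, i2) c p) (at p)"
    by (rule Lim_transform_eventually)
  then have "quot ?A' (\<lambda>q. f3 q * f4 q) p = (?a p * quot f1 f3 p) * (?b p * quot f2 f4 p) * spin_iso (i1, i2) c p"
    by (rule quot_eqI)
  moreover have "spin_iso (j1, j2) c p = quot ?A' (\<lambda>q. f3 q * f4 q) p" by (simp add: spin_iso_def j1 j2)
  ultimately show ?thesis by (simp add: S_sel i1 i2 j1 j2)
qed

lemma spin_iso_chart_change:
  assumes i: "i \<in> frame_set S" "j \<in> frame_set S" and c: "c \<in> X" "c' \<in> X"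
    and p: "p \<in> frame_dom S i \<inter> frame_dom S j" "p \<in> fst c \<inter> fst c'"
  shows "spin_iso (i, j) c p = jac c c' p * spin_iso (i, j) c' p"
proof -
  obtain U F V f where i': "i = ((U, F), (V, f))" by (metis prod.exhaust)
  obtain U' F' V' f' where j': "j = ((U', F'), (V', f'))" by (metis prod.exhaust)
  have L: "L0_frame X \<Psi> U F" "L0_frame X \<Psi> U' F'" using i by (auto simp: i' j' S_sel)
  have pp: "p \<in> U" "p \<in> U'" using p by (auto simp: i' j' S_sel)
  let ?A = "A_hom X \<Psi> ((U, F), (U', F'))"
  have "((\<lambda>q. jac c c' q * (?A c' q / (f q * f' q))) \<longlongrightarrow> jac c c' p * spin_iso (i, j) c' p) (at p)"
    using spin_iso_props(4)[OF i c(2), of p] p by (intro tendsto_mult jac_tendsto c p) (simp add: i' j')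
  moreover have "eventually (\<lambda>q. q \<in> U \<inter> U' \<inter> (fst c \<inter> fst c')) (at p)"
    using pp p(2) L0_frameD(2)[OF L(1)] L0_frameD(2)[OF L(2)] chart_open(1)[OF c(1)] chart_open(1)[OF c(2)]
    unfolding eventually_at_topological by (intro exI[of _ "U \<inter> U' \<inter> (fst c \<inter> fst c')"]) auto
  then have "eventually (\<lambda>q. jac c c' q * (?A c' q / (f q * f' q)) = ?A c q / (f q * f' q)) (at p)"
    by (rule eventually_mono) (use A_hom_chart_change[OF L c] in auto)
  ultimately have "((\<lambda>q. ?A c q / (f q * f' q)) \<longlongrightarrow> jac c c' p * spin_iso (i, j) c' p) (at p)"
    by (rule Lim_transform_eventually)
  then have "quot (?A c) (\<lambda>q. f q * f' q) p = jac c c' p * spin_iso (i, j) c' p" by (rule quot_eqI)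
  then show ?thesis by (simp add: spin_iso_def i' j')
qed

lemma spin_structure_S: "spin_structure X S spin_iso"
  unfolding spin_structure_def holomorphic_iso_def holomorphic_hom_def transition_canonical line_bundle_sel_canonical
proof (intro conjI holomorphic_line_bundle_S ballI)
  fix i c assume i: "i \<in> frame_set (tensor_bundle S S)" and c: "c \<in> X"
  have i': "fst i \<in> frame_set S" "snd i \<in> frame_set S" using i by auto
  show "holo_fun X (frame_dom (tensor_bundle S S) i \<inter> fst c) (spin_iso i c)"
    using spin_iso_props(1)[OF i' c] by simp
  show "spin_iso i c p \<noteq> 0" if "p \<in> frame_dom (tensor_bundle S S) i \<inter> fst c" for p
    using spin_iso_props(2)[OF i' c, of p] that by simp
next
  fix i j c p assume i: "i \<in> frame_set (tensor_bundle S S)" "j \<in> frame_set (tensor_bundle S S)" and c: "c \<in> X"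
    and p: "p \<in> frame_dom (tensor_bundle S S) i \<inter> frame_dom (tensor_bundle S S) j \<inter> fst c"
  show "spin_iso j c p = transition (tensor_bundle S S) i j p * spin_iso i c p"
    using spin_iso_frame_change[of "fst i" "snd i" "fst j" "snd j" c p] i c p by auto
next
  fix i c c' p assume i: "i \<in> frame_set (tensor_bundle S S)" and c: "c \<in> X" "c' \<in> X"
    and p: "p \<in> frame_dom (tensor_bundle S S) i \<inter> fst c \<inter> fst c'"
  show "spin_iso i c p = jac c c' p * spin_iso i c' p"
    using spin_iso_chart_change[of "fst i" "snd i" c c' p] i c p by auto
qed

end

section \<open>The eigenspinors\<close>

lemma sum_norm_sq_components:
  fixes v :: "complex ^ ('m::finite \<times> 2)"
  shows "(\<Sum>j\<in>UNIV. (cmod (v $ (j, 1)))\<^sup>2 + (cmod (v $ (j, 2)))\<^sup>2) = (norm v)\<^sup>2"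
proof -
  have "(norm v)\<^sup>2 = (\<Sum>i\<in>UNIV. (cmod (v $ i))\<^sup>2)"
    by (simp add: norm_vec_def L2_set_def sum_nonneg)
  then show ?thesis by (simp add: sum_prod_2)
qed

context quat_surface
begin

text \<open>Orthogonality makes \<open>perp\<close> act trivially, so \<open>g\<^sub>\<Psi>\<close>
  has the coefficient \<open>4 |dzbar F|^2 / |F|^2\<close>, where
  \<open>|dzbar F| = |A| |F|^3\<close>. The background metric \<open>k\<close> cancels, which is the
  independence of \<open>g\<^sub>\<Psi>\<close> from it.\<close>

lemma sqrt_g_Psi:
  assumes k: "conformal_metric X k" and F: "L0_frame X \<Psi> U F" and c: "c \<in> X" "p \<in> U \<inter> fst c"
  shows "sqrt (g_Psi X k \<Psi> c p) = 2 * cmod (A_coeff F c p) * (norm (F p))\<^sup>2"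
proof -
  have kp: "k c p \<noteq> 0" using conformal_metricD(1)[OF k c(1), of p] c by auto
  have Fp: "F p \<noteq> 0" using L0_frameD(4)[OF F] c by auto
  have "perp (F p) (dzbar_vec c F p) = dzbar_vec c F p" by (rule perp_eq[OF L0_frameD(6)[OF F c]])
  then have "g_Psi X k \<Psi> c p = 4 * (norm (dzbar_vec c F p))\<^sup>2 / (norm (F p))\<^sup>2"
    using norm_sq_lift(2)[OF k L0_frameD(1)[OF F] c] kp by (simp add: g_Psi_def fs4_sq_def dzbar_vec_eq)
  also have "\<dots> = (2 * cmod (A_coeff F c p) * (norm (F p))\<^sup>2)\<^sup>2"
    using Fp by (simp add: norm_A_coeff[OF F c] power2_eq_square power3_eq_cube field_simps)
  finally show ?thesis by (simp add: real_sqrt_unique)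
qed

text \<open>In the frame \<open>F\<^sup>* \<otimes> e\<^sub>f\<close> the \<open>k\<close>-th coordinate function of \<open>\<complex>\<^sup>2\<^sup>m\<close>, restricted to \<open>L\<^sub>0\<close> and multiplied by
  \<open>1\<^bsub>D/2\<^esub>\<close>, has the coefficient \<open>f F\<^sub>k\<close>. The factor \<open>\<surd>2\<close> makes the sum of the squared lengths equal to 1.\<close>

definition coord_section :: "'m \<times> 2 \<Rightarrow> ('a, 'm \<times> 2) spin_frame \<Rightarrow> 'a \<Rightarrow> complex" where
  "coord_section k i p = of_real (sqrt 2) * (snd (snd i) p * snd (fst i) p $ k)"

definition spinor ::
  "'m \<Rightarrow> (('a, 'm \<times> 2) spin_frame \<Rightarrow> 'a \<Rightarrow> complex) \<times> (('a, 'm \<times> 2) spin_frame \<Rightarrow> 'a \<Rightarrow> complex)" where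
  "spinor j = (coord_section (j, 1), \<lambda>i p. cnj (coord_section (j, 2) i p))"

lemma spinor_coords_eq: "spinor_coords spinor i p = (of_real (sqrt 2) * snd (snd i) p) *s snd (fst i) p"
proof -
  have "spinor_coords spinor i p $ (j, k) = ((of_real (sqrt 2) * snd (snd i) p) *s snd (fst i) p) $ (j, k)" for j k
    using exhaust_2[of k] by (auto simp: spinor_coords_def spinor_def coord_section_def)
  then show ?thesis by (simp add: vec_eq_iff)
qed

lemma smooth_coord_section:
  "smooth_section X S (coord_section k)" "smooth_section X (conj_bundle S) (\<lambda>i p. cnj (coord_section k i p))"
proof -
  have sm: "smooth_fun X (frame_dom S i) (coord_section k i)" if i: "i \<in> frame_set S" for i
  proof -
    obtain U F V f where i': "i = ((U, F), (V, f))" by (metis prod.exhaust)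
    have L: "L0_frame X \<Psi> U F" "local_equation X half V f" using i by (auto simp: i' S_sel)
    have op: "open (U \<inter> V)" using L0_frameD(2)[OF L(1)] local_equationD(1)[OF L(2)] by auto
    have "smooth_fun X (U \<inter> V) (\<lambda>p. of_real (sqrt 2) * (f p * F p $ k))"
      by (intro smooth_fun_mult smooth_fun_const smooth_fun_vec_nth op
          smooth_fun_subset[OF holo_fun_smooth[OF local_equationD(1,2)[OF L(2)]]] smooth_fun_subset[OF L0_frameD(3)[OF L(1)]]) auto
    then show ?thesis by (simp add: coord_section_def[abs_def] i' S_sel)
  qed
  have tr: "coord_section k i p = transition S i j p * coord_section k j p"
    if ij: "i \<in> frame_set S" "j \<in> frame_set S" and p: "p \<in> frame_dom S i \<inter> frame_dom S j" for i j p
  proof -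
    obtain U F V f where i': "i = ((U, F), (V, f))" by (metis prod.exhaust)
    obtain U' F' V' f' where j': "j = ((U', F'), (V', f'))" by (metis prod.exhaust)
    have L: "L0_frame X \<Psi> U F" "local_equation X half V f" "L0_frame X \<Psi> U' F'" "local_equation X half V' f'"
      using ij by (auto simp: i' j' S_sel)
    have pp: "p \<in> U \<inter> U'" "p \<in> V \<inter> V'" using p by (auto simp: i' j' S_sel)
    have op: "open (V \<inter> V')" using local_equationD(1)[OF L(2)] local_equationD(1)[OF L(4)] by auto
    have "f p = quot f f' p * f' p"
      by (rule quot_unit(3)[OF local_equation_subset[OF L(2) op] local_equation_subset[OF L(4) op] refl pp(2)]) auto
    moreover have "F' p = transition L0 (U, F) (U', F') p *s F p" "transition L0 (U, F) (U', F') p \<noteq> 0"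
      using L0_transition[OF L(1,3) pp(1)] by auto
    ultimately show ?thesis by (simp add: coord_section_def i' j' S_sel)
  qed
  have op: "open (frame_dom S i)" if "i \<in> frame_set S" for i
    using line_bundleD(1)[OF holomorphic_line_bundle_S that] .
  show "smooth_section X S (coord_section k)"
    unfolding smooth_section_def using sm tr by blast
  show "smooth_section X (conj_bundle S) (\<lambda>i p. cnj (coord_section k i p))"
    unfolding smooth_section_def line_bundle_sel_conj complex_cnj_mult[symmetric] complex_cnj_cancel_iff
    using smooth_fun_cnj[OF op sm] tr by blast
qed

text \<open>Expressed by \<open>A_coeff\<close>, the factor \<open>\<beta>\<close> is
  \<open>cnj A |F|^2\<close>; \<open>I\<close> exchanges the two coordinates of a pair, with one
  sign. That sign matches the one in the Dirac operator.\<close>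

lemma dzbar_frame_components:
  assumes F: "L0_frame X \<Psi> U F" and c: "c \<in> X" "p \<in> U \<inter> fst c"
  shows "dzbar c (\<lambda>q. F q $ (j, 1)) p = - cnj (A_coeff F c p) * of_real ((norm (F p))\<^sup>2) * cnj (F p $ (j, 2))"
    "dzbar c (\<lambda>q. F q $ (j, 2)) p = cnj (A_coeff F c p) * of_real ((norm (F p))\<^sup>2) * cnj (F p $ (j, 1))"
proof -
  have Fp: "F p \<noteq> 0" using L0_frameD(4)[OF F] c by auto
  have h: "cnj (herm (F p) (F p)) = herm (F p) (F p)" by (rule cnj_herm)
  have "herm (dzbar_vec c F p) (quat_I (F p)) / herm (F p) (F p) = cnj (A_coeff F c p) * herm (F p) (F p)"
    using Fp by (simp add: A_coeff_def h power2_eq_square)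
  then have "dzbar_vec c F p = (cnj (A_coeff F c p) * herm (F p) (F p)) *s quat_I (F p)"
    using dzbar_frame[OF F c] by simp
  then have "dzbar_vec c F p $ k = cnj (A_coeff F c p) * of_real ((norm (F p))\<^sup>2) * quat_I (F p) $ k" for k
    by (simp add: herm_self)
  from this[of "(j, 1)"] this[of "(j, 2)"]
  show "dzbar c (\<lambda>q. F q $ (j, 1)) p = - cnj (A_coeff F c p) * of_real ((norm (F p))\<^sup>2) * cnj (F p $ (j, 2))"
    "dzbar c (\<lambda>q. F q $ (j, 2)) p = cnj (A_coeff F c p) * of_real ((norm (F p))\<^sup>2) * cnj (F p $ (j, 1))"
    by (simp_all add: dzbar_vec_def quat_I_def)
qed

lemma dzbar_mult_holo:
  assumes V: "open V" and y: "holo_fun X V y" and f: "smooth_fun X V f" and c: "c \<in> X" "p \<in> V \<inter> fst c"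
  shows "dzbar c (\<lambda>q. y q * f q) p = y p * dzbar c f p"
proof -
  have "dzbar c y p = 0" using holo_fun_iff[OF V holo_fun_smooth[OF V y]] y c by blast
  then show ?thesis
    using smooth_fun_in_chart_differentiable[OF f c] smooth_fun_in_chart_differentiable[OF holo_fun_smooth[OF V y] c] c
    by (simp add: dzbar_eq in_chart_o(2)[of c "(*)" y f] wirtinger_mult)
qed

lemma dzbar_cong:
  assumes "open V" "c \<in> X" "p \<in> V \<inter> fst c" "\<And>q. q \<in> V \<Longrightarrow> f q = h q"
  shows "dzbar c f p = dzbar c h p" "dz c f p = dz c h p"
proof -
  have e: "in_chart c f z = in_chart c h z" if "z \<in> snd c ` (V \<inter> fst c)" for z
    using assms(2,4) that by auto
  show "dzbar c f p = dzbar c h p" "dz c f p = dz c h p"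
    unfolding dzbar_eq dz_eq
    by (rule wirtinger_cong[OF open_chart_image[OF assms(2,1)] _ e]; use assms(3) in blast)+
qed

text \<open>Relative to \<open>s0\<close> with \<open>s0 \<otimes> s0 = dz\<close>, the spinor
  components are, up to \<open>\<surd>2\<close> and a conjugation, \<open>y F_k\<close> with
  \<open>y\<close> a holomorphic square root of \<open>A\<close>. The equation reduces to
  \<open>y cnj A = |A| cnj y\<close>; the factors \<open>2\<close>, \<open>|A|\<close> and
  \<open>|F|^2\<close> cancel against \<open>sqrt g\<^sub>\<Psi>\<close> and leave the eigenvalue
  1.\<close>

lemma spinor_dirac:
  assumes k: "conformal_metric X k"
  shows "dirac_on X S spin_iso (g_Psi X k \<Psi>) {p. \<not> dbar_vanishes X \<Psi> p} (spinor j) (spinor j)"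
  unfolding dirac_on_def
proof (intro allI impI ballI)
  fix c i V u p
  assume root: "root_of_dz X S spin_iso c i V u" and p': "p \<in> V \<inter> {p. \<not> dbar_vanishes X \<Psi> p}"
  obtain U F W f where i: "i = ((U, F), (W, f))" by (metis prod.exhaust)
  have c: "c \<in> X" and iS: "i \<in> frame_set S" and V: "open V" "V \<subseteq> fst c" "V \<subseteq> frame_dom S i"
    and u: "holo_fun X V u" and sq: "\<And>q. q \<in> V \<Longrightarrow> u q * u q * spin_iso (i, i) c q = 1"
    using root by (auto simp: root_of_dz_def)
  have L: "L0_frame X \<Psi> U F" "local_equation X half W f" using iS by (auto simp: i S_sel)
  have VU: "V \<subseteq> U" "V \<subseteq> W" using V(3) by (auto simp: i S_sel)
  have p: "p \<in> V" "p \<in> V \<inter> fst c" "p \<in> U \<inter> fst c" "\<not> dbar_vanishes X \<Psi> p" using p' V VU by auto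
  have u0: "u q \<noteq> 0" if "q \<in> V" for q using sq[OF that] by auto
  define y where "y q = f q * inverse (u q)" for q
  have y: "holo_fun X V y"
    unfolding y_def
    by (intro holo_fun_mult holo_fun_inverse holo_fun_subset[OF local_equationD(2)[OF L(2)] VU(2)] u) (use u0 in auto)
  define A H where "A = A_coeff F c p" and "H = (norm (F p))\<^sup>2"
  have Fp: "F p \<noteq> 0" using L0_frameD(4)[OF L(1)] p VU by auto
  have H: "H > 0" using Fp by (simp add: H_def)
  have A0: "A \<noteq> 0"
  proof
    assume "A = 0"
    then have "norm (dzbar_vec c F p) = 0" using norm_A_coeff[OF L(1) c p(3)] Fp by (simp add: A_def)
    then show False using dbar_vanishes_iff[OF L(1) c p(3)] p(4) by simp
  qed
  \<comment> \<open>From \<open>u^2 \<iota> = 1\<close> and \<open>\<iota> f^2 = A\<close> one gets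
    \<open>(f / u)^2 = A\<close>.\<close>
  have yy: "y p * y p = A"
  proof -
    have "A_hom X \<Psi> (fst i, fst i) c p = A"
      using A_hom_eq[OF L(1,1) c, of p 1] p(3) by (simp add: i A_def)
    moreover have "A_hom X \<Psi> (fst i, fst i) c p = spin_iso (i, i) c p * (f p * f p)"
      using spin_iso_props(3)[OF iS iS c, of p] p V by (auto simp: i)
    ultimately have "A = spin_iso (i, i) c p * (f p * f p)" by simp
    moreover have "spin_iso (i, i) c p = inverse (u p) * inverse (u p)"
      using sq[OF p(1)] u0[OF p(1)] by (simp add: field_simps)
    ultimately show ?thesis by (simp add: y_def)
  qed
  have yu: "y p * u p = f p" using u0[OF p(1)] by (simp add: y_def)
  have cA: "cmod A = cmod (y p) * cmod (y p)" unfolding yy[symmetric] by (rule norm_mult)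
  have yc: "cnj (y p) * A = of_real (cmod A) * y p"
  proof -
    have "cnj (y p) * A = (y p * cnj (y p)) * y p" unfolding yy[symmetric] by simp
    also have "y p * cnj (y p) = of_real ((cmod (y p))\<^sup>2)" by (rule complex_norm_square[symmetric])
    finally show ?thesis unfolding cA power2_eq_square .
  qed
  have ycc: "y p * cnj A = of_real (cmod A) * cnj (y p)"
    using arg_cong[OF yc, of cnj] by simp
  have sm: "smooth_fun X V (\<lambda>q. F q $ k)" for k
    by (rule smooth_fun_vec_nth[OF V(1) smooth_fun_subset[OF L0_frameD(3)[OF L(1)] VU(1)]])
  note comp = dzbar_frame_components[OF L(1) c p(3), folded A_def H_def]
  have d1: "dzbar c (\<lambda>q. fst (spinor j) i q / u q) p = of_real (sqrt 2) * (y p * (- cnj A * of_real H * cnj (F p $ (j, 2))))"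
  proof -
    have "dzbar c (\<lambda>q. fst (spinor j) i q / u q) p = dzbar c (\<lambda>q. (of_real (sqrt 2) * y q) * F q $ (j, 1)) p"
      by (rule dzbar_cong(1)[OF V(1) c p(2)]) (simp add: spinor_def coord_section_def i y_def divide_inverse)
    also have "\<dots> = of_real (sqrt 2) * y p * dzbar c (\<lambda>q. F q $ (j, 1)) p"
      by (rule dzbar_mult_holo[OF V(1) _ sm c p(2)])
        (use y in \<open>auto simp: holo_fun_def in_chart_o(1)[of _ "\<lambda>v. of_real (sqrt 2) * v"] intro!: holomorphic_intros\<close>)
    finally show ?thesis unfolding comp by simp
  qed
  have d2: "dz c (\<lambda>q. snd (spinor j) i q / cnj (u q)) p = of_real (sqrt 2) * (cnj (y p) * (A * of_real H * F p $ (j, 1)))"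
  proof -
    let ?w = "\<lambda>q. (of_real (sqrt 2) * y q) * F q $ (j, 2)"
    have hy: "holo_fun X V (\<lambda>q. of_real (sqrt 2) * y q)"
      using y by (auto simp: holo_fun_def in_chart_o(1)[of _ "\<lambda>v. of_real (sqrt 2) * v"] intro!: holomorphic_intros)
    have sw: "smooth_fun X V ?w"
      by (rule smooth_fun_mult[OF V(1) holo_fun_smooth[OF V(1) hy] sm])
    have "dz c (\<lambda>q. snd (spinor j) i q / cnj (u q)) p = dz c (\<lambda>q. cnj (?w q)) p"
      by (rule dzbar_cong(2)[OF V(1) c p(2)]) (simp add: spinor_def coord_section_def i y_def divide_inverse)
    also have "\<dots> = cnj (dzbar c ?w p)"
      unfolding dz_eq dzbar_eq in_chart_o(1)[of c cnj ?w]
      by (rule wirtinger_cnj(1)[OF smooth_fun_in_chart_differentiable[OF sw c p(2)]])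
    also have "dzbar c ?w p = of_real (sqrt 2) * y p * dzbar c (\<lambda>q. F q $ (j, 2)) p"
      by (rule dzbar_mult_holo[OF V(1) hy sm c p(2)])
    finally show ?thesis unfolding comp by simp
  qed
  have sg: "sqrt (g_Psi X k \<Psi> c p) = 2 * cmod A * H"
    unfolding A_def H_def by (rule sqrt_g_Psi[OF k L(1) c p(3)])
  have cA0: "complex_of_real (cmod A) \<noteq> 0" "complex_of_real H \<noteq> 0" using A0 H by auto
  show "fst (spinor j) i p =
      2 * complex_of_real (1 / sqrt (g_Psi X k \<Psi> c p)) * dz c (\<lambda>q. snd (spinor j) i q / cnj (u q)) p * u p \<and>
    snd (spinor j) i p =
      - 2 * complex_of_real (1 / sqrt (g_Psi X k \<Psi> c p)) * dzbar c (\<lambda>q. fst (spinor j) i q / u q) p * cnj (u p)"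
  proof
    have "2 * complex_of_real (1 / sqrt (g_Psi X k \<Psi> c p)) * dz c (\<lambda>q. snd (spinor j) i q / cnj (u q)) p * u p =
        of_real (sqrt 2) * ((cnj (y p) * A) * F p $ (j, 1) * u p) / of_real (cmod A)"
      unfolding sg d2 using cA0 by (simp add: field_simps)
    also have "\<dots> = of_real (sqrt 2) * ((y p * u p) * F p $ (j, 1))"
      unfolding yc using cA0 by (simp add: field_simps)
    finally show "fst (spinor j) i p =
        2 * complex_of_real (1 / sqrt (g_Psi X k \<Psi> c p)) * dz c (\<lambda>q. snd (spinor j) i q / cnj (u q)) p * u p"
      unfolding yu by (simp add: spinor_def coord_section_def i)
    have "- 2 * complex_of_real (1 / sqrt (g_Psi X k \<Psi> c p)) * dzbar c (\<lambda>q. fst (spinor j) i q / u q) p * cnj (u p) =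
        of_real (sqrt 2) * ((y p * cnj A) * cnj (F p $ (j, 2)) * cnj (u p)) / of_real (cmod A)"
      unfolding sg d1 using cA0 by (simp add: field_simps)
    also have "\<dots> = of_real (sqrt 2) * (cnj (y p * u p) * cnj (F p $ (j, 2)))"
      unfolding ycc using cA0 by (simp add: field_simps)
    finally show "snd (spinor j) i p =
        - 2 * complex_of_real (1 / sqrt (g_Psi X k \<Psi> c p)) * dzbar c (\<lambda>q. fst (spinor j) i q / u q) p * cnj (u p)"
      unfolding yu by (simp add: spinor_def coord_section_def i)
  qed
qed

lemma spinor_eigen:
  assumes "conformal_metric X k"
  shows "eigenspinor_on X S spin_iso (g_Psi X k \<Psi>) {p. \<not> dbar_vanishes X \<Psi> p} 1 (spinor j)"
  unfolding eigenspinor_on_def smooth_spinor_def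
  using spinor_dirac[OF assms, of j] smooth_coord_section by (simp add: spinor_def)

text \<open>Order 0 means that the modulus has a positive limit at \<open>p\<close>, and by
  continuity this limit is \<open>|f p|\<close>.\<close>

lemma local_equation_nonzero:
  assumes "local_equation X E V f" "p \<in> V" "E p = 0"
  shows "f p \<noteq> 0"
proof
  assume f0: "f p = 0"
  obtain c where c: "c \<in> X" "p \<in> fst c" by (rule chart_cover)
  have "isCont f p"
    using smooth_fun_isCont[OF local_equationD(1)[OF assms(1)] holo_fun_smooth[OF local_equationD(1,2)[OF assms(1)]] assms(2)] .
  then have "((\<lambda>q. cmod (f q)) \<longlongrightarrow> 0) (at p)"
    using f0 tendsto_norm by (fastforce simp: isCont_def)
  moreover obtain m where "m > 0" "((\<lambda>q. cmod (f q) / cmod (snd c q - snd c p) ^ 0) \<longlongrightarrow> m) (at p)"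
    using local_equationD(3)[OF assms(1) c(1), of p] assms(2,3) c lim_order_chart[OF c] by auto
  ultimately show False using tendsto_unique[OF at_not_bot] by fastforce
qed

text \<open>In every frame the coordinate vector is the lift \<open>F\<close> times
  \<open>\<surd>2 f\<close>, hence spans \<open>\<Psi> p\<close> where it is nonzero. It can vanish
  only at zeros of \<open>dbar \<Psi>\<close>; these are isolated and the surface has no isolated
  points, whence the density.\<close>

lemma spinor_homogeneous_coords: "has_homogeneous_coords S \<Psi> (spinor_coords spinor)"
  unfolding has_homogeneous_coords_def
proof (intro conjI ballI impI)
  show "continuous_map_CP \<Psi>"
    unfolding continuous_map_CP_def
  proof
    fix p
    obtain U F where F: "p \<in> U" "smooth_lift X \<Psi> U F" using smooth unfolding smooth_map_CP_def by blast
    then show "\<exists>U F. p \<in> U \<and> open U \<and> continuous_on U F \<and> (\<forall>q\<in>U. F q \<noteq> 0 \<and> \<Psi> q = cline (F q))"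
      using smooth_liftD[OF F(2)] smooth_fun_continuous by blast
  qed
  have nv: "\<exists>i\<in>frame_set S. q \<in> frame_dom S i \<and> spinor_coords spinor i q \<noteq> 0" if q: "\<not> dbar_vanishes X \<Psi> q" for q
  proof -
    obtain U F where F: "q \<in> U" "L0_frame X \<Psi> U F" by (rule L0_frame_exists)
    obtain V f where f: "q \<in> V" "local_equation X half V f" using half_divisor_cover by blast
    have "half q = 0" using dbar_order_nonvanishing[OF q] by (simp add: half_divisor_def)
    then have "f q \<noteq> 0" by (rule local_equation_nonzero[OF f(2,1)])
    then have "spinor_coords spinor ((U, F), (V, f)) q \<noteq> 0"
      using L0_frameD(4)[OF F(2,1)] by (simp add: spinor_coords_eq)
    then show ?thesis using F f by (intro bexI[of _ "((U, F), (V, f))"]) (auto simp: S_sel)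
  qed
  show "closure {p. \<exists>i\<in>frame_set S. p \<in> frame_dom S i \<and> spinor_coords spinor i p \<noteq> 0} = UNIV"
  proof (intro equalityI subset_UNIV subsetI)
    fix p
    show "p \<in> closure {p. \<exists>i\<in>frame_set S. p \<in> frame_dom S i \<and> spinor_coords spinor i p \<noteq> 0}"
      unfolding closure_iff_nhds_not_empty
    proof (intro allI impI)
      fix A T assume T: "T \<subseteq> A" "open T" "p \<in> T"
      have "eventually (\<lambda>q. q \<in> T) (at p)" using T unfolding eventually_at_topological by blast
      then have "eventually (\<lambda>q. q \<in> T \<and> \<not> dbar_vanishes X \<Psi> q) (at p)"
        using nonvanishing_near by (rule eventually_conj)
      then obtain q where "q \<in> T" "\<not> dbar_vanishes X \<Psi> q"
        using eventually_happens'[OF at_not_bot] by blast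
      then show "{p. \<exists>i\<in>frame_set S. p \<in> frame_dom S i \<and> spinor_coords spinor i p \<noteq> 0} \<inter> A \<noteq> {}"
        using nv T by blast
    qed
  qed
  fix i p assume i: "i \<in> frame_set S" "p \<in> frame_dom S i" "spinor_coords spinor i p \<noteq> 0"
  obtain U F V f where i': "i = ((U, F), (V, f))" by (metis prod.exhaust)
  have L: "L0_frame X \<Psi> U F" "p \<in> U" using i by (auto simp: i' S_sel)
  have "f p \<noteq> 0" using i(3) by (auto simp: spinor_coords_eq i')
  then show "\<Psi> p = cline (spinor_coords spinor i p)"
    using L0_frameD(5)[OF L] by (simp add: spinor_coords_eq i' cline_scale)
qed

text \<open>By \<open>\<iota> f^2 = A\<close> the length is
  \<open>2 |A| |F_l|^2 / (2 |A| |F|^2)\<close>, independent of frame, chart and lift. The assumption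
  on \<open>s\<close> concerns moduli, so that both halves of a spinor, one of them conjugated, are
  covered.\<close>

lemma coord_section_norm:
  assumes k: "conformal_metric X k" and p: "\<not> dbar_vanishes X \<Psi> p" and v: "v \<in> \<Psi> p" "v \<noteq> 0"
    and s: "\<And>i. cmod (s i p) = cmod (coord_section l i p)"
  shows "spin_norm_sq X S spin_iso (g_Psi X k \<Psi>) s p = (cmod (v $ l))\<^sup>2 / (norm v)\<^sup>2"
proof -
  have val: "cmod (s i p * s i p * spin_iso (i, i) c p) / sqrt (g_Psi X k \<Psi> c p) = (cmod (v $ l))\<^sup>2 / (norm v)\<^sup>2"
    if i: "i \<in> frame_set S" and c: "c \<in> X" and pi: "p \<in> frame_dom S i \<inter> fst c" for i c
  proof -
    obtain U F V f where i': "i = ((U, F), (V, f))" by (metis prod.exhaust)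
    have L: "L0_frame X \<Psi> U F" using i by (auto simp: i' S_sel)
    have pu: "p \<in> U \<inter> fst c" using pi by (auto simp: i' S_sel)
    have Fp: "F p \<noteq> 0" "\<Psi> p = cline (F p)" using L0_frameD(4,5)[OF L] pu by auto
    obtain a where a: "v = a *s F p" using v(1) Fp by (auto simp: cline_def)
    then have a0: "a \<noteq> 0" using v(2) by auto
    define A where "A = A_coeff F c p"
    have A0: "A \<noteq> 0"
    proof
      assume "A = 0"
      then have "norm (dzbar_vec c F p) = 0" using norm_A_coeff[OF L c pu] Fp by (simp add: A_def)
      then show False using dbar_vanishes_iff[OF L c pu] p by simp
    qed
    have "A_hom X \<Psi> (fst i, fst i) c p = A"
      using A_hom_eq[OF L L c, of p 1] pu by (simp add: i' A_def)
    moreover have "A_hom X \<Psi> (fst i, fst i) c p = spin_iso (i, i) c p * (f p * f p)"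
      using spin_iso_props(3)[OF i i c, of p] pi by (auto simp: i')
    ultimately have "A = spin_iso (i, i) c p * (f p * f p)" by simp
    then have "cmod A = cmod (spin_iso (i, i) c p) * (cmod (f p) * cmod (f p))" by (simp only: norm_mult)
    then have "cmod (s i p * s i p * spin_iso (i, i) c p) = 2 * (cmod (F p $ l))\<^sup>2 * cmod A"
      by (simp add: norm_mult s coord_section_def i' power2_eq_square)
    then have "cmod (s i p * s i p * spin_iso (i, i) c p) / sqrt (g_Psi X k \<Psi> c p) = (cmod (F p $ l))\<^sup>2 / (norm (F p))\<^sup>2"
      unfolding sqrt_g_Psi[OF k L c pu] A_def[symmetric] using A0 by simp
    also have "\<dots> = (cmod (v $ l))\<^sup>2 / (norm v)\<^sup>2"
      using a0 by (simp add: a norm_mult power_mult_distrib)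
    finally show ?thesis .
  qed
  obtain U F where F: "p \<in> U" "L0_frame X \<Psi> U F" by (rule L0_frame_exists)
  obtain V f where f: "p \<in> V" "local_equation X half V f" using half_divisor_cover by blast
  obtain c where c: "c \<in> X" "p \<in> fst c" by (rule chart_cover)
  have i: "((U, F), (V, f)) \<in> frame_set S" "p \<in> frame_dom S ((U, F), (V, f)) \<inter> fst c"
    using F f c by (auto simp: S_sel)
  show ?thesis
    unfolding spin_norm_sq_def
  proof (rule the_equality)
    show "\<exists>i\<in>frame_set S. \<exists>c\<in>X. p \<in> frame_dom S i \<inter> fst c \<and>
        (cmod (v $ l))\<^sup>2 / (norm v)\<^sup>2 = cmod (s i p * s i p * spin_iso (i, i) c p) / sqrt (g_Psi X k \<Psi> c p)"
      by (rule bexI[OF _ i(1)], rule bexI[OF _ c(1)], rule conjI[OF i(2) val[OF i(1) c(1) i(2), symmetric]])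
  qed (use val in blast)
qed

lemma spinor_norm_sum:
  assumes k: "conformal_metric X k" and p: "\<not> dbar_vanishes X \<Psi> p"
  shows "(\<Sum>j\<in>UNIV. spinor_norm_sq X S spin_iso (g_Psi X k \<Psi>) (spinor j) p) = 1"
proof -
  obtain U F where F: "p \<in> U" "L0_frame X \<Psi> U F" by (rule L0_frame_exists)
  define v where "v = F p"
  have v: "v \<in> \<Psi> p" "v \<noteq> 0" using L0_frameD(4,5)[OF F(2,1)] cline_memI by (auto simp: v_def)
  have "spinor_norm_sq X S spin_iso (g_Psi X k \<Psi>) (spinor j) p =
      ((cmod (v $ (j, 1)))\<^sup>2 + (cmod (v $ (j, 2)))\<^sup>2) / (norm v)\<^sup>2" for j
    unfolding spinor_norm_sq_def spinor_def fst_conv snd_conv add_divide_distrib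
    by (intro arg_cong2[of _ _ _ _ "(+)"] coord_section_norm[OF k p v]) simp_all
  then have "(\<Sum>j\<in>UNIV. spinor_norm_sq X S spin_iso (g_Psi X k \<Psi>) (spinor j) p) = (norm v)\<^sup>2 / (norm v)\<^sup>2"
    by (simp add: sum_divide_distrib[symmetric] sum_norm_sq_components)
  then show ?thesis using v(2) by simp
qed

end

theorem proposition2p5:
  fixes X :: "'a::t2_space chart set"
    and C :: "'a conf_metric set"
    and \<Psi> :: "'a \<Rightarrow> (complex ^ ('m::finite \<times> 2)) set"
  assumes "compact_conformal_surface X C"
    and "quaternionic_harmonic X C \<Psi>"
  shows "holomorphic_hom_with_divisor X
           (tensor_bundle (dual_bundle (L0_bundle X \<Psi>)) (dual_bundle (L0_bundle X \<Psi>)))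
           (canonical_bundle X) (A_hom X \<Psi>) (dbar_order X \<Psi>) \<and>
         (\<exists>\<iota>. spin_structure X (S_Psi X \<Psi>) \<iota> \<and> induced_by_A X \<Psi> \<iota> \<and>
            (\<forall>g\<in>C. \<exists>(\<mu>::real) \<psi>.
               (\<forall>j::'m. eigenspinor_on X (S_Psi X \<Psi>) \<iota> (g_Psi X g \<Psi>)
                  {p. \<not> dbar_vanishes X \<Psi> p} \<mu> (\<psi> j)) \<and>
               has_homogeneous_coords (S_Psi X \<Psi>) \<Psi> (spinor_coords \<psi>) \<and>
               (\<forall>p. \<not> dbar_vanishes X \<Psi> p \<longrightarrow>
                  (\<Sum>j\<in>UNIV. spinor_norm_sq X (S_Psi X \<Psi>) \<iota> (g_Psi X g \<Psi>) (\<psi> j) p) = 1)))"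
proof -
  have C: "C = {g. conformal_metric X g}" and at: "complex_atlas X" and co: "compact (UNIV :: 'a set)" and "C \<noteq> {}"
    using assms(1) unfolding compact_conformal_surface_def by blast+
  \<comment> \<open>One metric of the class fixes the area measure in which harmonicity is
    exploited; the spin structure and the spinors are built from \<open>X\<close> and
    \<open>\<Psi>\<close> and do not depend on this choice.\<close>
  then obtain g0 where g0: "g0 \<in> C" by blast
  have q: "harmonic_map X C \<Psi>" "is_L_minus1 X \<Psi> (\<lambda>p. quat_I ` \<Psi> p)"
    "\<forall>p. dbar_vanishes X \<Psi> p \<longrightarrow> even (dbar_order X \<Psi> p)"
    using assms(2) unfolding quaternionic_harmonic_def by blast+
  interpret atlas X by (rule atlas.intro[OF at])
  interpret quat_surface X g0 \<Psi>
  proof unfold_locales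
    show "compact (UNIV :: 'a set)" by (rule co)
    show "conformal_metric X g0" using g0 C by simp
    show "smooth_map_CP X \<Psi>" using q(1) unfolding harmonic_map_def by blast
    show "((\<lambda>t. energy X g0 (\<Phi> t)) has_real_derivative 0) (at 0)" if "smooth_variation X \<Psi> \<epsilon> \<Phi>" for \<epsilon> \<Phi>
      using q(1) that g0 unfolding harmonic_map_def by blast
  qed (use q in auto)
  \<comment> \<open>The same \<open>spinor\<close> with eigenvalue 1 serves every \<open>g\<close>
    of the class, since the lemmas hold for an arbitrary conformal metric, not just for
    \<open>g0\<close>.\<close>
  have "\<forall>g\<in>C. (\<forall>j. eigenspinor_on X S spin_iso (g_Psi X g \<Psi>) {p. \<not> dbar_vanishes X \<Psi> p} 1 (spinor j)) \<and>
      has_homogeneous_coords S \<Psi> (spinor_coords spinor) \<and>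
      (\<forall>p. \<not> dbar_vanishes X \<Psi> p \<longrightarrow> (\<Sum>j\<in>UNIV. spinor_norm_sq X S spin_iso (g_Psi X g \<Psi>) (spinor j) p) = 1)"
    using spinor_eigen spinor_homogeneous_coords spinor_norm_sum C by blast
  then show ?thesis
    using A_hom_holomorphic spin_structure_S induced_by_spin_iso by blast
qed

end
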